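(* Let $(\{E_\lambda\}_{\lambda\in\Lambda},\{m_{\lambda,\lambda'}\}_{\lambda\preceq\lambda'})$ be a surjective regular projective system of topological graphs over a directed set $\Lambda$. Then $$\mathcal{O}\big(\varprojlim E_\lambda\big)\cong\varinjlim\mathcal{O}(E_\lambda),$$ where the inductive limit is taken with respect to the $*$-homomorphisms $\mathcal{O}(E_\lambda)\to\mathcal{O}(E_{\lambda'})$ induced by the regular factor maps $m_{\lambda,\lambda'}$.
   Context: A topological graph $E=(E^0,E^1,d,r)$ consists of two locally compact (Hausdorff) spaces $E^0,E^1$, a local homeomorphism $d\colon E^1\to E^0$ and a continuous map $r\colon E^1\to E^0$. $C_d(E^1)$ is the set of continuous functions $\xi$ on $E^1$ such that $\langle\xi,\xi\rangle(v)=\sum_{e\in d^{-1}(v)}|\xi(e)|^2<\infty$ for all $v\in E^0$ and $\langle\xi,\xi\rangle\in C_0(E^0)$. It is a right Hilbert $C_0(E^0)$-module with $(\xi f)(e)=\xi(e)f(d(e))$ and $\langle\xi,\eta\rangle(v)=\sum_{e\in d^{-1}(v)}\overline{\xi(e)}\eta(e)$. The left action $\pi_r$ of $C_0(E^0)$ is $(\pi_r(f)\xi)(e)=f(r(e))\xi(e)$. $\mathcal{K}(C_d(E^1))$ denotes the compact operators, the closed span of $\theta_{\xi,\eta}\colon\zeta\mapsto\xi\langle\eta,\zeta\rangle$. A Toeplitz $E$-pair in a $C^*$-algebra $A$ is a pair $T=(T^0,T^1)$ of a $*$-homomorphism $T^0\colon C_0(E^0)\to A$ and a linear map $T^1\colon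 C_d(E^1)\to A$ with $T^1(\xi)^*T^1(\eta)=T^0(\langle\xi,\eta\rangle)$ and $T^0(f)T^1(\xi)=T^1(\pi_r(f)\xi)$. It determines a $*$-homomorphism $\varPhi\colon\mathcal{K}(C_d(E^1))\to A$ with $\varPhi(\theta_{\xi,\eta})=T^1(\xi)T^1(\eta)^*$. $E^0_{\mathrm{sce}}=E^0\setminus\overline{r(E^1)}$; $E^0_{\mathrm{fin}}$ is the set of $v\in E^0$ having a neighborhood $V$ with $r^{-1}(V)$ compact; $E^0_{\mathrm{rg}}=E^0_{\mathrm{fin}}\setminus\overline{E^0_{\mathrm{sce}}}$ (open in $E^0$). For $f\in C_0(E^0_{\mathrm{rg}})\subset C_0(E^0)$ one has $\pi_r(f)\in\mathcal{K}(C_d(E^1))$. $T$ is a Cuntz-Krieger $E$-pair if $T^0(f)=\varPhi(\pi_r(f))$ for all $f\in C_0(E^0_{\mathrm{rg}})$. $\mathcal{O}(E)$ is the universal $C^*$-algebra generated by a Cuntz-Krieger $E$-pair $t_E=(t_E^0,t_E^1)$. For a locally compact space $X$, $\widetilde X=X\cup\{\infty\}$ is its one-point compactification ($\infty$ is isolated if $X$ is compact). Functions in $C_0(X)$ are regarded as continuous functions on $\widetilde X$ vanishing at $\infty$; elements of $C_d(E^1)$ (which lie in $C_0(E^1)$) are extended likewise. A factor map from $F=(F^0,F^1,d_F,r_F)$ to $E=(E^0,E^1,d_E,r_E)$ is a pair $m=(m^0,m^1)$ of continuous maps $m^0\colon\widetilde F^0\to\widetilde E^0$, $m^1\colon\widetilde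 F^1\to\widetilde E^1$ sending $\infty$ to $\infty$ such that: (i) for every $e\in F^1$ with $m^1(e)\in E^1$, $r_E(m^1(e))=m^0(r_F(e))$ and $d_E(m^1(e))=m^0(d_F(e))$; (ii) if $e'\in E^1$ and $v\in F^0$ satisfy $d_E(e')=m^0(v)$, then there is a unique $e\in F^1$ with $m^1(e)=e'$ and $d_F(e)=v$. It is regular if for every $v\in F^0$ with $m^0(v)\in E^0_{\mathrm{rg}}$, the set $(r_F)^{-1}(v)$ is non-empty and contained in $(m^1)^{-1}(E^1)$. A regular factor map induces a unique $*$-homomorphism $\mu\colon\mathcal{O}(E)\to\mathcal{O}(F)$ with $\mu(t_E^0(f))=t_F^0(f\circ m^0)$ and $\mu(t_E^1(\xi))=t_F^1(\xi\circ m^1)$. Composition of factor maps is componentwise. A projective system of topological graphs over a directed set $\Lambda$ consists of topological graphs $E_\lambda=(E_\lambda^0,E_\lambda^1,d_\lambda,r_\lambda)$ and factor maps $m_{\lambda,\lambda'}$ from $E_{\lambda'}$ to $E_\lambda$ for $\lambda\preceq\lambda'$, with $m_{\lambda,\lambda}=\mathrm{id}$ and $m_{\lambda,\lambda'}\circ m_{\lambda',\lambda''}=m_{\lambda,\lambda''}$. It is regular if every $m_{\lambda,\lambda'}$ is regular, and surjective if every $m_{\lambda,\lambda'}^0$ is surjective. Its projective limit $\varprojlim E_\lambda=(E^0,E^1,d,r)$: for $i=0,1$ let $\widetilde E^i$ be the projective limit of the compact spaces $\widetilde E_\lambda^i$ along the $m_{\lambda,\lambda'}^i$, with natural maps $m_\lambda^i\colon\widetilde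 E^i\to\widetilde E_\lambda^i$; let $\infty\in\widetilde E^i$ be the point with $m_\lambda^i(\infty)=\infty$ for all $\lambda$, and $E^i=\widetilde E^i\setminus\{\infty\}$. For $e\in E^1$ choose $\lambda_0$ with $m_{\lambda_0}^1(e)\in E_{\lambda_0}^1$; then $d(e)$, $r(e)$ are the points of $E^0$ determined by $m_\lambda^0(d(e))=d_\lambda(m_\lambda^1(e))$ and $m_\lambda^0(r(e))=r_\lambda(m_\lambda^1(e))$ for all $\lambda\succeq\lambda_0$. This is a topological graph. *)

theory Defs
  imports "HOL-Analysis.Analysis"
begin

section \<open>C*-algebras\<close>

text \<open>C*-algebras are complex and not assumed unital. They are carrier-based, because the algebras
  attached to the members of a family of graphs cannot be types.\<close>

record 'a cstar =
  cs_carrier :: "'a set"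
  cs_zero :: 'a
  cs_add :: "'a \<Rightarrow> 'a \<Rightarrow> 'a"
  cs_scale :: "complex \<Rightarrow> 'a \<Rightarrow> 'a"
  cs_mult :: "'a \<Rightarrow> 'a \<Rightarrow> 'a"
  cs_star :: "'a \<Rightarrow> 'a"
  cs_norm :: "'a \<Rightarrow> real"

text \<open>The value \<open>0\<close> off the carrier is needed since the locale \<open>Metric_space\<close> demands nonnegativity
  and symmetry of the distance on the whole type.\<close>

definition cs_dist :: "'a cstar \<Rightarrow> 'a \<Rightarrow> 'a \<Rightarrow> real" where
  "cs_dist A x y =
     (if x \<in> cs_carrier A \<and> y \<in> cs_carrier A then cs_norm A (cs_add A x (cs_scale A (-1) y)) else 0)"

definition cs_topology :: "'a cstar \<Rightarrow> 'a topology" where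
  "cs_topology A = Metric_space.mtopology (cs_carrier A) (cs_dist A)"

locale cstar_algebra =
  fixes A :: "'a cstar"
  assumes zero_closed: "cs_zero A \<in> cs_carrier A"
    and add_closed: "\<And>x y. x \<in> cs_carrier A \<Longrightarrow> y \<in> cs_carrier A \<Longrightarrow> cs_add A x y \<in> cs_carrier A"
    and scale_closed: "\<And>c x. x \<in> cs_carrier A \<Longrightarrow> cs_scale A c x \<in> cs_carrier A"
    and mult_closed: "\<And>x y. x \<in> cs_carrier A \<Longrightarrow> y \<in> cs_carrier A \<Longrightarrow> cs_mult A x y \<in> cs_carrier A"
    and star_closed: "\<And>x. x \<in> cs_carrier A \<Longrightarrow> cs_star A x \<in> cs_carrier A"
    and add_assoc: "\<And>x y z. x \<in> cs_carrier A \<Longrightarrow> y \<in> cs_carrier A \<Longrightarrow> z \<in> cs_carrier A \<Longrightarrow>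
          cs_add A (cs_add A x y) z = cs_add A x (cs_add A y z)"
    and add_commute: "\<And>x y. x \<in> cs_carrier A \<Longrightarrow> y \<in> cs_carrier A \<Longrightarrow> cs_add A x y = cs_add A y x"
    and add_zero: "\<And>x. x \<in> cs_carrier A \<Longrightarrow> cs_add A (cs_zero A) x = x"
    and add_minus: "\<And>x. x \<in> cs_carrier A \<Longrightarrow> cs_add A x (cs_scale A (-1) x) = cs_zero A"
    and scale_add_right: "\<And>c x y. x \<in> cs_carrier A \<Longrightarrow> y \<in> cs_carrier A \<Longrightarrow>
          cs_scale A c (cs_add A x y) = cs_add A (cs_scale A c x) (cs_scale A c y)"
    and scale_add_left: "\<And>c k x. x \<in> cs_carrier A \<Longrightarrow>
          cs_scale A (c + k) x = cs_add A (cs_scale A c x) (cs_scale A k x)"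
    and scale_scale: "\<And>c k x. x \<in> cs_carrier A \<Longrightarrow> cs_scale A c (cs_scale A k x) = cs_scale A (c * k) x"
    and scale_one: "\<And>x. x \<in> cs_carrier A \<Longrightarrow> cs_scale A 1 x = x"
    and mult_assoc: "\<And>x y z. x \<in> cs_carrier A \<Longrightarrow> y \<in> cs_carrier A \<Longrightarrow> z \<in> cs_carrier A \<Longrightarrow>
          cs_mult A (cs_mult A x y) z = cs_mult A x (cs_mult A y z)"
    and mult_add_left: "\<And>x y z. x \<in> cs_carrier A \<Longrightarrow> y \<in> cs_carrier A \<Longrightarrow> z \<in> cs_carrier A \<Longrightarrow>
          cs_mult A (cs_add A x y) z = cs_add A (cs_mult A x z) (cs_mult A y z)"
    and mult_add_right: "\<And>x y z. x \<in> cs_carrier A \<Longrightarrow> y \<in> cs_carrier A \<Longrightarrow> z \<in> cs_carrier A \<Longrightarrow>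
          cs_mult A x (cs_add A y z) = cs_add A (cs_mult A x y) (cs_mult A x z)"
    and mult_scale_left: "\<And>c x y. x \<in> cs_carrier A \<Longrightarrow> y \<in> cs_carrier A \<Longrightarrow>
          cs_mult A (cs_scale A c x) y = cs_scale A c (cs_mult A x y)"
    and mult_scale_right: "\<And>c x y. x \<in> cs_carrier A \<Longrightarrow> y \<in> cs_carrier A \<Longrightarrow>
          cs_mult A x (cs_scale A c y) = cs_scale A c (cs_mult A x y)"
    and star_star: "\<And>x. x \<in> cs_carrier A \<Longrightarrow> cs_star A (cs_star A x) = x"
    and star_add: "\<And>x y. x \<in> cs_carrier A \<Longrightarrow> y \<in> cs_carrier A \<Longrightarrow>
          cs_star A (cs_add A x y) = cs_add A (cs_star A x) (cs_star A y)"
    and star_scale: "\<And>c x. x \<in> cs_carrier A \<Longrightarrow> cs_star A (cs_scale A c x) = cs_scale A (cnj c) (cs_star A x)"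
    and star_mult: "\<And>x y. x \<in> cs_carrier A \<Longrightarrow> y \<in> cs_carrier A \<Longrightarrow>
          cs_star A (cs_mult A x y) = cs_mult A (cs_star A y) (cs_star A x)"
    and norm_nonneg: "\<And>x. x \<in> cs_carrier A \<Longrightarrow> 0 \<le> cs_norm A x"
    and norm_eq_zero: "\<And>x. x \<in> cs_carrier A \<Longrightarrow> cs_norm A x = 0 \<longleftrightarrow> x = cs_zero A"
    and norm_triangle: "\<And>x y. x \<in> cs_carrier A \<Longrightarrow> y \<in> cs_carrier A \<Longrightarrow>
          cs_norm A (cs_add A x y) \<le> cs_norm A x + cs_norm A y"
    and norm_scale: "\<And>c x. x \<in> cs_carrier A \<Longrightarrow> cs_norm A (cs_scale A c x) = cmod c * cs_norm A x"
    and norm_mult: "\<And>x y. x \<in> cs_carrier A \<Longrightarrow> y \<in> cs_carrier A \<Longrightarrow>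
          cs_norm A (cs_mult A x y) \<le> cs_norm A x * cs_norm A y"
    and norm_star_mult: "\<And>x. x \<in> cs_carrier A \<Longrightarrow> cs_norm A (cs_mult A (cs_star A x) x) = (cs_norm A x)\<^sup>2"
    and complete: "Metric_space.mcomplete (cs_carrier A) (cs_dist A)"

definition star_hom :: "'a cstar \<Rightarrow> 'b cstar \<Rightarrow> ('a \<Rightarrow> 'b) \<Rightarrow> bool" where
  "star_hom A B \<phi> \<longleftrightarrow>
     \<phi> \<in> cs_carrier A \<rightarrow> cs_carrier B \<and>
     (\<forall>x\<in>cs_carrier A. \<forall>y\<in>cs_carrier A. \<phi> (cs_add A x y) = cs_add B (\<phi> x) (\<phi> y)) \<and>
     (\<forall>c. \<forall>x\<in>cs_carrier A. \<phi> (cs_scale A c x) = cs_scale B c (\<phi> x)) \<and>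
     (\<forall>x\<in>cs_carrier A. \<forall>y\<in>cs_carrier A. \<phi> (cs_mult A x y) = cs_mult B (\<phi> x) (\<phi> y)) \<and>
     (\<forall>x\<in>cs_carrier A. \<phi> (cs_star A x) = cs_star B (\<phi> x))"

definition cs_isomorphic :: "'a cstar \<Rightarrow> 'b cstar \<Rightarrow> bool" where
  "cs_isomorphic A B \<longleftrightarrow> (\<exists>\<phi>. star_hom A B \<phi> \<and> bij_betw \<phi> (cs_carrier A) (cs_carrier B))"

definition closed_subspace :: "'a cstar \<Rightarrow> 'a set \<Rightarrow> bool" where
  "closed_subspace A W \<longleftrightarrow>
     closedin (cs_topology A) W \<and> cs_zero A \<in> W \<and>
     (\<forall>x\<in>W. \<forall>y\<in>W. cs_add A x y \<in> W) \<and> (\<forall>c. \<forall>x\<in>W. cs_scale A c x \<in> W)"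

definition closed_span :: "'a cstar \<Rightarrow> 'a set \<Rightarrow> 'a set" where
  "closed_span A S = \<Inter>{W. S \<subseteq> W \<and> closed_subspace A W}"

definition cstar_subalgebra :: "'a cstar \<Rightarrow> 'a set \<Rightarrow> bool" where
  "cstar_subalgebra A W \<longleftrightarrow>
     closed_subspace A W \<and> (\<forall>x\<in>W. \<forall>y\<in>W. cs_mult A x y \<in> W) \<and> (\<forall>x\<in>W. cs_star A x \<in> W)"

definition cstar_generated :: "'a cstar \<Rightarrow> 'a set \<Rightarrow> 'a cstar" where
  "cstar_generated A S = A\<lparr>cs_carrier := \<Inter>{W. S \<subseteq> W \<and> cstar_subalgebra A W}\<rparr>"

text \<open>The product of a family of C*-algebras: bounded families with the supremum norm.
  Here and below a \<open>0\<close> is inserted under \<open>Sup\<close> to get \<open>0\<close> for the empty family.\<close>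

definition cs_prod :: "'i set \<Rightarrow> ('i \<Rightarrow> 'a cstar) \<Rightarrow> ('i \<Rightarrow> 'a) cstar" where
  "cs_prod I A = \<lparr>
     cs_carrier = {x \<in> (\<Pi>\<^sub>E i\<in>I. cs_carrier (A i)). bdd_above ((\<lambda>i. cs_norm (A i) (x i)) ` I)},
     cs_zero = (\<lambda>i\<in>I. cs_zero (A i)),
     cs_add = (\<lambda>x y. \<lambda>i\<in>I. cs_add (A i) (x i) (y i)),
     cs_scale = (\<lambda>c x. \<lambda>i\<in>I. cs_scale (A i) c (x i)),
     cs_mult = (\<lambda>x y. \<lambda>i\<in>I. cs_mult (A i) (x i) (y i)),
     cs_star = (\<lambda>x. \<lambda>i\<in>I. cs_star (A i) (x i)),
     cs_norm = (\<lambda>x. Sup (insert 0 ((\<lambda>i. cs_norm (A i) (x i)) ` I)))\<rparr>"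

definition cs_coset :: "'a cstar \<Rightarrow> 'a set \<Rightarrow> 'a \<Rightarrow> 'a set" where
  "cs_coset A J x = {cs_add A x j | j. j \<in> J}"

text \<open>The quotient by a closed two-sided ideal \<open>J\<close>; the unions below are unions of equal cosets.\<close>

definition cs_quot :: "'a cstar \<Rightarrow> 'a set \<Rightarrow> 'a set cstar" where
  "cs_quot A J = \<lparr>
     cs_carrier = cs_coset A J ` cs_carrier A,
     cs_zero = cs_coset A J (cs_zero A),
     cs_add = (\<lambda>X Y. \<Union>x\<in>X. \<Union>y\<in>Y. cs_coset A J (cs_add A x y)),
     cs_scale = (\<lambda>c X. \<Union>x\<in>X. cs_coset A J (cs_scale A c x)),
     cs_mult = (\<lambda>X Y. \<Union>x\<in>X. \<Union>y\<in>Y. cs_coset A J (cs_mult A x y)),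
     cs_star = (\<lambda>X. \<Union>x\<in>X. cs_coset A J (cs_star A x)),
     cs_norm = (\<lambda>X. Inf (cs_norm A ` X))\<rparr>"

subsection \<open>Inductive limits\<close>

definition directed_set :: "'i set \<Rightarrow> ('i \<Rightarrow> 'i \<Rightarrow> bool) \<Rightarrow> bool" where
  "directed_set \<Lambda> le \<longleftrightarrow>
     \<Lambda> \<noteq> {} \<and> (\<forall>i\<in>\<Lambda>. le i i) \<and>
     (\<forall>i\<in>\<Lambda>. \<forall>j\<in>\<Lambda>. \<forall>k\<in>\<Lambda>. le i j \<longrightarrow> le j k \<longrightarrow> le i k) \<and>
     (\<forall>i\<in>\<Lambda>. \<forall>j\<in>\<Lambda>. \<exists>k\<in>\<Lambda>. le i k \<and> le j k)"

text \<open>The inductive limit of C*-algebras \<open>A i\<close> along connecting maps \<open>\<phi> i j\<close> from \<open>A i\<close> to \<open>A j\<close>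
  (for \<open>le i j\<close>), in the standard realization: the product of all \<open>A i\<close> is divided by the ideal of
  families whose norms tend to \<open>0\<close> along \<open>\<Lambda>\<close>, the element \<open>a\<close> of \<open>A i\<close> is sent to the class of
  \<open>(\<phi> i j a)\<close>, \<open>j \<succeq> i\<close>, and one takes the closure of the union of the images. The norm of the
  quotient is the limit superior of the norms, so the class of \<open>a\<close> has norm \<open>lim \<parallel>\<phi> i j a\<parallel>\<close>:
  this is the completion of the algebraic direct limit.\<close>

definition null_families :: "'i set \<Rightarrow> ('i \<Rightarrow> 'i \<Rightarrow> bool) \<Rightarrow> ('i \<Rightarrow> 'a cstar) \<Rightarrow> ('i \<Rightarrow> 'a) set" where
  "null_families \<Lambda> le A = {x \<in> cs_carrier (cs_prod \<Lambda> A).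
     \<forall>\<epsilon>>0. \<exists>i\<in>\<Lambda>. \<forall>j\<in>\<Lambda>. le i j \<longrightarrow> cs_norm (A j) (x j) < \<epsilon>}"

definition indlim_map ::
  "'i set \<Rightarrow> ('i \<Rightarrow> 'i \<Rightarrow> bool) \<Rightarrow> ('i \<Rightarrow> 'a cstar) \<Rightarrow> ('i \<Rightarrow> 'i \<Rightarrow> 'a \<Rightarrow> 'a) \<Rightarrow> 'i \<Rightarrow> 'a \<Rightarrow> ('i \<Rightarrow> 'a) set"
where
  "indlim_map \<Lambda> le A \<phi> i a =
     cs_coset (cs_prod \<Lambda> A) (null_families \<Lambda> le A) (\<lambda>j\<in>\<Lambda>. if le i j then \<phi> i j a else cs_zero (A j))"

definition inductive_limit ::
  "'i set \<Rightarrow> ('i \<Rightarrow> 'i \<Rightarrow> bool) \<Rightarrow> ('i \<Rightarrow> 'a cstar) \<Rightarrow> ('i \<Rightarrow> 'i \<Rightarrow> 'a \<Rightarrow> 'a) \<Rightarrow> ('i \<Rightarrow> 'a) set cstar"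
where
  "inductive_limit \<Lambda> le A \<phi> =
     (let Q = cs_quot (cs_prod \<Lambda> A) (null_families \<Lambda> le A)
      in Q\<lparr>cs_carrier :=
             cs_topology Q closure_of (\<Union>i\<in>\<Lambda>. indlim_map \<Lambda> le A \<phi> i ` cs_carrier (A i))\<rparr>)"

section \<open>Topological graphs\<close>

definition local_homeomorphism :: "'a topology \<Rightarrow> 'b topology \<Rightarrow> ('a \<Rightarrow> 'b) \<Rightarrow> bool" where
  "local_homeomorphism X Y f \<longleftrightarrow>
     f \<in> topspace X \<rightarrow> topspace Y \<and>
     (\<forall>x\<in>topspace X. \<exists>U. openin X U \<and> x \<in> U \<and> openin Y (f ` U) \<and>
        homeomorphic_map (subtopology X U) (subtopology Y (f ` U)) f)"

record ('v, 'e) tgraph =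
  verts :: "'v topology"
  edges :: "'e topology"
  dmap :: "'e \<Rightarrow> 'v"
  rmap :: "'e \<Rightarrow> 'v"

definition topological_graph :: "('v, 'e) tgraph \<Rightarrow> bool" where
  "topological_graph E \<longleftrightarrow>
     locally_compact_space (verts E) \<and> Hausdorff_space (verts E) \<and>
     locally_compact_space (edges E) \<and> Hausdorff_space (edges E) \<and>
     local_homeomorphism (edges E) (verts E) (dmap E) \<and>
     continuous_map (edges E) (verts E) (rmap E)"

definition E_sce :: "('v, 'e) tgraph \<Rightarrow> 'v set" where
  "E_sce E = topspace (verts E) - verts E closure_of (rmap E ` topspace (edges E))"

definition E_fin :: "('v, 'e) tgraph \<Rightarrow> 'v set" where
  "E_fin E = {v. \<exists>U V. openin (verts E) U \<and> v \<in> U \<and> U \<subseteq> V \<and> V \<subseteq> topspace (verts E) \<and>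
                compactin (edges E) {e \<in> topspace (edges E). rmap E e \<in> V}}"

definition E_rg :: "('v, 'e) tgraph \<Rightarrow> 'v set" where
  "E_rg E = E_fin E - verts E closure_of E_sce E"

section \<open>Function spaces\<close>

text \<open>Functions on a space are represented by functions on the type that are \<open>0\<close> off the space.
  In particular, for \<open>U\<close> open in \<open>X\<close>, the carrier of \<open>C0 (subtopology X U)\<close> is literally
  a subset of the carrier of \<open>C0 X\<close>.\<close>

definition C0 :: "'x topology \<Rightarrow> ('x \<Rightarrow> complex) cstar" where
  "C0 X = \<lparr>
     cs_carrier = {f. continuous_map X euclidean f \<and>
                      (\<forall>\<epsilon>>0. compactin X {x \<in> topspace X. \<epsilon> \<le> cmod (f x)}) \<and>
                      (\<forall>x. x \<notin> topspace X \<longrightarrow> f x = 0)},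
     cs_zero = (\<lambda>x. 0),
     cs_add = (\<lambda>f g x. f x + g x),
     cs_scale = (\<lambda>c f x. c * f x),
     cs_mult = (\<lambda>f g x. f x * g x),
     cs_star = (\<lambda>f x. cnj (f x)),
     cs_norm = (\<lambda>f. Sup (insert 0 ((\<lambda>x. cmod (f x)) ` topspace X)))\<rparr>"

definition cd_inner :: "('v, 'e) tgraph \<Rightarrow> ('e \<Rightarrow> complex) \<Rightarrow> ('e \<Rightarrow> complex) \<Rightarrow> 'v \<Rightarrow> complex" where
  "cd_inner E \<xi> \<eta> v = (\<Sum>\<^sub>\<infinity>e\<in>{e \<in> topspace (edges E). dmap E e = v}. cnj (\<xi> e) * \<eta> e)"

definition Cd :: "('v, 'e) tgraph \<Rightarrow> ('e \<Rightarrow> complex) set" where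
  "Cd E = {\<xi>. continuous_map (edges E) euclidean \<xi> \<and>
              (\<forall>e. e \<notin> topspace (edges E) \<longrightarrow> \<xi> e = 0) \<and>
              (\<forall>v\<in>topspace (verts E).
                 (\<lambda>e. (cmod (\<xi> e))\<^sup>2) summable_on {e \<in> topspace (edges E). dmap E e = v}) \<and>
              cd_inner E \<xi> \<xi> \<in> cs_carrier (C0 (verts E))}"

definition cd_norm :: "('v, 'e) tgraph \<Rightarrow> ('e \<Rightarrow> complex) \<Rightarrow> real" where
  "cd_norm E \<xi> = sqrt (cs_norm (C0 (verts E)) (cd_inner E \<xi> \<xi>))"

definition is_adjoint ::
  "('v, 'e) tgraph \<Rightarrow> (('e \<Rightarrow> complex) \<Rightarrow> ('e \<Rightarrow> complex)) \<Rightarrow> (('e \<Rightarrow> complex) \<Rightarrow> ('e \<Rightarrow> complex)) \<Rightarrow> bool"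
where
  "is_adjoint E S S' \<longleftrightarrow> S' \<in> Cd E \<rightarrow>\<^sub>E Cd E \<and>
     (\<forall>\<xi>\<in>Cd E. \<forall>\<eta>\<in>Cd E. cd_inner E (S \<xi>) \<eta> = cd_inner E \<xi> (S' \<eta>))"

text \<open>The adjointable operators on the Hilbert module; linearity and boundedness are automatic.\<close>

definition adjointable_ops :: "('v, 'e) tgraph \<Rightarrow> (('e \<Rightarrow> complex) \<Rightarrow> ('e \<Rightarrow> complex)) cstar" where
  "adjointable_ops E = \<lparr>
     cs_carrier = {S \<in> Cd E \<rightarrow>\<^sub>E Cd E. \<exists>S'. is_adjoint E S S'},
     cs_zero = (\<lambda>\<xi>\<in>Cd E. \<lambda>e. 0),
     cs_add = (\<lambda>S T. \<lambda>\<xi>\<in>Cd E. \<lambda>e. S \<xi> e + T \<xi> e),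
     cs_scale = (\<lambda>c S. \<lambda>\<xi>\<in>Cd E. \<lambda>e. c * S \<xi> e),
     cs_mult = (\<lambda>S T. \<lambda>\<xi>\<in>Cd E. S (T \<xi>)),
     cs_star = (\<lambda>S. THE S'. is_adjoint E S S'),
     cs_norm = (\<lambda>S. Sup {cd_norm E (S \<xi>) | \<xi>. \<xi> \<in> Cd E \<and> cd_norm E \<xi> \<le> 1})\<rparr>"

definition rank_one ::
  "('v, 'e) tgraph \<Rightarrow> ('e \<Rightarrow> complex) \<Rightarrow> ('e \<Rightarrow> complex) \<Rightarrow> ('e \<Rightarrow> complex) \<Rightarrow> ('e \<Rightarrow> complex)" where
  "rank_one E \<xi> \<eta> = (\<lambda>\<zeta>\<in>Cd E. \<lambda>e. \<xi> e * cd_inner E \<eta> \<zeta> (dmap E e))"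

definition compact_ops :: "('v, 'e) tgraph \<Rightarrow> (('e \<Rightarrow> complex) \<Rightarrow> ('e \<Rightarrow> complex)) cstar" where
  "compact_ops E = (adjointable_ops E)\<lparr>cs_carrier :=
     closed_span (adjointable_ops E) {rank_one E \<xi> \<eta> | \<xi> \<eta>. \<xi> \<in> Cd E \<and> \<eta> \<in> Cd E}\<rparr>"

definition left_action ::
  "('v, 'e) tgraph \<Rightarrow> ('v \<Rightarrow> complex) \<Rightarrow> ('e \<Rightarrow> complex) \<Rightarrow> ('e \<Rightarrow> complex)" where
  "left_action E f = (\<lambda>\<xi>\<in>Cd E. \<lambda>e. f (rmap E e) * \<xi> e)"

section \<open>Cuntz-Krieger pairs and the C*-algebra of a topological graph\<close>

definition toeplitz_pair ::
  "('v, 'e) tgraph \<Rightarrow> 'a cstar \<Rightarrow> (('v \<Rightarrow> complex) \<Rightarrow> 'a) \<Rightarrow> (('e \<Rightarrow> complex) \<Rightarrow> 'a) \<Rightarrow> bool"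
where
  "toeplitz_pair E A T0 T1 \<longleftrightarrow>
     star_hom (C0 (verts E)) A T0 \<and>
     T1 \<in> Cd E \<rightarrow> cs_carrier A \<and>
     (\<forall>\<xi>\<in>Cd E. \<forall>\<eta>\<in>Cd E. T1 (\<lambda>e. \<xi> e + \<eta> e) = cs_add A (T1 \<xi>) (T1 \<eta>)) \<and>
     (\<forall>c. \<forall>\<xi>\<in>Cd E. T1 (\<lambda>e. c * \<xi> e) = cs_scale A c (T1 \<xi>)) \<and>
     (\<forall>\<xi>\<in>Cd E. \<forall>\<eta>\<in>Cd E. cs_mult A (cs_star A (T1 \<xi>)) (T1 \<eta>) = T0 (cd_inner E \<xi> \<eta>)) \<and>
     (\<forall>f\<in>cs_carrier (C0 (verts E)). \<forall>\<xi>\<in>Cd E. cs_mult A (T0 f) (T1 \<xi>) = T1 (left_action E f \<xi>))"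

text \<open>The homomorphism \<open>\<Phi>\<close> below exists for every Toeplitz pair in a C*-algebra, and it is unique
  on the compact operators.\<close>

definition ck_pair ::
  "('v, 'e) tgraph \<Rightarrow> 'a cstar \<Rightarrow> (('v \<Rightarrow> complex) \<Rightarrow> 'a) \<Rightarrow> (('e \<Rightarrow> complex) \<Rightarrow> 'a) \<Rightarrow> bool"
where
  "ck_pair E A T0 T1 \<longleftrightarrow>
     toeplitz_pair E A T0 T1 \<and>
     (\<exists>\<Phi>. star_hom (compact_ops E) A \<Phi> \<and>
          (\<forall>\<xi>\<in>Cd E. \<forall>\<eta>\<in>Cd E. \<Phi> (rank_one E \<xi> \<eta>) = cs_mult A (T1 \<xi>) (cs_star A (T1 \<eta>))) \<and>
          (\<forall>f\<in>cs_carrier (C0 (subtopology (verts E) (E_rg E))). T0 f = \<Phi> (left_action E f)))"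

text \<open>The universal C*-algebra generated by a Cuntz-Krieger pair is realized in the usual way as the
  C*-algebra generated by the direct sum of all Cuntz-Krieger pairs, inside the product of the
  algebras in which these live. A set of algebras suffices: HOL requires their elements to come
  from one type, and \<open>ck_univ\<close> is large enough that every C*-algebra generated by a
  Cuntz-Krieger pair (in an algebra over any type) is isomorphic to one carried by \<open>ck_univ\<close>.
  Indeed each of its elements is the limit of a sequence of *-polynomials in the generators, and
  \<open>ck_term\<close> is the type of formal *-polynomials; choosing one such sequence for each element
  gives an injection into \<open>ck_univ\<close>.\<close>

datatype ('v, 'e) ck_term =
    Gen0 "'v \<Rightarrow> complex"
  | Gen1 "'e \<Rightarrow> complex"
  | Plus "('v, 'e) ck_term" "('v, 'e) ck_term"
  | Scale complex "('v, 'e) ck_term"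
  | Times "('v, 'e) ck_term" "('v, 'e) ck_term"
  | Star "('v, 'e) ck_term"

type_synonym ('v, 'e) ck_univ = "nat \<Rightarrow> ('v, 'e) ck_term"

type_synonym ('v, 'e) ck_rep =
  "('v, 'e) ck_univ cstar \<times> (('v \<Rightarrow> complex) \<Rightarrow> ('v, 'e) ck_univ) \<times> (('e \<Rightarrow> complex) \<Rightarrow> ('v, 'e) ck_univ)"

definition ck_reps :: "('v, 'e) tgraph \<Rightarrow> ('v, 'e) ck_rep set" where
  "ck_reps E = {(A, T0, T1). cstar_algebra A \<and> ck_pair E A T0 T1}"

definition t0 :: "('v, 'e) tgraph \<Rightarrow> ('v \<Rightarrow> complex) \<Rightarrow> (('v, 'e) ck_rep \<Rightarrow> ('v, 'e) ck_univ)" where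
  "t0 E f = (\<lambda>(A, T0, T1)\<in>ck_reps E. T0 f)"

definition t1 :: "('v, 'e) tgraph \<Rightarrow> ('e \<Rightarrow> complex) \<Rightarrow> (('v, 'e) ck_rep \<Rightarrow> ('v, 'e) ck_univ)" where
  "t1 E \<xi> = (\<lambda>(A, T0, T1)\<in>ck_reps E. T1 \<xi>)"

definition graph_algebra :: "('v, 'e) tgraph \<Rightarrow> (('v, 'e) ck_rep \<Rightarrow> ('v, 'e) ck_univ) cstar" where
  "graph_algebra E =
     cstar_generated (cs_prod (ck_reps E) fst) (t0 E ` cs_carrier (C0 (verts E)) \<union> t1 E ` Cd E)"

section \<open>Factor maps\<close>

text \<open>The one-point compactification of a space over \<open>'x\<close> is the library's, over
  \<open>'x option\<close>, with \<open>\<infinity>\<close> being \<open>None\<close>.\<close>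

type_synonym ('w, 'g, 'v, 'e) gmap = "('w option \<Rightarrow> 'v option) \<times> ('g option \<Rightarrow> 'e option)"

definition factor_map ::
  "('w, 'g) tgraph \<Rightarrow> ('v, 'e) tgraph \<Rightarrow> ('w, 'g, 'v, 'e) gmap \<Rightarrow> bool"
where
  "factor_map F E m \<longleftrightarrow>
     continuous_map (Alexandroff_compactification (verts F)) (Alexandroff_compactification (verts E)) (fst m) \<and>
     continuous_map (Alexandroff_compactification (edges F)) (Alexandroff_compactification (edges E)) (snd m) \<and>
     fst m None = None \<and> snd m None = None \<and>
     (\<forall>e\<in>topspace (edges F). \<forall>e'\<in>topspace (edges E). snd m (Some e) = Some e' \<longrightarrow>
        Some (rmap E e') = fst m (Some (rmap F e)) \<and>
        Some (dmap E e') = fst m (Some (dmap F e))) \<and>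
     (\<forall>e'\<in>topspace (edges E). \<forall>v\<in>topspace (verts F). Some (dmap E e') = fst m (Some v) \<longrightarrow>
        (\<exists>!e. e \<in> topspace (edges F) \<and> snd m (Some e) = Some e' \<and> dmap F e = v))"

definition regular_factor_map ::
  "('w, 'g) tgraph \<Rightarrow> ('v, 'e) tgraph \<Rightarrow> ('w, 'g, 'v, 'e) gmap \<Rightarrow> bool"
where
  "regular_factor_map F E m \<longleftrightarrow>
     factor_map F E m \<and>
     (\<forall>v\<in>topspace (verts F). fst m (Some v) \<in> Some ` E_rg E \<longrightarrow>
        {e \<in> topspace (edges F). rmap F e = v} \<noteq> {} \<and>
        (\<forall>e\<in>topspace (edges F). rmap F e = v \<longrightarrow> snd m (Some e) \<in> Some ` topspace (edges E)))"

text \<open>\<open>f \<circ> m\<close> for a function \<open>f\<close> extended by \<open>f \<infinity> = 0\<close>, as a function on the space \<open>X\<close>.\<close>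

definition pull :: "'x topology \<Rightarrow> ('x option \<Rightarrow> 'y option) \<Rightarrow> ('y \<Rightarrow> complex) \<Rightarrow> 'x \<Rightarrow> complex" where
  "pull X m f x = (if x \<in> topspace X then case_option 0 f (m (Some x)) else 0)"

definition induced_hom ::
  "('w, 'g) tgraph \<Rightarrow> ('v, 'e) tgraph \<Rightarrow> ('w, 'g, 'v, 'e) gmap \<Rightarrow>
   (('v, 'e) ck_rep \<Rightarrow> ('v, 'e) ck_univ) \<Rightarrow> (('w, 'g) ck_rep \<Rightarrow> ('w, 'g) ck_univ)"
where
  "induced_hom F E m = (THE \<mu>.
     \<mu> \<in> extensional (cs_carrier (graph_algebra E)) \<and>
     star_hom (graph_algebra E) (graph_algebra F) \<mu> \<and>
     (\<forall>f\<in>cs_carrier (C0 (verts E)). \<mu> (t0 E f) = t0 F (pull (verts F) (fst m) f)) \<and>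
     (\<forall>\<xi>\<in>Cd E. \<mu> (t1 E \<xi>) = t1 F (pull (edges F) (snd m) \<xi>)))"

section \<open>Projective systems and projective limits\<close>

text \<open>The factor map \<open>m i j\<close> goes from \<open>E j\<close> to \<open>E i\<close>, for \<open>le i j\<close>.\<close>

definition projective_system ::
  "'i set \<Rightarrow> ('i \<Rightarrow> 'i \<Rightarrow> bool) \<Rightarrow> ('i \<Rightarrow> ('v, 'e) tgraph) \<Rightarrow> ('i \<Rightarrow> 'i \<Rightarrow> ('v, 'e, 'v, 'e) gmap) \<Rightarrow> bool"
where
  "projective_system \<Lambda> le E m \<longleftrightarrow>
     directed_set \<Lambda> le \<and>
     (\<forall>i\<in>\<Lambda>. topological_graph (E i)) \<and>
     (\<forall>i\<in>\<Lambda>. \<forall>j\<in>\<Lambda>. le i j \<longrightarrow> factor_map (E j) (E i) (m i j)) \<and>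
     (\<forall>i\<in>\<Lambda>.
        (\<forall>x\<in>topspace (Alexandroff_compactification (verts (E i))). fst (m i i) x = x) \<and>
        (\<forall>x\<in>topspace (Alexandroff_compactification (edges (E i))). snd (m i i) x = x)) \<and>
     (\<forall>i\<in>\<Lambda>. \<forall>j\<in>\<Lambda>. \<forall>k\<in>\<Lambda>. le i j \<longrightarrow> le j k \<longrightarrow>
        (\<forall>x\<in>topspace (Alexandroff_compactification (verts (E k))).
           fst (m i j) (fst (m j k) x) = fst (m i k) x) \<and>
        (\<forall>x\<in>topspace (Alexandroff_compactification (edges (E k))).
           snd (m i j) (snd (m j k) x) = snd (m i k) x))"

definition regular_system ::
  "'i set \<Rightarrow> ('i \<Rightarrow> 'i \<Rightarrow> bool) \<Rightarrow> ('i \<Rightarrow> ('v, 'e) tgraph) \<Rightarrow> ('i \<Rightarrow> 'i \<Rightarrow> ('v, 'e, 'v, 'e) gmap) \<Rightarrow> bool"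
where
  "regular_system \<Lambda> le E m \<longleftrightarrow>
     (\<forall>i\<in>\<Lambda>. \<forall>j\<in>\<Lambda>. le i j \<longrightarrow> regular_factor_map (E j) (E i) (m i j))"

definition surjective_system ::
  "'i set \<Rightarrow> ('i \<Rightarrow> 'i \<Rightarrow> bool) \<Rightarrow> ('i \<Rightarrow> ('v, 'e) tgraph) \<Rightarrow> ('i \<Rightarrow> 'i \<Rightarrow> ('v, 'e, 'v, 'e) gmap) \<Rightarrow> bool"
where
  "surjective_system \<Lambda> le E m \<longleftrightarrow>
     (\<forall>i\<in>\<Lambda>. \<forall>j\<in>\<Lambda>. le i j \<longrightarrow>
        fst (m i j) ` topspace (Alexandroff_compactification (verts (E j)))
          = topspace (Alexandroff_compactification (verts (E i))))"

definition proj_lim_space ::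
  "'i set \<Rightarrow> ('i \<Rightarrow> 'i \<Rightarrow> bool) \<Rightarrow> ('i \<Rightarrow> 'x topology) \<Rightarrow> ('i \<Rightarrow> 'i \<Rightarrow> 'x \<Rightarrow> 'x) \<Rightarrow> ('i \<Rightarrow> 'x) topology"
where
  "proj_lim_space \<Lambda> le X m =
     subtopology (product_topology X \<Lambda>) {x. \<forall>i\<in>\<Lambda>. \<forall>j\<in>\<Lambda>. le i j \<longrightarrow> m i j (x j) = x i}"

definition proj_lim_part ::
  "'i set \<Rightarrow> ('i \<Rightarrow> 'i \<Rightarrow> bool) \<Rightarrow> ('i \<Rightarrow> 'x topology) \<Rightarrow> ('i \<Rightarrow> 'i \<Rightarrow> 'x option \<Rightarrow> 'x option) \<Rightarrow>
   ('i \<Rightarrow> 'x option) topology"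
where
  "proj_lim_part \<Lambda> le X m =
     (let P = proj_lim_space \<Lambda> le (\<lambda>i. Alexandroff_compactification (X i)) m
      in subtopology P (topspace P - {\<lambda>i\<in>\<Lambda>. None}))"

text \<open>The vertex \<open>v\<close> of the limit determined by \<open>v i = Some (h i (e i))\<close> for all \<open>i \<succeq> i0\<close>, where
  \<open>i0\<close> is some index at which the edge \<open>e\<close> is finite; used with \<open>h i\<close> being \<open>d\<close> or \<open>r\<close> of \<open>E i\<close>.\<close>

definition proj_lim_end ::
  "'i set \<Rightarrow> ('i \<Rightarrow> 'i \<Rightarrow> bool) \<Rightarrow> ('i \<Rightarrow> 'v option) set \<Rightarrow> ('i \<Rightarrow> 'e \<Rightarrow> 'v) \<Rightarrow> ('i \<Rightarrow> 'e option) \<Rightarrow> ('i \<Rightarrow> 'v option)"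
where
  "proj_lim_end \<Lambda> le V h e =
     (let i0 = (SOME i. i \<in> \<Lambda> \<and> e i \<noteq> None)
      in THE v. v \<in> V \<and> (\<forall>i\<in>\<Lambda>. le i0 i \<longrightarrow> v i = Some (h i (the (e i)))))"

definition proj_lim ::
  "'i set \<Rightarrow> ('i \<Rightarrow> 'i \<Rightarrow> bool) \<Rightarrow> ('i \<Rightarrow> ('v, 'e) tgraph) \<Rightarrow> ('i \<Rightarrow> 'i \<Rightarrow> ('v, 'e, 'v, 'e) gmap) \<Rightarrow>
   ('i \<Rightarrow> 'v option, 'i \<Rightarrow> 'e option) tgraph"
where
  "proj_lim \<Lambda> le E m =
     (let V = proj_lim_part \<Lambda> le (\<lambda>i. verts (E i)) (\<lambda>i j. fst (m i j))
      in \<lparr>verts = V,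
          edges = proj_lim_part \<Lambda> le (\<lambda>i. edges (E i)) (\<lambda>i j. snd (m i j)),
          dmap = proj_lim_end \<Lambda> le (topspace V) (\<lambda>i. dmap (E i)),
          rmap = proj_lim_end \<Lambda> le (topspace V) (\<lambda>i. rmap (E i))\<rparr>)"

end

theory Submission
 imports Defs
begin

text \<open>The projections of the limit graph \<open>G\<close> to the graphs \<open>E i\<close> are regular factor maps, so they induce
maps \<open>\<mu> i\<close> from the algebras of the \<open>E i\<close> to that of \<open>G\<close>. Conversely, since the connecting maps are
surjective, functions pulled back from some \<open>E i\<close> form dense subspaces on which the norms do not depend on \<open>i\<close>;
hence the images of the generators in the inductive limit extend by continuity to a Toeplitz pair of \<open>G\<close>. It is
a Cuntz-Krieger pair because the regular vertices of \<open>G\<close> are exhausted by the preimages of the regular vertices of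
the \<open>E i\<close>. The induced homomorphism \<open>\<nu>\<close> maps \<open>\<mu> i a\<close> to the class of \<open>a\<close>, whose norm is at least
that of \<open>\<mu> i a\<close>. So \<open>\<nu>\<close> is isometric on a dense set, hence injective with closed, dense range.\<close>

text \<open>The Cuntz-Krieger condition refers to an unspecified homomorphism \<open>\<Phi>\<close>
  on the compact operators, which is awkward for subalgebras, products and limits. It is replaced by
  equations between finite sums: for \<open>f\<close> with compact support in the regular vertices
  the left action of \<open>f\<close> is a finite sum of rank one operators, and the condition says
  that \<open>T0 f\<close> is the corresponding sum of products
  \<open>T1 \<xi> \<otimes> cs_star A (T1 \<eta>)\<close>. That such sums in \<open>A\<close> are
  bounded by the operator norm is what makes \<open>\<Phi>\<close> exist. A second obstacle is that
  uniform approximation does not control the module norm. Elements of \<open>Cd G\<close> are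
  therefore truncated to compact support, and the approximants are multiplied by one fixed bump
  function. Injectivity of \<open>\<nu>\<close> comes from a norm comparison alone:
  \<open>\<mu> i\<close> factors through \<open>\<mu> j\<close> for every later \<open>j\<close> and
  \<open>\<mu> j\<close> is contractive, so the norm of \<open>\<mu> i a\<close> is below the norm
  of the image of \<open>a\<close> at every later index, hence below that of its class.\<close>

notation cs_zero ("\<zero>\<index>")
notation cs_add (infixl "\<oplus>\<index>" 65)
notation cs_mult (infixl "\<otimes>\<index>" 70)
notation cs_scale (infixr "\<odot>\<index>" 75)

abbreviation add_at ("_ +[_] _" [65, 0, 66] 65) where "x +[A] y == cs_add A x y"
abbreviation mult_at ("_ *[_] _" [70, 0, 71] 70) where "x *[A] y == cs_mult A x y"
abbreviation scale_at ("_ .[_] _" [76, 0, 75] 75) where "c .[A] x == cs_scale A c x"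
abbreviation cs_minus (infixl "\<ominus>\<index>" 65) where "cs_minus A x y == x +[A] (-1) .[A] y"
abbreviation minus_at ("_ -[_] _" [65, 0, 66] 65) where "x -[A] y == cs_minus A x y"

abbreviation "car == cs_carrier"
abbreviation "nm == cs_norm"
abbreviation "vts E == topspace (verts E)"
abbreviation "eds E == topspace (edges E)"
abbreviation "C0c X == car (C0 X)"
abbreviation "OA == graph_algebra"

section \<open>Normed spaces and convergence of sequences\<close>

definition cs_lim :: "'a cstar => (nat => 'a) => 'a => bool" where
 "cs_lim A X x \<longleftrightarrow> (ALL n. X n : car A) & x : car A &
   (%n. nm A (X n -[A] x)) \<longlonglongrightarrow> 0"

definition cs_cauchy :: "'a cstar => (nat => 'a) => bool" where
 "cs_cauchy A X \<longleftrightarrow> (ALL n. X n : car A) &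
   (ALL eps>0. EX N. ALL m>=N. ALL n>=N. nm A (X m -[A] X n) < eps)"

text \<open>Kept apart from the C*-axioms because the Hilbert module \<open>CdN E\<close> and the
  adjointable operators are handled as normed spaces only.\<close>

locale normed_sp =
 fixes A :: "'a cstar" (structure)
 assumes zero_in [simp]: "\<zero> : car A"
  and add_in [simp]: "!!x y. x : car A ==> y : car A ==> x \<oplus> y : car A"
  and scale_in [simp]: "!!c x. x : car A ==> c \<odot> x : car A"
  and a_assoc: "!!x y z. x : car A ==> y : car A ==> z : car A ==>
     (x \<oplus> y) \<oplus> z = x \<oplus> (y \<oplus> z)"
  and a_comm: "!!x y. x : car A ==> y : car A ==> x \<oplus> y = y \<oplus> x"
  and zero_add [simp]: "!!x. x : car A ==> \<zero> \<oplus> x = x"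
  and minus_self [simp]: "!!x. x : car A ==> x \<ominus> x = \<zero>"
  and scale_addR: "!!c x y. x : car A ==> y : car A ==> c \<odot> (x \<oplus> y) = c \<odot> x \<oplus> c \<odot> y"
  and scale_addL: "!!c k x. x : car A ==> (c + k) \<odot> x = c \<odot> x \<oplus> k \<odot> x"
  and scale_sc [simp]: "!!c k x. x : car A ==> c \<odot> k \<odot> x = (c * k) \<odot> x"
  and scale_1 [simp]: "!!x. x : car A ==> 1 \<odot> x = x"
  and nm_nonneg [simp]: "!!x. x : car A ==> 0 <= nm A x"
  and nm_zero_iff: "!!x. x : car A ==> nm A x = 0 \<longleftrightarrow> x = \<zero>"
  and nm_triangle: "!!x y. x : car A ==> y : car A ==>
     nm A (x \<oplus> y) <= nm A x + nm A y"
  and nm_scale: "!!c x. x : car A ==> nm A (c \<odot> x) = cmod c * nm A x"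
begin

lemma add_zero_right [simp]: "x : car A ==> x \<oplus> \<zero> = x"
 using a_comm zero_add by simp

lemma a_lcomm:
 "[|x : car A; y : car A; z : car A|] ==> x \<oplus> (y \<oplus> z) = y \<oplus> (x \<oplus> z)"
 by (metis a_assoc a_comm)

lemmas a_ac = a_assoc a_comm a_lcomm

lemma scale_0 [simp]: "x : car A ==> 0 \<odot> x = \<zero>"
 using scale_addL[of x 1 "-1"] by simp

lemma scale_zero [simp]: "c \<odot> \<zero> = \<zero>"
 using scale_sc[of \<zero> c 0] by simp

lemma minus_self_left [simp]: "x : car A ==> (-1) \<odot> x \<oplus> x = \<zero>"
 by (simp add: a_comm)

lemma minus_eq_zero: "[|x : car A; y : car A|] ==> x \<ominus> y = \<zero> \<longleftrightarrow> x = y"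
 by (metis a_assoc add_zero_right minus_self_left minus_self scale_in zero_add)

lemma minus_trans:
 assumes "x : car A" "y : car A" "z : car A"
 shows "(x \<ominus> y) \<oplus> (y \<ominus> z) = x \<ominus> z"
 using assms by (metis a_assoc minus_self_left scale_in zero_add add_in)

lemma minus_add_cancel: "[|x : car A; y : car A|] ==> (x \<ominus> y) \<oplus> y = x"
 by (simp add: a_assoc)

lemma neg_minus: "[|x : car A; y : car A|] ==> (-1) \<odot> (x \<ominus> y) = y \<ominus> x"
 by (simp add: scale_addR a_comm)

lemma add_minus_add:
 "[|x : car A; y : car A; x' : car A; y' : car A|] ==>
  (x \<oplus> y) \<ominus> (x' \<oplus> y') = (x \<ominus> x') \<oplus> (y \<ominus> y')"
 by (simp add: scale_addR a_ac)

lemma nm_zero [simp]: "nm A \<zero> = 0"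
 using nm_zero_iff by simp

lemma nm_minus_commute: "[|x : car A; y : car A|] ==> nm A (x \<ominus> y) = nm A (y \<ominus> x)"
 by (metis neg_minus nm_scale norm_minus_cancel norm_one mult_1 scale_in add_in)

lemma nm_minus_triangle:
 "[|x : car A; y : car A; z : car A|] ==>
   nm A (x \<ominus> z) <= nm A (x \<ominus> y) + nm A (y \<ominus> z)"
 by (metis add_in minus_trans nm_triangle scale_in)

lemma nm_triangle_minus:
 "[|x : car A; y : car A|] ==> nm A (x \<ominus> y) <= nm A x + nm A y"
 using nm_triangle[of x "(-1) \<odot> y"] by (simp add: nm_scale)

lemma nm_le_minus:
 "[|x : car A; y : car A|] ==> nm A x <= nm A y + nm A (x \<ominus> y)"
 using nm_triangle[of "x \<ominus> y" y] by (simp add: minus_add_cancel)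

lemma nm_abs_minus:
 "[|x : car A; y : car A|] ==> \<bar>nm A x - nm A y\<bar> <= nm A (x \<ominus> y)"
 using nm_le_minus[of x y] nm_le_minus[of y x] by (simp add: nm_minus_commute)

sublocale ms: Metric_space "car A" "cs_dist A"
proof
 fix x y z
 show "0 <= cs_dist A x y" "cs_dist A x y = cs_dist A y x"
  by (auto simp: cs_dist_def nm_minus_commute)
 show "x : car A ==> y : car A ==> (cs_dist A x y = 0) = (x = y)"
  by (simp add: cs_dist_def nm_zero_iff minus_eq_zero)
 show "x : car A ==> y : car A ==> z : car A ==> cs_dist A x z <= cs_dist A x y + cs_dist A y z"
  by (simp add: cs_dist_def nm_minus_triangle)
qed

lemma cs_dist_eq: "[|x : car A; y : car A|] ==> cs_dist A x y = nm A (x \<ominus> y)"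
 by (simp add: cs_dist_def)

lemma cs_topology_eq: "cs_topology A = ms.mtopology"
 by (simp add: cs_topology_def)

lemma cs_lim_iff_limitin:
 assumes "!!n. X n : car A"
 shows "cs_lim A X x \<longleftrightarrow> limitin (cs_topology A) X x sequentially"
proof -
 have "cs_lim A X x \<longleftrightarrow> x : car A & (%n. cs_dist A (X n) x) \<longlonglongrightarrow> 0"
  using assms by (auto simp: cs_lim_def cs_dist_eq)
 also have "... \<longleftrightarrow> limitin (cs_topology A) X x sequentially"
  unfolding cs_topology_eq ms.limit_metric_sequentially lim_sequentially dist_real_def
  using assms by auto
 finally show ?thesis .
qed

text \<open>The spaces are metric, so sequences decide closedness; together with
  \<open>closure_of_seq_iff\<close> and \<open>mcomplete_iff\<close> this turns every topological
  notion of the definitions into a statement about \<open>cs_lim\<close>.\<close>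

lemma closedin_seq_iff:
 "closedin (cs_topology A) W \<longleftrightarrow>
   W <= car A & (ALL X x. (ALL n. X n : W) --> cs_lim A X x --> x : W)"
proof -
 have "closedin (cs_topology A) W \<longleftrightarrow>
   W <= car A & (ALL X x. range X <= W & limitin (cs_topology A) X x sequentially --> x : W)"
  unfolding cs_topology_eq ms.metric_closedin_iff_sequentially_closed ..
 also have "... \<longleftrightarrow> W <= car A & (ALL X x. (ALL n. X n : W) --> cs_lim A X x --> x : W)"
  using cs_lim_iff_limitin by (metis image_subset_iff iso_tuple_UNIV_I subsetD)
 finally show ?thesis .
qed

lemma closure_of_seq_iff:
 assumes "W <= car A"
 shows "x : cs_topology A closure_of W \<longleftrightarrow> (EX X. (ALL n. X n : W) & cs_lim A X x)"
proof -
 have "x : cs_topology A closure_of W \<longleftrightarrow>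
  (EX X. range X <= W Int car A & limitin (cs_topology A) X x sequentially)"
  unfolding cs_topology_eq ms.closure_of_sequentially by (auto dest: ms.limitin_mspace)
 also have "... \<longleftrightarrow> (EX X. (ALL n. X n : W) & cs_lim A X x)"
  using cs_lim_iff_limitin assms by (metis image_subset_iff inf.absorb1 iso_tuple_UNIV_I subsetD)
 finally show ?thesis .
qed

lemma mcomplete_iff: "ms.mcomplete \<longleftrightarrow> (ALL X. cs_cauchy A X --> (EX x. cs_lim A X x))"
proof -
 have *: "ms.MCauchy X \<longleftrightarrow> cs_cauchy A X" for X
 proof -
  have "ms.MCauchy X \<longleftrightarrow> (ALL n. X n : car A) &
    (ALL eps>0. EX N. ALL m n. N <= m --> N <= n --> cs_dist A (X m) (X n) < eps)"
   by (auto simp: ms.MCauchy_def)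
  then show ?thesis by (auto simp: cs_cauchy_def cs_dist_eq)
 qed
 show ?thesis unfolding ms.mcomplete_def *
  using cs_lim_iff_limitin by (metis cs_topology_eq cs_cauchy_def)
qed

lemma cs_lim_const [simp]: "x : car A ==> cs_lim A (%n. x) x"
 by (simp add: cs_lim_def)

lemma cs_lim_unique: "cs_lim A X x ==> cs_lim A X y ==> x = y"
proof -
 assume l: "cs_lim A X x" "cs_lim A X y"
 then have c: "!!n. X n : car A" by (simp add: cs_lim_def)
 show ?thesis
  using l[unfolded cs_lim_iff_limitin[of X, OF c] cs_topology_eq] ms.limitin_metric_unique
  by (metis trivial_limit_sequentially)
qed

lemma cs_lim_norm: assumes "cs_lim A X x" shows "(%n. nm A (X n)) \<longlonglongrightarrow> nm A x"
proof -
 have c: "!!n. X n : car A" "x : car A" and l: "(%n. nm A (X n \<ominus> x)) \<longlonglongrightarrow> 0"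
  using assms by (auto simp: cs_lim_def)
 have "(%n. nm A (X n) - nm A x) \<longlonglongrightarrow> 0"
  by (rule Lim_null_comparison[OF _ l]) (use c nm_abs_minus in auto)
 then show ?thesis by (simp add: LIM_zero_iff)
qed

lemma cs_lim_add: assumes "cs_lim A X x" "cs_lim A Y y" shows "cs_lim A (%n. X n \<oplus> Y n) (x \<oplus> y)"
proof -
 have c: "!!n. X n : car A" "x : car A" "!!n. Y n : car A" "y : car A"
  and l: "(%n. nm A (X n \<ominus> x)) \<longlonglongrightarrow> 0" "(%n. nm A (Y n \<ominus> y)) \<longlonglongrightarrow> 0"
  using assms by (auto simp: cs_lim_def)
 have "(%n. nm A ((X n \<oplus> Y n) \<ominus> (x \<oplus> y))) \<longlonglongrightarrow> 0"
  by (rule Lim_null_comparison[OF _ tendsto_add_zero[OF l]])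
    (use c in \<open>auto simp: add_minus_add nm_triangle\<close>)
 then show ?thesis using c by (simp add: cs_lim_def)
qed

lemma cs_lim_scale: assumes "cs_lim A X x" shows "cs_lim A (%n. c \<odot> X n) (c \<odot> x)"
proof -
 have c: "!!n. X n : car A" "x : car A"
  and l: "(%n. nm A (X n \<ominus> x)) \<longlonglongrightarrow> 0"
  using assms by (auto simp: cs_lim_def)
 have "c \<odot> X n \<ominus> c \<odot> x = c \<odot> (X n \<ominus> x)" for n using c by (simp add: scale_addR mult.commute)
 then have "nm A (c \<odot> X n \<ominus> c \<odot> x) = cmod c * nm A (X n \<ominus> x)" for n
  using c by (simp add: nm_scale)
 then have "(%n. nm A (c \<odot> X n \<ominus> c \<odot> x)) \<longlonglongrightarrow> 0"
  using tendsto_mult_right_zero[OF l, of "cmod c"] by simp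
 then show ?thesis using c by (simp add: cs_lim_def)
qed

lemma cs_lim_minus: "cs_lim A X x ==> cs_lim A Y y ==> cs_lim A (%n. X n \<ominus> Y n) (x \<ominus> y)"
 by (intro cs_lim_add cs_lim_scale)

lemma cs_lim_cauchy: assumes "cs_lim A X x" shows "cs_cauchy A X"
proof -
 have c: "!!n. X n : car A" "x : car A"
  and l: "(%n. nm A (X n \<ominus> x)) \<longlonglongrightarrow> 0"
  using assms by (auto simp: cs_lim_def)
 have "EX N. ALL m>=N. ALL n>=N. nm A (X m \<ominus> X n) < eps" if e: "eps > 0" for eps
 proof -
  obtain N where N: "!!n. n >= N ==> nm A (X n \<ominus> x) < eps/2"
   using LIMSEQ_D[OF l, of "eps/2"] e c by auto
  have "nm A (X m \<ominus> X n) < eps" if "m >= N" "n >= N" for m n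
   using nm_minus_triangle[of "X m" x "X n"] N[OF that(1)] N[OF that(2)] c
   by (simp add: nm_minus_commute[of x "X n"])
  then show ?thesis by blast
 qed
 then show ?thesis using c by (auto simp: cs_cauchy_def)
qed

lemma closed_subspace_lim:
 "closed_subspace A W ==> (!!n. X n : W) ==> cs_lim A X x ==> x : W"
 unfolding closed_subspace_def closedin_seq_iff by blast

lemma closed_subspace_subset: "closed_subspace A W ==> W <= car A"
 unfolding closed_subspace_def closedin_seq_iff by blast

lemma closed_subspace_closure:
 assumes W: "W <= car A" "\<zero> : W" "!!x y. x : W ==> y : W ==> x \<oplus> y : W" "!!c x. x : W ==> c \<odot> x : W"
 shows "closed_subspace A (cs_topology A closure_of W)"
 unfolding closed_subspace_def
proof (intro conjI ballI allI)
 show "closedin (cs_topology A) (cs_topology A closure_of W)" by simp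
 note cl = closure_of_seq_iff[OF W(1)]
 show "\<zero> : cs_topology A closure_of W" unfolding cl using W(2) by (metis cs_lim_const zero_in)
 fix x assume x: "x : cs_topology A closure_of W"
 then obtain X where X: "!!n. X n : W" "cs_lim A X x" unfolding cl by blast
 show "c \<odot> x : cs_topology A closure_of W" for c
  unfolding cl by (rule exI[of _ "%n. c \<odot> X n"]) (use X W(4) cs_lim_scale in auto)
 fix y assume "y : cs_topology A closure_of W"
 then obtain Y where Y: "!!n. Y n : W" "cs_lim A Y y" unfolding cl by blast
 show "x \<oplus> y : cs_topology A closure_of W"
  unfolding cl by (rule exI[of _ "%n. X n \<oplus> Y n"]) (use X Y W(3) cs_lim_add in auto)
qed

end

section \<open>Continuous extension of densely defined maps\<close>

text \<open>Extension of a densely defined bounded linear map, given as a relation \<open>R\<close>; working with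
 relations makes well-definedness part of the boundedness estimate.\<close>

definition lim_rel :: "'x cstar => 'a cstar => ('x => 'a => bool) => 'x => 'a => bool" where
 "lim_rel X A R x y \<longleftrightarrow> (EX sg tau. (ALL n. R (sg n) (tau n)) & cs_lim X sg x & cs_lim A tau y)"

locale dense_map = X: normed_sp X + A: normed_sp A for X :: "'x cstar" and A :: "'a cstar" +
 fixes R :: "'x => 'a => bool" and K :: real
 assumes R_in: "R x y ==> x : car X & y : car A"
  and R_add: "R x y ==> R x' y' ==> R (x +[X] x') (y +[A] y')"
  and R_scale: "R x y ==> R (c .[X] x) (c .[A] y)"
  and R_bound: "R x y ==> nm A y <= K * nm X x"
  and A_complete: "cs_cauchy A tau ==> EX y. cs_lim A tau y"
begin

lemma lim_relI: "R x y ==> lim_rel X A R x y"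
 unfolding lim_rel_def using R_in by (metis X.cs_lim_const A.cs_lim_const)

lemma lim_rel_in: "lim_rel X A R x y ==> x : car X & y : car A"
 by (auto simp: lim_rel_def cs_lim_def)

lemma lim_rel_add: "lim_rel X A R x y ==> lim_rel X A R x' y' ==> lim_rel X A R (x +[X] x') (y +[A] y')"
 unfolding lim_rel_def
 apply clarify
 subgoal for sg sg' tau tau'
  by (rule exI[of _ "%n. sg n +[X] sg' n"], rule exI[of _ "%n. tau n +[A] tau' n"])
    (auto intro: R_add X.cs_lim_add A.cs_lim_add)
 done

lemma lim_rel_scale: "lim_rel X A R x y ==> lim_rel X A R (c .[X] x) (c .[A] y)"
 unfolding lim_rel_def
 apply clarify
 subgoal for sg tau
  by (rule exI[of _ "%n. c .[X] sg n"], rule exI[of _ "%n. c .[A] tau n"])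
    (auto intro: R_scale X.cs_lim_scale A.cs_lim_scale)
 done

lemma lim_rel_bound: assumes "lim_rel X A R x y" shows "nm A y <= K * nm X x"
proof -
 obtain sg tau where s: "!!n. R (sg n) (tau n)" "cs_lim X sg x" "cs_lim A tau y"
  using assms by (auto simp: lim_rel_def)
 have "(%n. nm A (tau n)) \<longlonglongrightarrow> nm A y" "(%n. K * nm X (sg n)) \<longlonglongrightarrow> K * nm X x"
  using s by (auto intro: A.cs_lim_norm X.cs_lim_norm tendsto_intros)
 then show ?thesis using R_bound s(1) by (intro LIMSEQ_le) auto
qed

text \<open>Subtracting the two instances relates zero to \<open>y - y'\<close>, and the bound then
  leaves norm 0.\<close>

lemma lim_rel_unique: assumes "lim_rel X A R x y" "lim_rel X A R x y'" shows "y = y'"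
proof -
 have "lim_rel X A R (x -[X] x) (y -[A] y')"
  using assms lim_rel_add lim_rel_scale by blast
 from lim_rel_bound[OF this] lim_rel_in[OF assms(1)] lim_rel_in[OF assms(2)]
 have "nm A (y -[A] y') <= 0" by simp
 then show ?thesis using lim_rel_in[OF assms(1)] lim_rel_in[OF assms(2)]
  by (metis A.add_in A.minus_eq_zero A.nm_nonneg A.nm_zero_iff A.scale_in order_antisym)
qed

lemma lim_rel_exists:
 assumes sg: "!!n. EX y. R (sg n) y" "cs_lim X sg x"
 shows "EX y. lim_rel X A R x y"
proof -
 obtain tau where t: "!!n. R (sg n) (tau n)" using sg(1) by metis
 have diff: "nm A (tau m -[A] tau n) <= \<bar>K\<bar> * nm X (sg m -[X] sg n)" for m n
 proof -
  have "nm A (tau m -[A] tau n) <= K * nm X (sg m -[X] sg n)"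
   using R_bound R_add R_scale t by blast
  also have "... <= \<bar>K\<bar> * nm X (sg m -[X] sg n)"
   using R_in[OF t] by (intro mult_right_mono) auto
  finally show ?thesis .
 qed
 have "cs_cauchy A tau" unfolding cs_cauchy_def
 proof (intro conjI allI impI)
  show "tau n : car A" for n using R_in t by blast
  fix eps :: real assume "eps > 0"
  \<comment> \<open>The summand 1 keeps the denominator positive, as \<open>K\<close> is an
    arbitrary real.\<close>
  then have "eps / (\<bar>K\<bar> + 1) > 0" by auto
  then obtain N where N: "!!m n. m >= N ==> n >= N ==> nm X (sg m -[X] sg n) < eps / (\<bar>K\<bar> + 1)"
   using X.cs_lim_cauchy[OF sg(2)] unfolding cs_cauchy_def by meson
  have "nm A (tau m -[A] tau n) < eps" if "m >= N" "n >= N" for m n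
  proof -
   have "0 <= nm X (sg m -[X] sg n)" using R_in[OF t] by simp
   then have "\<bar>K\<bar> * nm X (sg m -[X] sg n) <= (\<bar>K\<bar> + 1) * nm X (sg m -[X] sg n)"
    by (intro mult_right_mono) auto
   also have "... < eps" using N[OF that] by (simp add: field_simps)
   finally show ?thesis using diff[of m n] by linarith
  qed
  then show "EX N. ALL m>=N. ALL n>=N. nm A (tau m -[A] tau n) < eps" by blast
 qed
 then show ?thesis using A_complete t sg(2) unfolding lim_rel_def by blast
qed

end

lemma (in normed_sp) geometric_cauchy:
 assumes X: "!!n. X n : car A" and K: "!!n. nm A (X (Suc n) \<ominus> X n) <= K * (1/2)^n"
 shows "cs_cauchy A X"
proof -
 \<comment> \<open>Telescoping, with the partial sum of the geometric series in closed form so that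
   the induction goes through.\<close>
 have *: "nm A (X (n + k) \<ominus> X n) <= 2 * K * ((1/2)^n - (1/2)^(n+k))" for n k
 proof (induction k)
  case (Suc k)
  have "nm A (X (n + Suc k) \<ominus> X n) <= nm A (X (Suc (n + k)) \<ominus> X (n+k)) + nm A (X (n + k) \<ominus> X n)"
   using nm_minus_triangle X by simp
  also have "... <= K * (1/2)^(n+k) + 2 * K * ((1/2)^n - (1/2)^(n+k))" using K Suc by (intro add_mono) auto
  also have "... = 2 * K * ((1/2)^n - (1/2)^(n+Suc k))" by (simp add: algebra_simps)
  finally show ?case .
 qed (use X in simp)
 have K0: "K >= 0" using order_trans[OF nm_nonneg K[of 0]] X by simp
 have **: "nm A (X m \<ominus> X n) <= 2 * K * (1/2)^N" if "m >= N" "n >= N" for m n N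
 proof -
  have a: "nm A (X m \<ominus> X n) <= 2 * K * (1/2)^N" if "m >= n" "n >= N" for m n
  proof -
   have "nm A (X m \<ominus> X n) <= 2 * K * ((1/2)^n - (1/2)^m)" using *[of n "m - n"] that by simp
   also have "... <= 2 * K * (1/2)^N" using that K0
    by (intro mult_left_mono) (auto intro: order_trans[OF _ power_decreasing[of N n]])
   finally show ?thesis .
  qed
  show ?thesis using a[of n m] a[of m n] that nm_minus_commute[of "X m" "X n"] X by (cases "n <= m") auto
 qed
 have "EX N. ALL m>=N. ALL n>=N. nm A (X m \<ominus> X n) < eps" if e: "eps > 0" for eps
 proof -
  obtain N where "(1/2::real)^N < eps / (2 * K + 1)"
   using real_arch_pow_inv[of "eps / (2 * K + 1)" "1/2"] e K0 by auto
  then have "2 * K * (1/2)^N < eps" using K0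
  proof -
   assume a: "(1/2::real)^N < eps / (2 * K + 1)"
   have "2 * K * (1/2)^N <= (2 * K + 1) * (1/2)^N" by (intro mult_right_mono) auto
   also have "... < eps" using a K0 by (simp add: field_simps)
   finally show ?thesis .
  qed
  then show ?thesis using ** by (meson order_le_less_trans)
 qed
 then show ?thesis using X by (simp add: cs_cauchy_def)
qed

section \<open>C*-algebras and automatic contractivity of homomorphisms\<close>

locale cs_alg = cstar_algebra A for A :: "'a cstar" (structure)

sublocale cs_alg \<subseteq> normed_sp A
 by unfold_locales (auto simp: zero_closed add_closed scale_closed add_zero add_minus scale_add_right
   scale_add_left scale_scale scale_one norm_nonneg norm_eq_zero norm_triangle norm_scale add_assoc
   intro: add_commute)

context cs_alg
begin

lemma mult_in [simp]: "x : car A ==> y : car A ==> x \<otimes> y : car A"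
 by (rule mult_closed)

lemma star_in [simp]: "x : car A ==> cs_star A x : car A"
 by (rule star_closed)

declare star_star [simp]

lemma cauchy_lim: "cs_cauchy A X ==> EX x. cs_lim A X x"
 using complete mcomplete_iff by blast

lemma zero_mult [simp]: "x : car A ==> \<zero> \<otimes> x = \<zero>"
 using mult_scale_left[of \<zero> x 0] by simp

lemma mult_zero [simp]: "x : car A ==> x \<otimes> \<zero> = \<zero>"
 using mult_scale_right[of x \<zero> 0] by simp

lemma star_zero [simp]: "cs_star A \<zero> = \<zero>"
 using star_scale[of \<zero> 0] by simp

lemma mult_minus_left: "[|x : car A; y : car A; z : car A|] ==> (x \<ominus> y) \<otimes> z = x \<otimes> z \<ominus> y \<otimes> z"
 by (simp add: mult_add_left mult_scale_left)

lemma mult_minus_right: "[|x : car A; y : car A; z : car A|] ==> z \<otimes> (x \<ominus> y) = z \<otimes> x \<ominus> z \<otimes> y"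
 by (simp add: mult_add_right mult_scale_right)

lemma star_minus: "[|x : car A; y : car A|] ==> cs_star A (x \<ominus> y) = cs_star A x \<ominus> cs_star A y"
 by (simp add: star_add star_scale)

text \<open>The C*-identity and submultiplicativity give \<open>||y||^2 <= ||y*|| ||y||\<close>; the
  converse inequality is the same for \<open>y*\<close>.\<close>

lemma norm_star [simp]: assumes x: "x : car A" shows "nm A (cs_star A x) = nm A x"
proof -
 have le: "nm A y <= nm A (cs_star A y)" if y: "y : car A" for y
 proof (cases "nm A y = 0")
  case False
  then have p: "nm A y > 0" using y nm_nonneg[OF y] by linarith
  have "nm A y * nm A y <= nm A (cs_star A y) * nm A y"
   using norm_star_mult[OF y] norm_mult[of "cs_star A y" y] y by (simp add: power2_eq_square)
  then show ?thesis using p by simp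
 qed (use y in simp)
 show ?thesis using le[OF x] le[of "cs_star A x"] x by simp
qed

lemma norm_selfadjoint_sq: "x : car A ==> cs_star A x = x ==> nm A (x \<otimes> x) = (nm A x)^2"
 using norm_star_mult[of x] by simp

lemma cs_lim_star: "cs_lim A X x ==> cs_lim A (%n. cs_star A (X n)) (cs_star A x)"
 by (auto simp: cs_lim_def star_minus[symmetric])

lemma mult_minus_mult:
 assumes "x : car A" "y : car A" "x' : car A" "y' : car A"
 shows "nm A (x \<otimes> y \<ominus> x' \<otimes> y') <= nm A (x \<ominus> x') * nm A y + nm A x' * nm A (y \<ominus> y')"
proof -
 have "x \<otimes> y \<ominus> x' \<otimes> y' = (x \<otimes> y \<ominus> x' \<otimes> y) \<oplus> (x' \<otimes> y \<ominus> x' \<otimes> y')"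
  using assms by (simp add: minus_trans)
 also have "... = (x \<ominus> x') \<otimes> y \<oplus> x' \<otimes> (y \<ominus> y')"
  using assms by (simp only: mult_minus_left mult_minus_right)
 also have "nm A ... <= nm A ((x \<ominus> x') \<otimes> y) + nm A (x' \<otimes> (y \<ominus> y'))"
  using assms by (intro nm_triangle) auto
 also have "... <= nm A (x \<ominus> x') * nm A y + nm A x' * nm A (y \<ominus> y')"
  using assms by (intro add_mono norm_mult) auto
 finally show ?thesis .
qed

lemma cs_lim_mult: assumes "cs_lim A X x" "cs_lim A Y y" shows "cs_lim A (%n. X n \<otimes> Y n) (x \<otimes> y)"
proof -
 have c: "!!n. X n : car A" "x : car A" "!!n. Y n : car A" "y : car A"
  and l: "(%n. nm A (X n \<ominus> x)) \<longlonglongrightarrow> 0" "(%n. nm A (Y n \<ominus> y)) \<longlonglongrightarrow> 0"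
  using assms by (auto simp: cs_lim_def)
 have "(%n. nm A (X n \<ominus> x) * nm A (Y n) + nm A x * nm A (Y n \<ominus> y))
    \<longlonglongrightarrow> 0 * nm A y + nm A x * 0"
  by (intro tendsto_intros l cs_lim_norm assms)
 then have "(%n. nm A (X n \<ominus> x) * nm A (Y n) + nm A x * nm A (Y n \<ominus> y)) \<longlonglongrightarrow> 0"
  by simp
 then have "(%n. nm A (X n \<otimes> Y n \<ominus> x \<otimes> y)) \<longlonglongrightarrow> 0"
  by (rule Lim_null_comparison[rotated]) (use c mult_minus_mult in auto)
 then show ?thesis using c by (simp add: cs_lim_def)
qed

text \<open>Solving \<open>(1 - c)\<^sup>2 = 1 - a\<^sup>2\<close> without a unit, by iterating the contraction
 \<open>c \<mapsto> (a\<^sup>2 + c\<^sup>2) / 2\<close>.\<close>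

lemma selfadjoint_root:
 assumes a: "a : car A" "cs_star A a = a" "nm A a <= 1/2"
 obtains c where "c : car A" "cs_star A c = c" "c \<otimes> a = a \<otimes> c" "c \<oplus> c = a \<otimes> a \<oplus> c \<otimes> c"
proof -
 define g where "g c = (1/2) \<odot> (a \<otimes> a \<oplus> c \<otimes> c)" for c
 define X where "X n = (g ^^ n) \<zero>" for n
 have X0: "X 0 = \<zero>" and XS: "X (Suc n) = g (X n)" for n by (simp_all add: X_def)
 have half: "cmod (1/2) = 1/2" by (simp add: norm_divide)
 have inv: "X n : car A & nm A (X n) <= 1/2 & cs_star A (X n) = X n & X n \<otimes> a = a \<otimes> X n" for n
 proof (induction n)
  case 0 then show ?case using a by (simp add: X0)
 next
  case (Suc n)
  then have c: "X n : car A" "nm A (X n) <= 1/2" "cs_star A (X n) = X n" and e: "X n \<otimes> a = a \<otimes> X n" by auto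
  have "nm A (a \<otimes> a \<oplus> X n \<otimes> X n) <= nm A a * nm A a + nm A (X n) * nm A (X n)"
   using a c by (intro order_trans[OF nm_triangle] add_mono norm_mult) auto
  also have "... <= 1/2 * (1/2) + 1/2 * (1/2)" using a c by (intro add_mono mult_mono) auto
  finally have "nm A (X (Suc n)) <= 1/2" using a c by (simp add: XS g_def nm_scale half)
  moreover have "X n \<otimes> X n \<otimes> a = a \<otimes> (X n \<otimes> X n)"
   using a c e by (metis mult_assoc)
  then have "X (Suc n) \<otimes> a = a \<otimes> X (Suc n)"
   using a c by (simp add: XS g_def mult_add_left mult_add_right mult_scale_left mult_scale_right mult_assoc)
  ultimately show ?case
   using a c by (simp add: XS g_def star_scale star_add star_mult)
 qed
 \<comment> \<open>On the ball of radius 1/2 the difference of two squares is at most the difference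
   of the elements, since \<open>1/2 + 1/2 = 1\<close>; the outer factor 1/2 is then the contraction
   constant.\<close>
 have step: "nm A (X (Suc n) \<ominus> X n) <= 1 * (1/2)^n" for n
 proof (induction n)
  case 0
  have "nm A (X 1 \<ominus> X 0) <= nm A (X 1) + nm A (X 0)" using inv by (intro nm_triangle_minus) auto
  then show ?case using inv[of 1] by (simp add: X0)
 next
  case (Suc n)
  let ?c = "X (Suc n)" let ?d = "X n"
  have c: "?c : car A" "?d : car A" using inv by auto
  have "g ?c \<ominus> g ?d = (1/2) \<odot> ((a \<otimes> a \<oplus> ?c \<otimes> ?c) \<ominus> (a \<otimes> a \<oplus> ?d \<otimes> ?d))"
   unfolding g_def using a c by (subst scale_addR) auto
  also have "... = (1/2) \<odot> (?c \<otimes> ?c \<ominus> ?d \<otimes> ?d)"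
   using a c by (simp add: add_minus_add del: scale_addR)
  finally have "nm A (g ?c \<ominus> g ?d) = 1/2 * nm A (?c \<otimes> ?c \<ominus> ?d \<otimes> ?d)"
   using c by (simp add: nm_scale half)
  also have "... <= 1/2 * (nm A (?c \<ominus> ?d) * nm A ?c + nm A ?d * nm A (?c \<ominus> ?d))"
   using mult_minus_mult c by (intro mult_left_mono) auto
  also have "... <= 1/2 * (nm A (?c \<ominus> ?d) * (1/2) + 1/2 * nm A (?c \<ominus> ?d))"
   using inv c by (intro mult_left_mono add_mono mult_right_mono) auto
  also have "... <= (1/2) ^ Suc n" using Suc by simp
  finally show ?case by (simp add: XS)
 qed
 obtain c where l: "cs_lim A X c" using geometric_cauchy[OF _ step] inv cauchy_lim by blast
 have c: "c : car A" using l by (simp add: cs_lim_def)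
 have "cs_star A c = c" using cs_lim_star[OF l] l inv cs_lim_unique by simp
 moreover have "c \<otimes> a = a \<otimes> c"
  using cs_lim_mult[OF l cs_lim_const[OF a(1)]] cs_lim_mult[OF cs_lim_const[OF a(1)] l] inv cs_lim_unique by simp
 moreover have "c \<oplus> c = a \<otimes> a \<oplus> c \<otimes> c"
 proof -
  have "cs_lim A (%n. g (X n)) (g c)" unfolding g_def
   by (intro cs_lim_scale cs_lim_add cs_lim_mult l cs_lim_const) (use a in auto)
  moreover have "cs_lim A (%n. g (X n)) c"
   using l LIMSEQ_Suc[of "%n. nm A (X n \<ominus> c)"] by (simp add: cs_lim_def XS[symmetric])
  ultimately have "c = g c" using cs_lim_unique by blast
  then have "c \<oplus> c = g c \<oplus> g c" by simp
  also have "... = a \<otimes> a \<oplus> c \<otimes> c" unfolding g_def using a c by (simp add: scale_addL[symmetric])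
  finally show ?thesis .
 qed
 ultimately show ?thesis using that c by blast
qed

text \<open>For self-adjoint elements the C*-identity makes squaring exact on norms. This is the
  substitute for the spectral radius formula.\<close>

lemma norm_iterated_square:
 assumes a: "a : car A" "cs_star A a = a"
 shows "((%x. x \<otimes> x) ^^ n) a : car A & cs_star A (((%x. x \<otimes> x) ^^ n) a) = ((%x. x \<otimes> x) ^^ n) a &
     nm A (((%x. x \<otimes> x) ^^ n) a) = nm A a ^ (2^n)"
 by (induction n) (use a in \<open>auto simp: star_mult norm_selfadjoint_sq power_mult[symmetric] mult.commute\<close>)

end

text \<open>A constant factor disappears on taking \<open>2^n\<close>-th roots: if
  \<open>x > t > 0\<close>, the powers of \<open>x / t\<close> would be bounded by
  \<open>C\<close>.\<close>

lemma le_of_power_le: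
 fixes x t C :: real
 assumes "0 <= t" and le: "!!n. x ^ (2^n) <= C * t ^ (2^n)"
 shows "x <= t"
proof (rule ccontr)
 assume "~ x <= t"
 then have xt: "x > t" "x > 0" using assms by auto
 show False
 proof (cases "t = 0")
  case True then show False using le[of 0] xt by simp
 next
  case False
  then have t: "t > 0" using assms by simp
  then have r: "x / t > 1" using xt by simp
  obtain n where n: "C < (x/t) ^ n" using real_arch_pow[OF r] by blast
  have "(x/t)^n <= (x/t)^(2^n)" using r by (intro power_increasing) (auto simp: less_imp_le)
  moreover have "(x/t)^(2^n) <= C" using le[of n] t by (simp add: power_divide field_simps)
  ultimately show False using n by simp
 qed
qed

lemma star_homD:
 assumes "star_hom A B phi"
 shows "x : car A ==> phi x : car B"
  and "x : car A ==> y : car A ==> phi (x +[A] y) = phi x +[B] phi y"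
  and "x : car A ==> phi (c .[A] x) = c .[B] phi x"
  and "x : car A ==> y : car A ==> phi (x *[A] y) = phi x *[B] phi y"
  and "x : car A ==> phi (cs_star A x) = cs_star B (phi x)"
 using assms by (auto simp: star_hom_def)

text \<open>For self-adjoint \<open>a\<close> of norm at most \<open>1/2\<close> take \<open>c\<close> with \<open>(1 - c)\<^sup>2 + a\<^sup>2 = 1\<close>. This
 algebraic relation survives under \<open>\<phi>\<close>, so \<open>1 + w\<close> with \<open>w = - \<phi> c + \<i> \<phi> a\<close> is unitary and
 \<open>\<parallel>\<phi> a\<parallel> \<le> \<parallel>w\<parallel> \<le> 2\<close>. Iterated squaring turns the resulting constant into \<open>1\<close>.\<close>

lemma star_hom_contractive:
 assumes A: "cstar_algebra A" and B: "cstar_algebra B" and h: "star_hom A B phi" and x: "x : car A"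
 shows "nm B (phi x) <= nm A x"
proof -
 interpret A: cs_alg A using A by (simp add: cs_alg_def)
 interpret B: cs_alg B using B by (simp add: cs_alg_def)
 note hD = star_homD[OF h]
 have small: "nm B (phi a) <= 2"
  if a: "a : car A" "cs_star A a = a" "nm A a <= 1/2" for a
 proof -
  obtain c where c: "c : car A" "cs_star A c = c" "c *[A] a = a *[A] c"
   "c +[A] c = a *[A] a +[A] c *[A] c" using A.selfadjoint_root[OF a] by blast
  define b d where "b = phi a" and "d = phi c"
  have bd: "b : car B" "d : car B" "cs_star B b = b" "cs_star B d = d"
   using hD a c unfolding b_def d_def by metis+
  have comm: "d *[B] b = b *[B] d" unfolding b_def d_def using hD(4) a c by metis
  have rel: "d +[B] d = b *[B] b +[B] d *[B] d"
   unfolding b_def d_def using hD(2,4) a c A.mult_in by metis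
  define w where "w = (-1) .[B] d +[B] \<i> .[B] b"
  have w: "w : car B" using bd by (simp add: w_def)
  have sw: "cs_star B w = (-1) .[B] d +[B] (-\<i>) .[B] b" using bd by (simp add: w_def B.star_add B.star_scale)
  have z: "\<i> .[B] u +[B] (-\<i>) .[B] u = (cs_zero B)" if "u : car B" for u
   using B.scale_addL[OF that, of \<i> "-\<i>"] that by simp
  \<comment> \<open>Expanding \<open>w* w\<close>, the mixed terms cancel because \<open>b\<close>
    and \<open>d\<close> commute; what remains is \<open>b^2 + d^2 = 2d\<close>.\<close>
  have "cs_star B w *[B] w = (d *[B] d +[B] (-\<i>) .[B] (b *[B] d)) +[B] (\<i> .[B] (b *[B] d) +[B] b *[B] b)"
   unfolding sw unfolding w_def using bd
   by (simp add: B.mult_add_left B.mult_add_right B.mult_scale_left B.mult_scale_right comm B.scale_addR B.a_ac)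
  also have "... = (\<i> .[B] (b *[B] d) +[B] (-\<i>) .[B] (b *[B] d)) +[B] (b *[B] b +[B] d *[B] d)"
   using bd by (simp add: B.a_ac)
  also have "... = d +[B] d" using bd by (simp add: z rel)
  finally have ww: "cs_star B w *[B] w = d +[B] d" .
  \<comment> \<open>Since \<open>w + w* = -2d\<close>, the C*-identity reads
    \<open>||w||^2 = ||2d|| <= 2 ||w||\<close>, so \<open>||w|| <= 2\<close>. Below,
    \<open>w - w* = 2 i b\<close> transfers the bound to \<open>b\<close>.\<close>
  have "w +[B] cs_star B w = ((-1) .[B] d +[B] (-1) .[B] d) +[B] (\<i> .[B] b +[B] (-\<i>) .[B] b)"
   unfolding sw unfolding w_def using bd by (simp add: B.a_ac)
  also have "... = (-1) .[B] (d +[B] d)" using bd by (simp add: z B.scale_addR)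
  finally have "nm B (d +[B] d) = nm B (w +[B] cs_star B w)" using bd by (simp add: B.nm_scale)
  also have "... <= nm B w + nm B w" using B.nm_triangle[of w "cs_star B w"] w by simp
  finally have "(nm B w)^2 <= 2 * nm B w" using B.norm_star_mult[OF w] ww by simp
  then have w2: "nm B w <= 2" using B.nm_nonneg[OF w] by (cases "nm B w = 0") (auto simp: power2_eq_square)
  have "w -[B] cs_star B w = ((-1) .[B] d +[B] d) +[B] (\<i> .[B] b +[B] \<i> .[B] b)"
   unfolding sw unfolding w_def using bd by (simp add: B.scale_addR B.a_ac del: B.minus_self B.minus_self_left)
  also have "... = (2 * \<i>) .[B] b" using bd B.scale_addL[of b \<i> \<i>] by simp
  finally have "2 * nm B b = nm B (w -[B] cs_star B w)" using bd by (simp add: B.nm_scale norm_mult)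
  also have "... <= nm B w + nm B w" using B.nm_triangle_minus[of w "cs_star B w"] w by simp
  finally show ?thesis using w2 by (simp add: b_def)
 qed
 \<comment> \<open>Rescaling \<open>a\<close> to norm 1/2 turns the absolute bound 2 into the
   constant 4.\<close>
 have bd: "nm B (phi a) <= 4 * nm A a" if a: "a : car A" "cs_star A a = a" for a
 proof (cases "nm A a = 0")
  case True
  then have "a = 0 .[A] a" using A.nm_zero_iff a by simp
  then have "phi a = 0 .[B] phi a" using hD(3)[OF a(1), of 0] by simp
  then have "phi a = (cs_zero B)" using hD(1)[OF a(1)] by simp
  then show ?thesis using True by simp
 next
  case False
  define r where "r = nm A a"
  have r: "r > 0" using False A.nm_nonneg[OF a(1)] by (simp add: r_def less_le)
  let ?a = "complex_of_real (1/(2*r)) .[A] a"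
  have nr: "cmod (complex_of_real (1/(2*r))) = 1/(2*r)" using r by (simp only: norm_of_real) simp
  have "nm A ?a = 1/2" using a r unfolding A.nm_scale[OF a(1)] nr r_def[symmetric] by simp
  moreover have "cs_star A ?a = ?a" using a by (simp add: A.star_scale)
  ultimately have "nm B (phi ?a) <= 2" using small a by simp
  then have "1/(2*r) * nm B (phi a) <= 2"
   unfolding hD(3)[OF a(1)] B.nm_scale[OF hD(1)[OF a(1)]] nr .
  then show ?thesis using r by (simp add: r_def[symmetric] field_simps)
 qed
 have sa: "nm B (phi a) <= nm A a" if a: "a : car A" "cs_star A a = a" for a
 proof (rule le_of_power_le)
  show "0 <= nm A a" using a by simp
  fix n
  note A' = A.norm_iterated_square[OF a, of n]
  have e: "phi (((%x. x *[A] x) ^^ n) a) = ((%x. x *[B] x) ^^ n) (phi a)"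
   by (induction n) (simp_all add: hD(4) A.norm_iterated_square[OF a])
  have "cs_star B (phi a) = phi a" using hD(5) a by metis
  from B.norm_iterated_square[OF hD(1)[OF a(1)] this, of n]
  show "nm B (phi a) ^ 2 ^ n <= 4 * nm A a ^ 2 ^ n"
   using bd A' e by metis
 qed
 \<comment> \<open>The general case is the self-adjoint one for \<open>x* x\<close>, by the
   C*-identity on both sides.\<close>
 have "(nm B (phi x))^2 = nm B (phi (cs_star A x *[A] x))"
  using hD x B.norm_star_mult by (metis A.star_in)
 also have "... <= nm A (cs_star A x *[A] x)" using x by (intro sa) (auto simp: A.star_mult)
 also have "... = (nm A x)^2" using A.norm_star_mult x by simp
 finally show ?thesis by (rule power2_le_imp_le) (use x in simp)
qed

text \<open>The C*-axioms without completeness: for function algebras, products and quotients the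
  algebra is verified first, and completeness is then supplied with sequences through
  \<open>cstar_algebraI\<close>.\<close>

locale pre_cstar = normed_sp A for A :: "'a cstar" (structure) +
 assumes m_in: "!!x y. x : car A ==> y : car A ==> x \<otimes> y : car A"
  and st_in: "!!x. x : car A ==> cs_star A x : car A"
  and m_assoc: "!!x y z. x : car A ==> y : car A ==> z : car A ==> (x \<otimes> y) \<otimes> z = x \<otimes> (y \<otimes> z)"
  and m_addL: "!!x y z. x : car A ==> y : car A ==> z : car A ==> (x \<oplus> y) \<otimes> z = x \<otimes> z \<oplus> y \<otimes> z"
  and m_addR: "!!x y z. x : car A ==> y : car A ==> z : car A ==> x \<otimes> (y \<oplus> z) = x \<otimes> y \<oplus> x \<otimes> z"
  and m_scaleL: "!!c x y. x : car A ==> y : car A ==> (c \<odot> x) \<otimes> y = c \<odot> (x \<otimes> y)"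
  and m_scaleR: "!!c x y. x : car A ==> y : car A ==> x \<otimes> (c \<odot> y) = c \<odot> (x \<otimes> y)"
  and st_st: "!!x. x : car A ==> cs_star A (cs_star A x) = x"
  and st_add: "!!x y. x : car A ==> y : car A ==> cs_star A (x \<oplus> y) = cs_star A x \<oplus> cs_star A y"
  and st_scale: "!!c x. x : car A ==> cs_star A (c \<odot> x) = cnj c \<odot> cs_star A x"
  and st_mult: "!!x y. x : car A ==> y : car A ==> cs_star A (x \<otimes> y) = cs_star A y \<otimes> cs_star A x"
  and nm_mult: "!!x y. x : car A ==> y : car A ==> nm A (x \<otimes> y) <= nm A x * nm A y"
  and nm_star_mult: "!!x. x : car A ==> nm A (cs_star A x \<otimes> x) = (nm A x)^2"

lemma cstar_algebraI:
 assumes "pre_cstar A" and c: "!!X. cs_cauchy A X ==> EX x. cs_lim A X x"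
 shows "cstar_algebra A"
proof -
 interpret pre_cstar A by fact
 have "ms.mcomplete" using c mcomplete_iff by blast
 then show ?thesis
  by unfold_locales (auto simp: a_assoc scale_addR scale_addL nm_zero_iff nm_triangle nm_scale m_in st_in m_assoc m_addL
    m_addR m_scaleL m_scaleR st_st st_add st_scale st_mult nm_mult nm_star_mult intro: a_comm)
qed

lemma (in cs_alg) is_pre_cstar: "pre_cstar A"
 by unfold_locales (auto simp: mult_assoc mult_add_left mult_add_right mult_scale_left mult_scale_right
   star_add star_scale star_mult norm_mult norm_star_mult)

section \<open>Subalgebras\<close>

context cs_alg
begin

lemma subalgebra_subset: "cstar_subalgebra A W ==> W <= car A"
 using closed_subspace_subset by (auto simp: cstar_subalgebra_def)

lemma subalgebra_cstar:
 assumes W: "cstar_subalgebra A W"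
 shows "cstar_algebra (A\<lparr>cs_carrier := W\<rparr>)"
proof (rule cstar_algebraI)
 have s: "x : car A" if "x : W" for x using subalgebra_subset[OF W] that by blast
 have cl: "\<zero> : W" "!!x y. x : W ==> y : W ==> x \<oplus> y : W" "!!c x. x : W ==> c \<odot> x : W"
  "!!x y. x : W ==> y : W ==> x \<otimes> y : W" "!!x. x : W ==> cs_star A x : W"
  using W by (auto simp: cstar_subalgebra_def closed_subspace_def)
 show "pre_cstar (A\<lparr>cs_carrier := W\<rparr>)"
  by unfold_locales (auto simp: s cl a_assoc scale_addR scale_addL nm_zero_iff nm_triangle nm_scale mult_assoc mult_add_left mult_add_right mult_scale_left mult_scale_right
   star_add star_scale star_mult norm_mult norm_star_mult intro: a_comm)
 fix X assume X: "cs_cauchy (A\<lparr>cs_carrier := W\<rparr>) X"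
 then have "cs_cauchy A X" using s by (auto simp: cs_cauchy_def)
 then obtain x where x: "cs_lim A X x" using cauchy_lim by blast
 moreover have "X n : W" for n using X by (auto simp: cs_cauchy_def)
 ultimately have "x : W" using W closed_subspace_lim by (auto simp: cstar_subalgebra_def)
 then have "cs_lim (A\<lparr>cs_carrier := W\<rparr>) X x" using x \<open>!!n. X n : W\<close> by (auto simp: cs_lim_def)
 then show "EX x. cs_lim (A\<lparr>cs_carrier := W\<rparr>) X x" by blast
qed

lemma subalgebraI:
 assumes "W <= car A" "\<zero> : W" "!!x y. x : W ==> y : W ==> x \<oplus> y : W" "!!c x. x : W ==> c \<odot> x : W"
  "!!x y. x : W ==> y : W ==> x \<otimes> y : W" "!!x. x : W ==> cs_star A x : W"
  "!!X x. (!!n. X n : W) ==> cs_lim A X x ==> x : W"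
 shows "cstar_subalgebra A W"
 unfolding cstar_subalgebra_def closed_subspace_def closedin_seq_iff
proof (intro conjI ballI allI impI)
 fix X x assume "ALL n. X n : W" "cs_lim A X x" then show "x : W" using assms(7)[of X x] by simp
qed (use assms(1-6) in auto)

lemma closure_subalgebra:
 assumes W: "W <= car A" "\<zero> : W" "!!x y. x : W ==> y : W ==> x \<oplus> y : W" "!!c x. x : W ==> c \<odot> x : W"
  "!!x y. x : W ==> y : W ==> x \<otimes> y : W" "!!x. x : W ==> cs_star A x : W"
 shows "cstar_subalgebra A (cs_topology A closure_of W)"
 unfolding cstar_subalgebra_def
proof (intro conjI ballI)
 show "closed_subspace A (cs_topology A closure_of W)" using closed_subspace_closure W by auto
 note cl = closure_of_seq_iff[OF W(1)]
 fix x assume x: "x : cs_topology A closure_of W"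
 then obtain X where X: "!!n. X n : W" "cs_lim A X x" unfolding cl by blast
 show "cs_star A x : cs_topology A closure_of W"
  unfolding cl by (rule exI[of _ "%n. cs_star A (X n)"]) (use X W(6) cs_lim_star in auto)
 fix y assume "y : cs_topology A closure_of W"
 then obtain Y where Y: "!!n. Y n : W" "cs_lim A Y y" unfolding cl by blast
 show "x \<otimes> y : cs_topology A closure_of W"
  unfolding cl by (rule exI[of _ "%n. X n \<otimes> Y n"]) (use X Y W(5) cs_lim_mult in auto)
qed

lemma carrier_subalgebra: "cstar_subalgebra A (car A)"
 by (rule subalgebraI) (auto simp: cs_lim_def)

end

lemma generated_simps [simp]:
 "cs_zero (cstar_generated A S) = cs_zero A" "cs_add (cstar_generated A S) = cs_add A"
 "cs_scale (cstar_generated A S) = cs_scale A" "cs_mult (cstar_generated A S) = cs_mult A"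
 "cs_star (cstar_generated A S) = cs_star A" "nm (cstar_generated A S) = nm A"
 by (simp_all add: cstar_generated_def)

lemma generated_carrier: "car (cstar_generated A S) = \<Inter>{W. S <= W & cstar_subalgebra A W}"
 by (simp add: cstar_generated_def)

lemma generated_upd: "cstar_generated A S = A\<lparr>cs_carrier := car (cstar_generated A S)\<rparr>"
 by (simp add: cstar_generated_def)

lemma generated_least: "S <= W ==> cstar_subalgebra A W ==> car (cstar_generated A S) <= W"
 by (auto simp: generated_carrier)

lemma generated_superset: "S <= car (cstar_generated A S)"
 by (auto simp: generated_carrier)

context cs_alg
begin

lemma generated_subalgebra:
 assumes S: "S <= car A"
 shows "cstar_subalgebra A (car (cstar_generated A S))"
proof (rule subalgebraI)
 show "car (cstar_generated A S) <= car A" by (rule generated_least[OF S carrier_subalgebra])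
 fix X x assume "!!n. X n : car (cstar_generated A S)" "cs_lim A X x"
 then show "x : car (cstar_generated A S)"
  unfolding generated_carrier cstar_subalgebra_def using closed_subspace_lim[of _ X x] by auto
qed (auto simp: generated_carrier cstar_subalgebra_def closed_subspace_def)

lemma generated_cstar: "S <= car A ==> cstar_algebra (cstar_generated A S)"
 using subalgebra_cstar[OF generated_subalgebra] generated_upd by metis

end

lemma star_hom_lim:
 assumes A: "cstar_algebra A" and B: "cstar_algebra B" and h: "star_hom A B phi" and x: "cs_lim A X x"
 shows "cs_lim B (%n. phi (X n)) (phi x)"
proof -
 interpret A: cs_alg A using A by (simp add: cs_alg_def)
 note hD = star_homD[OF h]
 have c: "!!n. X n : car A" "x : car A" "(%n. nm A (X n -[A] x)) \<longlonglongrightarrow> 0" using x by (auto simp: cs_lim_def)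
 have "nm B (phi (X n) -[B] phi x) <= nm A (X n -[A] x)" for n
  using star_hom_contractive[OF A B h, of "X n -[A] x"] hD c by simp
 moreover interpret B: cs_alg B using B by (simp add: cs_alg_def)
 have "0 <= nm B (phi (X n) -[B] phi x)" for n using hD c by simp
 ultimately have "(%n. nm B (phi (X n) -[B] phi x)) \<longlonglongrightarrow> 0"
  by (intro Lim_null_comparison[OF _ c(3)]) auto
 then show ?thesis using hD c by (auto simp: cs_lim_def)
qed

lemma star_hom_comp: "star_hom A B phi ==> star_hom B C \<psi> ==> star_hom A C (%x. \<psi> (phi x))"
 unfolding star_hom_def by (auto simp: Pi_iff)

lemma star_hom_zero:
 assumes "cstar_algebra A" "cstar_algebra B" "star_hom A B phi"
 shows "phi (cs_zero A) = (cs_zero B)"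
proof -
 interpret A: cs_alg A using assms by (simp add: cs_alg_def)
 interpret B: cs_alg B using assms by (simp add: cs_alg_def)
 show ?thesis using star_homD(3)[OF assms(3), of "(cs_zero A)" 0] star_homD(1)[OF assms(3), of "(cs_zero A)"] by simp
qed

text \<open>The set where two homomorphisms agree is a C*-subalgebra; its closedness rests on the
  automatic continuity in \<open>star_hom_lim\<close>.\<close>

lemma star_hom_agree:
 assumes A: "cstar_algebra A" and S: "S <= car A" and B: "cstar_algebra B"
  and h: "star_hom (cstar_generated A S) B phi" "star_hom (cstar_generated A S) B \<psi>"
  and eq: "!!x. x : S ==> phi x = \<psi> x" and x: "x : car (cstar_generated A S)"
 shows "phi x = \<psi> x"
proof -
 interpret A: cs_alg A using A by (simp add: cs_alg_def)
 interpret B: cs_alg B using B by (simp add: cs_alg_def)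
 let ?G = "cstar_generated A S"
 have G: "cstar_algebra ?G" using A.generated_cstar[OF S] .
 interpret G: cs_alg ?G using G by (simp add: cs_alg_def)
 note h1 = star_homD[OF h(1)] and h2 = star_homD[OF h(2)]
 have sub: "car ?G <= car A" using A.subalgebra_subset[OF A.generated_subalgebra[OF S]] .
 let ?W = "{x : car ?G. phi x = \<psi> x}"
 have "cstar_subalgebra A ?W"
 proof (rule A.subalgebraI)
  fix X x assume X: "!!n. X n : ?W" and l: "cs_lim A X x"
  have x: "x : car ?G" using A.generated_subalgebra[OF S] A.closed_subspace_lim[of _ X x] X l
   by (auto simp: cstar_subalgebra_def)
  then have l': "cs_lim ?G X x" using X l by (auto simp: cs_lim_def)
  have "cs_lim B (%n. phi (X n)) (phi x)" "cs_lim B (%n. \<psi> (X n)) (\<psi> x)"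
   using star_hom_lim[OF G B] h l' by auto
  then show "x : ?W" using X x B.cs_lim_unique by auto
 next
  show "?W <= car A" using sub by blast
  show "(cs_zero A) : ?W" using star_hom_zero[OF G B h(1)] star_hom_zero[OF G B h(2)] G.zero_in by simp
  fix x y assume xy: "x : ?W" "y : ?W"
  show "x +[A] y : ?W" using xy h1(2)[of x y] h2(2)[of x y] G.add_in[of x y] by simp
  show "x *[A] y : ?W" using xy h1(4)[of x y] h2(4)[of x y] G.mult_in[of x y] by simp
 next
  fix x c assume xy: "x : ?W"
  show "c .[A] x : ?W" using xy h1(3)[of x c] h2(3)[of x c] G.scale_in[of x c] by simp
  show "cs_star A x : ?W" using xy h1(5)[of x] h2(5)[of x] G.star_in[of x] by simp
 qed
 moreover have "S <= ?W" using eq generated_superset[of S A] by auto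
 ultimately have "car ?G <= ?W" by (rule generated_least[rotated])
 then show ?thesis using x by auto
qed

section \<open>Products\<close>

lemma prod_simps [simp]:
 "cs_zero (cs_prod I A) = (\<lambda>i\<in>I. cs_zero (A i))"
 "cs_add (cs_prod I A) x y = (\<lambda>i\<in>I. cs_add (A i) (x i) (y i))"
 "cs_scale (cs_prod I A) c x = (\<lambda>i\<in>I. cs_scale (A i) c (x i))"
 "cs_mult (cs_prod I A) x y = (\<lambda>i\<in>I. cs_mult (A i) (x i) (y i))"
 "cs_star (cs_prod I A) x = (\<lambda>i\<in>I. cs_star (A i) (x i))"
 by (simp_all add: cs_prod_def)

locale cs_family =
 fixes I :: "'i set" and A :: "'i => 'a cstar"
 assumes fam: "i : I ==> cstar_algebra (A i)"
begin

lemma falg: "i : I ==> cs_alg (A i)"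
 using fam by (simp add: cs_alg_def)

lemma fns: "i : I ==> normed_sp (A i)"
 using falg by (rule cs_alg.axioms [THEN cs_alg.intro, THEN cs_alg.is_pre_cstar, THEN pre_cstar.axioms(1)])

lemma prod_carrierI:
 assumes "x : extensional I" "!!i. i : I ==> x i : car (A i)" "!!i. i : I ==> nm (A i) (x i) <= c"
 shows "x : car (cs_prod I A)"
 using assms by (auto simp: cs_prod_def PiE_iff intro!: bdd_aboveI2)

lemma prod_in: "x : car (cs_prod I A) ==> i : I ==> x i : car (A i)"
 by (auto simp: cs_prod_def)

lemma prod_ext: "x : car (cs_prod I A) ==> x : extensional I"
 by (auto simp: cs_prod_def PiE_iff)

lemma prod_eqI: "x : extensional I ==> y : extensional I ==> (!!i. i : I ==> x i = y i) ==> x = y"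
 by (rule extensionalityI)

lemma prod_norm_ge:
 assumes "x : car (cs_prod I A)" "i : I" shows "nm (A i) (x i) <= nm (cs_prod I A) x"
 using assms by (auto simp: cs_prod_def intro!: cSup_upper)

lemma prod_norm_nonneg:
 assumes "x : car (cs_prod I A)" shows "0 <= nm (cs_prod I A) x"
 using assms by (auto simp: cs_prod_def intro!: cSup_upper)

lemma prod_norm_le: "0 <= c ==> (!!i. i : I ==> nm (A i) (x i) <= c) ==> nm (cs_prod I A) x <= c"
 by (auto simp: cs_prod_def intro!: cSup_least)

lemma prod_add_in:
 assumes "x : car (cs_prod I A)" "y : car (cs_prod I A)"
 shows "x +[cs_prod I A] y : car (cs_prod I A)"
proof (rule prod_carrierI)
 fix i assume i: "i : I"
 then interpret Ai: cs_alg "A i" by (rule falg)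
 have c: "x i : car (A i)" "y i : car (A i)" using prod_in assms i by auto
 then show "(x +[cs_prod I A] y) i : car (A i)" using i by simp
 show "nm (A i) ((x +[cs_prod I A] y) i) <= nm (cs_prod I A) x + nm (cs_prod I A) y"
  using Ai.nm_triangle[OF c] prod_norm_ge[OF assms(1) i] prod_norm_ge[OF assms(2) i] i by simp
qed simp

lemma prod_scale_in:
 assumes "x : car (cs_prod I A)"
 shows "c .[cs_prod I A] x : car (cs_prod I A)"
proof (rule prod_carrierI)
 fix i assume i: "i : I"
 then interpret Ai: cs_alg "A i" by (rule falg)
 have x: "x i : car (A i)" using prod_in assms i by auto
 then show "(c .[cs_prod I A] x) i : car (A i)" using i by simp
 show "nm (A i) ((c .[cs_prod I A] x) i) <= cmod c * nm (cs_prod I A) x"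
  using Ai.nm_scale[OF x] prod_norm_ge[OF assms(1) i] i by (simp add: mult_left_mono)
qed simp

lemma prod_mult_le:
 assumes "x : car (cs_prod I A)" "y : car (cs_prod I A)" "i : I"
 shows "nm (A i) (x i *[A i] y i) <= nm (cs_prod I A) x * nm (cs_prod I A) y"
proof -
 interpret Ai: cs_alg "A i" using assms by (intro falg)
 have c: "x i : car (A i)" "y i : car (A i)" using prod_in assms by auto
 show ?thesis
  by (rule order_trans[OF Ai.norm_mult[OF c]], rule mult_mono) (use prod_norm_ge prod_norm_nonneg assms c in auto)
qed

lemma prod_norm_star_mult:
 assumes x: "x : car (cs_prod I A)"
 shows "nm (cs_prod I A) (\<lambda>i\<in>I. cs_star (A i) (x i) *[A i] x i) = (nm (cs_prod I A) x)^2" (is "?l = _")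
proof (rule antisym)
 have e: "nm (A i) (cs_star (A i) (x i) *[A i] x i) = (nm (A i) (x i))^2"
  and c: "cs_star (A i) (x i) *[A i] x i : car (A i)" "0 <= nm (A i) (x i)" if i: "i : I" for i
 proof -
  interpret Ai: cs_alg "A i" using i by (rule falg)
  have "x i : car (A i)" using prod_in x i by auto
  then show "nm (A i) (cs_star (A i) (x i) *[A i] x i) = (nm (A i) (x i))^2"
   "cs_star (A i) (x i) *[A i] x i : car (A i)" "0 <= nm (A i) (x i)"
   by (simp_all add: Ai.norm_star_mult)
 qed
 show "?l <= (nm (cs_prod I A) x)^2"
  by (rule prod_norm_le) (use e c prod_norm_ge[OF x] in \<open>auto intro!: power_mono\<close>)
 have mem: "(\<lambda>i\<in>I. cs_star (A i) (x i) *[A i] x i) : car (cs_prod I A)"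
  by (rule prod_carrierI[where c = "(nm (cs_prod I A) x)^2"])
    (use e c prod_norm_ge[OF x] in \<open>auto intro!: power_mono\<close>)
 have l0: "?l >= 0" by (rule prod_norm_nonneg[OF mem])
 have "nm (cs_prod I A) x <= sqrt ?l"
 proof (rule prod_norm_le)
  fix i assume i: "i : I"
  have "(nm (A i) (x i))^2 <= ?l" using prod_norm_ge[OF mem i] e[OF i] i by simp
  then show "nm (A i) (x i) <= sqrt ?l" by (rule real_le_rsqrt)
 qed (use l0 in simp)
 then show "(nm (cs_prod I A) x)^2 <= ?l"
  using l0 prod_norm_nonneg[OF x] by (metis power_mono real_sqrt_pow2)
qed

lemma prod_pre_cstar: "pre_cstar (cs_prod I A)"
proof -
 let ?P = "cs_prod I A"
 have in_alg: "!!i. i : I ==> pre_cstar (A i)" using falg cs_alg.is_pre_cstar by blast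
 note R = in_alg[THEN pre_cstar.axioms(1)]
 note ns = R[THEN normed_sp.zero_in] R[THEN normed_sp.add_in] R[THEN normed_sp.scale_in]
   R[THEN normed_sp.zero_add] R[THEN normed_sp.minus_self] R[THEN normed_sp.scale_addR] R[THEN normed_sp.scale_addL]
   R[THEN normed_sp.scale_sc] R[THEN normed_sp.scale_1]
 note st = in_alg[THEN pre_cstar.m_in] in_alg[THEN pre_cstar.st_in] in_alg[THEN pre_cstar.m_assoc] in_alg[THEN pre_cstar.m_addL]
   in_alg[THEN pre_cstar.m_addR] in_alg[THEN pre_cstar.m_scaleL] in_alg[THEN pre_cstar.m_scaleR] in_alg[THEN pre_cstar.st_st]
   in_alg[THEN pre_cstar.st_add] in_alg[THEN pre_cstar.st_scale] in_alg[THEN pre_cstar.st_mult]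
 have star_norm: "nm (A i) (cs_star (A i) (x i)) <= nm ?P x" if "x : car ?P" "i : I" for x i
  using cs_alg.norm_star[OF falg] prod_norm_ge prod_in that by metis
 have zero: "nm ?P x = 0 \<longleftrightarrow> x = cs_zero ?P" if x: "x : car ?P" for x
 proof
  assume 0: "nm ?P x = 0"
  have "x i = cs_zero (A i)" if i: "i : I" for i
  proof -
   interpret Ai: cs_alg "A i" using i by (rule falg)
   have "nm (A i) (x i) <= 0" using prod_norm_ge[OF x i] 0 by simp
   then show ?thesis using Ai.nm_zero_iff[OF prod_in[OF x i]] Ai.nm_nonneg[OF prod_in[OF x i]] by linarith
  qed
  then show "x = cs_zero ?P" using prod_ext[OF x] by (intro prod_eqI) auto
 next
  assume "x = cs_zero ?P"
  then have "nm ?P x <= 0" using normed_sp.nm_zero[OF R] by (intro prod_norm_le) auto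
  then show "nm ?P x = 0" using prod_norm_nonneg[OF x] by simp
 qed
 \<comment> \<open>Coordinatewise estimates give only \<open><=\<close>; the reverse follows by
   applying this to \<open>inverse c\<close>, which is why \<open>c = 0\<close> is split
   off.\<close>
 have scale: "nm ?P (c .[?P] x) = cmod c * nm ?P x" if x: "x : car ?P" for c x
 proof (cases "c = 0")
  case True
  have "0 .[?P] x = cs_zero ?P" using prod_in[OF x] normed_sp.scale_0[OF R] by (intro prod_eqI) auto
  then show ?thesis using zero[of "cs_zero ?P"] prod_scale_in[OF x, of 0] True by simp
 next
  case False
  have le: "nm ?P (c .[?P] x) <= cmod c * nm ?P x" if x: "x : car ?P" for c x
   using prod_norm_ge[OF x] prod_in[OF x] normed_sp.nm_scale[OF R] prod_norm_nonneg[OF x]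
   by (intro prod_norm_le) (auto intro!: mult_left_mono)
  have "inverse c .[?P] c .[?P] x = x" using prod_in[OF x] prod_ext[OF x] False by (intro prod_eqI) (auto simp: ns)
  then have "nm ?P x <= inverse (cmod c) * nm ?P (c .[?P] x)"
   using le[OF prod_scale_in[OF x], of "inverse c" c] by (simp add: norm_inverse)
  then have "cmod c * nm ?P x <= nm ?P (c .[?P] x)" using False by (simp add: field_simps)
  then show ?thesis using le[OF x, of c] by simp
 qed
 show ?thesis
 proof
  show "cs_zero ?P : car ?P"
   by (rule prod_carrierI[where c = 0]) (use ns normed_sp.nm_zero[OF R] in auto)
 next
  fix x y assume x: "x : car ?P" and y: "y : car ?P"
  show "x +[?P] y : car ?P" by (rule prod_add_in[OF x y])
  show "x +[?P] y = y +[?P] x"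
   using x y by (intro prod_eqI) (auto intro!: normed_sp.a_comm[OF R] prod_in)
  show "nm ?P (x +[?P] y) <= nm ?P x + nm ?P y"
   using x y normed_sp.nm_triangle[OF R] prod_norm_ge[OF x] prod_norm_ge[OF y] prod_norm_nonneg
   by (intro prod_norm_le) (auto dest: prod_in intro!: order_trans[OF normed_sp.nm_triangle[OF R]] add_mono)
  show "x *[?P] y : car ?P" using prod_mult_le[OF x y] x y
   by (intro prod_carrierI) (auto simp: st(1) prod_in)
  show "nm ?P (x *[?P] y) <= nm ?P x * nm ?P y" using prod_mult_le[OF x y] prod_norm_nonneg x y
   by (intro prod_norm_le) auto
 next
  fix x assume x: "x : car ?P"
  show "c .[?P] x : car ?P" for c by (rule prod_scale_in[OF x])
  show "0 <= nm ?P x" by (rule prod_norm_nonneg[OF x])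
  show "nm ?P x = 0 \<longleftrightarrow> x = cs_zero ?P" by (rule zero[OF x])
  show "nm ?P (c .[?P] x) = cmod c * nm ?P x" for c by (rule scale[OF x])
  show "cs_star ?P x : car ?P" using star_norm[OF x] x by (intro prod_carrierI) (auto simp: st dest: prod_in)
  show "nm ?P (cs_star ?P x *[?P] x) = (nm ?P x)^2"
  proof -
   have "cs_star ?P x *[?P] x = (\<lambda>i\<in>I. cs_star (A i) (x i) *[A i] x i)" by (intro prod_eqI) auto
   then show ?thesis using prod_norm_star_mult[OF x] by simp
  qed
 qed (rule prod_eqI; auto simp: ns st prod_ext prod_in normed_sp.a_assoc[OF R])+
qed

lemma prod_complete:
 assumes X: "cs_cauchy (cs_prod I A) X" shows "EX x. cs_lim (cs_prod I A) X x"
proof -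
 let ?P = "cs_prod I A"
 interpret P: pre_cstar ?P by (rule prod_pre_cstar)
 have Xc: "X n : car ?P" for n using X by (simp add: cs_cauchy_def)
 have comp: "nm (A i) (X m i -[A i] X n i) <= nm ?P (X m -[?P] X n)" if i: "i : I" for i m n
 proof -
  have "X m -[?P] X n : car ?P" using Xc P.add_in P.scale_in by blast
  from prod_norm_ge[OF this i] show ?thesis using i by simp
 qed
 have "EX z. cs_lim (A i) (%n. X n i) z" if i: "i : I" for i
 proof -
  interpret Ai: cs_alg "A i" using i by (rule falg)
  have "cs_cauchy (A i) (%n. X n i)" unfolding cs_cauchy_def
   using X[unfolded cs_cauchy_def] comp[OF i] prod_in[OF Xc i] order.strict_trans1 by meson
  then show ?thesis by (rule Ai.cauchy_lim)
 qed
 then obtain z where z: "!!i. i : I ==> cs_lim (A i) (%n. X n i) (z i)" by metis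
 define x where "x = restrict z I"
 have xi: "x i : car (A i)" if "i : I" for i using z[OF that] that by (simp add: x_def cs_lim_def)
 \<comment> \<open>Letting \<open>m\<close> tend to infinity in one coordinate keeps the Cauchy
   bound, uniformly in \<open>i\<close>. It gives both the boundedness of the limit family and the
   convergence in norm.\<close>
 have unif: "nm (A i) (X n i -[A i] x i) <= eps"
  if N: "!!m n. m >= N ==> n >= N ==> nm ?P (X m -[?P] X n) < eps" and n: "n >= N" and i: "i : I" for i n N eps
 proof -
  interpret Ai: cs_alg "A i" using i by (rule falg)
  have "cs_lim (A i) (%m. X n i -[A i] X m i) (X n i -[A i] x i)"
   using z[OF i] i prod_in[OF Xc i] by (intro Ai.cs_lim_minus Ai.cs_lim_const) (auto simp: x_def)
  from Ai.cs_lim_norm[OF this]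
  show ?thesis
  proof (rule LIMSEQ_le_const2)
   have "nm (A i) (X n i -[A i] X m i) <= eps" if "m >= N" for m
    using comp[OF i, of n m] N[OF n that] by linarith
   then show "EX N. ALL m>=N. nm (A i) (X n i -[A i] X m i) <= eps" by blast
  qed
 qed
 obtain N1 where N1: "!!m n. m >= N1 ==> n >= N1 ==> nm ?P (X m -[?P] X n) < 1"
  using X[unfolded cs_cauchy_def] zero_less_one by meson
 have xc: "x : car ?P"
 proof (rule prod_carrierI)
  fix i assume i: "i : I"
  interpret Ai: cs_alg "A i" using i by (rule falg)
  show "x i : car (A i)" by (rule xi[OF i])
  have u: "nm (A i) (X N1 i -[A i] x i) <= 1" by (rule unif[of N1 1 N1, OF _ order_refl i]) (rule N1)
  show "nm (A i) (x i) <= nm ?P (X N1) + 1"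
   using Ai.nm_le_minus[OF xi[OF i] prod_in[OF Xc[of N1] i]] Ai.nm_minus_commute[OF xi[OF i] prod_in[OF Xc[of N1] i]]
    u prod_norm_ge[OF Xc[of N1] i] by linarith
 qed (simp add: x_def)
 have "(%n. nm ?P (X n -[?P] x)) \<longlonglongrightarrow> 0"
 proof (rule LIMSEQ_I)
  fix r :: real assume r: "r > 0"
  then obtain N where N: "!!m n. m >= N ==> n >= N ==> nm ?P (X m -[?P] X n) < r/2"
   using X[unfolded cs_cauchy_def] half_gt_zero by meson
  have "norm (nm ?P (X n -[?P] x) - 0) < r" if "n >= N" for n
  proof -
   have "nm ?P (X n -[?P] x) <= r/2" using unif[OF N that] r by (intro prod_norm_le) auto
   moreover have "0 <= nm ?P (X n -[?P] x)" using Xc xc P.add_in P.scale_in P.nm_nonneg by blast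
   ultimately show ?thesis using r by simp
  qed
  then show "EX N. ALL n>=N. norm (nm ?P (X n -[?P] x) - 0) < r" by blast
 qed
 then show ?thesis using Xc xc by (auto simp: cs_lim_def)
qed

lemma prod_cstar: "cstar_algebra (cs_prod I A)"
 by (rule cstar_algebraI[OF prod_pre_cstar prod_complete])

lemma prod_eval: "i : I ==> star_hom (cs_prod I A) (A i) (%x. x i)"
 using prod_in by (auto simp: star_hom_def)

end

section \<open>Quotients\<close>

text \<open>The C*-identity of a quotient norm usually rests on approximate units. For the ideal of null
 families it is seen directly, hence it is an assumption here.\<close>

locale cs_ideal = cs_alg A for A :: "'a cstar" (structure) +
 fixes J :: "'a set"
 assumes J: "closed_subspace A J"
  and J_mult: "!!a x. a : car A ==> x : J ==> a \<otimes> x : J & x \<otimes> a : J"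
  and J_star: "!!x. x : J ==> cs_star A x : J"
  and J_cstar: "!!x j eps. x : car A ==> j : J ==> eps > 0 ==>
    EX j':J. (nm A (x \<oplus> j'))^2 <= nm A (cs_star A x \<otimes> x \<oplus> j) + eps"
begin

abbreviation "Q == cs_quot A J"
abbreviation "cl == cs_coset A J"

lemma J_in [simp]: "j : J ==> j : car A"
 using closed_subspace_subset[OF J] by blast

lemma J_zero [simp]: "\<zero> : J" and J_add: "x : J ==> y : J ==> x \<oplus> y : J" and J_scale: "x : J ==> c \<odot> x : J"
 using J by (auto simp: closed_subspace_def)

lemma coset_mem: "z : cl x \<longleftrightarrow> (EX j:J. z = x \<oplus> j)"
 by (auto simp: cs_coset_def)

lemma coset_mem_iff: "x : car A ==> z : cl x \<longleftrightarrow> z : car A & z \<ominus> x : J"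
proof
 assume x: "x : car A"
 { assume "z : cl x"
  then obtain j where j: "j : J" "z = x \<oplus> j" by (auto simp: coset_mem)
  then have "z \<ominus> x = j \<oplus> (x \<ominus> x)" using x by (simp add: a_ac del: minus_self)
  then show "z : car A & z \<ominus> x : J" using j x by simp }
 { assume z: "z : car A & z \<ominus> x : J"
  then have "z = x \<oplus> (z \<ominus> x)" using x minus_add_cancel[of z x] by (simp add: a_comm[of x])
  then show "z : cl x" using z by (auto simp: coset_mem) }
qed

lemma coset_eq: assumes "x : car A" "y : car A" shows "cl x = cl y \<longleftrightarrow> x \<ominus> y : J"
proof
 assume "cl x = cl y"
 moreover have "x : cl x" using assms by (simp add: coset_mem_iff)
 ultimately show "x \<ominus> y : J" using assms by (simp add: coset_mem_iff)
next
 assume d: "x \<ominus> y : J"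
 then have d': "y \<ominus> x : J" using J_scale[of "x \<ominus> y" "-1"] assms by (simp add: neg_minus)
 show "cl x = cl y"
 proof (intro set_eqI iffI)
  fix z assume "z : cl x" then show "z : cl y"
   using d J_add[of "z \<ominus> x" "x \<ominus> y"] assms minus_trans[of z x y] by (simp add: coset_mem_iff)
 next
  fix z assume "z : cl y" then show "z : cl x"
   using d' J_add[of "z \<ominus> y" "y \<ominus> x"] assms minus_trans[of z y x] by (simp add: coset_mem_iff)
 qed
qed

lemma coset_self: "x : car A ==> x : cl x"
 by (simp add: coset_mem_iff)

lemma coset_eqI: "x : car A ==> z : cl x ==> cl z = cl x"
 using coset_mem_iff coset_eq by metis

lemma quot_zero: "cs_zero Q = cl \<zero>"
 by (simp add: cs_quot_def)

lemma quot_carrier: "car Q = cl ` car A"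
 by (simp add: cs_quot_def)

lemma coset_ne: "x : car A ==> cl x ~= {}"
 using coset_self by blast

text \<open>The operations of \<open>cs_quot\<close> are unions over representatives; they are well
  defined exactly because all cosets in such a union coincide.\<close>

lemma union_const: assumes "S ~= {}" "!!x. x : S ==> f x = c" shows "(\<Union>x\<in>S. f x) = c"
 using assms by auto

lemma union_const2:
 assumes "S ~= {}" "T ~= {}" "!!x y. x : S ==> y : T ==> f x y = c"
 shows "(\<Union>x\<in>S. \<Union>y\<in>T. f x y) = c"
 using assms by (simp add: union_const)

lemma quot_add:
 assumes "x : car A" "y : car A" shows "cl x +[Q] cl y = cl (x \<oplus> y)"
proof -
 have "cl (x' \<oplus> y') = cl (x \<oplus> y)" if "x' : cl x" "y' : cl y" for x' y'
 proof -
  have c: "x' : car A" "y' : car A" "x' \<ominus> x : J" "y' \<ominus> y : J"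
   using that assms coset_mem_iff by auto
  then show ?thesis using assms J_add[of "x' \<ominus> x" "y' \<ominus> y"] by (simp add: coset_eq add_minus_add)
 qed
 then have "(\<Union>x'\<in>cl x. \<Union>y'\<in>cl y. cl (x' \<oplus> y')) = cl (x \<oplus> y)"
  by (intro union_const2 coset_ne assms)
 then show ?thesis by (simp add: cs_quot_def)
qed

lemma quot_mult:
 assumes "x : car A" "y : car A" shows "cl x *[Q] cl y = cl (x \<otimes> y)"
proof -
 have "cl (x' \<otimes> y') = cl (x \<otimes> y)" if "x' : cl x" "y' : cl y" for x' y'
 proof -
  have c: "x' : car A" "y' : car A" "x' \<ominus> x : J" "y' \<ominus> y : J"
   using that assms coset_mem_iff by auto
  have "x' \<otimes> y' \<ominus> x \<otimes> y = (x' \<otimes> y' \<ominus> x \<otimes> y') \<oplus> (x \<otimes> y' \<ominus> x \<otimes> y)"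
   using assms c by (simp add: minus_trans)
  also have "... = (x' \<ominus> x) \<otimes> y' \<oplus> x \<otimes> (y' \<ominus> y)"
   using assms c by (simp only: mult_minus_left mult_minus_right)
  also have "... : J" using c assms J_mult J_add by simp
  finally show ?thesis using assms c by (simp add: coset_eq)
 qed
 then have "(\<Union>x'\<in>cl x. \<Union>y'\<in>cl y. cl (x' \<otimes> y')) = cl (x \<otimes> y)"
  by (intro union_const2 coset_ne assms)
 then show ?thesis by (simp add: cs_quot_def)
qed

lemma quot_scale:
 assumes "x : car A" shows "c .[Q] cl x = cl (c \<odot> x)"
proof -
 have "cl (c \<odot> x') = cl (c \<odot> x)" if "x' : cl x" for x'
 proof -
  have *: "x' : car A" "x' \<ominus> x : J" using that assms coset_mem_iff by auto
  have "c \<odot> x' \<ominus> c \<odot> x = c \<odot> (x' \<ominus> x)" using * assms by (simp add: scale_addR mult.commute)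
  then show ?thesis using * assms J_scale by (simp add: coset_eq)
 qed
 then have "(\<Union>x'\<in>cl x. cl (c \<odot> x')) = cl (c \<odot> x)"
  by (intro union_const coset_ne assms)
 then show ?thesis by (simp add: cs_quot_def)
qed

lemma quot_star:
 assumes "x : car A" shows "cs_star Q (cl x) = cl (cs_star A x)"
proof -
 have "cl (cs_star A x') = cl (cs_star A x)" if "x' : cl x" for x'
 proof -
  have *: "x' : car A" "x' \<ominus> x : J" using that assms coset_mem_iff by auto
  then show ?thesis using assms J_star[of "x' \<ominus> x"] by (simp add: coset_eq star_minus)
 qed
 then have "(\<Union>x'\<in>cl x. cl (cs_star A x')) = cl (cs_star A x)"
  by (intro union_const coset_ne assms)
 then show ?thesis by (simp add: cs_quot_def)
qed

lemma quot_norm_le: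
 assumes "x : car A" "j : J" shows "nm Q (cl x) <= nm A (x \<oplus> j)"
proof -
 have "bdd_below (nm A ` cl x)"
  using assms coset_mem_iff by (intro bdd_belowI2[where m = 0]) auto
 then have "Inf (nm A ` cl x) <= nm A (x \<oplus> j)"
  by (rule cInf_lower[rotated]) (use assms coset_mem in blast)
 then show ?thesis by (simp add: cs_quot_def)
qed

lemma quot_norm_le': "x : car A ==> nm Q (cl x) <= nm A x"
 using quot_norm_le[of x \<zero>] by simp

lemma quot_norm_ge:
 assumes "x : car A" "!!j. j : J ==> c <= nm A (x \<oplus> j)" shows "c <= nm Q (cl x)"
proof -
 have "c <= Inf (nm A ` cl x)"
  by (rule cInf_greatest) (use coset_ne[OF assms(1)] assms(2) coset_mem in auto)
 then show ?thesis by (simp add: cs_quot_def)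
qed

lemma quot_norm_approx:
 assumes "x : car A" "nm Q (cl x) < c"
 obtains j where "j : J" "nm A (x \<oplus> j) < c"
 using quot_norm_ge[OF assms(1), of c] assms(2) by (meson linorder_not_less)

lemma quot_norm_nonneg: "x : car A ==> 0 <= nm Q (cl x)"
 by (rule quot_norm_ge) auto

lemma quot_minus: "x : car A ==> y : car A ==> cl x -[Q] cl y = cl (x \<ominus> y)"
 by (simp add: quot_add quot_scale)

text \<open>If the norms of \<open>x \<oplus> j n\<close> tend to 0, the elements
  \<open>(-1) \<odot> j n\<close> of \<open>J\<close> converge to \<open>x\<close>, and
  \<open>J\<close> is closed.\<close>

lemma quot_norm_zero: assumes x: "x : car A" shows "nm Q (cl x) = 0 \<longleftrightarrow> cl x = cl \<zero>"
proof
 assume "cl x = cl \<zero>"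
 then show "nm Q (cl x) = 0" using quot_norm_le'[of \<zero>] quot_norm_nonneg[of \<zero>] by simp
next
 assume 0: "nm Q (cl x) = 0"
 have "EX j:J. nm A (x \<oplus> j) < inverse (real (Suc n))" for n
  using quot_norm_approx[OF x, of "inverse (real (Suc n))"] 0 by (metis inverse_positive_iff_positive of_nat_0_less_iff zero_less_Suc)
 then obtain j where j: "!!n. j n : J" "!!n. nm A (x \<oplus> j n) < inverse (real (Suc n))" by metis
 have "(%n. nm A ((-1) \<odot> j n \<ominus> x)) \<longlonglongrightarrow> 0"
 proof (rule Lim_null_comparison[OF _ LIMSEQ_inverse_real_of_nat])
  have "nm A ((-1) \<odot> j n \<ominus> x) = nm A (x \<oplus> j n)" for n
   using nm_scale[of "x \<oplus> j n" "-1"] j x by (simp add: scale_addR a_comm)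
  then show "\<forall>\<^sub>F n in sequentially. norm (nm A ((-1) \<odot> j n \<ominus> x)) <= inverse (real (Suc n))"
   using j(2) j(1) x by (simp add: less_imp_le)
 qed
 then have "cs_lim A (%n. (-1) \<odot> j n) x" using j x by (simp add: cs_lim_def)
 then have "x : J" using closed_subspace_lim[OF J, of "%n. (-1) \<odot> j n" x] j J_scale by blast
 then show "cl x = cl \<zero>" using x by (simp add: coset_eq)
qed

lemma quot_triangle:
 assumes "x : car A" "y : car A"
 shows "nm Q (cl (x \<oplus> y)) <= nm Q (cl x) + nm Q (cl y)"
proof (rule field_le_epsilon)
 fix e :: real assume e: "e > 0"
 obtain j where j: "j : J" "nm A (x \<oplus> j) < nm Q (cl x) + e/2"
  using quot_norm_approx[OF assms(1), of "nm Q (cl x) + e/2"] e by auto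
 obtain k where k: "k : J" "nm A (y \<oplus> k) < nm Q (cl y) + e/2"
  using quot_norm_approx[OF assms(2), of "nm Q (cl y) + e/2"] e by auto
 have "nm Q (cl (x \<oplus> y)) <= nm A ((x \<oplus> y) \<oplus> (j \<oplus> k))" using assms j k J_add by (intro quot_norm_le) auto
 also have "(x \<oplus> y) \<oplus> (j \<oplus> k) = (x \<oplus> j) \<oplus> (y \<oplus> k)" using assms j k by (simp add: a_ac)
 also have "nm A ... <= nm A (x \<oplus> j) + nm A (y \<oplus> k)" using assms j k by (intro nm_triangle) auto
 finally show "nm Q (cl (x \<oplus> y)) <= nm Q (cl x) + nm Q (cl y) + e" using j k by linarith
qed

lemma quot_norm_scale:
 assumes "x : car A" shows "nm Q (cl (c \<odot> x)) = cmod c * nm Q (cl x)"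
proof (cases "c = 0")
 case True then show ?thesis using assms quot_norm_zero[of \<zero>] by simp
next
 case False
 have le: "nm Q (cl (c \<odot> x)) <= cmod c * nm Q (cl x)" if "x : car A" "c ~= 0" for x c
 proof -
  have "nm Q (cl (c \<odot> x)) / cmod c <= nm Q (cl x)"
  proof (rule quot_norm_ge[OF that(1)])
   fix j assume j: "j : J"
   have "nm Q (cl (c \<odot> x)) <= nm A (c \<odot> x \<oplus> c \<odot> j)" using j that J_scale by (intro quot_norm_le) auto
   also have "c \<odot> x \<oplus> c \<odot> j = c \<odot> (x \<oplus> j)" using j that by (simp add: scale_addR)
   finally show "nm Q (cl (c \<odot> x)) / cmod c <= nm A (x \<oplus> j)"
    using j that by (simp add: nm_scale field_simps)
  qed
  then show ?thesis using that by (simp add: field_simps)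
 qed
 have "nm Q (cl (inverse c \<odot> c \<odot> x)) <= cmod (inverse c) * nm Q (cl (c \<odot> x))"
  using assms False by (intro le) auto
 then have "cmod c * nm Q (cl x) <= nm Q (cl (c \<odot> x))"
  using assms False by (simp add: norm_divide field_simps)
 then show ?thesis using le[OF assms False] by simp
qed

lemma quot_norm_mult:
 assumes x: "x : car A" and y: "y : car A"
 shows "nm Q (cl (x \<otimes> y)) <= nm Q (cl x) * nm Q (cl y)"
proof -
 have *: "nm Q (cl (x \<otimes> y)) <= nm A (x \<oplus> j) * nm A (y \<oplus> k)" if "j : J" "k : J" for j k
 proof -
  have "(x \<oplus> j) \<otimes> (y \<oplus> k) = x \<otimes> y \<oplus> (x \<otimes> k \<oplus> (j \<otimes> y \<oplus> j \<otimes> k))"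
   using that x y by (simp add: mult_add_left mult_add_right a_ac)
  moreover have "nm Q (cl (x \<otimes> y)) <= nm A (x \<otimes> y \<oplus> (x \<otimes> k \<oplus> (j \<otimes> y \<oplus> j \<otimes> k)))"
   using x y that J_add J_mult by (intro quot_norm_le) auto
  ultimately show ?thesis using norm_mult[of "x \<oplus> j" "y \<oplus> k"] x y that by simp
 qed
 have **: "nm Q (cl (x \<otimes> y)) <= (nm Q (cl x) + e) * (nm Q (cl y) + e)" if e: "e > 0" for e
 proof -
  obtain j where j: "j : J" "nm A (x \<oplus> j) < nm Q (cl x) + e"
   using quot_norm_approx[OF x, of "nm Q (cl x) + e"] e by auto
  obtain k where k: "k : J" "nm A (y \<oplus> k) < nm Q (cl y) + e"
   using quot_norm_approx[OF y, of "nm Q (cl y) + e"] e by auto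
  show ?thesis by (rule order_trans[OF *[OF j(1) k(1)]], rule mult_mono)
   (use x y j k e quot_norm_nonneg in \<open>auto simp: less_imp_le\<close>)
 qed
 have "((%e. (nm Q (cl x) + e) * (nm Q (cl y) + e)) \<longlongrightarrow> (nm Q (cl x) + 0) * (nm Q (cl y) + 0)) (at_right 0)"
  by (intro tendsto_intros)
 then show ?thesis
  by (intro tendsto_lowerbound[where F = "at_right (0::real)"]) (auto simp: eventually_at_right_less ** intro!: eventually_at_rightI[of 0 1])
qed

lemma quot_norm_star:
 assumes x: "x : car A" shows "nm Q (cl (cs_star A x)) <= nm Q (cl x)"
proof (rule quot_norm_ge[OF x])
 fix j assume j: "j : J"
 have "nm Q (cl (cs_star A x)) <= nm A (cs_star A x \<oplus> cs_star A j)" using x j J_star by (intro quot_norm_le) auto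
 also have "... = nm A (x \<oplus> j)" using x j norm_star[of "x \<oplus> j"] by (simp add: star_add)
 finally show "nm Q (cl (cs_star A x)) <= nm A (x \<oplus> j)" .
qed

text \<open>One inequality is submultiplicativity with \<open>quot_norm_star\<close>; the other is
  \<open>J_cstar\<close> with the error tending to 0.\<close>

lemma quot_cstar_identity:
 assumes x: "x : car A" shows "nm Q (cl (cs_star A x \<otimes> x)) = (nm Q (cl x))^2"
proof (rule antisym)
 have "nm Q (cl (cs_star A x \<otimes> x)) <= nm Q (cl (cs_star A x)) * nm Q (cl x)"
  using x by (intro quot_norm_mult) auto
 also have "... <= nm Q (cl x) * nm Q (cl x)"
  using quot_norm_star[OF x] quot_norm_nonneg[OF x] by (intro mult_right_mono) auto
 finally show "nm Q (cl (cs_star A x \<otimes> x)) <= (nm Q (cl x))^2" by (simp add: power2_eq_square)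
 show "(nm Q (cl x))^2 <= nm Q (cl (cs_star A x \<otimes> x))"
 proof (rule quot_norm_ge)
  show "cs_star A x \<otimes> x : car A" using x by simp
  fix j assume j: "j : J"
  show "(nm Q (cl x))^2 <= nm A (cs_star A x \<otimes> x \<oplus> j)"
  proof (rule field_le_epsilon)
   fix e :: real assume "e > 0"
   then obtain j' where j': "j' : J" "(nm A (x \<oplus> j'))^2 <= nm A (cs_star A x \<otimes> x \<oplus> j) + e"
    using J_cstar[OF x j] by blast
   have "(nm Q (cl x))^2 <= (nm A (x \<oplus> j'))^2"
    using quot_norm_le[OF x j'(1)] quot_norm_nonneg[OF x] by (intro power_mono)
   then show "(nm Q (cl x))^2 <= nm A (cs_star A x \<otimes> x \<oplus> j) + e" using j' by linarith
  qed
 qed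
qed

lemma quot_pre_cstar: "pre_cstar Q"
proof -
 note defs = quot_carrier quot_zero quot_add quot_scale quot_mult quot_star
 show ?thesis
 proof
  show "nm Q x = 0 \<longleftrightarrow> x = cs_zero Q" if "x : car Q" for x
   using that quot_norm_zero by (auto simp: defs)
  show "cs_add Q x y = cs_add Q y x" if "x : car Q" "y : car Q" for x y
   using that by (auto simp: defs a_comm)
 qed (auto simp: defs a_assoc scale_addR scale_addL quot_norm_nonneg quot_triangle quot_norm_scale mult_assoc mult_add_left
   mult_add_right mult_scale_left mult_scale_right star_add star_scale star_mult quot_norm_mult quot_cstar_identity)
qed

text \<open>A subsequence with steps below \<open>(1/2)^k\<close> is lifted one element at a time to
  a sequence in \<open>A\<close> with the same step sizes; the class of its limit is the limit of
  the whole sequence.\<close>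

lemma quot_complete:
 assumes X: "cs_cauchy Q X" shows "EX z. cs_lim Q X z"
proof -
 interpret Q: pre_cstar Q by (rule quot_pre_cstar)
 have Xc: "X n : car Q" for n using X by (simp add: cs_cauchy_def)
 have "EX N. ALL m>=N. ALL n>=N. nm Q (X m -[Q] X n) < (1/2)^k" for k
  using X[unfolded cs_cauchy_def] by simp
 then obtain N0 where N0: "!!k m n. m >= N0 k ==> n >= N0 k ==> nm Q (X m -[Q] X n) < (1/2)^k"
  by metis
 \<comment> \<open>The maximum over all earlier thresholds makes the subsequence of indices
   monotone.\<close>
 define N where "N k = Max (N0 ` {..k})" for k
 have Nge: "N k >= N0 k" for k by (simp add: N_def)
 have Nmono: "N (Suc k) >= N k" for k unfolding N_def by (intro Max_mono) auto
 \<comment> \<open>An arbitrary lift of the next term is corrected by an element of \<open>J\<close>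
   that nearly realizes the quotient norm of its difference from the previous lift.\<close>
 have step: "EX b. b : car A & cl b = X (N (Suc k)) & nm A (b \<ominus> a) < (1/2)^k"
  if a: "a : car A" "cl a = X (N k)" for a k
 proof -
  obtain z where z: "z : car A" "cl z = X (N (Suc k))" using Xc[of "N (Suc k)"] by (auto simp: quot_carrier)
  have "nm Q (cl (z \<ominus> a)) < (1/2)^k"
   using N0[of k "N (Suc k)" "N k"] Nge[of k] Nmono[of k] a z quot_minus[of z a] by simp
  then obtain j where j: "j : J" "nm A ((z \<ominus> a) \<oplus> j) < (1/2)^k"
   using quot_norm_approx[of "z \<ominus> a" "(1/2)^k"] z a by auto
  have "(z \<oplus> j) \<ominus> a = (z \<ominus> a) \<oplus> j" using z a j by (simp add: a_ac)
  moreover have "cl (z \<oplus> j) = cl z"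
   by (rule coset_eqI) (use z(1) j(1) coset_mem in blast)+
  ultimately show ?thesis using z j by (intro exI[of _ "z \<oplus> j"]) auto
 qed
 obtain a0 where a0: "a0 : car A" "cl a0 = X (N 0)" using Xc[of "N 0"] by (auto simp: quot_carrier)
 define a where "a = rec_nat a0 (%k x. SOME b. b : car A & cl b = X (N (Suc k)) & nm A (b \<ominus> x) < (1/2)^k)"
 have aS: "a (Suc k) = (SOME b. b : car A & cl b = X (N (Suc k)) & nm A (b \<ominus> a k) < (1/2)^k)" for k
  by (simp add: a_def)
 have inv: "a k : car A & cl (a k) = X (N k)" for k
 proof (induction k)
  case (Suc k) then show ?case using someI_ex[OF step[of "a k" k]] aS[of k] by metis
 qed (use a0 in \<open>simp add: a_def\<close>)
 have diff: "nm A (a (Suc k) \<ominus> a k) <= 1 * (1/2)^k" for k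
  using someI_ex[OF step[of "a k" k]] inv aS[of k] by (metis less_imp_le mult_1)
 obtain x where x: "cs_lim A a x" using geometric_cauchy[OF _ diff] inv cauchy_lim by blast
 have xc: "x : car A" using x by (simp add: cs_lim_def)
 have l: "(%k. nm A (a k \<ominus> x)) \<longlonglongrightarrow> 0" using x by (simp add: cs_lim_def)
 have "(%n. nm Q (X n -[Q] cl x)) \<longlonglongrightarrow> 0"
 proof (rule LIMSEQ_I)
  fix r :: real assume r: "r > 0"
  obtain k1 where k1: "!!k. k >= k1 ==> nm A (a k \<ominus> x) < r/2"
   using LIMSEQ_D[OF l, of "r/2"] r inv xc by auto
  obtain k2 where k2: "(1/2::real)^k2 < r/2" using real_arch_pow_inv[of "r/2" "1/2"] r by auto
  define k where "k = max k1 k2"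
  have "(1/2::real)^k <= (1/2)^k2" by (rule power_decreasing) (auto simp: k_def)
  then have k3: "(1/2::real)^k < r/2" using k2 by linarith
  have "norm (nm Q (X n -[Q] cl x) - 0) < r" if n: "n >= N k" for n
  proof -
   have "nm Q (X n -[Q] cl x) <= nm Q (X n -[Q] X (N k)) + nm Q (X (N k) -[Q] cl x)"
    using Xc xc by (intro Q.nm_minus_triangle) (auto simp: quot_carrier)
   moreover have "nm Q (X n -[Q] X (N k)) < (1/2)^k" using N0[of k n "N k"] Nge[of k] n by simp
   moreover have "nm Q (X (N k) -[Q] cl x) <= nm A (a k \<ominus> x)"
    using quot_norm_le'[of "a k \<ominus> x"] inv[of k] xc quot_minus[of "a k" x] by simp
   moreover have "0 <= nm Q (X n -[Q] cl x)" using Xc[of n] xc Q.nm_nonneg by (auto simp: quot_carrier quot_minus)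
   ultimately show ?thesis using k1[of k] k3 by (simp add: k_def)
  qed
  then show "EX no. ALL n>=no. norm (nm Q (X n -[Q] cl x) - 0) < r" by blast
 qed
 then show ?thesis using Xc xc by (auto simp: cs_lim_def quot_carrier)
qed

lemma quot_cstar: "cstar_algebra Q"
 by (rule cstar_algebraI[OF quot_pre_cstar quot_complete])

lemma quot_hom: "star_hom A Q cl"
 by (auto simp: star_hom_def quot_carrier quot_add quot_scale quot_mult quot_star)

end

section \<open>Inductive limits\<close>

locale cs_system = cs_family Lam A for Lam :: "'i set" and A :: "'i => 'a cstar" +
 fixes le :: "'i => 'i => bool" and phi :: "'i => 'i => 'a => 'a"
 assumes dir: "directed_set Lam le"
  and hom: "!!i j. i : Lam ==> j : Lam ==> le i j ==> star_hom (A i) (A j) (phi i j)"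
  and comp: "!!i j k a. i : Lam ==> j : Lam ==> k : Lam ==> le i j ==> le j k ==> a : car (A i) ==>
    phi j k (phi i j a) = phi i k a"
begin

abbreviation "P == cs_prod Lam A"
abbreviation "N == null_families Lam le A"

lemma le_refl: "i : Lam ==> le i i"
 and le_trans: "i : Lam ==> j : Lam ==> k : Lam ==> le i j ==> le j k ==> le i k"
 and Lam_ne: "Lam ~= {}"
proof -
 note d = dir[unfolded directed_set_def]
 show "i : Lam ==> le i i" using d by simp
 show "Lam ~= {}" using d by simp
 show "i : Lam ==> j : Lam ==> k : Lam ==> le i j ==> le j k ==> le i k"
  using d[THEN conjunct2, THEN conjunct2, THEN conjunct1, rule_format, of i j k] by simp
qed

lemma ub: assumes "i : Lam" "j : Lam" obtains k where "k : Lam" "le i k" "le j k"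
 using dir assms unfolding directed_set_def by blast

lemma null_iff: "x : N \<longleftrightarrow> x : car P & (ALL eps>0. EX i:Lam. ALL j:Lam. le i j --> nm (A j) (x j) < eps)"
 by (simp add: null_families_def)

lemma nullD: assumes "x : N" "eps > 0" obtains i where "i : Lam" "!!j. j : Lam ==> le i j ==> nm (A j) (x j) < eps"
 using assms unfolding null_iff by blast

text \<open>The one estimate behind all ideal properties of \<open>N\<close>; the unary cases take
  \<open>z = y\<close>, at the price of a harmless factor 2.\<close>

lemma null_dominated:
 assumes x: "x : car P" and y: "y : N" and z: "z : N"
  and K: "!!j. j : Lam ==> nm (A j) (x j) <= K * (nm (A j) (y j) + nm (A j) (z j))"
 shows "x : N"
 unfolding null_iff
proof (intro conjI allI impI x)
 fix eps :: real assume e: "eps > 0"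
 define d where "d = eps / (2 * (\<bar>K\<bar> + 1))"
 have d: "d > 0" using e by (simp add: d_def)
 obtain i where i: "i : Lam" "!!j. j : Lam ==> le i j ==> nm (A j) (y j) < d" using nullD[OF y d] by metis
 obtain i' where i': "i' : Lam" "!!j. j : Lam ==> le i' j ==> nm (A j) (z j) < d" using nullD[OF z d] by metis
 obtain k where k: "k : Lam" "le i k" "le i' k" using ub i(1) i'(1) by metis
 have "nm (A j) (x j) < eps" if j: "j : Lam" "le k j" for j
 proof -
  interpret Aj: cs_alg "A j" using falg j by blast
  have l: "nm (A j) (y j) < d" "nm (A j) (z j) < d"
   using i i' k j le_trans[of i k j] le_trans[of i' k j] by auto
  have c: "0 <= nm (A j) (y j)" "0 <= nm (A j) (z j)"
   using y z j by (auto simp: null_iff intro!: Aj.nm_nonneg prod_in)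
  have "nm (A j) (x j) <= (\<bar>K\<bar> + 1) * (nm (A j) (y j) + nm (A j) (z j))"
   using c by (intro order_trans[OF K[OF j(1)]] mult_right_mono) auto
  also have "... < (\<bar>K\<bar> + 1) * (d + d)" using l by (intro mult_strict_left_mono) auto
  also have "... = eps"
  proof -
   have "k * (eps / (2 * k) + eps / (2 * k)) = eps" if "k ~= 0" for k :: real using that by (simp add: field_simps)
   then show ?thesis unfolding d_def by (metis abs_ge_zero add_nonneg_pos order_less_irrefl zero_less_one)
  qed
  finally show ?thesis .
 qed
 then show "EX i:Lam. ALL j:Lam. le i j --> nm (A j) (x j) < eps" using k by blast
qed

sublocale PP: cs_alg P
 using prod_cstar by (simp add: cs_alg_def)

lemma zero_null: "(cs_zero P) : N"
proof -
 have "nm (A j) (cs_zero (A j)) = 0" if "j : Lam" for j using normed_sp.nm_zero[OF fns[OF that]] .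
 then show ?thesis unfolding null_iff using PP.zero_in Lam_ne by auto
qed

sublocale NN: cs_ideal P N
proof
 have sub: "N <= car P" by (auto simp: null_iff)
 have eval: "nm (A j) (x j) <= nm P x" "x j : car (A j)" if "x : car P" "j : Lam" for x j
  using prod_norm_ge prod_in that by auto
 show "closed_subspace P N"
  unfolding closed_subspace_def PP.closedin_seq_iff
 proof (intro conjI ballI allI impI sub zero_null)
  fix X x assume X: "ALL n. X n : N" and l: "cs_lim P X x"
  have c: "x : car P" "!!n. X n : car P" using l by (auto simp: cs_lim_def)
  show "x : N" unfolding null_iff
  proof (intro conjI allI impI c)
   fix eps :: real assume e: "eps > 0"
   obtain n where n: "nm P (X n -[P] x) < eps/2"
    using LIMSEQ_D[of "%n. nm P (X n -[P] x)" 0 "eps/2"] l e c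
    unfolding cs_lim_def by (metis diff_zero half_gt_zero le_refl linorder_le_cases real_norm_def abs_less_iff)
   obtain i where i: "i : Lam" "!!j. j : Lam ==> le i j ==> nm (A j) (X n j) < eps/2"
    using nullD[of "X n" "eps/2"] X e by auto
   have "nm (A j) (x j) < eps" if j: "j : Lam" "le i j" for j
   proof -
    interpret Aj: cs_alg "A j" using falg j by blast
    have "nm (A j) (X n j -[A j] x j) <= nm P (X n -[P] x)"
     using eval(1)[of "X n -[P] x" j] PP.add_in[OF c(2) PP.scale_in[OF c(1)], of n "-1"] j by simp
    then show ?thesis using Aj.nm_le_minus[of "x j" "X n j"] Aj.nm_minus_commute[of "x j" "X n j"]
      eval(2)[OF c(1) j(1)] eval(2)[OF c(2) j(1), of n] i(2)[OF j] n by simp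
   qed
   then show "EX i:Lam. ALL j:Lam. le i j --> nm (A j) (x j) < eps" using i by blast
  qed
 next
  fix x y assume xy: "x : N" "y : N"
  show "x +[P] y : N"
  proof (rule null_dominated[OF _ xy, where K = 1])
   show "x +[P] y : car P" using xy sub PP.add_in by blast
   fix j assume j: "j : Lam"
   have "x j : car (A j)" "y j : car (A j)" using eval(2) xy sub j by blast+
   then show "nm (A j) ((x +[P] y) j) <= 1 * (nm (A j) (x j) + nm (A j) (y j))"
    using normed_sp.nm_triangle[OF fns[OF j]] j by simp
  qed
 next
  fix c x assume x: "x : N"
  show "c .[P] x : N"
  proof (rule null_dominated[OF _ x x, where K = "cmod c"])
   show "c .[P] x : car P" using x sub PP.scale_in by blast
   fix j assume j: "j : Lam"
   have "0 <= nm (A j) (x j)" using normed_sp.nm_nonneg[OF fns[OF j]] eval(2) x sub j by blast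
   then have "cmod c * nm (A j) (x j) <= cmod c * (nm (A j) (x j) + nm (A j) (x j))"
    by (intro mult_left_mono) auto
   then show "nm (A j) ((c .[P] x) j) <= cmod c * (nm (A j) (x j) + nm (A j) (x j))"
    using normed_sp.nm_scale[OF fns[OF j]] eval(2)[of x j] x sub j by auto
  qed
 qed
 show "a *[P] x : N & x *[P] a : N" if a: "a : car P" and x: "x : N" for a x
 proof -
  have xc: "x : car P" using x sub by blast
  have *: "nm (A j) (a j *[A j] x j) <= nm P a * (nm (A j) (x j) + nm (A j) (x j))"
   "nm (A j) (x j *[A j] a j) <= nm P a * (nm (A j) (x j) + nm (A j) (x j))" if j: "j : Lam" for j
  proof -
   interpret Aj: cs_alg "A j" using falg j by blast
   have c: "a j : car (A j)" "x j : car (A j)" using eval(2) a xc j by auto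
   have "nm (A j) (a j) * nm (A j) (x j) <= nm P a * (nm (A j) (x j) + nm (A j) (x j))"
    using c eval(1)[OF a j] prod_norm_nonneg[OF a] by (intro mult_mono) auto
   then show "nm (A j) (a j *[A j] x j) <= nm P a * (nm (A j) (x j) + nm (A j) (x j))"
    "nm (A j) (x j *[A j] a j) <= nm P a * (nm (A j) (x j) + nm (A j) (x j))"
    using Aj.norm_mult[OF c] Aj.norm_mult[OF c(2,1)] by (simp_all add: mult.commute)
  qed
  show ?thesis
   by (intro conjI null_dominated[OF _ x x, where K = "nm P a"] PP.mult_in a xc) (simp_all only: prod_simps restrict_apply' *)
 qed
 show "cs_star P x : N" if x: "x : N" for x
 proof (rule null_dominated[OF _ x x, where K = 1])
  show "cs_star P x : car P" using x sub PP.star_in by blast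
  fix j assume j: "j : Lam"
  interpret Aj: cs_alg "A j" using falg j by blast
  have "x j : car (A j)" using eval(2) x sub j by blast
  then show "nm (A j) (cs_star P x j) <= 1 * (nm (A j) (x j) + nm (A j) (x j))" using j by simp
 qed
 fix x j and eps :: real assume x: "x : car P" and j: "j : N" and e: "eps > 0"
 obtain i0 where i0: "i0 : Lam" "!!i. i : Lam ==> le i0 i ==> nm (A i) (j i) < eps" using nullD[OF j e] by metis
 \<comment> \<open>The correction cancels \<open>x\<close> at the indices where \<open>j\<close> is
   not yet small and vanishes above \<open>i0\<close>, so it is null. Where \<open>x\<close>
   survives, the C*-identity of the coordinate costs at most the norm of \<open>j i\<close>, which
   is below \<open>eps\<close>.\<close>
 define k where "k = (\<lambda>i\<in>Lam. if le i0 i then cs_zero (A i) else (-1) .[A i] x i)"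
 have kc: "k : car P"
 proof (rule prod_carrierI[where c = "nm P x"])
  fix i assume i: "i : Lam"
  interpret Ai: cs_alg "A i" using falg i by blast
  show "k i : car (A i)" "nm (A i) (k i) <= nm P x"
   using eval[OF x i] i by (auto simp: k_def Ai.nm_scale prod_norm_nonneg[OF x])
 qed (simp add: k_def)
 have kN: "k : N" unfolding null_iff
 proof (intro conjI allI impI kc)
  fix eps :: real assume "eps > 0"
  then show "EX i:Lam. ALL j:Lam. le i j --> nm (A j) (k j) < eps"
   using i0 normed_sp.nm_zero[OF fns] by (intro bexI[of _ i0]) (auto simp: k_def)
 qed
 let ?s = "nm P (cs_star P x *[P] x +[P] j)"
 have jc: "j : car P" using j sub by blast
 have sc: "cs_star P x *[P] x +[P] j : car P" by (intro PP.add_in PP.mult_in PP.star_in x jc)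
 have s0: "?s >= 0" by (rule PP.nm_nonneg[OF sc])
 have "nm P (x +[P] k) <= sqrt (?s + eps)"
 proof (rule prod_norm_le)
  fix i assume i: "i : Lam"
  interpret Ai: cs_alg "A i" using falg i by blast
  have xi: "x i : car (A i)" and ji: "j i : car (A i)" using eval x jc i by auto
  show "nm (A i) ((x +[P] k) i) <= sqrt (?s + eps)"
  proof (cases "le i0 i")
   case False
   then have "(x +[P] k) i = cs_zero (A i)" using i xi by (simp add: k_def)
   then show ?thesis using s0 e by simp
  next
   case True
   then have xk: "(x +[P] k) i = x i" using i xi by (simp add: k_def)
   have "(nm (A i) (x i))^2 = nm (A i) (cs_star (A i) (x i) *[A i] x i)" using xi by (simp add: Ai.norm_star_mult)
   also have "... <= nm (A i) (cs_star (A i) (x i) *[A i] x i +[A i] j i) + nm (A i) (j i)"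
   proof -
    let ?u = "cs_star (A i) (x i) *[A i] x i"
    have u: "?u : car (A i)" using xi by simp
    have "?u +[A i] j i -[A i] j i = ?u" using u ji by (simp add: Ai.a_assoc)
    then show ?thesis using Ai.nm_triangle_minus[of "?u +[A i] j i" "j i"] u ji by simp
   qed
   also have "... <= ?s + eps" using eval(1)[OF sc i] i0(2)[OF i True] i by simp
   finally show ?thesis unfolding xk by (rule real_le_rsqrt)
  qed
 qed (use s0 e in simp)
 then have "(nm P (x +[P] k))^2 <= (sqrt (?s + eps))^2"
  using PP.nm_nonneg[OF PP.add_in[OF x kc]] by (intro power_mono)
 also have "... = ?s + eps" using s0 e by simp
 finally show "EX j':N. (nm P (x +[P] j'))^2 <= ?s + eps" using kN by blast
qed

abbreviation "Q == cs_quot P N"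
abbreviation "L == inductive_limit Lam le A phi"
abbreviation "inc == indlim_map Lam le A phi"

definition ext :: "'i => 'a => 'i => 'a" where
 "ext i a = (\<lambda>j\<in>Lam. if le i j then phi i j a else cs_zero (A j))"

lemma inc_eq: "inc i a = cs_coset P N (ext i a)"
 by (simp add: indlim_map_def ext_def)

lemma ext_hom: assumes i: "i : Lam" shows "star_hom (A i) P (ext i)"
proof -
 have c: "ext i a : car P" if a: "a : car (A i)" for a
 proof (rule prod_carrierI[where c = "nm (A i) a"])
  fix j assume j: "j : Lam"
  interpret Aj: cs_alg "A j" using falg j by blast
  interpret Ai: cs_alg "A i" using falg i by blast
  show "ext i a j : car (A j)" using hom[OF i j] a j by (auto simp: ext_def dest: star_homD(1))
  show "nm (A j) (ext i a j) <= nm (A i) a"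
   using star_hom_contractive[OF fam[OF i] fam[OF j] hom[OF i j] a] a j by (simp add: ext_def)
 qed (simp add: ext_def)
 have z: "z +[A j] z = z" "z *[A j] z = z" "c .[A j] z = z" "cs_star (A j) z = z" if "z = cs_zero (A j)" "j : Lam" for z j c
 proof -
  interpret Aj: cs_alg "A j" using falg that by blast
  show "z +[A j] z = z" "z *[A j] z = z" "c .[A j] z = z" "cs_star (A j) z = z" using that by simp_all
 qed
 show ?thesis unfolding star_hom_def
  by (intro conjI ballI allI funcsetI c)
    (auto simp: ext_def fun_eq_iff z star_homD[OF hom[OF i]])
qed

lemma inc_hom_Q: assumes i: "i : Lam" shows "star_hom (A i) Q (inc i)"
 using star_hom_comp[OF ext_hom[OF i] NN.quot_hom] by (simp add: inc_eq[abs_def])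

text \<open>The two families agree at every index above \<open>j\<close>, so their difference is
  null.\<close>

lemma inc_compat:
 assumes i: "i : Lam" and j: "j : Lam" and le: "le i j" and a: "a : car (A i)"
 shows "inc j (phi i j a) = inc i a"
proof -
 have b: "phi i j a : car (A j)" using star_homD(1)[OF hom[OF i j le] a] .
 have c: "ext j (phi i j a) : car P" "ext i a : car P"
  using star_homD(1)[OF ext_hom] i j a b by auto
 have d: "ext j (phi i j a) -[P] ext i a : car P" by (intro PP.add_in PP.scale_in c)
 have "ext j (phi i j a) -[P] ext i a : N"
  unfolding null_iff
 proof (intro conjI allI impI d)
  fix eps :: real assume e: "eps > 0"
  have "nm (A k) ((ext j (phi i j a) -[P] ext i a) k) < eps" if k: "k : Lam" "le j k" for k
  proof -
   interpret Ak: cs_alg "A k" using falg k by blast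
   have ik: "le i k" using le_trans[OF i j k(1) le k(2)] .
   have "phi i k a : car (A k)" using star_homD(1)[OF hom[OF i k(1) ik] a] .
   then show ?thesis using comp[OF i j k(1) le k(2) a] k ik e by (simp add: ext_def)
  qed
  then show "EX i':Lam. ALL k:Lam. le i' k --> nm (A k) ((ext j (phi i j a) -[P] ext i a) k) < eps" using j by blast
 qed
 then show ?thesis unfolding inc_eq using NN.coset_eq c by simp
qed

text \<open>A null family is arbitrarily small at some index above \<open>i\<close>, so adding it
  cannot push the norm below the common lower bound of the images of \<open>a\<close>. This is the
  half of the norm formula for classes that makes \<open>\<nu>\<close> isometric.\<close>

lemma inc_norm_ge:
 assumes i: "i : Lam" and a: "a : car (A i)" and r: "!!j. j : Lam ==> le i j ==> r <= nm (A j) (phi i j a)"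
 shows "r <= nm Q (inc i a)"
 unfolding inc_eq
proof (rule NN.quot_norm_ge)
 show c: "ext i a : car P" using star_homD(1)[OF ext_hom[OF i] a] .
 fix n assume n: "n : N"
 have nc: "n : car P" using n null_iff by blast
 show "r <= nm P (ext i a +[P] n)"
 proof (rule field_le_epsilon)
  fix e :: real assume e: "e > 0"
  obtain i' where i': "i' : Lam" "!!j. j : Lam ==> le i' j ==> nm (A j) (n j) < e" using nullD[OF n e] by metis
  obtain k where k: "k : Lam" "le i k" "le i' k" using ub i i'(1) by metis
  interpret Ak: cs_alg "A k" using falg k by blast
  have cc: "phi i k a : car (A k)" "n k : car (A k)" using star_homD(1)[OF hom[OF i k(1,2)] a] prod_in[OF nc k(1)] .
  have "phi i k a = (phi i k a +[A k] n k) -[A k] n k" using cc by (simp add: Ak.a_assoc)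
  then have "nm (A k) (phi i k a) <= nm (A k) (phi i k a +[A k] n k) + nm (A k) (n k)"
   using Ak.nm_triangle_minus[of "phi i k a +[A k] n k" "n k"] cc by simp
  moreover have "nm (A k) (phi i k a +[A k] n k) <= nm P (ext i a +[P] n)"
   using prod_norm_ge[OF PP.add_in[OF c nc] k(1)] k by (simp add: ext_def)
  ultimately show "r <= nm P (ext i a +[P] n) + e" using r[OF k(1,2)] i'(2)[OF k(1,3)] by linarith
 qed
qed

abbreviation "images == (\<Union>i\<in>Lam. inc i ` car (A i))"

lemma L_eq: "L = Q\<lparr>cs_carrier := cs_topology Q closure_of images\<rparr>"
 by (simp add: inductive_limit_def Let_def)

sublocale QQ: cs_alg Q
 using NN.quot_cstar by (simp add: cs_alg_def)

lemma images_I: assumes "i : Lam" "a : car (A i)" shows "inc i a : images"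
 using assms by (intro UN_I[of i] imageI)

lemma images_in: "images <= car Q"
 using star_homD(1)[OF inc_hom_Q] by blast

lemma images_common:
 assumes "x : images" "y : images"
 obtains i a b where "i : Lam" "a : car (A i)" "b : car (A i)" "x = inc i a" "y = inc i b"
proof -
 obtain i a where i: "i : Lam" "a : car (A i)" "x = inc i a" using assms(1) by blast
 obtain j b where j: "j : Lam" "b : car (A j)" "y = inc j b" using assms(2) by blast
 obtain k where k: "k : Lam" "le i k" "le j k" using ub i(1) j(1) by metis
 have "x = inc k (phi i k a)" "y = inc k (phi j k b)" using inc_compat i j k by auto
 then show ?thesis using that[of k "phi i k a" "phi j k b"] star_homD(1)[OF hom] i j k by auto
qed

lemma L_subalgebra: "cstar_subalgebra Q (cs_topology Q closure_of images)"
proof (rule QQ.closure_subalgebra[OF images_in])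
 obtain i0 where i0: "i0 : Lam" using Lam_ne by blast
 have "inc i0 (cs_zero (A i0)) = cs_zero Q"
  by (rule star_hom_zero[OF fam[OF i0] NN.quot_cstar inc_hom_Q[OF i0]])
 moreover have "inc i0 (cs_zero (A i0)) : images"
  by (intro images_I i0 normed_sp.zero_in[OF fns[OF i0]])
 ultimately show "cs_zero Q : images" by (simp only:)
 fix x assume x: "x : images"
 { fix c
  obtain i a where i: "i : Lam" "a : car (A i)" "x = inc i a" using x by blast
  interpret Ai: cs_alg "A i" using falg i by blast
  have "c .[Q] x = inc i (c .[A i] a)" "cs_star Q x = inc i (cs_star (A i) a)"
   using star_homD(3,5)[OF inc_hom_Q[OF i(1)]] i by auto
  then show "c .[Q] x : images" "cs_star Q x : images"
   by (simp_all only:) (intro images_I i Ai.scale_in Ai.star_in)+ }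
 fix y assume y: "y : images"
 obtain i a b where i: "i : Lam" "a : car (A i)" "b : car (A i)" "x = inc i a" "y = inc i b"
  using images_common[OF x y] by metis
 interpret Ai: cs_alg "A i" using falg i by blast
 have "x +[Q] y = inc i (a +[A i] b)" "x *[Q] y = inc i (a *[A i] b)"
  using star_homD(2,4)[OF inc_hom_Q[OF i(1)]] i by auto
 then show "x +[Q] y : images" "x *[Q] y : images"
  by (simp_all only:) (intro images_I i Ai.add_in Ai.mult_in)+
qed

lemma L_cstar: "cstar_algebra L"
 unfolding L_eq by (rule QQ.subalgebra_cstar[OF L_subalgebra])

lemma images_L: "images <= car L"
 using closure_of_subset[of images "cs_topology Q"] images_in by (simp add: L_eq QQ.cs_topology_eq)

lemma inc_hom: assumes i: "i : Lam" shows "star_hom (A i) L (inc i)"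
 using inc_hom_Q[OF i] images_L i unfolding star_hom_def L_eq by auto

lemma L_dense: assumes "x : car L" shows "EX X. (ALL n. X n : images) & cs_lim L X x"
proof -
 obtain X where X: "ALL n. X n : images" "cs_lim Q X x"
  using assms QQ.closure_of_seq_iff[OF images_in] by (auto simp: L_eq)
 then have "cs_lim L X x" using assms images_L by (auto simp: L_eq cs_lim_def)
 then show ?thesis using X by blast
qed

lemma L_norm: "nm L = nm Q"
 by (simp add: L_eq)

end

section \<open>Functions vanishing at infinity\<close>

lemma cont_iff_tendsto:
 fixes f :: "'a => 'b::topological_space"
 shows "continuous_map X euclidean f \<longleftrightarrow> (ALL x:topspace X. (f \<longlongrightarrow> f x) (atin X x))"
 by (simp add: continuous_map_atin)

lemma cont_mult:
 fixes f g :: "'a => 'b::real_normed_algebra"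
 shows "continuous_map X euclidean f ==> continuous_map X euclidean g ==> continuous_map X euclidean (%x. f x * g x)"
 unfolding cont_iff_tendsto by (auto intro: tendsto_mult)

lemma cont_cnj: "continuous_map X euclidean f ==> continuous_map X euclidean (%x. cnj (f x))"
 unfolding cont_iff_tendsto by (auto intro: tendsto_cnj)

lemma cont_of_real: "continuous_map X euclideanreal f ==> continuous_map X euclidean (%x. complex_of_real (f x))"
 unfolding cont_iff_tendsto by (auto intro: tendsto_of_real)

lemma cont_cmod:
 fixes f :: "'a => complex"
 shows "continuous_map X euclidean f ==> continuous_map X euclideanreal (%x. cmod (f x))"
 unfolding cont_iff_tendsto by (auto intro: tendsto_norm)

lemma cont_Re: "continuous_map X euclidean f ==> continuous_map X euclideanreal (%x. Re (f x))"
 unfolding cont_iff_tendsto by (auto intro: tendsto_Re)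

lemma cont_uniform_limit:
 fixes g :: "'a => 'b::metric_space"
 assumes "!!eps. eps > 0 ==> EX f. continuous_map X euclidean f & (ALL x:topspace X. dist (f x) (g x) <= eps)"
 shows "continuous_map X euclidean g"
 unfolding cont_iff_tendsto
proof (intro ballI tendstoI)
 fix x and e :: real assume x: "x : topspace X" and e: "e > 0"
 obtain f where f: "continuous_map X euclidean f" "!!x. x : topspace X ==> dist (f x) (g x) <= e/4"
  using assms[of "e/4"] e by auto
 have "\<forall>\<^sub>F y in atin X x. dist (f y) (f x) < e/4"
  using f(1)[unfolded cont_iff_tendsto] x e tendstoD by (metis divide_pos_pos zero_less_numeral)
 moreover have "\<forall>\<^sub>F y in atin X x. y : topspace X"
  unfolding eventually_atin using x openin_topspace by blast
 ultimately show "\<forall>\<^sub>F y in atin X x. dist (g y) (g x) < e"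
 proof eventually_elim
  case (elim y)
  then show ?case using f(2)[OF x] f(2)[of y] e dist_triangle[of "g y" "g x" "f y"] dist_triangle[of "f y" "g x" "f x"]
   dist_commute[of "g y" "f y"] by linarith
 qed
qed

lemma C0_simps [simp]:
 "cs_zero (C0 X) = (%x. 0)" "cs_add (C0 X) f g = (%x. f x + g x)" "cs_scale (C0 X) c f = (%x. c * f x)"
 "cs_mult (C0 X) f g = (%x. f x * g x)" "cs_star (C0 X) f = (%x. cnj (f x))"
 by (simp_all add: C0_def)

lemma C0_iff: "f : C0c X \<longleftrightarrow> continuous_map X euclidean f &
  (ALL eps>0. compactin X {x : topspace X. eps <= cmod (f x)}) & (ALL x. x ~: topspace X --> f x = 0)"
 by (simp add: C0_def)

lemma C0_cont: "f : C0c X ==> continuous_map X euclidean f"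
 and C0_level: "f : C0c X ==> eps > 0 ==> compactin X {x : topspace X. eps <= cmod (f x)}"
 and C0_off: "f : C0c X ==> x ~: topspace X ==> f x = 0"
 by (auto simp: C0_iff)

lemma closedin_level:
 fixes f :: "'a => complex"
 assumes "continuous_map X euclidean f" shows "closedin X {x : topspace X. eps <= cmod (f x)}"
 using closedin_continuous_map_preimage[OF cont_cmod[OF assms], of "{eps..}"] by simp

lemma C0_I:
 assumes c: "continuous_map X euclidean f" and "!!x. x ~: topspace X ==> f x = 0"
  and K: "!!eps. eps > 0 ==> EX K. compactin X K & (ALL x:topspace X. eps <= cmod (f x) --> x : K)"
 shows "f : C0c X"
proof -
 have "compactin X {x : topspace X. eps <= cmod (f x)}" if e: "eps > 0" for eps
 proof -
  obtain K where "compactin X K" "ALL x:topspace X. eps <= cmod (f x) --> x : K" using K[OF e] by blast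
  then show ?thesis using closedin_level[OF c]
   by (metis (mono_tags, lifting) closed_compactin mem_Collect_eq subsetI)
 qed
 then show ?thesis using assms by (simp add: C0_iff)
qed

lemma C0_zero: "(%x. 0) : C0c X"
 by (rule C0_I) (auto intro!: exI[of _ "{}"])

text \<open>The level sets of \<open>h\<close> lie in level sets of \<open>f\<close> or \<open>g\<close>.\<close>

lemma C0_dominated:
 assumes f: "f : C0c X" and g: "g : C0c X" and h: "continuous_map X euclidean h"
  and off: "!!x. x ~: topspace X ==> h x = 0"
  and le: "!!x. x : topspace X ==> cmod (h x) <= M * (cmod (f x) + cmod (g x))"
 shows "h : C0c X"
proof (rule C0_I[OF h off])
 fix eps :: real assume e: "eps > 0"
 define d where "d = eps / (2 * (\<bar>M\<bar> + 1))"
 have d: "d > 0" using e by (simp add: d_def)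
 have "d <= cmod (f x) | d <= cmod (g x)" if x: "x : topspace X" "eps <= cmod (h x)" for x
 proof (rule ccontr)
  assume "~ ?thesis"
  then have "(\<bar>M\<bar> + 1) * (cmod (f x) + cmod (g x)) < (\<bar>M\<bar> + 1) * (2 * d)" by (intro mult_strict_left_mono) auto
  moreover have "(\<bar>M\<bar> + 1) * (2 * d) = eps"
  proof -
   have k: "k * (2 * (eps / (2 * k))) = eps" if "k ~= 0" for k :: real using that by (simp add: field_simps)
   show ?thesis unfolding d_def by (rule k) linarith
  qed
  moreover have "M * (cmod (f x) + cmod (g x)) <= (\<bar>M\<bar> + 1) * (cmod (f x) + cmod (g x))"
   by (intro mult_right_mono) auto
  ultimately show False using le[OF x(1)] x(2) by linarith
 qed
 then show "EX K. compactin X K & (ALL x:topspace X. eps <= cmod (h x) --> x : K)"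
  using C0_level[OF f d] C0_level[OF g d]
  by (intro exI[of _ "{x : topspace X. d <= cmod (f x)} Un {x : topspace X. d <= cmod (g x)}"]) (auto intro: compactin_Un)
qed

lemma C0_bounded: assumes "f : C0c X" shows "bdd_above ((%x. cmod (f x)) ` topspace X)"
proof -
 have "compact ((%x. cmod (f x)) ` {x : topspace X. 1 <= cmod (f x)})"
  using image_compactin[OF C0_level[OF assms zero_less_one] cont_cmod[OF C0_cont[OF assms]]] by simp
 then have "bounded ((%x. cmod (f x)) ` {x : topspace X. 1 <= cmod (f x)})" by (rule compact_imp_bounded)
 then obtain B where B: "!!x. x : topspace X ==> 1 <= cmod (f x) ==> cmod (f x) <= B"
  unfolding bounded_iff by fastforce
 show ?thesis by (rule bdd_aboveI2[where M = "max 1 B"]) (use B in \<open>force simp: max_def\<close>)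
qed

lemma C0_norm_ge: assumes "f : C0c X" shows "cmod (f x) <= nm (C0 X) f"
 using C0_bounded[OF assms] C0_off[OF assms] by (cases "x : topspace X") (auto simp: C0_def intro!: cSup_upper)

lemma C0_norm_le: "0 <= c ==> (!!x. x : topspace X ==> cmod (f x) <= c) ==> nm (C0 X) f <= c"
 by (auto simp: C0_def intro!: cSup_least)

lemma C0_norm_nonneg: assumes "f : C0c X" shows "0 <= nm (C0 X) f"
 using C0_norm_ge[OF assms] norm_ge_zero order_trans by blast

lemma C0_add: "f : C0c X ==> g : C0c X ==> (%x. f x + g x) : C0c X"
 by (rule C0_dominated[of f X g _ 1]) (use C0_cont[of f X] C0_cont[of g X] in \<open>auto simp: C0_off intro!: continuous_map_add norm_triangle_ineq\<close>)

lemma C0_mult_bounded: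
 assumes f: "f : C0c X" and g: "continuous_map X euclidean g" "!!x. x : topspace X ==> cmod (g x) <= M"
 shows "(%x. g x * f x) : C0c X"
proof (rule C0_dominated[OF f f, where M = M])
 show "cmod (g x * f x) <= M * (cmod (f x) + cmod (f x))" if x: "x : topspace X" for x
 proof -
  have "0 <= M" using g(2)[OF x] norm_ge_zero order_trans by blast
  then show ?thesis unfolding norm_mult using g(2)[OF x] by (intro mult_mono) auto
 qed
qed (use f g C0_cont[OF f] in \<open>auto simp: C0_off intro!: cont_mult\<close>)

lemma C0_scale: "f : C0c X ==> (%x. c * f x) : C0c X"
 by (rule C0_mult_bounded[where M = "cmod c"]) auto

lemma C0_mult: "f : C0c X ==> g : C0c X ==> (%x. f x * g x) : C0c X"
 by (rule C0_mult_bounded[where M = "nm (C0 X) f"]) (auto intro: C0_cont C0_norm_ge)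

lemma C0_cnj: "f : C0c X ==> (%x. cnj (f x)) : C0c X"
 by (rule C0_dominated[of f X f _ 1]) (use C0_cont[of f X] in \<open>auto simp: C0_off intro!: cont_cnj\<close>)

lemma C0_uniform_limit:
 assumes off: "!!x. x ~: topspace X ==> g x = 0"
  and approx: "!!eps. eps > 0 ==> EX f:C0c X. ALL x:topspace X. cmod (f x - g x) <= eps"
 shows "g : C0c X"
proof (rule C0_I[OF _ off])
 show "continuous_map X euclidean g"
 proof (rule cont_uniform_limit)
  fix eps :: real assume "eps > 0"
  then obtain f where "f : C0c X" "ALL x:topspace X. cmod (f x - g x) <= eps" using approx by metis
  then show "EX f. continuous_map X euclidean f & (ALL x:topspace X. dist (f x) (g x) <= eps)"
   using C0_cont by (intro exI[of _ f]) (auto simp: dist_norm)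
 qed
 fix eps :: real assume e: "eps > 0"
 obtain f where f: "f : C0c X" "!!x. x : topspace X ==> cmod (f x - g x) <= eps/2"
  using approx[of "eps/2"] e by auto
 have "eps/2 <= cmod (f x)" if "x : topspace X" "eps <= cmod (g x)" for x
  using f(2)[OF that(1)] that(2) norm_triangle_ineq2[of "g x" "f x"] by (simp add: norm_minus_commute)
 then show "EX K. compactin X K & (ALL x:topspace X. eps <= cmod (g x) --> x : K)"
  using C0_level[OF f(1), of "eps/2"] e by (intro exI[of _ "{x : topspace X. eps/2 <= cmod (f x)}"]) auto
qed

lemma C0_cauchy_lim:
 assumes X: "!!n. f n : C0c X"
  and C: "!!eps. eps > 0 ==> EX N. ALL m>=N. ALL n>=N. ALL x:topspace X. cmod (f m x - f n x) <= eps"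
 shows "EX g:C0c X. (ALL x. (%n. f n x) \<longlonglongrightarrow> g x) &
   (ALL eps>0. EX N. ALL n>=N. ALL x:topspace X. cmod (f n x - g x) <= eps)"
proof -
 have "Cauchy (%n. f n x)" if x: "x : topspace X" for x
  unfolding Cauchy_iff
 proof (intro allI impI)
  fix e :: real assume "e > 0"
  then obtain N where "ALL m>=N. ALL n>=N. ALL x:topspace X. cmod (f m x - f n x) <= e/2" using C[of "e/2"] by auto
  then show "EX M. ALL m>=M. ALL n>=M. cmod (f m x - f n x) < e" using x \<open>e > 0\<close>
   by (intro exI[of _ N]) (smt (verit) field_sum_of_halves)
 qed
 then have "EX l. (%n. f n x) \<longlonglongrightarrow> l" for x
  using C0_off[OF X] by (cases "x : topspace X") (auto simp: Cauchy_convergent_iff convergent_def)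
 then obtain g where g: "!!x. (%n. f n x) \<longlonglongrightarrow> g x" by metis
 have unif: "EX N. ALL n>=N. ALL x:topspace X. cmod (f n x - g x) <= eps" if e: "eps > 0" for eps
 proof -
  obtain N where N: "!!m n x. m >= N ==> n >= N ==> x : topspace X ==> cmod (f n x - f m x) <= eps" using C[OF e] by auto
  have "cmod (f n x - g x) <= eps" if "n >= N" "x : topspace X" for n x
  proof (rule LIMSEQ_le_const2)
   show "(%m. cmod (f n x - f m x)) \<longlonglongrightarrow> cmod (f n x - g x)" by (intro tendsto_intros g)
   show "EX N. ALL m>=N. cmod (f n x - f m x) <= eps" using N that by blast
  qed
  then show ?thesis by blast
 qed
 have "g x = 0" if "x ~: topspace X" for x
  using g[of x] C0_off[OF X that] by (simp add: LIMSEQ_const_iff)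
 then have "g : C0c X"
 proof (rule C0_uniform_limit)
  fix eps :: real assume "eps > 0"
  then show "EX f:C0c X. ALL x:topspace X. cmod (f x - g x) <= eps" using unif X by (meson order_refl)
 qed
 then show ?thesis using g unif by blast
qed

lemma C0_cstar: "cstar_algebra (C0 X)"
proof (rule cstar_algebraI)
 show "pre_cstar (C0 X)"
 proof
  fix f assume f: "f : C0c X"
  show "nm (C0 X) f = 0 \<longleftrightarrow> f = cs_zero (C0 X)"
  proof
   assume "nm (C0 X) f = 0" then show "f = cs_zero (C0 X)" using C0_norm_ge[OF f] by (auto simp: fun_eq_iff)
  next
   assume "f = cs_zero (C0 X)"
   then have "nm (C0 X) f <= 0" by (intro C0_norm_le) auto
   then show "nm (C0 X) f = 0" using C0_norm_nonneg[OF f] by simp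
  qed
  show "nm (C0 X) (c .[C0 X] f) = cmod c * nm (C0 X) f" for c
  proof (cases "c = 0")
   case True
   then have "nm (C0 X) (c .[C0 X] f) <= 0" by (intro C0_norm_le) auto
   then show ?thesis using True C0_norm_nonneg[OF C0_zero, of X] by simp
  next
   case False
   have le: "nm (C0 X) (%x. c * f x) <= cmod c * nm (C0 X) f" if f: "f : C0c X" for c f
    using C0_norm_ge[OF f] C0_norm_nonneg[OF f] by (intro C0_norm_le) (auto simp: norm_mult intro: mult_left_mono)
   have "(%x. inverse c * (c * f x)) = f" using False by (auto simp: fun_eq_iff)
   then have "nm (C0 X) f <= inverse (cmod c) * nm (C0 X) (%x. c * f x)"
    using le[OF C0_scale[OF f], of "inverse c" c] by (simp add: norm_inverse)
   then show ?thesis using le[OF f, of c] False by (simp add: field_simps)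
  qed
  show "nm (C0 X) (cs_star (C0 X) f *[C0 X] f) = (nm (C0 X) f)^2"
  proof (rule antisym)
   have e: "cmod (cnj (f x) * f x) = (cmod (f x))^2" for x by (simp add: norm_mult power2_eq_square)
   show "nm (C0 X) (cs_star (C0 X) f *[C0 X] f) <= (nm (C0 X) f)^2"
    using C0_norm_ge[OF f] by (intro C0_norm_le) (auto simp: e intro: power_mono)
   have m: "(%x. cnj (f x) * f x) : C0c X" by (intro C0_mult C0_cnj f)
   have "nm (C0 X) f <= sqrt (nm (C0 X) (%x. cnj (f x) * f x))"
    using C0_norm_ge[OF m] C0_norm_nonneg[OF m] by (intro C0_norm_le) (auto simp: e intro: real_le_rsqrt)
   then have "(nm (C0 X) f)^2 <= (sqrt (nm (C0 X) (%x. cnj (f x) * f x)))^2"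
    by (intro power_mono C0_norm_nonneg f)
   then show "(nm (C0 X) f)^2 <= nm (C0 X) (cs_star (C0 X) f *[C0 X] f)"
    using C0_norm_nonneg[OF m] by simp
  qed
  fix g assume g: "g : C0c X"
  show "nm (C0 X) (f +[C0 X] g) <= nm (C0 X) f + nm (C0 X) g"
  proof (rule C0_norm_le)
   show "cmod ((f +[C0 X] g) x) <= nm (C0 X) f + nm (C0 X) g" for x
    using C0_norm_ge[OF f, of x] C0_norm_ge[OF g, of x] norm_triangle_ineq[of "f x" "g x"] by simp
  qed (use C0_norm_nonneg[OF f] C0_norm_nonneg[OF g] in simp)
  show "nm (C0 X) (f *[C0 X] g) <= nm (C0 X) f * nm (C0 X) g"
  proof (rule C0_norm_le)
   show "cmod ((f *[C0 X] g) x) <= nm (C0 X) f * nm (C0 X) g" for x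
    unfolding C0_simps norm_mult
    by (rule mult_mono[OF C0_norm_ge[OF f] C0_norm_ge[OF g]]) (use C0_norm_nonneg[OF f] in auto)
  qed (use C0_norm_nonneg[OF f] C0_norm_nonneg[OF g] in simp)
 qed (auto simp: C0_zero C0_add C0_scale C0_mult C0_cnj C0_norm_nonneg algebra_simps)
 fix F assume F: "cs_cauchy (C0 X) F"
 have c: "!!n. F n : C0c X" using F by (simp add: cs_cauchy_def)
 have d: "(%x. f x + (-1) * g x) : C0c X" if "f : C0c X" "g : C0c X" for f g
  by (intro C0_add C0_scale that)
 have "EX N. ALL m>=N. ALL n>=N. ALL x:topspace X. cmod (F m x - F n x) <= eps" if e: "eps > 0" for eps
 proof -
  obtain N where N: "!!m n. m >= N ==> n >= N ==> nm (C0 X) (%x. F m x + (-1) * F n x) < eps"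
   using F e unfolding cs_cauchy_def C0_simps by meson
  have "cmod (F m x - F n x) <= eps" if "m >= N" "n >= N" for m n x
   using C0_norm_ge[OF d[OF c[of m] c[of n]], of x] N[OF that] by simp
  then show ?thesis by blast
 qed
 then obtain g where g: "g : C0c X" "!!eps. eps > 0 ==> EX N. ALL n>=N. ALL x:topspace X. cmod (F n x - g x) <= eps"
  using C0_cauchy_lim[of F X] c by metis
 have "(%n. nm (C0 X) (F n -[C0 X] g)) \<longlonglongrightarrow> 0"
 proof (rule LIMSEQ_I)
  fix r :: real assume r: "r > 0"
  then obtain N where N: "!!n x. n >= N ==> x : topspace X ==> cmod (F n x - g x) <= r/2" using g(2)[of "r/2"] by auto
  have "nm (C0 X) (F n -[C0 X] g) <= r/2" if "n >= N" for n
   using N[OF that] r by (intro C0_norm_le) auto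
  then have "nm (C0 X) (F n -[C0 X] g) < r" if "n >= N" for n
   by (rule order.strict_trans1[of _ "r/2"]) (use that r in auto)
  moreover have "0 <= nm (C0 X) (F n -[C0 X] g)" for n
   unfolding C0_simps by (rule C0_norm_nonneg[OF d[OF c g(1)]])
  ultimately show "EX no. ALL n>=no. norm (nm (C0 X) (F n -[C0 X] g) - 0) < r" using r
   by (intro exI[of _ N]) auto
 qed
 then show "EX g. cs_lim (C0 X) F g" using c g(1) by (auto simp: cs_lim_def)
qed

text \<open>A closed set missing 0 stays away from 0, so its preimage is closed in a compact level
  set; a closed set containing 0 is treated through its complement. In this form composing with a
  map of compactifications visibly preserves \<open>C0\<close>.\<close>

lemma C0_iff_Alexandroff:
 "f : C0c X \<longleftrightarrow> (ALL x. x ~: topspace X --> f x = 0) &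
   continuous_map (Alexandroff_compactification X) euclidean (case_option 0 f)"
proof
 assume f: "f : C0c X"
 have "closedin (Alexandroff_compactification X) {x : topspace (Alexandroff_compactification X). case_option 0 f x : C}"
  if C: "closed C" for C
 proof (cases "0 : C")
  case True
  have op: "openin X {x : topspace X. f x : - C}"
   using openin_continuous_map_preimage[OF C0_cont[OF f], of "- C"] C by (simp add: open_Compl)
  have "{x : topspace (Alexandroff_compactification X). case_option 0 f x : C} =
   topspace (Alexandroff_compactification X) - Some ` {x : topspace X. f x : - C}"
  proof (intro set_eqI)
   fix x show "(x : {x : topspace (Alexandroff_compactification X). case_option 0 f x : C}) =
    (x : topspace (Alexandroff_compactification X) - Some ` {x : topspace X. f x : - C})"
    by (cases x) (use True in auto)
  qed
  then show ?thesis using op unfolding closedin_Alexandroff_compactification by blast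
 next
  case False
  then obtain e where e: "e > 0" "!!y. y : C ==> e <= cmod y"
   using C separate_point_closed[of C 0] by auto
  have cl: "closedin X {x : topspace X. f x : C}"
   using closedin_continuous_map_preimage[OF C0_cont[OF f]] C by simp
  moreover have "compactin X {x : topspace X. f x : C}"
   using closed_compactin[OF C0_level[OF f e(1)] _ cl] e(2) by auto
  moreover have "{x : topspace (Alexandroff_compactification X). case_option 0 f x : C} = Some ` {x : topspace X. f x : C}"
   using False by (auto split: option.splits)
  ultimately show ?thesis by simp
 qed
 then show "(ALL x. x ~: topspace X --> f x = 0) & continuous_map (Alexandroff_compactification X) euclidean (case_option 0 f)"
  using C0_off[OF f] unfolding continuous_map_closedin by auto
next
 assume a: "(ALL x. x ~: topspace X --> f x = 0) & continuous_map (Alexandroff_compactification X) euclidean (case_option 0 f)"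
 then have c: "continuous_map (Alexandroff_compactification X) euclidean (case_option 0 f)" by blast
 have "continuous_map X euclidean (case_option 0 f \<circ> Some)"
  using continuous_map_compose[OF continuous_map_Some c] .
 then have "continuous_map X euclidean f" by (simp add: o_def)
 moreover have "compactin X {x : topspace X. eps <= cmod (f x)}" if e: "eps > 0" for eps
 proof -
  have "closedin (Alexandroff_compactification X) {x : topspace (Alexandroff_compactification X). eps <= cmod (case_option 0 f x)}"
   by (rule closedin_level[OF c])
  moreover have "{x : topspace (Alexandroff_compactification X). eps <= cmod (case_option 0 f x)} = Some ` {x : topspace X. eps <= cmod (f x)}"
   using e by (auto split: option.splits)
  ultimately show ?thesis by simp
 qed
 ultimately show "f : C0c X" using a by (simp add: C0_iff)
qed

text \<open>Density of compactly supported functions: \<open>g\<close> lives on the level set of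
  \<open>f\<close> at height \<open>eps\<close>, which is compact.\<close>

lemma C0_cutoff:
 assumes f: "f : C0c X" and e: "eps > 0"
 shows "EX g:C0c X. (ALL x. cmod (g x - f x) <= eps) & (ALL x. g x ~= 0 --> x : topspace X & eps <= cmod (f x))"
proof -
 \<comment> \<open>Equal to 0 where \<open>cmod (f x) <= eps\<close> and to
   \<open>1 - eps / cmod (f x)\<close> elsewhere, so \<open>(1 - h x) * cmod (f x)\<close> never
   exceeds \<open>eps\<close>. The outer \<open>max\<close> keeps the quotient continuous at zeros
   of \<open>f\<close>.\<close>
 define h where "h x = max 0 (cmod (f x) - eps) / max eps (cmod (f x))" for x
 have h01: "0 <= h x" "h x <= 1" for x using e by (auto simp: h_def divide_le_eq)
 have "continuous_map X euclideanreal h"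
  unfolding h_def using e
  by (intro continuous_map_real_divide continuous_map_real_max continuous_map_diff cont_cmod C0_cont f) auto
 then have g: "(%x. complex_of_real (h x) * f x) : C0c X"
  by (intro C0_mult_bounded[where M = 1] f cont_of_real) (use h01 in auto)
 have "cmod (complex_of_real (h x) * f x - f x) <= eps" for x
 proof -
  have "complex_of_real (h x) * f x - f x = complex_of_real (h x - 1) * f x" by (simp add: algebra_simps)
  then have "cmod (complex_of_real (h x) * f x - f x) = (1 - h x) * cmod (f x)" using h01[of x] by (simp only: norm_mult norm_of_real) simp
  also have "... <= eps"
  proof (cases "cmod (f x) <= eps")
   case True then show ?thesis using h01[of x] mult_mono[of "1 - h x" 1 "cmod (f x)" eps] e by auto
  next
   case False
   then have "cmod (f x) > 0" using e by linarith
   then have "(1 - h x) * cmod (f x) = eps" using e False by (auto simp: h_def field_simps max_def)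
   then show ?thesis by simp
  qed
  finally show ?thesis .
 qed
 moreover have "x : topspace X & eps <= cmod (f x)" if "complex_of_real (h x) * f x ~= 0" for x
  using that C0_off[OF f] by (auto simp: h_def max_def split: if_splits)
 ultimately show ?thesis by (intro bexI[OF _ g]) blast
qed

section \<open>Partitions of unity and fibre sums on a topological graph\<close>

lemma compactin_indexed_cover:
 assumes "compactin X K" "!!i. i : A ==> openin X (W i)" "K <= (\<Union>i\<in>A. W i)"
 obtains I where "finite I" "I <= A" "K <= (\<Union>i\<in>I. W i)"
proof -
 obtain \<F> where F: "finite \<F>" "\<F> <= W ` A" "K <= \<Union>\<F>"
  using compactinD[OF assms(1), of "W ` A"] assms(2,3) by auto
 obtain I where "I <= A" "finite I" "\<F> = W ` I" using finite_subset_image[OF F(1,2)] by blast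
 then show thesis using that F by blast
qed

text \<open>Urysohn's lemma, applied inside a compact neighbourhood \<open>L\<close> of
  \<open>K\<close>, with the additional demand of a compact support contained in
  \<open>U\<close>.\<close>

lemma LCH_bump:
 assumes X: "locally_compact_space X" "Hausdorff_space X" and K: "compactin X K" and U: "openin X U" and KU: "K <= U"
 obtains h :: "'a => real" and D where "continuous_map X euclideanreal h" "!!x. 0 <= h x" "!!x. h x <= 1"
  "!!x. x : K ==> h x = 1" "compactin X D" "D <= U" "!!x. x ~: D ==> h x = 0"
proof -
 have reg: "regular_space X" using X locally_compact_Hausdorff_imp_regular_space by blast
 have cr: "completely_regular_space X" using X reg locally_compact_regular_imp_completely_regular_space by blast
 obtain W L where WL: "openin X W" "compactin X L" "K <= W" "W <= L"
  using locally_compact_space_compact_closed_compact[of X] X K by blast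
 have 1: "closedin X (topspace X - W Int U)" using WL U by blast
 have 2: "disjnt K (topspace X - W Int U)" using WL KU by (auto simp: disjnt_def)
 obtain f :: "'a => real" where f: "continuous_map X (subtopology euclidean {0..1}) f" "f ` (topspace X - W Int U) <= {0}" "f ` K <= {1}"
  by (rule Urysohn_completely_regular_compact_closed[OF zero_le_one cr K 1 2], rule that, assumption+)
 have fc: "continuous_map X euclideanreal f" and f01: "!!x. x : topspace X ==> 0 <= f x & f x <= 1"
  using f(1) by (auto simp: continuous_map_in_subtopology)
 \<comment> \<open>The ramp \<open>2 * f x - 1\<close> is still 1 on \<open>K\<close> but positive
   only where \<open>f > 1/2\<close>. So \<open>h\<close> vanishes off the closed set
   \<open>D\<close>, which lies in \<open>W Int U\<close> and hence in the compact set
   \<open>L\<close>.\<close>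
 define h where "h x = (if x : topspace X then max 0 (2 * f x - 1) else 0)" for x
 define D where "D = {x : topspace X. f x : {1/2..}}"
 have Kt: "K <= topspace X" using K compactin_subset_topspace by blast
 have "closedin X D" unfolding D_def by (rule closedin_continuous_map_preimage[OF fc]) simp
 moreover have DWU: "D <= W Int U" using f(2) unfolding D_def by (fastforce simp: image_subset_iff)
 ultimately have Dc: "compactin X D" using closed_compactin[OF WL(2)] WL(4) by blast
 have "continuous_map X euclideanreal (%x. max 0 (2 * f x - 1))"
  by (intro continuous_map_real_max continuous_map_diff continuous_map_real_mult fc) auto
 then have hc: "continuous_map X euclideanreal h" by (rule continuous_map_eq) (auto simp: h_def)
 show thesis
 proof (rule that[OF hc])
  show "0 <= h x" for x by (simp add: h_def)
  show "h x <= 1" for x using f01 by (auto simp: h_def)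
  show "h x = 1" if "x : K" for x using f(3) Kt that by (auto simp: h_def)
  show "compactin X D" by (rule Dc)
  show "D <= U" using DWU by blast
  show "h x = 0" if "x ~: D" for x using that by (auto simp: h_def D_def)
 qed
qed

lemma has_sum_sum_family:
 fixes f :: "'i => 'a => 'b::topological_comm_monoid_add"
 assumes "finite I" "!!i. i : I ==> (f i has_sum s i) A"
 shows "((%x. \<Sum>i\<in>I. f i x) has_sum (\<Sum>i\<in>I. s i)) A"
 using assms by (induction I) (auto intro: has_sum_add)

definition chart :: "('v, 'e) tgraph => 'e set => bool" where
 "chart E U \<longleftrightarrow> openin (edges E) U & openin (verts E) (dmap E ` U) &
   homeomorphic_map (subtopology (edges E) U) (subtopology (verts E) (dmap E ` U)) (dmap E)"

abbreviation fib :: "('v, 'e) tgraph => 'v => 'e set" where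
 "fib E v == {e : eds E. dmap E e = v}"

locale tgr =
 fixes E :: "('v, 'e) tgraph"
 assumes tg: "topological_graph E"
begin

lemma verts_LCH: "locally_compact_space (verts E)" "Hausdorff_space (verts E)"
 and edges_LCH: "locally_compact_space (edges E)" "Hausdorff_space (edges E)"
 and r_cont: "continuous_map (edges E) (verts E) (rmap E)"
 and d_lh: "local_homeomorphism (edges E) (verts E) (dmap E)"
 using tg by (auto simp: topological_graph_def)

lemma d_in: "e : eds E ==> dmap E e : vts E"
 and r_in: "e : eds E ==> rmap E e : vts E"
 using d_lh r_cont by (auto simp: local_homeomorphism_def continuous_map_def)

lemma chart_exists: assumes "e : eds E" obtains U where "chart E U" "e : U"
 using d_lh assms unfolding local_homeomorphism_def chart_def by meson

lemma chart_inj: assumes "chart E U" shows "inj_on (dmap E) U"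
proof -
 have "topspace (subtopology (edges E) U) = U" using assms openin_subset by (fastforce simp: chart_def)
 then show ?thesis using assms unfolding chart_def by (metis homeomorphic_imp_injective_map)
qed

lemma d_cont: "continuous_map (edges E) (verts E) (dmap E)"
 unfolding continuous_map_eq_topcontinuous_at
proof
 fix e assume "e : eds E"
 then obtain U where U: "chart E U" "e : U" by (rule chart_exists)
 show "topcontinuous_at (edges E) (verts E) (dmap E) e"
  unfolding topcontinuous_at_def
 proof (intro conjI allI impI)
  show "e : eds E" by fact
  show "dmap E : eds E \<rightarrow> vts E" using d_in by blast
  fix V assume V: "openin (verts E) V & dmap E e : V"
  have op: "openin (edges E) U" and c: "continuous_map (subtopology (edges E) U) (subtopology (verts E) (dmap E ` U)) (dmap E)"
   using U by (auto simp: chart_def homeomorphic_eq_everything_map)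
  from c have "continuous_map (subtopology (edges E) U) (verts E) (dmap E)" by (simp add: continuous_map_in_subtopology)
  then have "openin (subtopology (edges E) U) {x : topspace (subtopology (edges E) U). dmap E x : V}"
   using V openin_continuous_map_preimage by blast
  then have "openin (edges E) {x : topspace (subtopology (edges E) U). dmap E x : V}"
   using op openin_open_subtopology by blast
  then show "EX W. openin (edges E) W & e : W & (ALL y:W. dmap E y : V)"
   using U V \<open>e : eds E\<close> by (intro exI[of _ "{x : topspace (subtopology (edges E) U). dmap E x : V}"]) auto
 qed
qed

lemma fib_empty: "v ~: vts E ==> fib E v = {}"
 using d_in by blast

text \<open>\<open>cd_inner E xi eta\<close> is \<open>fsum\<close> of the pointwise product of
  \<open>cnj xi\<close> and \<open>eta\<close>, so continuity of inner products is continuity of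
  fibre sums.\<close>

definition fsum :: "('e => complex) => 'v => complex" where
 "fsum g v = infsum g (fib E v)"

lemma fsum_off: "v ~: vts E ==> fsum g v = 0"
 by (simp add: fsum_def fib_empty)

text \<open>A chart meets each fibre of \<open>d\<close> in at most one edge.\<close>

lemma small_support:
 assumes U: "chart E U" and g: "!!e. e ~: U ==> g e = 0"
 shows "finite {e : fib E v. g e ~= (0::'b::zero)}" and "e : U ==> e' : fib E (dmap E e) ==> e' ~= e ==> g e' = 0"
proof -
 show "e : U ==> e' : fib E (dmap E e) ==> e' ~= e ==> g e' = 0"
  using chart_inj[OF U] g unfolding inj_on_def by blast
 have "{e : fib E v. g e ~= 0} <= {the_inv_into U (dmap E) v}"
 proof
  fix e assume e: "e : {e : fib E v. g e ~= 0}"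
  then have "e : U" "dmap E e = v" using g by auto
  then show "e : {the_inv_into U (dmap E) v}" using the_inv_into_f_f[OF chart_inj[OF U]] by auto
 qed
 then show "finite {e : fib E v. g e ~= 0}" using finite_subset by blast
qed

text \<open>On the open set \<open>dmap E\<close>
  U\<open>the fibre sum is\<close>g\<open>composed with the inverse of the chart; off the closed set\<close>dmap
  E \<open>D\<close> it is 0. Both descriptions agree on the overlap and paste together.\<close>

lemma fsum_small:
 assumes U: "chart E U" and D: "compactin (edges E) D" "D <= U" and g: "continuous_map (edges E) euclidean g"
  and off: "!!e. e ~: D ==> g e = 0"
 shows "continuous_map (verts E) euclidean (fsum g)"
proof -
 have offU: "g e = 0" if "e ~: U" for e using that D off by blast
 have oU: "openin (edges E) U" and odU: "openin (verts E) (dmap E ` U)" using U by (auto simp: chart_def)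
 have Ut: "U <= eds E" using oU openin_subset by blast
 obtain j where j: "homeomorphic_maps (subtopology (edges E) U) (subtopology (verts E) (dmap E ` U)) (dmap E) j"
  using U unfolding chart_def homeomorphic_map_maps by blast
 have jc: "continuous_map (subtopology (verts E) (dmap E ` U)) (subtopology (edges E) U) j"
  and ji: "!!e. e : U ==> j (dmap E e) = e"
  using j Ut by (auto simp: homeomorphic_maps_def)
 have val: "fsum g (dmap E e) = g e" if e: "e : U" for e
 proof -
  have "fsum g (dmap E e) = infsum g {e}" unfolding fsum_def
   by (rule infsum_cong_neutral) (use e Ut small_support(2)[of U g, OF U offU e] in auto)
  then show ?thesis by simp
 qed
 have dD: "compactin (verts E) (dmap E ` D)" using image_compactin[OF D(1) d_cont] .
 then have cdD: "closedin (verts E) (dmap E ` D)" using compactin_imp_closedin[OF verts_LCH(2)] by blast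
 have zero: "fsum g v = 0" if "v ~: dmap E ` D" for v
  unfolding fsum_def using that off by (intro infsum_0) auto
 let ?T = "%b. if b then dmap E ` U else vts E - dmap E ` D"
 let ?f = "%b v. if b then g (j v) else 0"
 show ?thesis
 proof (rule pasting_lemma[of UNIV "verts E" ?T euclidean ?f])
  show "openin (verts E) (?T b)" for b using odU cdD by auto
  show "continuous_map (subtopology (verts E) (?T b)) euclidean (?f b)" for b
   using continuous_map_compose[OF jc continuous_map_from_subtopology[OF g]] by (cases b) (auto simp: o_def)
  show "?f i x = ?f k x" if "x : vts E Int ?T i Int ?T k" for i k x
  proof -
   have "g (j x) = 0" if x: "x : dmap E ` U" "x ~: dmap E ` D"
   proof -
    obtain e where e: "e : U" "x = dmap E e" using x by blast
    then have "e ~: D" using x by blast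
    then show ?thesis using e ji off by simp
   qed
   then show ?thesis using that by (auto split: if_splits)
  qed
  show "EX b. b : UNIV & x : ?T b & fsum g x = ?f b x" if x: "x : vts E" for x
  proof (cases "x : dmap E ` D")
   case True
   then obtain e where e: "e : D" "x = dmap E e" by blast
   then have "e : U" using D by blast
   then show ?thesis using e val ji by (intro exI[of _ True]) auto
  next
   case False then show ?thesis using x zero by (intro exI[of _ False]) auto
  qed
 qed
qed

text \<open>Subordinate to charts, so that functions with compact support split into pieces whose
  fibre sums have at most one term, and so that two distinct edges of a fibre are never in the
  support of the same piece.\<close>

lemma partition_of_unity:
 assumes C: "compactin (edges E) C"
 obtains I :: "'e set" and k :: "'e => 'e => real" and U D where "finite I"
  "!!i. i : I ==> continuous_map (edges E) euclideanreal (k i)" "!!i e. i : I ==> 0 <= k i e"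
  "!!i. i : I ==> chart E (U i)" "!!i. i : I ==> compactin (edges E) (D i)" "!!i. i : I ==> D i <= U i"
  "!!i e. i : I ==> e ~: D i ==> k i e = 0" "!!e. e : C ==> (\<Sum>i\<in>I. k i e) = 1"
proof -
 have Ct: "C <= eds E" using C compactin_subset_topspace by blast
 have "EX U D h. chart E U & compactin (edges E) D & D <= U & continuous_map (edges E) euclideanreal h & (ALL x. 0 <= h x) &
   h c = 1 & (ALL x. x ~: D --> h x = (0::real))" if c: "c : C" for c
 proof -
  obtain U where U: "chart E U" "c : U" using chart_exists[of c] c Ct by blast
  have "compactin (edges E) {c}" using c Ct by (auto simp: compactin_sing)
  then obtain h D where "continuous_map (edges E) euclideanreal h" "!!x. 0 <= h x" "!!x. h x <= 1"
   "!!x. x : {c} ==> h x = 1" "compactin (edges E) D" "D <= U" "!!x. x ~: D ==> h x = (0::real)"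
   using LCH_bump[OF edges_LCH, of "{c}" U] U by (auto simp: chart_def)
  then show ?thesis using U by blast
 qed
 then obtain U D h where H: "!!c. c : C ==> chart E (U c) & compactin (edges E) (D c) & D c <= U c &
   continuous_map (edges E) euclideanreal (h c) & (ALL x. 0 <= h c x) & h c c = 1 & (ALL x. x ~: D c --> h c x = (0::real))"
  by metis
 let ?O = "%c. {x : eds E. h c x : {1/2<..}}"
 have 1: "openin (edges E) (?O c)" if "c : C" for c
 proof -
  have "continuous_map (edges E) euclideanreal (h c)" using H[OF that] by blast
  from openin_continuous_map_preimage[OF this, of "{1/2<..}"] show ?thesis by simp
 qed
 have 2: "C <= (\<Union>c\<in>C. ?O c)"
 proof
  fix c assume c: "c : C"
  have "h c c = 1" using H[OF c] by blast
  then show "c : (\<Union>c\<in>C. ?O c)" using c Ct by (intro UN_I[OF c]) auto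
 qed
 obtain I where I: "finite I" "I <= C" "C <= (\<Union>c\<in>I. ?O c)"
  by (rule compactin_indexed_cover[OF C 1 2])
 \<comment> \<open>The lower bound 1/2 makes \<open>s\<close> nowhere zero and changes nothing on
   \<open>C\<close>, where some \<open>h i\<close> already exceeds 1/2.\<close>
 define s where "s e = max (1/2) (\<Sum>i\<in>I. h i e)" for e
 define k where "k i e = h i e / s e" for i e
 have spos: "s e > 0" for e unfolding s_def by linarith
 show thesis
 proof (rule that[OF I(1), where k = k and U = U and D = D])
  fix i assume i: "i : I"
  then have iC: "i : C" using I by blast
  have "continuous_map (edges E) euclideanreal (%e. h i e / s e)"
   unfolding s_def
  proof (intro continuous_map_real_divide continuous_map_real_max continuous_map_sum)
   show "max (1/2) (\<Sum>i\<in>I. h i e) ~= 0" for e using spos[of e] unfolding s_def by linarith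
  qed (use H iC I in auto)
  then show "continuous_map (edges E) euclideanreal (k i)" by (simp add: k_def[abs_def])
  show "0 <= k i e" for e using H[OF iC] spos[of e] by (simp add: k_def)
  show "chart E (U i)" "compactin (edges E) (D i)" "D i <= U i" using H[OF iC] by auto
  show "k i e = 0" if "e ~: D i" for e using H[OF iC] that by (simp add: k_def)
 next
  fix e assume e: "e : C"
  then obtain i where i: "i : I" "h i e > 1/2" using I by auto
  have "h i e <= (\<Sum>i\<in>I. h i e)" using i I H by (intro member_le_sum) auto
  then have "s e = (\<Sum>i\<in>I. h i e)" using i by (simp add: s_def)
  then show "(\<Sum>i\<in>I. k i e) = 1" using spos[of e] by (simp add: k_def sum_divide_distrib[symmetric])
 qed
qed

text \<open>The partition of unity writes \<open>g\<close> as a finite sum of functions supported in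
  charts, where \<open>fsum_small\<close> applies.\<close>

lemma fsum_Cc:
 assumes C: "compactin (edges E) C" and g: "continuous_map (edges E) euclidean g" and off: "!!e. e ~: C ==> g e = 0"
 shows "finite {e : fib E v. g e ~= 0}" and "g summable_on fib E v" and "fsum g : C0c (verts E)"
proof -
 obtain I :: "'e set" and k and U D where k: "finite I"
  "!!i. i : I ==> continuous_map (edges E) euclideanreal (k i)" "!!i e. i : I ==> 0 <= k i e"
  "!!i. i : I ==> chart E (U i)" "!!i. i : I ==> compactin (edges E) (D i)" "!!i. i : I ==> D i <= U i"
  "!!i e. i : I ==> e ~: D i ==> k i e = 0" "!!e. e : C ==> (\<Sum>i\<in>I. k i e) = 1"
  by (rule partition_of_unity[OF C], rule that, assumption+)
 let ?g = "%i e. complex_of_real (k i e) * g e"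
 have gsum: "g e = (\<Sum>i\<in>I. ?g i e)" for e
 proof (cases "e : C")
  case True
  have "(\<Sum>i\<in>I. ?g i e) = complex_of_real (\<Sum>i\<in>I. k i e) * g e" by (simp add: sum_distrib_right)
  then show ?thesis using k(8)[OF True] by simp
 qed (simp add: off)
 have goff: "?g i e = 0" if "i : I" "e ~: U i" for i e using k(6,7) that by auto
 have fin: "finite {e : fib E v. ?g i e ~= 0}" if i: "i : I" for i v
  by (rule small_support(1)[OF k(4)[OF i]]) (use goff i in blast)
 have "{e : fib E v. g e ~= 0} <= (\<Union>i\<in>I. {e : fib E v. ?g i e ~= 0})" for v
 proof
  fix e assume e: "e : {e : fib E v. g e ~= 0}"
  then obtain i where "i : I" "?g i e ~= 0" using gsum[of e] sum.neutral[of I "%i. ?g i e"] by fastforce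
  then show "e : (\<Union>i\<in>I. {e : fib E v. ?g i e ~= 0})" using e by blast
 qed
 then show fing: "finite {e : fib E v. g e ~= 0}" for v using k(1) fin finite_subset by (metis (no_types, lifting) finite_UN)
 then show "g summable_on fib E v" by (rule finite_nonzero_values_imp_summable_on)
 have has: "(?g i has_sum fsum (?g i) v) (fib E v)" if "i : I" for i v
  unfolding fsum_def using finite_nonzero_values_imp_summable_on[OF fin[OF that]] by (rule has_sum_infsum)
 have "((%e. \<Sum>i\<in>I. ?g i e) has_sum (\<Sum>i\<in>I. fsum (?g i) v)) (fib E v)" for v
  using has by (rule has_sum_sum_family[OF k(1)])
 then have eq: "fsum g v = (\<Sum>i\<in>I. fsum (?g i) v)" for v
  unfolding fsum_def using gsum infsumI by (metis (no_types, lifting) ext)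
 have "continuous_map (verts E) euclidean (fsum (?g i))" if i: "i : I" for i
  by (rule fsum_small[OF k(4,5,6)[OF i]]) (use k i in \<open>auto intro!: cont_mult cont_of_real g\<close>)
 then have "continuous_map (verts E) euclidean (%v. \<Sum>i\<in>I. fsum (?g i) v)"
  using k(1) by (intro continuous_map_sum) auto
 then have cont: "continuous_map (verts E) euclidean (fsum g)" by (simp add: eq[abs_def])
 show "fsum g : C0c (verts E)"
 proof (rule C0_I[OF cont fsum_off])
  fix eps :: real assume e: "eps > 0"
  have "v : dmap E ` C" if "eps <= cmod (fsum g v)" for v
  proof (rule ccontr)
   assume "v ~: dmap E ` C"
   then have "fsum g v = 0" unfolding fsum_def using off by (intro infsum_0) auto
   then show False using that e by simp
  qed
  then show "EX K. compactin (verts E) K & (ALL v:vts E. eps <= cmod (fsum g v) --> v : K)"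
   using image_compactin[OF C d_cont] by blast
 qed
qed

end

section \<open>The Hilbert module of a topological graph\<close>

definition sqn :: "('v, 'e) tgraph => ('e => complex) => 'v => real" where
 "sqn E xi v = infsum (%e. (cmod (xi e))^2) (fib E v)"

lemma sqn_nonneg [simp]: "0 <= sqn E xi v"
 unfolding sqn_def by (rule infsum_nonneg) auto

lemma cd_inner_fsum: "cd_inner E xi eta v = infsum (%e. cnj (xi e) * eta e) (fib E v)"
 by (simp add: cd_inner_def)

lemma cnj_mult_self: "cnj z * z = complex_of_real ((cmod z)^2)"
 by (metis complex_norm_square mult.commute)

lemma infsum_of_real_complex: "infsum (%x. complex_of_real (f x)) A = complex_of_real (infsum f A)"
proof (cases "f summable_on A")
 case True
 then have "((%x. complex_of_real (f x)) has_sum complex_of_real (infsum f A)) A"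
  unfolding has_sum_of_real_iff by (rule has_sum_infsum)
 then show ?thesis by (rule infsumI)
next
 \<comment> \<open>An unsummable family has sum 0 by convention on both sides; complex summability
   would pass to the real parts.\<close>
 case False
 have "~ (%x. complex_of_real (f x)) summable_on A"
  using False summable_on_Re[of "%x. complex_of_real (f x)" A] by auto
 then show ?thesis using False by (simp add: infsum_not_exists)
qed

lemma cd_inner_self: "cd_inner E xi xi v = complex_of_real (sqn E xi v)"
 unfolding cd_inner_fsum sqn_def cnj_mult_self by (rule infsum_of_real_complex)

lemma inner_summable:
 fixes xi eta :: "'e => complex"
 assumes "(%e. (cmod (xi e))^2) summable_on S" "(%e. (cmod (eta e))^2) summable_on S"
  and g: "!!e. e : S ==> cmod (g e) <= M * ((cmod (xi e))^2 + (cmod (eta e))^2)"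
 shows "(%e. cmod (g e)) summable_on S"
 by (rule summable_on_comparison_test[of "%e. M * ((cmod (xi e))^2 + (cmod (eta e))^2)"])
   (use assms in \<open>auto intro!: summable_on_cmult_right summable_on_add\<close>)

lemma mult_le_squares: "x * y <= 1 * (x^2 + y^2)" for x y :: real
proof -
 have "2 * (x * y) <= x^2 + y^2" using sum_squares_bound[of x y] by (simp only: mult.assoc)
 moreover have "0 <= x^2 + y^2" by simp
 ultimately show ?thesis by argo
qed

lemma add_square_le: "cmod (x + y) ^ 2 <= 2 * ((cmod x)^2 + (cmod y)^2)"
proof -
 have "cmod (x + y) ^ 2 <= (cmod x + cmod y)^2" by (intro power_mono norm_triangle_ineq) auto
 also have "... <= 2 * ((cmod x)^2 + (cmod y)^2)"
  using sum_squares_bound[of "cmod x" "cmod y"] by (simp add: power2_sum)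
 finally show ?thesis .
qed

lemma CdD:
 assumes "xi : Cd E"
 shows "continuous_map (edges E) euclidean xi" and "!!e. e ~: eds E ==> xi e = 0"
  and "cd_inner E xi xi : C0c (verts E)"
 using assms by (auto simp: Cd_def)

lemma (in tgr) Cd_summable: "xi : Cd E ==> (%e. (cmod (xi e))^2) summable_on fib E v"
 by (cases "v : vts E") (auto simp: Cd_def fib_empty)

lemma cd_norm_sq: "xi : Cd E ==> (cd_norm E xi)^2 = nm (C0 (verts E)) (cd_inner E xi xi)"
 unfolding cd_norm_def by (intro real_sqrt_pow2 C0_norm_nonneg CdD)

lemma cd_norm_nonneg: "xi : Cd E ==> 0 <= cd_norm E xi"
 unfolding cd_norm_def by (intro real_sqrt_ge_zero C0_norm_nonneg CdD)

lemma sqn_le: assumes "xi : Cd E" shows "sqn E xi v <= (cd_norm E xi)^2"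
 using C0_norm_ge[OF CdD(3)[OF assms], of v] by (simp add: cd_norm_sq[OF assms] cd_inner_self)

lemma cd_norm_le: assumes "0 <= c" "!!v. v : vts E ==> sqn E xi v <= c^2" shows "cd_norm E xi <= c"
 unfolding cd_norm_def using assms by (intro real_le_lsqrt C0_norm_le) (auto simp: cd_inner_self)

context tgr
begin

lemma infsum_le_sqrt_mult:
 assumes "(%e. (cmod (xi e))^2) summable_on fib E v" "(%e. (cmod (eta e))^2) summable_on fib E v"
 shows "cmod (cd_inner E xi eta v) <= sqrt (sqn E xi v) * sqrt (sqn E eta v)"
proof -
 have abs: "(%e. cmod (cnj (xi e) * eta e)) summable_on fib E v"
  by (rule inner_summable[OF assms, of _ 1]) (simp add: norm_mult mult_le_squares[simplified])
 have "cmod (cd_inner E xi eta v) <= infsum (%e. cmod (cnj (xi e) * eta e)) (fib E v)"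
  unfolding cd_inner_fsum by (rule norm_infsum_bound[OF abs])
 also have "... <= sqrt (sqn E xi v) * sqrt (sqn E eta v)"
 proof (rule infsum_le_finite_sums[OF abs])
  fix F assume F: "finite F" "F <= fib E v"
  have "(\<Sum>e\<in>F. cmod (cnj (xi e) * eta e)) <= L2_set (%e. cmod (xi e)) F * L2_set (%e. cmod (eta e)) F"
   using L2_set_mult_ineq[of "%e. cmod (xi e)" "%e. cmod (eta e)" F] by (simp add: norm_mult)
  also have "... <= sqrt (sqn E xi v) * sqrt (sqn E eta v)"
   unfolding L2_set_def sqn_def using F assms
   by (intro mult_mono real_sqrt_le_mono finite_sum_le_infsum) (auto intro!: real_sqrt_ge_zero sum_nonneg infsum_nonneg)
  finally show "(\<Sum>e\<in>F. cmod (cnj (xi e) * eta e)) <= sqrt (sqn E xi v) * sqrt (sqn E eta v)" .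
 qed
 finally show ?thesis .
qed

lemma sqn_add_le:
 assumes "(%e. (cmod (xi e))^2) summable_on fib E v" "(%e. (cmod (eta e))^2) summable_on fib E v"
 shows "sqn E (%e. xi e + eta e) v <= (sqrt (sqn E xi v) + sqrt (sqn E eta v))^2"
 unfolding sqn_def[of E "%e. xi e + eta e"]
proof (rule infsum_le_finite_sums)
 have "(%e. cmod (complex_of_real ((cmod (xi e + eta e))^2))) summable_on fib E v"
 proof (rule inner_summable[OF assms, of _ 2])
  show "cmod (complex_of_real ((cmod (xi e + eta e))^2)) <= 2 * ((cmod (xi e))^2 + (cmod (eta e))^2)" for e
   unfolding norm_of_real abs_power2 by (rule add_square_le)
 qed
 then show "(%e. (cmod (xi e + eta e))^2) summable_on fib E v" unfolding norm_of_real abs_power2 .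
 fix F assume F: "finite F" "F <= fib E v"
 have "(\<Sum>e\<in>F. (cmod (xi e + eta e))^2) = (L2_set (%e. cmod (xi e + eta e)) F)^2"
  unfolding L2_set_def by (simp add: sum_nonneg)
 also have "... <= (L2_set (%e. cmod (xi e) + cmod (eta e)) F)^2"
  by (intro power_mono L2_set_mono) (auto simp: norm_triangle_ineq)
 also have "... <= (L2_set (%e. cmod (xi e)) F + L2_set (%e. cmod (eta e)) F)^2"
  by (intro power_mono L2_set_triangle_ineq) auto
 also have "... <= (sqrt (sqn E xi v) + sqrt (sqn E eta v))^2"
  unfolding L2_set_def sqn_def using F assms
  by (intro power_mono add_mono real_sqrt_le_mono finite_sum_le_infsum) (auto intro!: add_nonneg_nonneg real_sqrt_ge_zero sum_nonneg)
 finally show "(\<Sum>e\<in>F. (cmod (xi e + eta e))^2) <= (sqrt (sqn E xi v) + sqrt (sqn E eta v))^2" .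
qed

text \<open>A Dini argument. At each \<open>v\<close> a finite part of the fibre carries all but
  \<open>eps\<close> of the mass; a bump around it does the same at nearby vertices by continuity.
  Compactness of the level set \<open>K\<close> gives one bump, and off \<open>K\<close> the whole
  mass is small. This reduces questions about \<open>Cd E\<close> to compact supports.\<close>

lemma sqn_tail:
 assumes xi: "xi : Cd E" and e: "eps > 0"
 obtains h :: "'e => real" and D where "continuous_map (edges E) euclideanreal h" "!!e. 0 <= h e" "!!e. h e <= 1"
  "compactin (edges E) D" "!!e. e ~: D ==> h e = 0"
  "!!v. v : vts E ==> infsum (%e. (1 - h e) * (cmod (xi e))^2) (fib E v) <= eps"
proof -
 define K where "K = {v : vts E. eps <= cmod (cd_inner E xi xi v)}"
 have K: "compactin (verts E) K" unfolding K_def by (rule C0_level[OF CdD(3)[OF xi] e])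
 have summ: "(%e. (cmod (xi e))^2) summable_on fib E v" for v using Cd_summable[OF xi] .
 have summh: "(%e. f e * (cmod (xi e))^2) summable_on fib E v" if "!!e. 0 <= f e" "!!e. f e <= 1" for f :: "'e => real" and v
  by (rule summable_on_comparison_test[OF summ]) (use that in \<open>auto intro: mult_left_le_one_le\<close>)
 define good where "good v h D W \<longleftrightarrow> continuous_map (edges E) euclideanreal h & (ALL e. 0 <= h e) & (ALL e. h e <= 1) & compactin (edges E) D &
   (ALL e. e ~: D --> h e = (0::real)) & openin (verts E) W & v : W &
   (ALL w:W. infsum (%e. (1 - h e) * (cmod (xi e))^2) (fib E w) < eps)" for v h D W
 have ex: "EX h D W. good v h D W" if v: "v : K" for v
 proof -
  have vt: "v : vts E" using v by (simp add: K_def)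
  have "eventually (%F. sqn E xi v - eps < (\<Sum>e\<in>F. (cmod (xi e))^2)) (finite_subsets_at_top (fib E v))"
   using has_sum_infsum[OF summ[of v]] e unfolding has_sum_def sqn_def
   by (intro order_tendstoD(1)) auto
  then obtain F where F: "finite F" "F <= fib E v" "sqn E xi v - eps < (\<Sum>e\<in>F. (cmod (xi e))^2)"
   unfolding eventually_finite_subsets_at_top by blast
  have "compactin (edges E) F" using F by (intro finite_imp_compactin) auto
  then obtain h D where h: "continuous_map (edges E) euclideanreal h" "!!x. 0 <= h x" "!!x. h x <= 1"
   "!!x. x : F ==> h x = 1" "compactin (edges E) D" "!!x. x ~: D ==> h x = (0::real)"
   using LCH_bump[OF edges_LCH, of F "eds E"] F by (metis (no_types, lifting) compactin_subset_topspace openin_topspace)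
  let ?g = "%e. complex_of_real (h e * (cmod (xi e))^2)"
  have "fsum ?g : C0c (verts E)"
  proof (rule fsum_Cc(3)[OF h(5)])
   show "continuous_map (edges E) euclidean ?g"
    by (intro cont_of_real continuous_map_real_mult continuous_map_real_pow cont_cmod h CdD[OF xi])
  qed (simp add: h)
  then have "continuous_map (verts E) euclideanreal (%w. Re (cd_inner E xi xi w) - Re (fsum ?g w))"
   by (intro continuous_map_diff cont_Re C0_cont CdD(3)[OF xi])
  \<comment> \<open>The remaining mass is the inner product minus a fibre sum with compact support,
    hence continuous in the vertex.\<close>
  moreover have eq: "Re (cd_inner E xi xi w) - Re (fsum ?g w) = infsum (%e. (1 - h e) * (cmod (xi e))^2) (fib E w)" for w
  proof -
   have "infsum (%e. (1 - h e) * (cmod (xi e))^2 + h e * (cmod (xi e))^2) (fib E w) =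
    infsum (%e. (1 - h e) * (cmod (xi e))^2) (fib E w) + infsum (%e. h e * (cmod (xi e))^2) (fib E w)"
    by (intro infsum_add summh) (use h in auto)
   moreover have "fsum ?g w = complex_of_real (infsum (%e. h e * (cmod (xi e))^2) (fib E w))"
    unfolding fsum_def by (rule infsum_of_real_complex)
   ultimately show ?thesis by (simp add: cd_inner_self sqn_def algebra_simps)
  qed
  ultimately have c: "continuous_map (verts E) euclideanreal (%w. infsum (%e. (1 - h e) * (cmod (xi e))^2) (fib E w))" by simp
  let ?W = "{w : vts E. infsum (%e. (1 - h e) * (cmod (xi e))^2) (fib E w) : {..<eps}}"
  have W: "openin (verts E) ?W" using openin_continuous_map_preimage[OF c, of "{..<eps}"] by simp
  have "infsum (%e. (1 - h e) * (cmod (xi e))^2) (fib E v) <= infsum (%e. (cmod (xi e))^2) (fib E v - F)"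
  proof (rule infsum_mono_neutral)
   show "(%e. (1 - h e) * (cmod (xi e))^2) summable_on fib E v" by (intro summh) (use h in auto)
   show "(%e. (cmod (xi e))^2) summable_on fib E v - F" by (rule summable_on_subset_banach[OF summ[of v]]) auto
  qed (use h in \<open>auto intro: mult_left_le_one_le\<close>)
  also have "... = sqn E xi v - (\<Sum>e\<in>F. (cmod (xi e))^2)"
   unfolding sqn_def using infsum_Diff[OF summ[of v] _ F(2)] F(1) by simp
  also have "... < eps" using F by simp
  finally have "v : ?W" using vt by simp
  then have "good v h D ?W" using h W by (simp add: good_def)
  then show ?thesis by blast
 qed
 then obtain h D W where "!!v. v : K ==> good v (h v) (D v) (W v)" by metis
 then have H: "!!v. v : K ==> continuous_map (edges E) euclideanreal (h v) & (ALL e. 0 <= h v e) & (ALL e. h v e <= 1) & compactin (edges E) (D v) &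
   (ALL e. e ~: D v --> h v e = (0::real)) & openin (verts E) (W v) & v : W v & (ALL w:W v. infsum (%e. (1 - h v e) * (cmod (xi e))^2) (fib E w) < eps)"
  unfolding good_def by blast
 have 1: "openin (verts E) (W v)" if "v : K" for v using H[OF that] by blast
 have 2: "K <= (\<Union>v\<in>K. W v)" using H by blast
 obtain I where I: "finite I" "I <= K" "K <= (\<Union>v\<in>I. W v)"
  by (rule compactin_indexed_cover[OF K 1 2])
 \<comment> \<open>\<open>1 - k\<close> is the product of the factors \<open>1 - h v\<close>, thus
   below each of them, while \<open>k\<close> still vanishes off the union of the supports.\<close>
 define k where "k e = 1 - (\<Prod>v\<in>I. 1 - h v e)" for e
 have p01: "0 <= (\<Prod>v\<in>I. 1 - h v e)" "(\<Prod>v\<in>I. 1 - h v e) <= 1" for e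
  using H I by (auto intro!: prod_nonneg prod_le_1)
 have ple: "(\<Prod>v\<in>I. 1 - h v e) <= 1 - h u e" if "u : I" for u e
 proof -
  have "(\<Prod>v\<in>I. 1 - h v e) = (1 - h u e) * (\<Prod>v\<in>I - {u}. 1 - h v e)" using I(1) that by (simp add: prod.remove)
  also have "... <= (1 - h u e) * 1" using H I that by (intro mult_left_mono prod_le_1) auto
  finally show ?thesis by simp
 qed
 show thesis
 proof (rule that[of k "\<Union>v\<in>I. D v"])
  show "continuous_map (edges E) euclideanreal k" unfolding k_def[abs_def]
   using H I by (intro continuous_map_diff continuous_map_prod) auto
  show "0 <= k e" "k e <= 1" for e using p01[of e] by (simp_all add: k_def)
  show "compactin (edges E) (\<Union>v\<in>I. D v)" using H I by (intro compactin_Union) auto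
  show "k e = 0" if "e ~: (\<Union>v\<in>I. D v)" for e
  proof -
   have "(\<Prod>v\<in>I. 1 - h v e) = (\<Prod>v\<in>I. 1)" using H I that by (intro prod.cong) auto
   then show ?thesis by (simp add: k_def)
  qed
  fix w assume w: "w : vts E"
  have s1: "(%e. (1 - k e) * (cmod (xi e))^2) summable_on fib E w" by (intro summh) (use p01 in \<open>auto simp: k_def\<close>)
  show "infsum (%e. (1 - k e) * (cmod (xi e))^2) (fib E w) <= eps"
  proof (cases "w : K")
   case True
   then obtain u where u: "u : I" "w : W u" using I by blast
   then have uK: "u : K" using I by blast
   have "infsum (%e. (1 - k e) * (cmod (xi e))^2) (fib E w) <= infsum (%e. (1 - h u e) * (cmod (xi e))^2) (fib E w)"
    by (rule infsum_mono[OF s1 summh]) (use H[OF uK] ple[OF u(1)] in \<open>auto simp: k_def intro: mult_right_mono\<close>)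
   then show ?thesis using H[OF uK] u by fastforce
  next
   case False
   have "infsum (%e. (1 - k e) * (cmod (xi e))^2) (fib E w) <= sqn E xi w" unfolding sqn_def
    by (rule infsum_mono[OF s1 summ]) (use p01 in \<open>auto simp: k_def intro: mult_left_le_one_le\<close>)
   then show ?thesis using False w by (simp add: K_def cd_inner_self)
  qed
 qed
qed

text \<open>After truncation \<open>fsum\<close> is covered by \<open>fsum_Cc\<close>, and by the
  domination the error is at most \<open>M'\<close> times the two tails of \<open>sqn_tail\<close>.
  So the fibre sum is a uniform limit.\<close>

lemma fsum_dominated:
 assumes xi: "xi : Cd E" and eta: "eta : Cd E" and g: "continuous_map (edges E) euclidean g"
  and off: "!!e. e ~: eds E ==> g e = 0"
  and le: "!!e. cmod (g e) <= M * ((cmod (xi e))^2 + (cmod (eta e))^2)"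
 shows "(%e. cmod (g e)) summable_on fib E v" and "fsum g : C0c (verts E)"
proof -
 have abs: "(%e. cmod (g e)) summable_on fib E v" for v by (rule inner_summable[OF Cd_summable[OF xi] Cd_summable[OF eta] le])
 then show "(%e. cmod (g e)) summable_on fib E v" .
 \<comment> \<open>A strictly positive majorant of \<open>M\<close>, since the tolerance is going to
   be divided by it.\<close>
 define M' where "M' = \<bar>M\<bar> + 1"
 have M': "M' > 0" "!!e. cmod (g e) <= M' * ((cmod (xi e))^2 + (cmod (eta e))^2)"
 proof -
  show "M' > 0" by (simp add: M'_def add_nonneg_pos)
  show "cmod (g e) <= M' * ((cmod (xi e))^2 + (cmod (eta e))^2)" for e
   by (rule order_trans[OF le]) (auto simp: M'_def intro!: mult_right_mono)
 qed
 show "fsum g : C0c (verts E)"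
 proof (rule C0_uniform_limit[OF fsum_off])
  fix eps :: real assume e: "eps > 0"
  have d: "eps / (2 * M') > 0" using e M' by simp
  obtain h D where h: "continuous_map (edges E) euclideanreal h" "!!e. 0 <= h e" "!!e. h e <= 1"
   "compactin (edges E) D" "!!e. e ~: D ==> h e = (0::real)"
   "!!v. v : vts E ==> infsum (%e. (1 - h e) * (cmod (xi e))^2) (fib E v) <= eps / (2 * M')"
   by (rule sqn_tail[OF xi d], rule that, assumption+)
  obtain k C where k: "continuous_map (edges E) euclideanreal k" "!!e. 0 <= k e" "!!e. k e <= 1"
   "compactin (edges E) C" "!!e. e ~: C ==> k e = (0::real)"
   "!!v. v : vts E ==> infsum (%e. (1 - k e) * (cmod (eta e))^2) (fib E v) <= eps / (2 * M')"
   by (rule sqn_tail[OF eta d], rule that, assumption+)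
  \<comment> \<open>Chosen so that \<open>1 - p\<close> is below both \<open>1 - h\<close> and
    \<open>1 - k\<close>: the truncation controls the tails of \<open>xi\<close> and
    \<open>eta\<close> at once.\<close>
  define p where "p e = 1 - (1 - h e) * (1 - k e)" for e
  have p: "0 <= p e" "p e <= 1" "1 - p e <= 1 - h e" "1 - p e <= 1 - k e" for e
   using h(2,3)[of e] k(2,3)[of e] mult_nonneg_nonneg[of "1 - h e" "1 - k e"] mult_le_one[of "1 - h e" "1 - k e"]
    mult_left_le[of "1 - k e" "1 - h e"] mult_left_le[of "1 - h e" "1 - k e"]
   by (auto simp: p_def mult.commute)
  let ?g = "%e. complex_of_real (p e) * g e"
  have "fsum ?g : C0c (verts E)"
  proof (rule fsum_Cc(3)[OF compactin_Un[OF h(4) k(4)]])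
   show "continuous_map (edges E) euclidean ?g" unfolding p_def
    by (intro cont_mult cont_of_real g continuous_map_diff continuous_map_real_mult h k) auto
  qed (simp add: p_def h k)
  moreover have "cmod (fsum ?g v - fsum g v) <= eps" if v: "v : vts E" for v
  proof -
   have sh: "(%e. f e * (cmod (zeta e))^2) summable_on fib E v" if "!!e. 0 <= f e" "!!e. f e <= 1" "zeta : Cd E" for f :: "'e => real" and zeta
    by (rule summable_on_comparison_test[OF Cd_summable[OF that(3)]]) (use that in \<open>auto intro: mult_left_le_one_le\<close>)
   have a1: "(%e. cmod (?g e)) summable_on fib E v"
    by (rule summable_on_comparison_test[OF abs]) (use p in \<open>auto simp: norm_mult intro: mult_left_le_one_le\<close>)
   have a2: "(%e. cmod (complex_of_real (1 - p e) * g e)) summable_on fib E v"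
    by (rule summable_on_comparison_test[OF abs]) (use p in \<open>auto simp: norm_mult norm_of_real[of "1 - _", simplified] intro!: mult_left_le_one_le simp del: of_real_diff\<close>)
   have "fsum g v = infsum (%e. ?g e + complex_of_real (1 - p e) * g e) (fib E v)"
    unfolding fsum_def by (rule infsum_cong) (simp add: algebra_simps)
   also have "... = fsum ?g v + infsum (%e. complex_of_real (1 - p e) * g e) (fib E v)"
    unfolding fsum_def by (rule infsum_add[OF abs_summable_summable[OF a1] abs_summable_summable[OF a2]])
   finally have "cmod (fsum ?g v - fsum g v) = cmod (infsum (%e. complex_of_real (1 - p e) * g e) (fib E v))"
    by (simp add: norm_minus_commute)
   also have "... <= infsum (%e. cmod (complex_of_real (1 - p e) * g e)) (fib E v)" by (rule norm_infsum_bound[OF a2])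
   also have "... <= infsum (%e. M' * ((1 - h e) * (cmod (xi e))^2 + (1 - k e) * (cmod (eta e))^2)) (fib E v)"
   proof (rule infsum_mono[OF a2])
    show "(%e. M' * ((1 - h e) * (cmod (xi e))^2 + (1 - k e) * (cmod (eta e))^2)) summable_on fib E v"
     by (intro summable_on_cmult_right summable_on_add sh xi eta) (use h k in auto)
    fix e
    have "cmod (complex_of_real (1 - p e) * g e) = (1 - p e) * cmod (g e)" unfolding norm_mult norm_of_real using p[of e] by simp
    also have "... <= (1 - p e) * (M' * ((cmod (xi e))^2 + (cmod (eta e))^2))" using p[of e] M' by (intro mult_left_mono) auto
    also have "... = M' * ((1 - p e) * (cmod (xi e))^2 + (1 - p e) * (cmod (eta e))^2)" by (simp add: algebra_simps)
    also have "... <= M' * ((1 - h e) * (cmod (xi e))^2 + (1 - k e) * (cmod (eta e))^2)"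
     using p[of e] M' by (intro mult_left_mono add_mono mult_right_mono) auto
    finally show "cmod (complex_of_real (1 - p e) * g e) <= M' * ((1 - h e) * (cmod (xi e))^2 + (1 - k e) * (cmod (eta e))^2)" .
   qed
   also have "... = M' * (infsum (%e. (1 - h e) * (cmod (xi e))^2) (fib E v) + infsum (%e. (1 - k e) * (cmod (eta e))^2) (fib E v))"
   proof -
    have s: "(%e. (1 - h e) * (cmod (xi e))^2) summable_on fib E v" "(%e. (1 - k e) * (cmod (eta e))^2) summable_on fib E v"
     by (intro sh xi eta; use h k in auto)+
    show ?thesis using s by (simp add: infsum_cmult_right summable_on_add infsum_add)
   qed
   also have "... <= M' * (eps / (2 * M') + eps / (2 * M'))" using h(6)[OF v] k(6)[OF v] M' by (intro mult_left_mono add_mono) auto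
   also have "... = eps" using M' by (simp add: field_simps)
   finally show ?thesis .
  qed
  ultimately show "EX f:C0c (verts E). ALL v:vts E. cmod (f v - fsum g v) <= eps" by blast
 qed
qed

text \<open>Closure of \<open>Cd E\<close> under sums and under multiplication by bounded continuous
  functions are instances of this criterion.\<close>

lemma Cd_dominated:
 assumes xi: "xi : Cd E" and eta: "eta : Cd E" and g: "continuous_map (edges E) euclidean g"
  and off: "!!e. e ~: eds E ==> g e = 0"
  and le: "!!e. (cmod (g e))^2 <= M * ((cmod (xi e))^2 + (cmod (eta e))^2)"
 shows "g : Cd E"
proof -
 let ?g = "%e. cnj (g e) * g e"
 have n: "cmod (?g e) = (cmod (g e))^2" for e by (simp add: norm_mult power2_eq_square)
 have c: "continuous_map (edges E) euclidean ?g" by (intro cont_mult cont_cnj g)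
 have a: "(%e. cmod (?g e)) summable_on fib E v" "fsum ?g : C0c (verts E)" for v
  using fsum_dominated(1)[OF xi eta c, of M v] fsum_dominated(2)[OF xi eta c, of M] off le n by auto
 have "cd_inner E g g = fsum ?g" by (simp add: fun_eq_iff cd_inner_fsum fsum_def)
 then show ?thesis using a g off by (auto simp: Cd_def n)
qed

lemma Cd_inner: assumes "xi : Cd E" "eta : Cd E" shows "cd_inner E xi eta : C0c (verts E)"
 and "(%e. cnj (xi e) * eta e) summable_on fib E v"
proof -
 let ?g = "%e. cnj (xi e) * eta e"
 have c: "continuous_map (edges E) euclidean ?g" by (intro cont_mult cont_cnj CdD assms)
 have a: "(%e. cmod (?g e)) summable_on fib E v" "fsum ?g : C0c (verts E)"
  using fsum_dominated(1)[OF assms c, of 1 v] fsum_dominated(2)[OF assms c, of 1] CdD(2)[OF assms(1)] mult_le_squares by (auto simp: norm_mult)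
 have "cd_inner E xi eta = fsum ?g" by (simp add: fun_eq_iff cd_inner_fsum fsum_def)
 then show "cd_inner E xi eta : C0c (verts E)" using a by simp
 show "(%e. cnj (xi e) * eta e) summable_on fib E v" using a(1) by (rule abs_summable_summable)
qed

lemma Cd_Cc:
 assumes C: "compactin (edges E) C" and g: "continuous_map (edges E) euclidean g" and off: "!!e. e ~: C ==> g e = 0"
 shows "g : Cd E"
proof -
 let ?g = "%e. cnj (g e) * g e"
 have n: "?g e = complex_of_real ((cmod (g e))^2)" for e by (rule cnj_mult_self)
 have c: "continuous_map (edges E) euclidean ?g" by (intro cont_mult cont_cnj g)
 have fin: "finite {e : fib E v. ?g e ~= 0}" "fsum ?g : C0c (verts E)" for v
  using fsum_Cc(1)[OF C c, of v] fsum_Cc(3)[OF C c] off by auto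
 have "cd_inner E g g = fsum ?g" by (simp add: fun_eq_iff cd_inner_fsum fsum_def)
 moreover have "(%e. (cmod (g e))^2) summable_on fib E v" for v
  by (rule finite_nonzero_values_imp_summable_on) (use fin(1)[of v] in simp)
 moreover have "g e = 0" if "e ~: eds E" for e
  using that off compactin_subset_topspace[OF C] by blast
 ultimately show ?thesis using fin(2) g by (simp add: Cd_def)
qed

lemma Cd_zero: "(%e. 0) : Cd E"
 by (rule Cd_Cc[of "{}"]) auto

lemma Cd_add: "xi : Cd E ==> eta : Cd E ==> (%e. xi e + eta e) : Cd E"
 by (rule Cd_dominated[OF _ _ _ _ add_square_le]) (auto simp: CdD continuous_map_add)

lemma Cd_mult:
 assumes xi: "xi : Cd E" and b: "continuous_map (edges E) euclidean b" "!!e. e : eds E ==> cmod (b e) <= M"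
 shows "(%e. b e * xi e) : Cd E"
proof (rule Cd_dominated[OF xi xi, where M = "M^2"])
 show "continuous_map (edges E) euclidean (%e. b e * xi e)" by (intro cont_mult b CdD xi)
 show "(cmod (b e * xi e))^2 <= M^2 * ((cmod (xi e))^2 + (cmod (xi e))^2)" for e
 proof (cases "e : eds E")
  case True
  then show ?thesis unfolding norm_mult power_mult_distrib using b(2) by (intro mult_mono power_mono) auto
 qed (simp add: CdD[OF xi])
qed (simp add: CdD[OF xi])

lemma Cd_scale: "xi : Cd E ==> (%e. c * xi e) : Cd E"
 by (rule Cd_mult[where M = "cmod c"]) auto

lemma Cd_mult_right:
 assumes xi: "xi : Cd E" and f: "f : C0c (verts E)" shows "(%e. xi e * f (dmap E e)) : Cd E"
 using Cd_mult[OF xi continuous_map_compose[OF d_cont C0_cont[OF f]], of "nm (C0 (verts E)) f"] C0_norm_ge[OF f]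
 by (simp add: o_def mult.commute)

lemma Cd_mult_left:
 assumes xi: "xi : Cd E" and f: "f : C0c (verts E)" shows "(%e. f (rmap E e) * xi e) : Cd E"
 using Cd_mult[OF xi continuous_map_compose[OF r_cont C0_cont[OF f]], of "nm (C0 (verts E)) f"] C0_norm_ge[OF f]
 by (simp add: o_def)

text \<open>An edge outside the support \<open>D\<close> of the truncation contributes its full
  square to the tail, so there \<open>xi\<close> has modulus below \<open>eps\<close>; the level set
  lies in \<open>D\<close>. Vanishing at infinity is what allows pulling back along maps of
  compactifications.\<close>

lemma Cd_in_C0: assumes xi: "xi : Cd E" shows "xi : C0c (edges E)"
proof (rule C0_I)
 fix eps :: real assume e: "eps > 0"
 then have e2: "eps^2 / 2 > 0" by simp
 obtain h D where h: "continuous_map (edges E) euclideanreal h" "!!e. 0 <= h e" "!!e. h e <= 1"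
   "compactin (edges E) D" "!!e. e ~: D ==> h e = (0::real)"
   "!!v. v : vts E ==> infsum (%e. (1 - h e) * (cmod (xi e))^2) (fib E v) <= eps^2 / 2"
  by (rule sqn_tail[OF xi e2], rule that, assumption+)
 have "e : D" if e': "e : eds E" "eps <= cmod (xi e)" for e
 proof (rule ccontr)
  assume "e ~: D"
  have s: "(%e. (1 - h e) * (cmod (xi e))^2) summable_on fib E (dmap E e)"
   by (rule summable_on_comparison_test[OF Cd_summable[OF xi]]) (use h in \<open>auto intro: mult_left_le_one_le\<close>)
  have "(\<Sum>e\<in>{e}. (1 - h e) * (cmod (xi e))^2) <= infsum (%e. (1 - h e) * (cmod (xi e))^2) (fib E (dmap E e))"
   by (rule finite_sum_le_infsum[OF s]) (use e' h in auto)
  also have "... <= eps^2 / 2" using h(6) d_in e' by blast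
  finally have "(cmod (xi e))^2 <= eps^2 / 2" using h(5) \<open>e ~: D\<close> by simp
  moreover have "eps^2 <= (cmod (xi e))^2" using e e' by (intro power_mono) auto
  ultimately show False using e2 by linarith
 qed
 then show "EX K. compactin (edges E) K & (ALL x:eds E. eps <= cmod (xi x) --> x : K)" using h(4) by blast
qed (use CdD[OF xi] in auto)

end

text \<open>Only the normed space structure is meaningful; multiplication and star are fillers.\<close>

definition CdN :: "('v, 'e) tgraph => ('e => complex) cstar" where
 "CdN E = \<lparr>cs_carrier = Cd E, cs_zero = (%e. 0), cs_add = (%xi eta e. xi e + eta e), cs_scale = (%c xi e. c * xi e),
   cs_mult = (%xi eta. xi), cs_star = (%xi. xi), cs_norm = cd_norm E\<rparr>"

lemma CdN_simps [simp]:
 "car (CdN E) = Cd E" "cs_zero (CdN E) = (%e. 0)" "cs_add (CdN E) xi eta = (%e. xi e + eta e)"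
 "cs_scale (CdN E) c xi = (%e. c * xi e)" "nm (CdN E) = cd_norm E"
 by (simp_all add: CdN_def)

lemma inner_cnj: "cd_inner E eta xi v = cnj (cd_inner E xi eta v)"
 unfolding cd_inner_def infsum_cnj[symmetric] by (rule infsum_cong) (simp add: mult.commute)

lemma inner_scale_right: "cd_inner E xi (%e. c * eta e) v = c * cd_inner E xi eta v"
 unfolding cd_inner_def infsum_cmult_right'[symmetric] by (rule infsum_cong) simp

lemma inner_scale_left: "cd_inner E (%e. c * xi e) eta v = cnj c * cd_inner E xi eta v"
 unfolding cd_inner_def infsum_cmult_right'[symmetric] by (rule infsum_cong) simp

lemma inner_module_right: "cd_inner E xi (%e. eta e * f (dmap E e)) v = cd_inner E xi eta v * f v"
 unfolding cd_inner_def infsum_cmult_left'[symmetric] by (rule infsum_cong) simp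

lemma inner_module_left: "cd_inner E (%e. xi e * f (dmap E e)) eta v = cnj (f v) * cd_inner E xi eta v"
 unfolding cd_inner_def infsum_cmult_right'[symmetric] by (rule infsum_cong) simp

section \<open>Norm and completeness of the Hilbert module\<close>

context tgr
begin

lemma inner_add_right:
 "xi : Cd E ==> eta : Cd E ==> zeta : Cd E ==> cd_inner E xi (%e. eta e + zeta e) v = cd_inner E xi eta v + cd_inner E xi zeta v"
 unfolding cd_inner_def using infsum_add[OF Cd_inner(2) Cd_inner(2), of xi eta xi zeta v] by (simp add: distrib_left)

lemma inner_add_left:
 "xi : Cd E ==> eta : Cd E ==> zeta : Cd E ==> cd_inner E (%e. eta e + zeta e) xi v = cd_inner E eta xi v + cd_inner E zeta xi v"
 using inner_add_right[of xi eta zeta v] by (subst (1 2 3) inner_cnj) simp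

lemma Cd_point: assumes "xi : Cd E" shows "(cmod (xi e))^2 <= sqn E xi (dmap E e)"
proof (cases "e : eds E")
 case True
 have "(\<Sum>e\<in>{e}. (cmod (xi e))^2) <= sqn E xi (dmap E e)" unfolding sqn_def
  by (rule finite_sum_le_infsum[OF Cd_summable[OF assms]]) (use True in auto)
 then show ?thesis by simp
qed (simp add: CdD(2)[OF assms])

lemma Cd_point_norm: assumes "xi : Cd E" shows "cmod (xi e) <= cd_norm E xi"
 by (rule power2_le_imp_le[OF order_trans[OF Cd_point[OF assms] sqn_le[OF assms]] cd_norm_nonneg[OF assms]])

lemma sqrt_sqn_le: "xi : Cd E ==> sqrt (sqn E xi v) <= cd_norm E xi"
 using sqn_le[of xi E v] cd_norm_nonneg[of xi E] by (simp add: real_le_lsqrt)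

lemma inner_norm:
 assumes "xi : Cd E" "eta : Cd E" shows "nm (C0 (verts E)) (cd_inner E xi eta) <= cd_norm E xi * cd_norm E eta"
proof (rule C0_norm_le)
 fix v
 have "cmod (cd_inner E xi eta v) <= sqrt (sqn E xi v) * sqrt (sqn E eta v)"
  by (rule infsum_le_sqrt_mult[OF Cd_summable Cd_summable]) (use assms in auto)
 also have "... <= cd_norm E xi * cd_norm E eta"
  using assms by (intro mult_mono sqrt_sqn_le cd_norm_nonneg) auto
 finally show "cmod (cd_inner E xi eta v) <= cd_norm E xi * cd_norm E eta" .
qed (intro mult_nonneg_nonneg cd_norm_nonneg assms)

lemma CdN_normed: "normed_sp (CdN E)"
proof
 fix xi assume "xi : car (CdN E)"
 then have xi: "xi : Cd E" by simp
 show "0 <= nm (CdN E) xi" using cd_norm_nonneg[OF xi] by simp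
 show "nm (CdN E) xi = 0 \<longleftrightarrow> xi = cs_zero (CdN E)"
 proof
  assume "nm (CdN E) xi = 0"
  then show "xi = cs_zero (CdN E)" using Cd_point_norm[OF xi] by (auto simp: fun_eq_iff)
 next
  assume "xi = cs_zero (CdN E)"
  then have "cd_norm E xi <= 0" by (intro cd_norm_le) (auto simp: sqn_def)
  then show "nm (CdN E) xi = 0" using cd_norm_nonneg[OF xi] by simp
 qed
 interpret C: cs_alg "C0 (verts E)" using C0_cstar by (simp add: cs_alg_def)
 show "nm (CdN E) (c .[CdN E] xi) = cmod c * nm (CdN E) xi" for c
 proof -
  have "cd_inner E (%e. c * xi e) (%e. c * xi e) = cs_scale (C0 (verts E)) (cnj c * c) (cd_inner E xi xi)"
   by (simp add: fun_eq_iff inner_scale_left inner_scale_right)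
  moreover have "nm (C0 (verts E)) (cs_scale (C0 (verts E)) (cnj c * c) (cd_inner E xi xi)) =
    cmod (cnj c * c) * nm (C0 (verts E)) (cd_inner E xi xi)"
   by (rule C.nm_scale[OF CdD(3)[OF xi]])
  moreover have "cmod (cnj c * c) = (cmod c)^2" by (simp add: norm_mult power2_eq_square)
  ultimately show ?thesis by (simp add: cd_norm_def real_sqrt_mult)
 qed
 fix eta assume "eta : car (CdN E)"
 then have eta: "eta : Cd E" by simp
 show "nm (CdN E) (xi +[CdN E] eta) <= nm (CdN E) xi + nm (CdN E) eta"
  unfolding CdN_simps
 proof (rule cd_norm_le)
  fix v
  have "sqn E (%e. xi e + eta e) v <= (sqrt (sqn E xi v) + sqrt (sqn E eta v))^2"
   by (rule sqn_add_le[OF Cd_summable[OF xi] Cd_summable[OF eta]])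
  also have "... <= (cd_norm E xi + cd_norm E eta)^2"
   by (intro power_mono add_mono sqrt_sqn_le xi eta) simp
  finally show "sqn E (%e. xi e + eta e) v <= (cd_norm E xi + cd_norm E eta)^2" .
 qed (intro add_nonneg_nonneg cd_norm_nonneg xi eta)
qed (auto simp: Cd_zero Cd_add Cd_scale algebra_simps)

sublocale N: normed_sp "CdN E" by (rule CdN_normed)

lemma Cd_diff: "xi : Cd E ==> eta : Cd E ==> (%e. xi e - eta e) : Cd E"
 using Cd_add[of xi "%e. (-1) * eta e"] Cd_scale[of eta "-1"] by simp

text \<open>The square root is the fibre norm, which obeys the triangle inequality; so it is this
  function, and not its square, that is seen to converge uniformly in
  \<open>Cd_complete\<close>.\<close>

lemma sqrt_sqn_C0: assumes "xi : Cd E" shows "(%v. complex_of_real (sqrt (sqn E xi v))) : C0c (verts E)"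
proof (rule C0_I)
 have "continuous_map (verts E) euclideanreal (%v. sqrt (Re (cd_inner E xi xi v)))"
  by (intro continuous_map_sqrt cont_Re C0_cont CdD assms)
 then show "continuous_map (verts E) euclidean (%v. complex_of_real (sqrt (sqn E xi v)))"
  by (intro cont_of_real) (simp add: cd_inner_self)
 show "complex_of_real (sqrt (sqn E xi v)) = 0" if "v ~: vts E" for v
  using C0_off[OF CdD(3)[OF assms] that] by (simp add: cd_inner_self)
 fix eps :: real assume e: "eps > 0"
 have "eps^2 <= sqn E xi v" if "eps <= sqrt (sqn E xi v)" for v
  using that e power_mono[OF that, of 2] by simp
 then show "EX K. compactin (verts E) K & (ALL v:vts E. eps <= cmod (complex_of_real (sqrt (sqn E xi v))) --> v : K)"
  using C0_level[OF CdD(3)[OF assms], of "eps^2"] e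
  by (intro exI[of _ "{v : vts E. eps^2 <= cmod (cd_inner E xi xi v)}"]) (auto simp: cd_inner_self)
qed

lemma Cd_complete: assumes X: "cs_cauchy (CdN E) X" shows "EX xi. cs_lim (CdN E) X xi"
proof -
 have Xc: "X n : Cd E" for n using X by (simp add: cs_cauchy_def)
 have C: "EX N. ALL m>=N. ALL n>=N. cd_norm E (%e. X m e - X n e) < eps" if "eps > 0" for eps
  using X that unfolding cs_cauchy_def by simp
 have "EX g:C0c (edges E). (ALL e. (%n. X n e) \<longlonglongrightarrow> g e) &
   (ALL eps>0. EX N. ALL n>=N. ALL e:eds E. cmod (X n e - g e) <= eps)"
 proof (rule C0_cauchy_lim)
  show "X n : C0c (edges E)" for n by (rule Cd_in_C0[OF Xc])
  fix eps :: real assume "eps > 0"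
  from C[OF this] obtain N where N: "!!m n. m >= N ==> n >= N ==> cd_norm E (%e. X m e - X n e) < eps" by blast
  have "cmod (X m e - X n e) <= eps" if "m >= N" "n >= N" for m n e
   using Cd_point_norm[OF Cd_diff[OF Xc[of m] Xc[of n]], of e] N[OF that] by simp
  then show "EX N. ALL m>=N. ALL n>=N. ALL e:eds E. cmod (X m e - X n e) <= eps" by blast
 qed
 then obtain g where g: "g : C0c (edges E)" "!!e. (%n. X n e) \<longlonglongrightarrow> g e" by blast
 \<comment> \<open>The estimate is passed to the limit over finite sets of edges only; the bound for
   finite sums then gives summability and the bound on the whole fibre.\<close>
 have key: "(%e. (cmod (X n e - g e))^2) summable_on fib E v & sqn E (%e. X n e - g e) v <= eps^2"
  if e: "eps > 0" and N: "!!m n. m >= N ==> n >= N ==> cd_norm E (%e. X m e - X n e) < eps" and n: "n >= N" for eps N n v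
 proof -
  have fin: "(\<Sum>e\<in>F. (cmod (X n e - g e))^2) <= eps^2" if F: "finite F" "F <= fib E v" for F
  proof (rule LIMSEQ_le_const2)
   show "(%m. \<Sum>e\<in>F. (cmod (X n e - X m e))^2) \<longlonglongrightarrow> (\<Sum>e\<in>F. (cmod (X n e - g e))^2)"
    by (intro tendsto_intros g)
   have "(\<Sum>e\<in>F. (cmod (X n e - X m e))^2) <= eps^2" if m: "m >= N" for m
   proof -
    have d: "(%e. X n e - X m e) : Cd E" by (rule Cd_diff[OF Xc Xc])
    have "(\<Sum>e\<in>F. (cmod (X n e - X m e))^2) <= sqn E (%e. X n e - X m e) v" unfolding sqn_def
     by (rule finite_sum_le_infsum[OF Cd_summable[OF d] F]) simp
    also have "... <= (cd_norm E (%e. X n e - X m e))^2" by (rule sqn_le[OF d])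
    also have "... <= eps^2" using N[OF n m] cd_norm_nonneg[OF d] by (intro power_mono) auto
    finally show ?thesis .
   qed
   then show "EX N. ALL m>=N. (\<Sum>e\<in>F. (cmod (X n e - X m e))^2) <= eps^2" by blast
  qed
  have s: "(%e. (cmod (X n e - g e))^2) summable_on fib E v"
   by (rule nonneg_bdd_above_summable_on) (use fin in \<open>auto intro!: bdd_aboveI[of _ "eps^2"]\<close>)
  moreover have "sqn E (%e. X n e - g e) v <= eps^2" unfolding sqn_def
   by (rule infsum_le_finite_sums[OF s fin])
  ultimately show ?thesis by blast
 qed
 obtain N1 where N1: "!!m n. m >= N1 ==> n >= N1 ==> cd_norm E (%e. X m e - X n e) < 1" using C[of 1] by auto
 \<comment> \<open>\<open>g\<close> is the sum of \<open>X N1\<close> and \<open>g - X N1\<close>,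
   both square summable on fibres.\<close>
 have gs: "(%e. (cmod (g e))^2) summable_on fib E v" for v
 proof -
  have "(%e. cmod (complex_of_real ((cmod (X N1 e + (g e - X N1 e)))^2))) summable_on fib E v"
  proof (rule inner_summable[OF Cd_summable[OF Xc[of N1]], where eta = "%e. g e - X N1 e" and M = 2])
   show "(%e. (cmod (g e - X N1 e))^2) summable_on fib E v"
    using key[OF zero_less_one, of N1 N1 v] N1 by (simp add: norm_minus_commute)
   show "cmod (complex_of_real ((cmod (X N1 e + (g e - X N1 e)))^2)) <= 2 * ((cmod (X N1 e))^2 + (cmod (g e - X N1 e))^2)" for e
    unfolding norm_of_real abs_power2 by (rule add_square_le)
  qed
  then show ?thesis unfolding norm_of_real abs_power2 by simp
 qed
 \<comment> \<open>By the triangle inequality in both directions the fibre norms of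
   \<open>X N\<close> approach those of \<open>g\<close> uniformly; squaring gives
   \<open>cd_inner E g g\<close>.\<close>
 have "(%v. complex_of_real (sqrt (sqn E g v))) : C0c (verts E)"
 proof (rule C0_uniform_limit)
  show "complex_of_real (sqrt (sqn E g v)) = 0" if "v ~: vts E" for v
   unfolding sqn_def fib_empty[OF that] by simp
  fix eps :: real assume e: "eps > 0"
  from C[OF this] obtain N where N: "!!m n. m >= N ==> n >= N ==> cd_norm E (%e. X m e - X n e) < eps" by blast
  have "cmod (complex_of_real (sqrt (sqn E (X N) v)) - complex_of_real (sqrt (sqn E g v))) <= eps" for v
  proof -
   have k: "(%e. (cmod (X N e - g e))^2) summable_on fib E v" "sqn E (%e. X N e - g e) v <= eps^2"
    using key[OF e, of N N v] N by auto
   have k': "(%e. (cmod (g e - X N e))^2) summable_on fib E v" "sqn E (%e. g e - X N e) v <= eps^2"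
    using k by (simp_all add: norm_minus_commute sqn_def)
   have a: "sqrt (sqn E (%e. X N e - g e) v) <= eps" "sqrt (sqn E (%e. g e - X N e) v) <= eps"
    using k k' e by (auto intro!: real_le_lsqrt)
   have "sqn E (%e. g e + (X N e - g e)) v <= (sqrt (sqn E g v) + sqrt (sqn E (%e. X N e - g e) v))^2"
    by (rule sqn_add_le[OF gs k(1)])
   then have "sqrt (sqn E (X N) v) <= sqrt (sqn E g v) + sqrt (sqn E (%e. X N e - g e) v)"
    by (intro real_le_lsqrt) auto
   moreover have "sqn E (%e. X N e + (g e - X N e)) v <= (sqrt (sqn E (X N) v) + sqrt (sqn E (%e. g e - X N e) v))^2"
    by (rule sqn_add_le[OF Cd_summable[OF Xc] k'(1)])
   then have "sqrt (sqn E g v) <= sqrt (sqn E (X N) v) + sqrt (sqn E (%e. g e - X N e) v)"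
    by (intro real_le_lsqrt) auto
   ultimately have "\<bar>sqrt (sqn E (X N) v) - sqrt (sqn E g v)\<bar> <= eps" using a by linarith
   then show ?thesis unfolding of_real_diff[symmetric] norm_of_real .
  qed
  then show "EX f:C0c (verts E). ALL v:vts E. cmod (f v - complex_of_real (sqrt (sqn E g v))) <= eps"
   by (intro bexI[OF _ sqrt_sqn_C0[OF Xc[of N]]]) blast
 qed
 from C0_mult[OF this this] have "(%v. complex_of_real (sqn E g v)) : C0c (verts E)"
  by (simp flip: of_real_mult)
 moreover have "cd_inner E g g = (%v. complex_of_real (sqn E g v))" by (rule ext, rule cd_inner_self)
 ultimately have "cd_inner E g g : C0c (verts E)" by simp
 then have gC: "g : Cd E" using gs C0_cont[OF g(1)] C0_off[OF g(1)] by (simp add: Cd_def)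
 have "(%n. cd_norm E (%e. X n e - g e)) \<longlonglongrightarrow> 0"
 proof (rule LIMSEQ_I)
  fix r :: real assume r: "r > 0"
  then obtain N where N: "!!m n. m >= N ==> n >= N ==> cd_norm E (%e. X m e - X n e) < r/2" using C[of "r/2"] by auto
  have "norm (cd_norm E (%e. X n e - g e) - 0) < r" if "n >= N" for n
  proof -
   have "cd_norm E (%e. X n e - g e) <= r/2" using key[OF _ N that] r by (intro cd_norm_le) auto
   then show ?thesis using r cd_norm_nonneg[OF Cd_diff[OF Xc gC], of n] by simp
  qed
  then show "EX no. ALL n>=no. norm (cd_norm E (%e. X n e - g e) - 0) < r" by blast
 qed
 then show ?thesis using Xc gC by (auto simp: cs_lim_def)
qed

section \<open>Adjointable operators\<close>

text \<open>Test with \<open>zeta\<close> the difference of \<open>x\<close> and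
  \<open>y\<close>.\<close>

lemma inner_ext:
 assumes x: "x : Cd E" and y: "y : Cd E" and eq: "!!zeta. zeta : Cd E ==> cd_inner E zeta x = cd_inner E zeta y"
 shows "x = y"
proof -
 let ?d = "%e. x e - y e"
 have d: "?d : Cd E" by (rule Cd_diff[OF x y])
 have "cd_inner E ?d ?d v = 0" for v
 proof -
  have "cd_inner E ?d (%e. ?d e + y e) v = cd_inner E ?d ?d v + cd_inner E ?d y v" by (rule inner_add_right[OF d d y])
  then show ?thesis using fun_cong[OF eq[OF d], of v] by simp
 qed
 then have "sqn E ?d v = 0" for v by (simp add: cd_inner_self)
 then have "(cmod (?d e))^2 <= 0" for e using Cd_point[OF d, of e] by simp
 then show ?thesis by (auto simp: fun_eq_iff)
qed

text \<open>Compared with \<open>is_adjoint\<close>, extensionality of \<open>S'\<close> is dropped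
  and \<open>S\<close> is required to preserve \<open>Cd E\<close>; this makes the relation
  symmetric and easy to establish for explicit formulas.\<close>

definition adj_pair :: "(('e => complex) => ('e => complex)) => (('e => complex) => ('e => complex)) => bool" where
 "adj_pair S S' \<longleftrightarrow> (ALL xi:Cd E. S xi : Cd E) & (ALL xi:Cd E. S' xi : Cd E) &
   (ALL xi:Cd E. ALL eta:Cd E. cd_inner E (S xi) eta = cd_inner E xi (S' eta))"

lemma adj_pairD: assumes "adj_pair S S'"
 shows "xi : Cd E ==> S xi : Cd E" "xi : Cd E ==> S' xi : Cd E"
  "xi : Cd E ==> eta : Cd E ==> cd_inner E (S xi) eta = cd_inner E xi (S' eta)"
 using assms by (auto simp: adj_pair_def)

lemma adj_pair_sym: assumes "adj_pair S S'" shows "adj_pair S' S"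
proof -
 have "cd_inner E (S' xi) eta = cd_inner E xi (S eta)" if "xi : Cd E" "eta : Cd E" for xi eta
  using adj_pairD(3)[OF assms that(2,1)] by (auto simp: fun_eq_iff inner_cnj[of E "S' xi"] inner_cnj[of E xi])
 then show ?thesis using assms by (auto simp: adj_pair_def)
qed

text \<open>Linearity is automatic: inside an inner product \<open>S\<close> moves to the other
  side, and \<open>inner_ext\<close> removes the test vector. The same holds for
  \<open>adj_scale\<close>.\<close>

lemma adj_add: assumes "adj_pair S S'" "xi : Cd E" "eta : Cd E" shows "S (%e. xi e + eta e) = (%e. S xi e + S eta e)"
proof (rule inner_ext)
 note D = adj_pairD[OF assms(1)] adj_pairD[OF adj_pair_sym[OF assms(1)]]
 show "S (%e. xi e + eta e) : Cd E" "(%e. S xi e + S eta e) : Cd E" by (intro D(1) Cd_add assms)+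
 fix zeta assume z: "zeta : Cd E"
 have "cd_inner E zeta (S (%e. xi e + eta e)) = cd_inner E (S' zeta) (%e. xi e + eta e)" using D(6) z Cd_add assms by simp
 also have "... = (%v. cd_inner E (S' zeta) xi v + cd_inner E (S' zeta) eta v)"
  using inner_add_right[OF D(2)[OF z] assms(2,3)] by (simp add: fun_eq_iff)
 also have "... = (%v. cd_inner E zeta (S xi) v + cd_inner E zeta (S eta) v)" using D(6) z assms by simp
 also have "... = cd_inner E zeta (%e. S xi e + S eta e)" using inner_add_right[OF z D(1)[OF assms(2)] D(1)[OF assms(3)]] by (simp add: fun_eq_iff)
 finally show "cd_inner E zeta (S (%e. xi e + eta e)) = cd_inner E zeta (%e. S xi e + S eta e)" .
qed

lemma adj_scale: assumes "adj_pair S S'" "xi : Cd E" shows "S (%e. c * xi e) = (%e. c * S xi e)"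
proof (rule inner_ext)
 note D = adj_pairD[OF assms(1)] adj_pairD[OF adj_pair_sym[OF assms(1)]]
 show "S (%e. c * xi e) : Cd E" "(%e. c * S xi e) : Cd E" by (intro D(1) Cd_scale assms)+
 fix zeta assume z: "zeta : Cd E"
 have "cd_inner E zeta (S (%e. c * xi e)) = cd_inner E (S' zeta) (%e. c * xi e)" using D(6) z Cd_scale assms by simp
 also have "... = cd_inner E zeta (%e. c * S xi e)" using D(6) z assms by (simp add: fun_eq_iff inner_scale_right)
 finally show "cd_inner E zeta (S (%e. c * xi e)) = cd_inner E zeta (%e. c * S xi e)" .
qed

text \<open>Boundedness is a gliding hump argument (uniform boundedness for the maps \<open>\<eta> \<mapsto> \<langle>S \<xi>, \<eta>\<rangle>\<close>,
 \<open>\<parallel>\<xi>\<parallel> \<le> 1\<close>, which are pointwise bounded by \<open>\<parallel>S' \<eta>\<parallel>\<close>).\<close>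

lemma adj_bounded: assumes S: "adj_pair S S'" shows "EX M>=0. ALL xi:Cd E. cd_norm E (S xi) <= M * cd_norm E xi"
proof (rule ccontr)
 assume no: "~ ?thesis"
 note D = adj_pairD[OF S]
 let ?n = "nm (C0 (verts E))"
 interpret C: cs_alg "C0 (verts E)" using C0_cstar by (simp add: cs_alg_def)
 \<comment> \<open>The factor \<open>4^n\<close> compensates the size \<open>(1/4)^n\<close> of the
   \<open>n\<close>-th correction below, so that a contribution of order \<open>n\<close>
   survives.\<close>
 have "EX xi:Cd E. cd_norm E xi <= 1 & cd_norm E (S xi) > real n * 4^n" for n
 proof -
  have "0 <= real n * 4^n" by simp
  then have "~ (ALL xi:Cd E. cd_norm E (S xi) <= real n * 4^n * cd_norm E xi)" using no by blast
  then obtain xi where xi: "xi : Cd E" "cd_norm E (S xi) > real n * 4^n * cd_norm E xi" by (auto simp: not_le)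
  have "cd_norm E xi ~= 0"
  proof
   assume 0: "cd_norm E xi = 0"
   then have "xi = (%e. 0 * xi e)" using N.nm_zero_iff[of xi] xi by auto
   then have "S xi = (%e. 0)" using adj_scale[OF S xi(1), of 0] by simp
   then show False using xi(2) 0 N.nm_zero by simp
  qed
  then have p: "cd_norm E xi > 0" using cd_norm_nonneg[OF xi(1)] by simp
  let ?c = "complex_of_real (1 / cd_norm E xi)"
  have nc: "cmod ?c = 1 / cd_norm E xi" using p by (simp only: norm_of_real) simp
  have a: "cd_norm E (%e. ?c * xi e) = 1" using N.nm_scale[of xi ?c] xi(1) p unfolding CdN_simps nc by simp
  have "cd_norm E (S (%e. ?c * xi e)) = 1 / cd_norm E xi * cd_norm E (S xi)"
   unfolding adj_scale[OF S xi(1)] using N.nm_scale[of "S xi" ?c] D(1)[OF xi(1)] unfolding CdN_simps nc by blast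
  also have "... > real n * 4^n" using xi(2) p by (simp add: field_simps)
  finally show ?thesis using a Cd_scale[OF xi(1), of ?c] by (intro bexI[of _ "%e. ?c * xi e"]) auto
 qed
 then obtain xi where xi: "!!n. xi n : Cd E" "!!n. cd_norm E (xi n) <= 1" "!!n. cd_norm E (S (xi n)) > real n * 4^n" by metis
 define t where "t n eta = ?n (cd_inner E (S (xi n)) eta)" for n eta
 define b where "b n = cd_norm E (S (xi n))" for n
 have bpos: "b n > 0" for n using xi(3)[of n] unfolding b_def by (rule le_less_trans[rotated]) simp
 have t_le: "t n eta <= b n * cd_norm E eta" if "eta : Cd E" for n eta
  unfolding t_def b_def by (rule inner_norm[OF D(1)[OF xi(1)] that])
 have t_le': "t n eta <= cd_norm E (S' eta)" if h: "eta : Cd E" for n eta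
 proof -
  have "t n eta = ?n (cd_inner E (xi n) (S' eta))" unfolding t_def using D(3)[OF xi(1) h] by simp
  also have "... <= cd_norm E (xi n) * cd_norm E (S' eta)" by (rule inner_norm[OF xi(1) D(2)[OF h]])
  also have "... <= 1 * cd_norm E (S' eta)" by (rule mult_right_mono[OF xi(2) cd_norm_nonneg[OF D(2)[OF h]]])
  finally show ?thesis by simp
 qed
 have t_add: "t n (%e. eta e + zeta e) <= t n eta + t n zeta" if "eta : Cd E" "zeta : Cd E" for n eta zeta
 proof -
  have eq: "cd_inner E (S (xi n)) (%e. eta e + zeta e) = (%v. cd_inner E (S (xi n)) eta v + cd_inner E (S (xi n)) zeta v)"
   by (rule ext, rule inner_add_right[OF D(1)[OF xi(1)] that])
  show ?thesis unfolding t_def eq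
   using C.nm_triangle[OF Cd_inner(1)[OF D(1)[OF xi(1)] that(1)] Cd_inner(1)[OF D(1)[OF xi(1)] that(2)]] by simp
 qed
 have t_scale: "t n (%e. c * eta e) = cmod c * t n eta" if "eta : Cd E" for n c eta
 proof -
  have eq: "cd_inner E (S (xi n)) (%e. c * eta e) = (%v. c * cd_inner E (S (xi n)) eta v)"
   by (rule ext, rule inner_scale_right)
  show ?thesis unfolding t_def eq using C.nm_scale[OF Cd_inner(1)[OF D(1)[OF xi(1)] that]] by simp
 qed
 define z where "z n = (%e. complex_of_real ((1/4)^n / b n) * S (xi n) e)" for n
 have zc: "z n : Cd E" for n unfolding z_def by (rule Cd_scale[OF D(1)[OF xi(1)]])
 have nc: "cmod (complex_of_real ((1/4)^n / b n)) = (1/4)^n / b n" for n using bpos[of n] by (simp only: norm_of_real) simp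
 have zn: "cd_norm E (z n) = (1/4)^n" for n
 proof -
  have "cd_norm E (z n) = cmod (complex_of_real ((1/4)^n / b n)) * cd_norm E (S (xi n))"
   using N.nm_scale[of "S (xi n)" "complex_of_real ((1/4)^n / b n)"] D(1)[OF xi(1)] unfolding CdN_simps z_def by blast
  then show ?thesis using bpos[of n] unfolding nc b_def[symmetric] by simp
 qed
 have tz: "t n (z n) = (1/4)^n * b n" for n
 proof -
  have "t n (S (xi n)) = (b n)^2" unfolding t_def b_def by (rule cd_norm_sq[OF D(1)[OF xi(1)], symmetric])
  then have "t n (z n) = (1/4)^n / b n * (b n)^2" unfolding z_def t_scale[OF D(1)[OF xi(1)]] nc by simp
  then show ?thesis using bpos[of n] by (simp add: power2_eq_square)
 qed
 \<comment> \<open>Of \<open>x + z n\<close> and \<open>x - z n\<close> at least one has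
   \<open>t n\<close>-value not below that of \<open>z n\<close>, because their difference is
   \<open>2 * z n\<close>. The sign is chosen accordingly.\<close>
 define step where "step n x = (if t n (%e. x e + z n e) >= (1/4)^n * b n then (%e. x e + z n e) else (%e. x e - z n e))" for n x
 have step: "step n x : Cd E & t n (step n x) >= (1/4)^n * b n & cd_norm E (%e. step n x e - x e) = (1/4)^n" if x: "x : Cd E" for n x
 proof -
  have c: "(%e. x e + z n e) : Cd E" "(%e. x e - z n e) : Cd E" using x zc by (auto intro: Cd_add Cd_diff)
  have neg: "(%e. - (x e - z n e)) : Cd E" using Cd_scale[OF c(2), of "-1"] by simp
  have "2 * ((1/4)^n * b n) = t n (%e. 2 * z n e)" using t_scale[OF zc, of n 2] by (simp add: tz)
  also have "... = t n (%e. (x e + z n e) + (- (x e - z n e)))" by simp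
  also have "... <= t n (%e. x e + z n e) + t n (%e. - (x e - z n e))" by (rule t_add[OF c(1) neg])
  also have "t n (%e. - (x e - z n e)) = t n (%e. x e - z n e)" using t_scale[OF c(2), of n "-1"] by simp
  finally have "t n (step n x) >= (1/4)^n * b n" by (auto simp: step_def)
  moreover have "cd_norm E (%e. - z n e) = cd_norm E (z n)" using N.nm_scale[of "z n" "-1"] zc by simp
  ultimately show ?thesis using c by (auto simp: step_def zn)
 qed
 define x where "x = rec_nat (%e. 0) step"
 have x0: "x 0 = (%e. 0)" and xS: "x (Suc n) = step n (x n)" for n by (simp_all add: x_def)
 have xc: "x n : Cd E" for n by (induction n) (use x0 xS step Cd_zero in auto)
 have tail: "cd_norm E (%e. x (n + k) e - x n e) <= 4/3 * ((1/4)^n - (1/4)^(n+k))" for n k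
 proof (induction k)
  case 0 then show ?case using N.nm_zero by simp
 next
  case (Suc k)
  have "cd_norm E (%e. x (n + Suc k) e - x n e) <= cd_norm E (%e. x (Suc (n + k)) e - x (n+k) e) + cd_norm E (%e. x (n + k) e - x n e)"
   using N.nm_minus_triangle[of "x (Suc (n+k))" "x (n+k)" "x n"] xc by simp
  also have "... <= (1/4)^(n+k) + 4/3 * ((1/4)^n - (1/4)^(n+k))" using Suc step[OF xc[of "n+k"], of "n+k"] by (simp add: xS)
  also have "... = 4/3 * ((1/4)^n - (1/4)^(n+Suc k))" by (simp add: algebra_simps)
  finally show ?case .
 qed
 have "cs_cauchy (CdN E) x"
 proof (rule N.geometric_cauchy)
  show "x n : car (CdN E)" for n using xc by simp
  show "nm (CdN E) (x (Suc n) -[CdN E] x n) <= 1 * (1/2)^n" for n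
   using step[OF xc, of n n] power_mono[of "1/4" "1/2::real" n] by (simp add: xS)
 qed
 then obtain y where y: "cs_lim (CdN E) x y" using Cd_complete by blast
 then have yc: "y : Cd E" by (simp add: cs_lim_def)
 have ytail: "cd_norm E (%e. y e - x n e) <= 4/3 * (1/4)^n" for n
 proof (rule LIMSEQ_le_const2)
  show "(%k. cd_norm E (%e. x k e - x n e)) \<longlonglongrightarrow> cd_norm E (%e. y e - x n e)"
   using N.cs_lim_norm[OF N.cs_lim_minus[OF y N.cs_lim_const[of "x n"]]] xc by simp
  have "cd_norm E (%e. x k e - x n e) <= 4/3 * (1/4)^n" if "k >= n" for k
  proof -
   have "cd_norm E (%e. x k e - x n e) <= 4/3 * ((1/4)^n - (1/4)^k)" using tail[of n "k - n"] that by simp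
   also have "... <= 4/3 * (1/4)^n" by simp
   finally show ?thesis .
  qed
  then show "EX N. ALL k>=N. cd_norm E (%e. x k e - x n e) <= 4/3 * (1/4)^n" by blast
 qed
 \<comment> \<open>The corrections after step \<open>n\<close> add up to at most
   \<open>4/3 * (1/4)^(n+1)\<close>, that is a third of \<open>(1/4)^n\<close>; two thirds of what
   step \<open>n\<close> achieved are left in the limit \<open>y\<close>.\<close>
 have low: "2/3 * real n <= cd_norm E (S' y)" for n
 proof -
  let ?d = "%e. x (Suc n) e - y e"
  have dc: "?d : Cd E" by (rule Cd_diff[OF xc yc])
  have "(1/4)^n * b n <= t n (x (Suc n))" using step[OF xc[of n], of n] by (simp add: xS)
  also have "... = t n (%e. y e + ?d e)" by simp
  also have "... <= t n y + t n ?d" by (rule t_add[OF yc dc])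
  also have "t n ?d <= b n * (4/3 * (1/4)^(Suc n))"
  proof -
   have "cd_norm E ?d <= 4/3 * (1/4)^(Suc n)" using ytail[of "Suc n"] N.nm_minus_commute[of y "x (Suc n)"] xc yc by simp
   then show ?thesis using t_le[OF dc, of n] bpos[of n] by (meson less_imp_le mult_left_mono order_trans)
  qed
  finally have "(1/4)^n * b n <= t n y + b n * (4/3 * (1/4)^(Suc n))" by simp
  then have "2/3 * ((1/4)^n * b n) <= t n y" by (simp add: field_simps)
  moreover have "real n <= (1/4)^n * b n"
  proof -
   have "real n = (1/4)^n * (real n * 4^n)" by (simp add: power_divide)
   also have "... <= (1/4)^n * b n" using xi(3)[of n] unfolding b_def by (intro mult_left_mono) auto
   finally show ?thesis .
  qed
  ultimately show ?thesis using t_le'[OF yc, of n] by linarith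
 qed
 obtain n where "cd_norm E (S' y) < real n" using reals_Archimedean2 by blast
 then have "cd_norm E (S' y) < 2/3 * real (2 * n)" by simp
 then show False using low[of "2 * n"] by linarith
qed

end

context tgr
begin

abbreviation "Ad == adjointable_ops E"

lemma Ad_simps [simp]:
 "cs_zero Ad = (\<lambda>xi\<in>Cd E. %e. 0)" "cs_add Ad S T = (\<lambda>xi\<in>Cd E. %e. S xi e + T xi e)"
 "cs_scale Ad c S = (\<lambda>xi\<in>Cd E. %e. c * S xi e)" "cs_mult Ad S T = (\<lambda>xi\<in>Cd E. S (T xi))"
 by (simp_all add: adjointable_ops_def)

lemma Ad_iff: "S : car Ad \<longleftrightarrow> S : extensional (Cd E) & (EX S'. adj_pair S S')"
proof
 assume "S : car Ad"
 then show "S : extensional (Cd E) & (EX S'. adj_pair S S')"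
  by (auto simp: adjointable_ops_def is_adjoint_def adj_pair_def PiE_iff)
next
 assume "S : extensional (Cd E) & (EX S'. adj_pair S S')"
 then obtain S' where S: "S : extensional (Cd E)" "adj_pair S S'" by blast
 then have "is_adjoint E S (restrict S' (Cd E))" by (auto simp: is_adjoint_def adj_pair_def)
 then show "S : car Ad" using S by (auto simp: adjointable_ops_def adj_pair_def PiE_iff)
qed

lemma Ad_in: "S : car Ad ==> xi : Cd E ==> S xi : Cd E"
 by (auto simp: Ad_iff adj_pair_def)

lemma Ad_ext: "S : car Ad ==> S : extensional (Cd E)"
 by (simp add: Ad_iff)

lemma opn_props:
 assumes S: "S : car Ad"
 shows "0 <= nm Ad S" and "xi : Cd E ==> cd_norm E (S xi) <= nm Ad S * cd_norm E xi"
proof -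
 obtain S' where S': "adj_pair S S'" using S by (auto simp: Ad_iff)
 obtain M where M: "M >= 0" "!!xi. xi : Cd E ==> cd_norm E (S xi) <= M * cd_norm E xi" using adj_bounded[OF S'] by blast
 let ?T = "{cd_norm E (S xi) | xi. xi : Cd E & cd_norm E xi <= 1}"
 have nrm: "nm Ad S = Sup ?T" by (simp add: adjointable_ops_def)
 have "t <= M" if t: "t : ?T" for t
 proof -
  obtain xi where x: "xi : Cd E" "cd_norm E xi <= 1" "t = cd_norm E (S xi)" using t by blast
  have "M * cd_norm E xi <= M * 1" using x M by (intro mult_left_mono) auto
  then show ?thesis using M(2)[OF x(1)] x by simp
 qed
 then have bdd: "bdd_above ?T" by (rule bdd_aboveI)
 have up: "cd_norm E (S xi) <= nm Ad S" if "xi : Cd E" "cd_norm E xi <= 1" for xi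
  unfolding nrm by (rule cSup_upper[OF _ bdd]) (use that in blast)
 have z: "S (%e. 0) = (%e. 0)" using adj_scale[OF S' Cd_zero, of 0] by simp
 show "0 <= nm Ad S" using up[OF Cd_zero] z N.nm_zero by simp
 show "cd_norm E (S xi) <= nm Ad S * cd_norm E xi" if x: "xi : Cd E"
 proof (cases "cd_norm E xi = 0")
  case True
  then have "xi = (%e. 0)" using N.nm_zero_iff[of xi] x by simp
  then show ?thesis using z N.nm_zero by simp
 next
  case False
  then have p: "cd_norm E xi > 0" using cd_norm_nonneg[OF x] by simp
  let ?c = "complex_of_real (1 / cd_norm E xi)"
  have nc: "cmod ?c = 1 / cd_norm E xi" using p by (simp only: norm_of_real) simp
  have "cd_norm E (%e. ?c * xi e) = 1" using N.nm_scale[of xi ?c] x p unfolding CdN_simps nc by simp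
  then have "cd_norm E (S (%e. ?c * xi e)) <= nm Ad S" by (intro up Cd_scale x) simp
  moreover have "cd_norm E (S (%e. ?c * xi e)) = 1 / cd_norm E xi * cd_norm E (S xi)"
   unfolding adj_scale[OF S' x] using N.nm_scale[of "S xi" ?c] Ad_in[OF S x] unfolding CdN_simps nc by blast
  ultimately have "1 / cd_norm E xi * cd_norm E (S xi) <= nm Ad S" by (simp only:)
  then show ?thesis using p by (simp add: field_simps)
 qed
qed

lemma opn_le: assumes "0 <= c" "!!xi. xi : Cd E ==> cd_norm E (S xi) <= c * cd_norm E xi" shows "nm Ad S <= c"
proof -
 have "Sup {cd_norm E (S xi) | xi. xi : Cd E & cd_norm E xi <= 1} <= c"
 proof (rule cSup_least)
  show "{cd_norm E (S xi) | xi. xi : Cd E & cd_norm E xi <= 1} ~= {}" using Cd_zero N.nm_zero by auto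
  fix t assume "t : {cd_norm E (S xi) | xi. xi : Cd E & cd_norm E xi <= 1}"
  then obtain xi where x: "xi : Cd E" "cd_norm E xi <= 1" "t = cd_norm E (S xi)" by blast
  have "c * cd_norm E xi <= c * 1" using x assms by (intro mult_left_mono) auto
  then show "t <= c" using assms(2)[OF x(1)] x by simp
 qed
 then show ?thesis by (simp add: adjointable_ops_def)
qed

lemma adj_pair_add:
 assumes "adj_pair S S'" "adj_pair T T'"
 shows "adj_pair (\<lambda>xi\<in>Cd E. %e. S xi e + T xi e) (\<lambda>xi\<in>Cd E. %e. S' xi e + T' xi e)"
 using adj_pairD[OF assms(1)] adj_pairD[OF assms(2)]
 by (auto simp: adj_pair_def Cd_add inner_add_left inner_add_right fun_eq_iff)

lemma adj_pair_scale:
 assumes "adj_pair S S'" shows "adj_pair (\<lambda>xi\<in>Cd E. %e. c * S xi e) (\<lambda>xi\<in>Cd E. %e. cnj c * S' xi e)"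
 using adj_pairD[OF assms] by (auto simp: adj_pair_def Cd_scale inner_scale_left inner_scale_right fun_eq_iff)

lemma Ad_add_in: "S : car Ad ==> T : car Ad ==> S +[Ad] T : car Ad"
 unfolding Ad_iff Ad_simps using adj_pair_add by blast

lemma Ad_scale_in: "S : car Ad ==> c .[Ad] S : car Ad"
 unfolding Ad_iff Ad_simps using adj_pair_scale by blast

lemma Ad_normed: "normed_sp Ad"
proof
 show "cs_zero Ad : car Ad" unfolding Ad_iff Ad_simps
  by (auto simp: adj_pair_def Cd_zero cd_inner_def fun_eq_iff intro!: exI[of _ "%xi e. 0"])
 fix S assume S: "S : car Ad"
 show "0 <= nm Ad S" using opn_props(1)[OF S] .
 show "c .[Ad] S : car Ad" for c using Ad_scale_in[OF S] .
 show "nm Ad S = 0 \<longleftrightarrow> S = cs_zero Ad"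
 proof
  assume 0: "nm Ad S = 0"
  have "S xi = (%e. 0)" if x: "xi : Cd E" for xi
   using opn_props(2)[OF S x] 0 N.nm_zero_iff[of "S xi"] Ad_in[OF S x] cd_norm_nonneg[OF Ad_in[OF S x]] by simp
  then show "S = cs_zero Ad" using Ad_ext[OF S] by (intro extensionalityI[of _ "Cd E"]) auto
 next
  assume "S = cs_zero Ad"
  then have "nm Ad S <= 0" using N.nm_zero by (intro opn_le) auto
  then show "nm Ad S = 0" using opn_props(1)[OF S] by simp
 qed
 have scale_le: "nm Ad (c .[Ad] S) <= cmod c * nm Ad S" if S: "S : car Ad" for c S
 proof (rule opn_le)
  show "0 <= cmod c * nm Ad S" using opn_props(1)[OF S] by simp
  fix xi assume x: "xi : Cd E"
  have "cd_norm E (%e. c * S xi e) = cmod c * cd_norm E (S xi)" using N.nm_scale[of "S xi" c] Ad_in[OF S x] by simp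
  then show "cd_norm E ((c .[Ad] S) xi) <= cmod c * nm Ad S * cd_norm E xi"
   using opn_props(2)[OF S x] x by (simp add: mult_left_mono mult.assoc)
 qed
 show "nm Ad (c .[Ad] S) = cmod c * nm Ad S" for c
 proof (cases "c = 0")
  case True then show ?thesis using scale_le[OF S, of 0] opn_props(1)[OF Ad_scale_in[OF S, of 0]] by simp
 next
  case False
  have "inverse c .[Ad] c .[Ad] S = S" using Ad_ext[OF S] False by (intro extensionalityI[of _ "Cd E"]) auto
  then have "nm Ad S <= cmod (inverse c) * nm Ad (c .[Ad] S)" using scale_le[OF Ad_scale_in[OF S], of "inverse c" c] by metis
  then have "cmod c * nm Ad S <= cmod c * (cmod (inverse c) * nm Ad (c .[Ad] S))" by (rule mult_left_mono) simp
  also have "... = nm Ad (c .[Ad] S)" using False by (simp only: norm_inverse) simp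
  finally show ?thesis using scale_le[OF S, of c] by simp
 qed
 fix T assume T: "T : car Ad"
 show "S +[Ad] T : car Ad" by (rule Ad_add_in[OF S T])
 show "nm Ad (S +[Ad] T) <= nm Ad S + nm Ad T"
 proof (rule opn_le)
  show "0 <= nm Ad S + nm Ad T" using opn_props(1) S T by simp
  fix xi assume x: "xi : Cd E"
  have "cd_norm E (%e. S xi e + T xi e) <= cd_norm E (S xi) + cd_norm E (T xi)"
   using N.nm_triangle[of "S xi" "T xi"] Ad_in[OF S x] Ad_in[OF T x] by simp
  also have "... <= (nm Ad S + nm Ad T) * cd_norm E xi"
   using opn_props(2)[OF S x] opn_props(2)[OF T x] by (simp add: distrib_right)
  finally show "cd_norm E ((S +[Ad] T) xi) <= (nm Ad S + nm Ad T) * cd_norm E xi" using x by simp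
 qed
qed (rule extensionalityI[of _ "Cd E"]; auto simp: fun_eq_iff algebra_simps Ad_ext)+

sublocale Ad: normed_sp Ad by (rule Ad_normed)

text \<open>The square of the norm of \<open>S' xi\<close> is the norm of the inner product of
  \<open>S (S' xi)\<close> with \<open>xi\<close>; Cauchy-Schwarz and cancelling one factor give the
  bound.\<close>

lemma adj_norm_le:
 assumes S: "adj_pair S S'" and t: "0 <= t" "!!xi. xi : Cd E ==> cd_norm E (S xi) <= t * cd_norm E xi" and x: "xi : Cd E"
 shows "cd_norm E (S' xi) <= t * cd_norm E xi"
proof -
 note D = adj_pairD[OF S]
 have "(cd_norm E (S' xi))^2 = nm (C0 (verts E)) (cd_inner E (S (S' xi)) xi)"
  using cd_norm_sq[OF D(2)[OF x]] D(3)[OF D(2)[OF x] x] by simp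
 also have "... <= cd_norm E (S (S' xi)) * cd_norm E xi" by (rule inner_norm[OF D(1)[OF D(2)[OF x]] x])
 also have "... <= (t * cd_norm E (S' xi)) * cd_norm E xi"
  by (rule mult_right_mono[OF t(2)[OF D(2)[OF x]] cd_norm_nonneg[OF x]])
 finally have le: "cd_norm E (S' xi) * cd_norm E (S' xi) <= cd_norm E (S' xi) * (t * cd_norm E xi)"
  by (simp add: power2_eq_square algebra_simps)
 show ?thesis
 proof (cases "cd_norm E (S' xi) = 0")
  case True then show ?thesis using t(1) cd_norm_nonneg[OF x] by simp
 next
  case False
  then have "cd_norm E (S' xi) > 0" using cd_norm_nonneg[OF D(2)[OF x]] by simp
  then show ?thesis using le by (simp add: mult_le_cancel_left_pos)
 qed
qed

lemma adj_unique:
 assumes "adj_pair S S'" "adj_pair S S''" "xi : Cd E" shows "S' xi = S'' xi"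
 using assms adj_pairD by (intro inner_ext) metis+

lemma Ad_star:
 assumes S: "adj_pair S S'" "S : extensional (Cd E)" shows "cs_star Ad S = restrict S' (Cd E)"
proof -
 have a: "is_adjoint E S (restrict S' (Cd E))" using S by (auto simp: is_adjoint_def adj_pair_def)
 have "T = restrict S' (Cd E)" if T: "is_adjoint E S T" for T
 proof (rule extensionalityI[of _ "Cd E"])
  have "adj_pair S T" using S T by (auto simp: is_adjoint_def adj_pair_def)
  then show "T xi = restrict S' (Cd E) xi" if "xi : Cd E" for xi using adj_unique[OF _ S(1) that] that by simp
 qed (use T in \<open>auto simp: is_adjoint_def PiE_iff\<close>)
 then have "(THE T. is_adjoint E S T) = restrict S' (Cd E)" using a by (intro the_equality)
 then show ?thesis by (simp add: adjointable_ops_def)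
qed

lemma Ad_star_pair: assumes S: "S : car Ad" shows "adj_pair S (cs_star Ad S)" "cs_star Ad S : car Ad"
proof -
 obtain S' where S': "adj_pair S S'" "S : extensional (Cd E)" using S by (auto simp: Ad_iff)
 have e: "cs_star Ad S = restrict S' (Cd E)" by (rule Ad_star[OF S'])
 show p: "adj_pair S (cs_star Ad S)" unfolding e using S'(1) by (auto simp: adj_pair_def)
 show "cs_star Ad S : car Ad" unfolding Ad_iff using adj_pair_sym[OF p] e by auto
qed

lemma Ad_lim_star: assumes l: "cs_lim Ad sg S" shows "cs_lim Ad (%n. cs_star Ad (sg n)) (cs_star Ad S)"
proof -
 have c: "!!n. sg n : car Ad" "S : car Ad" and l0: "(%n. nm Ad (sg n -[Ad] S)) \<longlonglongrightarrow> 0"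
  using l by (auto simp: cs_lim_def)
 have sc: "cs_star Ad (sg n) : car Ad" "cs_star Ad S : car Ad" for n using Ad_star_pair c by auto
 have "nm Ad (cs_star Ad (sg n) -[Ad] cs_star Ad S) <= nm Ad (sg n -[Ad] S)" for n
 proof (rule opn_le)
  have d: "sg n -[Ad] S : car Ad" using c Ad.add_in Ad.scale_in by blast
  show "0 <= nm Ad (sg n -[Ad] S)" by (rule opn_props(1)[OF d])
  have p: "adj_pair (sg n -[Ad] S) (cs_star Ad (sg n) -[Ad] cs_star Ad S)"
   using adj_pair_add[OF Ad_star_pair(1)[OF c(1)[of n]] adj_pair_scale[OF Ad_star_pair(1)[OF c(2)], of "-1"]] by simp
  fix xi assume x: "xi : Cd E"
  show "cd_norm E ((cs_star Ad (sg n) -[Ad] cs_star Ad S) xi) <= nm Ad (sg n -[Ad] S) * cd_norm E xi"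
   by (rule adj_norm_le[OF p opn_props(1)[OF d] opn_props(2)[OF d] x])
 qed
 moreover have "0 <= nm Ad (cs_star Ad (sg n) -[Ad] cs_star Ad S)" for n
  using sc Ad.add_in Ad.scale_in Ad.nm_nonneg by blast
 ultimately have "(%n. nm Ad (cs_star Ad (sg n) -[Ad] cs_star Ad S)) \<longlonglongrightarrow> 0"
  by (intro Lim_null_comparison[OF _ l0]) auto
 then show ?thesis using sc by (simp add: cs_lim_def)
qed

lemma Ad_mult_in: assumes "S : car Ad" "T : car Ad" shows "S *[Ad] T : car Ad"
proof -
 obtain S' T' where p: "adj_pair S S'" "adj_pair T T'" using assms by (auto simp: Ad_iff)
 have "adj_pair (\<lambda>xi\<in>Cd E. S (T xi)) (%xi. T' (S' xi))" using adj_pairD[OF p(1)] adj_pairD[OF p(2)] by (auto simp: adj_pair_def)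
 then show ?thesis unfolding Ad_iff Ad_simps by auto
qed

text \<open>The operators are treated as a normed space only, so continuity of the composition is
  derived directly from the operator norm.\<close>

lemma Ad_lim_mult:
 assumes l: "cs_lim Ad sg S" and l': "cs_lim Ad tau T" shows "cs_lim Ad (%n. sg n *[Ad] tau n) (S *[Ad] T)"
proof -
 have c: "!!n. sg n : car Ad" "S : car Ad" "!!n. tau n : car Ad" "T : car Ad"
  and l0: "(%n. nm Ad (sg n -[Ad] S)) \<longlonglongrightarrow> 0" "(%n. nm Ad (tau n -[Ad] T)) \<longlonglongrightarrow> 0"
  using l l' by (auto simp: cs_lim_def)
 have le: "nm Ad (sg n *[Ad] tau n -[Ad] S *[Ad] T) <=
  nm Ad (sg n -[Ad] S) * nm Ad (tau n) + nm Ad S * nm Ad (tau n -[Ad] T)" for n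
 proof (rule opn_le)
  have d: "sg n -[Ad] S : car Ad" "tau n -[Ad] T : car Ad" using c Ad.add_in Ad.scale_in by blast+
  show "0 <= nm Ad (sg n -[Ad] S) * nm Ad (tau n) + nm Ad S * nm Ad (tau n -[Ad] T)"
   by (intro add_nonneg_nonneg mult_nonneg_nonneg opn_props(1) d c)
  fix xi assume x: "xi : Cd E"
  let ?a = "tau n xi" let ?b = "T xi"
  have ab: "?a : Cd E" "?b : Cd E" using Ad_in c x by auto
  obtain S' where S': "adj_pair S S'" using c(2) by (auto simp: Ad_iff)
  have "S (%e. ?a e + (-1) * ?b e) = (%e. S ?a e + S (%e. (-1) * ?b e) e)"
   by (rule adj_add[OF S' ab(1) Cd_scale[OF ab(2)]])
  then have Sd: "S (%e. ?a e - ?b e) = (%e. S ?a e - S ?b e)" using adj_scale[OF S' ab(2), of "-1"] by simp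
  have e: "(sg n *[Ad] tau n -[Ad] S *[Ad] T) xi = (%e. (sg n -[Ad] S) ?a e + S ((tau n -[Ad] T) xi) e)"
   using x ab Sd by (simp add: fun_eq_iff)
  have "cd_norm E ((sg n *[Ad] tau n -[Ad] S *[Ad] T) xi) <= cd_norm E ((sg n -[Ad] S) ?a) + cd_norm E (S ((tau n -[Ad] T) xi))"
   unfolding e using N.nm_triangle[of "(sg n -[Ad] S) ?a" "S ((tau n -[Ad] T) xi)"]
    Ad_in[OF d(1) ab(1)] Ad_in[OF c(2) Ad_in[OF d(2) x]] unfolding CdN_simps by blast
  also have "... <= nm Ad (sg n -[Ad] S) * (nm Ad (tau n) * cd_norm E xi) + nm Ad S * (nm Ad (tau n -[Ad] T) * cd_norm E xi)"
   by (intro add_mono order_trans[OF opn_props(2)[OF d(1) ab(1)]] order_trans[OF opn_props(2)[OF c(2) Ad_in[OF d(2) x]]]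
     mult_left_mono opn_props(2) opn_props(1) c d x)
  finally show "cd_norm E ((sg n *[Ad] tau n -[Ad] S *[Ad] T) xi) <=
    (nm Ad (sg n -[Ad] S) * nm Ad (tau n) + nm Ad S * nm Ad (tau n -[Ad] T)) * cd_norm E xi"
   by (simp add: distrib_right mult.assoc)
 qed
 have "(%n. nm Ad (sg n -[Ad] S) * nm Ad (tau n) + nm Ad S * nm Ad (tau n -[Ad] T)) \<longlonglongrightarrow> 0 * nm Ad T + nm Ad S * 0"
  by (intro tendsto_intros l0 Ad.cs_lim_norm l')
 then have z: "(%n. nm Ad (sg n -[Ad] S) * nm Ad (tau n) + nm Ad S * nm Ad (tau n -[Ad] T)) \<longlonglongrightarrow> 0" by simp
 have mc: "sg n *[Ad] tau n : car Ad" "S *[Ad] T : car Ad" for n using Ad_mult_in c by auto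
 have "0 <= nm Ad (sg n *[Ad] tau n -[Ad] S *[Ad] T)" for n
  by (rule Ad.nm_nonneg[OF Ad.add_in[OF mc(1) Ad.scale_in[OF mc(2)]]])
 then have "(%n. nm Ad (sg n *[Ad] tau n -[Ad] S *[Ad] T)) \<longlonglongrightarrow> 0"
  by (intro Lim_null_comparison[OF _ z]) (use le in simp)
 then show ?thesis using mc by (simp add: cs_lim_def del: Ad_simps)
qed

section \<open>Finite sums of rank one operators\<close>

text \<open>Lists of pairs of legs represent finite sums of rank one operators. Addition, adjoint
  and composition become list operations, which act in the same way on the sums \<open>ksum\<close>
  in an algebra.\<close>

definition osum :: "(('e => complex) \<times> ('e => complex)) list => ('e => complex) => ('e => complex)" where
 "osum ps = (\<lambda>zeta\<in>Cd E. %e. (\<Sum>(xi, eta)\<leftarrow>ps. xi e * cd_inner E eta zeta (dmap E e)))"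

abbreviation valid :: "(('e => complex) \<times> ('e => complex)) list => bool" where
 "valid ps == set ps <= Cd E \<times> Cd E"

lemma osum_Nil: "osum [] = cs_zero Ad" and osum_rank: "osum [(xi, eta)] = rank_one E xi eta"
 and osum_append: "osum (ps @ qs) = osum ps +[Ad] osum qs"
 by (auto simp: osum_def rank_one_def fun_eq_iff restrict_def)

lemma osum_Cons: "zeta : Cd E ==> osum ((xi, eta) # ps) zeta = (%e. xi e * cd_inner E eta zeta (dmap E e) + osum ps zeta e)"
 by (simp add: osum_def)

lemma osum_in: "valid ps ==> zeta : Cd E ==> osum ps zeta : Cd E"
proof (induction ps)
 case (Cons p ps)
 then show ?case by (cases p) (auto simp: osum_Cons intro!: Cd_add Cd_mult_right Cd_inner)
qed (simp add: osum_Nil Cd_zero)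

lemma osum_adj: "valid ps ==> adj_pair (osum ps) (osum (map prod.swap ps))"
proof (induction ps)
 case Nil
 then show ?case by (auto simp: osum_Nil adj_pair_def Cd_zero cd_inner_def fun_eq_iff)
next
 case (Cons p ps)
 obtain xi eta where p: "p = (xi, eta)" by fastforce
 have c: "xi : Cd E" "eta : Cd E" and IH: "adj_pair (osum ps) (osum (map prod.swap ps))" using Cons p by auto
 have m: "(%e. xi e * cd_inner E eta zeta (dmap E e)) : Cd E" "(%e. eta e * cd_inner E xi zeta (dmap E e)) : Cd E" if "zeta : Cd E" for zeta
  using c that by (auto intro: Cd_mult_right Cd_inner)
 note D = adj_pairD[OF IH]
 have "cd_inner E (osum (p # ps) zeta) \<omega> v = cd_inner E zeta (osum (map prod.swap (p # ps)) \<omega>) v" if z: "zeta : Cd E" "\<omega> : Cd E" for zeta \<omega> v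
 proof -
  have "cd_inner E (osum (p # ps) zeta) \<omega> v = cnj (cd_inner E eta zeta v) * cd_inner E xi \<omega> v + cd_inner E (osum ps zeta) \<omega> v"
   using z m D(1) by (simp add: p osum_Cons inner_add_left inner_module_left)
  also have "... = cd_inner E zeta eta v * cd_inner E xi \<omega> v + cd_inner E zeta (osum (map prod.swap ps) \<omega>) v"
   using z D(3) by (simp add: inner_cnj[of E zeta eta])
  also have "... = cd_inner E zeta (osum (map prod.swap (p # ps)) \<omega>) v"
   using z m D(2) by (simp add: p osum_Cons inner_add_right inner_module_right)
  finally show ?thesis .
 qed
 moreover have "valid (map prod.swap (p # ps))" using Cons by auto
 ultimately show ?case unfolding adj_pair_def fun_eq_iff using osum_in Cons(2) by blast
qed

lemma osum_Ad: "valid ps ==> osum ps : car Ad"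
 unfolding Ad_iff using osum_adj by (auto simp: osum_def)

lemma osum_scale: "valid ps ==> c .[Ad] osum ps = osum (map (%(xi, eta). (%e. c * xi e, eta)) ps)"
proof (rule extensionalityI[of _ "Cd E"])
 fix zeta assume z: "zeta : Cd E"
 show "(c .[Ad] osum ps) zeta = osum (map (%(xi, eta). (%e. c * xi e, eta)) ps) zeta"
  by (induction ps) (use z in \<open>auto simp: osum_Nil osum_Cons fun_eq_iff algebra_simps\<close>)
qed (auto simp: osum_def)

text \<open>Composing an operator with a rank one operator only applies it to the first leg; for
  this \<open>osum ps\<close> has to commute with the right module action, which is
  \<open>mod\<close>.\<close>

lemma osum_comp:
 assumes "valid ps" "valid qs" shows "osum ps *[Ad] osum qs = osum (map (%(xi, eta). (osum ps xi, eta)) qs)"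
proof (rule extensionalityI[of _ "Cd E"])
 fix zeta assume z: "zeta : Cd E"
 have mod: "osum ps (%e. xi e * f (dmap E e)) = (%e. osum ps xi e * f (dmap E e))"
  if "xi : Cd E" "f : C0c (verts E)" for xi f
  by (induction ps) (use Cd_mult_right[OF that] that in \<open>auto simp: osum_Nil osum_Cons inner_module_right fun_eq_iff algebra_simps\<close>)
 have "osum ps (osum qs zeta) = osum (map (%(xi, eta). (osum ps xi, eta)) qs) zeta" using assms(2)
 proof (induction qs)
  case Nil
  have "osum ps (%e. 0) = (%e. 0)" using adj_scale[OF osum_adj[OF assms(1)] Cd_zero, of 0] by simp
  then show ?case using z by (simp add: osum_Nil)
 next
  case (Cons q qs)
  obtain xi eta where q: "q = (xi, eta)" by fastforce
  have c: "xi : Cd E" "eta : Cd E" "valid qs" using Cons q by auto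
  have i: "cd_inner E eta zeta : C0c (verts E)" using Cd_inner(1) c z by blast
  have "osum ps (osum (q # qs) zeta) = (%e. osum ps (%e. xi e * cd_inner E eta zeta (dmap E e)) e + osum ps (osum qs zeta) e)"
   using z by (simp add: q osum_Cons adj_add[OF osum_adj[OF assms(1)] Cd_mult_right[OF c(1) i] osum_in[OF c(3) z]])
  then show ?case using Cons(1)[OF c(3)] z by (simp add: q osum_Cons mod[OF c(1) i])
 qed
 then show "(osum ps *[Ad] osum qs) zeta = osum (map (%(xi, eta). (osum ps xi, eta)) qs) zeta" using z by simp
qed (auto simp: osum_def)

text \<open>The matrix of a finite sum of rank one operators on a fibre of \<open>d\<close>, compared with that of \<open>\<pi>\<^sub>r f\<close>.\<close>

definition kern :: "('v => complex) => (('e => complex) \<times> ('e => complex)) list => bool" where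
 "kern f ps \<longleftrightarrow> (ALL e:eds E. ALL e':eds E. dmap E e = dmap E e' -->
   (\<Sum>(xi, eta)\<leftarrow>ps. xi e * cnj (eta e')) = (if e = e' then f (rmap E e) else 0))"

lemma osum_has_sum:
 "valid ps ==> zeta : Cd E ==> ((%e'. (\<Sum>(xi, eta)\<leftarrow>ps. xi e * cnj (eta e')) * zeta e') has_sum osum ps zeta e) (fib E (dmap E e))"
proof (induction ps)
 case (Cons p ps)
 obtain xi eta where p: "p = (xi, eta)" by fastforce
 have c: "xi : Cd E" "eta : Cd E" "valid ps" using Cons p by auto
 have "((%e'. cnj (eta e') * zeta e') has_sum cd_inner E eta zeta (dmap E e)) (fib E (dmap E e))"
  unfolding cd_inner_def by (rule has_sum_infsum[OF Cd_inner(2)[OF c(2) Cons(3)]])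
 from has_sum_add[OF has_sum_cmult_right[OF this, of "xi e"] Cons(1)[OF c(3) Cons(3)]]
 show ?case using Cons(3) by (simp add: p osum_Cons algebra_simps)
qed (simp add: osum_Nil)

text \<open>By \<open>kern\<close> the matrix on each fibre is diagonal with entry
  \<open>f (rmap E e)\<close>, so a single term of the sum over the fibre survives.\<close>

lemma kern_left_action: assumes ps: "valid ps" and k: "kern f ps" shows "left_action E f = osum ps"
proof (rule extensionalityI[of _ "Cd E"])
 fix zeta assume z: "zeta : Cd E"
 have "osum ps zeta e = f (rmap E e) * zeta e" for e
 proof (cases "e : eds E")
  case True
  have "((%e'. (\<Sum>(xi, eta)\<leftarrow>ps. xi e * cnj (eta e')) * zeta e') has_sum f (rmap E e) * zeta e) {e}"
   by (rule has_sum_finiteI) (use k True in \<open>auto simp: kern_def\<close>)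
  also have "?this \<longleftrightarrow> ((%e'. (\<Sum>(xi, eta)\<leftarrow>ps. xi e * cnj (eta e')) * zeta e') has_sum f (rmap E e) * zeta e) (fib E (dmap E e))"
   by (rule has_sum_cong_neutral) (use k True in \<open>auto simp: kern_def\<close>)
  finally show ?thesis using osum_has_sum[OF ps z, of e] has_sum_unique by blast
 next
  case False
  then show ?thesis using CdD(2)[OF osum_in[OF ps z]] CdD(2)[OF z] by simp
 qed
 then show "left_action E f zeta = osum ps zeta" using z by (simp add: left_action_def fun_eq_iff)
qed (auto simp: osum_def left_action_def)

end

section \<open>Toeplitz pairs\<close>

text \<open>The value that a homomorphism \<open>\<Phi>\<close> as in \<open>ck_pair\<close> is
  forced to take at \<open>osum ps\<close>.\<close>

primrec ksum :: "'a cstar => (('e => complex) => 'a) => (('e => complex) \<times> ('e => complex)) list => 'a" where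
 "ksum A T1 [] = cs_zero A"
| "ksum A T1 (p # ps) = cs_add A (cs_mult A (T1 (fst p)) (cs_star A (T1 (snd p)))) (ksum A T1 ps)"

lemma toeplitzD:
 assumes "toeplitz_pair E A T0 T1"
 shows "star_hom (C0 (verts E)) A T0" and "xi : Cd E ==> T1 xi : car A"
  and "xi : Cd E ==> eta : Cd E ==> T1 (%e. xi e + eta e) = cs_add A (T1 xi) (T1 eta)"
  and "xi : Cd E ==> T1 (%e. c * xi e) = cs_scale A c (T1 xi)"
  and "xi : Cd E ==> eta : Cd E ==> cs_mult A (cs_star A (T1 xi)) (T1 eta) = T0 (cd_inner E xi eta)"
  and "f : C0c (verts E) ==> xi : Cd E ==> cs_mult A (T0 f) (T1 xi) = T1 (left_action E f xi)"
 using assms by (auto simp: toeplitz_pair_def)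

locale toep = tgr E + A: cs_alg A for E :: "('v, 'e) tgraph" and A :: "'a cstar" +
 fixes T0 :: "('v => complex) => 'a" and T1 :: "('e => complex) => 'a"
 assumes toep: "toeplitz_pair E A T0 T1"
begin

lemmas TD = toeplitzD[OF toep]
lemmas T0D = star_homD[OF TD(1)]

lemma T0_norm: "f : C0c (verts E) ==> nm A (T0 f) <= nm (C0 (verts E)) f"
 by (rule star_hom_contractive[OF C0_cstar A.cstar_algebra_axioms TD(1)])

lemma T1_norm: assumes x: "xi : Cd E" shows "nm A (T1 xi) <= cd_norm E xi"
proof -
 have "(nm A (T1 xi))^2 = nm A (T0 (cd_inner E xi xi))"
  using A.norm_star_mult[OF TD(2)[OF x]] TD(5)[OF x x] by simp
 also have "... <= (cd_norm E xi)^2" unfolding cd_norm_sq[OF x] by (rule T0_norm[OF CdD(3)[OF x]])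
 finally show ?thesis by (rule power2_le_imp_le[OF _ cd_norm_nonneg[OF x]])
qed

text \<open>Compatibility with the right action is a consequence of the inner product relation: for
  the two sides \<open>x\<close> and \<open>y\<close> the four products of an adjoint of one with
  either are the same \<open>T0 g\<close>, so \<open>x - y\<close> has norm 0 by the
  C*-identity.\<close>

lemma T1_right:
 assumes x: "xi : Cd E" and f: "f : C0c (verts E)"
 shows "cs_mult A (T1 xi) (T0 f) = T1 (%e. xi e * f (dmap E e))"
proof -
 let ?xf = "%e. xi e * f (dmap E e)"
 define x where "x = cs_mult A (T1 xi) (T0 f)"
 define y where "y = T1 ?xf"
 have xf: "?xf : Cd E" by (rule Cd_mult_right[OF x f])
 have c1: "T1 xi : car A" "T0 f : car A" using TD(2)[OF x] T0D(1)[OF f] by auto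
 have c: "x : car A" "y : car A" using c1 TD(2)[OF xf] by (auto simp: x_def y_def)
 have fc: "(%v. cnj (f v)) : C0c (verts E)" by (rule C0_cnj[OF f])
 define g where "g = (%v. cnj (f v) * cd_inner E xi xi v * f v)"
 have i: "cd_inner E xi xi : C0c (verts E)" by (rule CdD(3)[OF x])
 have i1: "cd_inner E xi ?xf = (%v. cd_inner E xi xi v * f v)" by (rule ext, rule inner_module_right)
 have i2: "cd_inner E ?xf xi = (%v. cnj (f v) * cd_inner E xi xi v)" by (rule ext, rule inner_module_left)
 have i3: "cd_inner E ?xf ?xf = g" unfolding g_def by (rule ext) (simp only: inner_module_left inner_module_right mult.assoc)
 have sf: "cs_star A (T0 f) = T0 (%v. cnj (f v))" using T0D(5)[OF f] by simp
 have sx: "cs_star A x = cs_mult A (T0 (%v. cnj (f v))) (cs_star A (T1 xi))" unfolding x_def using c1 by (simp add: A.star_mult sf)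
 have fc': "T0 (%v. cnj (f v)) : car A" by (rule T0D(1)[OF fc])
 have yc: "cs_mult A (cs_star A x) y = T0 g"
 proof -
  have "cs_mult A (cs_star A x) y = cs_mult A (T0 (%v. cnj (f v))) (cs_mult A (cs_star A (T1 xi)) y)"
   unfolding sx using c c1 fc' by (simp add: A.mult_assoc)
  also have "... = cs_mult A (T0 (%v. cnj (f v))) (T0 (%v. cd_inner E xi xi v * f v))"
   unfolding y_def TD(5)[OF x xf] i1 ..
  also have "... = T0 g" using T0D(4)[OF fc C0_mult[OF i f]] by (simp add: g_def mult.assoc)
  finally show ?thesis .
 qed
 have xx: "cs_mult A (cs_star A x) x = T0 g"
 proof -
  have "cs_mult A (cs_star A x) x = cs_mult A (T0 (%v. cnj (f v))) (cs_mult A (cs_mult A (cs_star A (T1 xi)) (T1 xi)) (T0 f))"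
   unfolding sx unfolding x_def using c1 fc' by (simp add: A.mult_assoc)
  also have "... = T0 g" unfolding TD(5)[OF x x] using T0D(4)[OF i f] T0D(4)[OF fc C0_mult[OF i f]] by (simp add: g_def mult.assoc)
  finally show ?thesis .
 qed
 have yx: "cs_mult A (cs_star A y) x = T0 g"
 proof -
  have "cs_mult A (cs_star A y) x = cs_mult A (cs_mult A (cs_star A (T1 ?xf)) (T1 xi)) (T0 f)"
   unfolding x_def y_def using c1 TD(2)[OF xf] by (simp add: A.mult_assoc)
  also have "... = T0 g" unfolding TD(5)[OF xf x] i2 using T0D(4)[OF C0_mult[OF fc i] f] by (simp add: g_def)
  finally show ?thesis .
 qed
 have yy: "cs_mult A (cs_star A y) y = T0 g" unfolding y_def TD(5)[OF xf xf] i3 ..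
 have gc: "T0 g : car A" using yy c A.mult_in A.star_in by metis
 have "cs_mult A (cs_star A (cs_minus A x y)) (cs_minus A x y) = cs_zero A"
 proof -
  have "cs_mult A (cs_star A (cs_minus A x y)) (cs_minus A x y) =
   cs_minus A (cs_mult A (cs_star A x) (cs_minus A x y)) (cs_mult A (cs_star A y) (cs_minus A x y))"
   using c by (simp add: A.star_minus A.mult_minus_left del: A.minus_self)
  also have "... = cs_zero A" using c gc by (simp only: A.mult_minus_right A.star_in xx yc yx yy A.minus_self A.zero_in)
  finally show ?thesis .
 qed
 then have "(nm A (cs_minus A x y))^2 = 0" using A.norm_star_mult[of "cs_minus A x y"] c by simp
 then have "cs_minus A x y = cs_zero A" using A.nm_zero_iff[of "cs_minus A x y"] c by simp
 then show ?thesis using c A.minus_eq_zero unfolding x_def y_def by blast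
qed

section \<open>The homomorphism on the compact operators\<close>

abbreviation "K == ksum A T1"

lemma K_in: "valid ps ==> K ps : car A"
 by (induction ps) (auto simp: TD)

lemma K_append: "valid ps ==> valid qs ==> K (ps @ qs) = cs_add A (K ps) (K qs)"
proof (induction ps)
 case (Cons p ps)
 then show ?case using K_in[of ps] K_in[of qs] by (auto simp: A.a_assoc TD)
qed (simp add: K_in)

lemma K_scale: "valid ps ==> cs_scale A c (K ps) = K (map (%(xi, eta). (%e. c * xi e, eta)) ps)"
proof (induction ps)
 case (Cons p ps)
 then show ?case using K_in[of ps] by (auto simp: A.scale_addR TD A.mult_scale_left)
qed simp

lemma K_star: "valid ps ==> cs_star A (K ps) = K (map prod.swap ps)"
proof (induction ps)
 case (Cons p ps)
 then show ?case using K_in[of ps] by (auto simp: A.star_add A.star_mult TD)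
qed simp

text \<open>\<open>K ps\<close> multiplies \<open>T1\<close> as \<open>osum ps\<close> acts on the
  module; the product rule \<open>K_mult\<close> mirroring \<open>osum_comp\<close> follows.\<close>

lemma K_T1: "valid ps ==> zeta : Cd E ==> cs_mult A (K ps) (T1 zeta) = T1 (osum ps zeta)"
proof (induction ps)
 case Nil
 have "T1 (%e. 0) = cs_zero A" using TD(4)[OF Cd_zero, of 0] TD(2)[OF Cd_zero] by simp
 then show ?case using Nil TD(2) by (simp add: osum_Nil)
next
 case (Cons p ps)
 obtain xi eta where p: "p = (xi, eta)" by fastforce
 have c: "xi : Cd E" "eta : Cd E" "valid ps" "zeta : Cd E" using Cons p by auto
 have i: "cd_inner E eta zeta : C0c (verts E)" using Cd_inner(1) c by blast
 have "cs_mult A (K (p # ps)) (T1 zeta) = cs_add A (cs_mult A (T1 xi) (cs_mult A (cs_star A (T1 eta)) (T1 zeta))) (cs_mult A (K ps) (T1 zeta))"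
  using c K_in[OF c(3)] by (simp add: p A.mult_add_left A.mult_assoc TD(2))
 also have "... = cs_add A (T1 (%e. xi e * cd_inner E eta zeta (dmap E e))) (T1 (osum ps zeta))"
  using c i Cons(1) by (simp add: TD(5) T1_right)
 also have "... = T1 (osum (p # ps) zeta)"
  using c by (simp add: p osum_Cons TD(3)[OF Cd_mult_right[OF c(1) i] osum_in[OF c(3,4)]])
 finally show ?case .
qed

lemma K_mult: "valid ps ==> valid qs ==> cs_mult A (K ps) (K qs) = K (map (%(xi, eta). (osum ps xi, eta)) qs)"
proof (induction qs)
 case (Cons q qs)
 obtain xi eta where q: "q = (xi, eta)" by fastforce
 have c: "xi : Cd E" "eta : Cd E" "valid qs" using Cons q by auto
 show ?case using c Cons(1,2) K_in[OF c(3)] K_in[OF Cons(2)]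
  by (simp add: q A.mult_add_right TD(2) K_T1 flip: A.mult_assoc)
qed (simp add: K_in)

lemma valid_map: "valid qs ==> (!!xi. xi : Cd E ==> S xi : Cd E) ==> valid (map (%(xi, eta). (S xi, eta)) qs)"
 by auto

text \<open>A crude bound with \<open>C\<close> the sum of the products of the norms of the legs.
  What matters is that \<open>C\<close> does not depend on \<open>S\<close>; taking powers removes
  it afterwards.\<close>

lemma K_norm_const: "valid qs ==> EX C>=0. ALL S t. (ALL xi:Cd E. S xi : Cd E & cd_norm E (S xi) <= t * cd_norm E xi) --> 0 <= t -->
  nm A (K (map (%(xi, eta). (S xi, eta)) qs)) <= C * t"
proof (induction qs)
 case (Cons q qs)
 obtain xi eta where q: "q = (xi, eta)" by fastforce
 have c: "xi : Cd E" "eta : Cd E" "valid qs" using Cons q by auto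
 obtain C where C: "C >= 0" "!!S t. (ALL xi:Cd E. S xi : Cd E & cd_norm E (S xi) <= t * cd_norm E xi) ==> 0 <= t ==>
   nm A (K (map (%(xi, eta). (S xi, eta)) qs)) <= C * t" using Cons(1)[OF c(3)] by blast
 show ?case
 proof (intro exI[of _ "cd_norm E xi * cd_norm E eta + C"] conjI allI impI)
  show "0 <= cd_norm E xi * cd_norm E eta + C" by (intro add_nonneg_nonneg mult_nonneg_nonneg cd_norm_nonneg C(1) c)
  fix S t assume S: "ALL xi:Cd E. S xi : Cd E & cd_norm E (S xi) <= t * cd_norm E xi" and t: "0 <= t"
  have Sx: "S xi : Cd E" using S c by blast
  have v: "K (map (%(xi, eta). (S xi, eta)) qs) : car A" by (rule K_in[OF valid_map[OF c(3)]]) (use S in blast)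
  have "nm A (K (map (%(xi, eta). (S xi, eta)) (q # qs))) <=
   nm A (cs_mult A (T1 (S xi)) (cs_star A (T1 eta))) + nm A (K (map (%(xi, eta). (S xi, eta)) qs))"
   using v Sx c by (simp add: q TD(2) A.nm_triangle)
  also have "... <= cd_norm E xi * cd_norm E eta * t + C * t"
  proof (intro add_mono C(2) S t)
   have "nm A (cs_mult A (T1 (S xi)) (cs_star A (T1 eta))) <= nm A (T1 (S xi)) * nm A (T1 eta)"
    using A.norm_mult[of "T1 (S xi)" "cs_star A (T1 eta)"] Sx c by (simp add: TD(2))
   also have "... <= (t * cd_norm E xi) * cd_norm E eta"
    by (intro mult_mono order_trans[OF T1_norm[OF Sx]] T1_norm mult_nonneg_nonneg t cd_norm_nonneg A.nm_nonneg TD(2) c)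
      (use S c in blast)
   finally show "nm A (cs_mult A (T1 (S xi)) (cs_star A (T1 eta))) <= cd_norm E xi * cd_norm E eta * t" by (simp add: algebra_simps)
  qed
  finally show "nm A (K (map (%(xi, eta). (S xi, eta)) (q # qs))) <= (cd_norm E xi * cd_norm E eta + C) * t"
   by (simp add: distrib_right)
 qed
qed (auto intro!: exI[of _ 0])

text \<open>With \<open>h = K ps\<^sup>* K ps\<close>, the powers \<open>h\<^sup>n\<^sup>+\<^sup>1\<close> are again such sums, with one leg moved by the \<open>n\<close>-th power of the
 operator of \<open>h\<close>. So \<open>\<parallel>h\<^sup>n\<^sup>+\<^sup>1\<parallel>\<close> grows at most like the \<open>n\<close>-th power of the operator norm; for self-adjoint \<open>h\<close>
 this bounds \<open>\<parallel>h\<parallel>\<close>.\<close>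

lemma K_bound:
 assumes ps: "valid ps" and t: "0 <= t" "!!xi. xi : Cd E ==> cd_norm E (osum ps xi) <= t * cd_norm E xi"
 shows "nm A (K ps) <= t"
proof -
 define hs where "hs = map (%(xi, eta). (osum (map prod.swap ps) xi, eta)) ps"
 have sw: "valid (map prod.swap ps)" using ps by auto
 have hs: "valid hs" unfolding hs_def by (rule valid_map[OF ps]) (rule osum_in[OF sw])
 define h where "h = K hs"
 have h: "h = cs_mult A (cs_star A (K ps)) (K ps)" unfolding h_def hs_def K_star[OF ps] K_mult[OF sw ps] ..
 have hc: "h : car A" "cs_star A h = h" using K_in[OF ps] by (simp_all add: h A.star_mult)
 have hn: "nm A h = (nm A (K ps))^2" unfolding h using A.norm_star_mult[OF K_in[OF ps]] .
 define S where "S = osum hs"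
 have S: "S xi : Cd E & cd_norm E (S xi) <= t^2 * cd_norm E xi" if x: "xi : Cd E" for xi
 proof -
  have "S xi = (osum (map prod.swap ps) *[Ad] osum ps) xi" unfolding S_def hs_def osum_comp[OF sw ps] ..
  then have e: "S xi = osum (map prod.swap ps) (osum ps xi)" using x by simp
  have "cd_norm E (osum (map prod.swap ps) (osum ps xi)) <= t * cd_norm E (osum ps xi)"
   by (rule adj_norm_le[OF osum_adj[OF ps] t osum_in[OF ps x]])
  also have "... <= t * (t * cd_norm E xi)" by (rule mult_left_mono[OF t(2)[OF x] t(1)])
  finally show ?thesis using osum_in[OF hs x] e by (simp add: S_def power2_eq_square mult.assoc)
 qed
 \<comment> \<open>There is no unit to start from, so \<open>pw n\<close> is the power of
   \<open>h\<close> with exponent \<open>n + 1\<close>, and \<open>n\<close>-fold squaring ends at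
   \<open>pw (2^n - 1)\<close>.\<close>
 define pw where "pw n = rec_nat h (%_ y. cs_mult A y h) n" for n
 have pw0: "pw 0 = h" and pwS: "pw (Suc n) = cs_mult A (pw n) h" for n by (simp_all add: pw_def)
 have pwc: "pw n : car A" for n by (induction n) (use hc in \<open>simp_all add: pw0 pwS\<close>)
 have Sn: "(S ^^ n) xi : Cd E & cd_norm E ((S ^^ n) xi) <= (t^2)^n * cd_norm E xi" if x: "xi : Cd E" for n xi
 proof (induction n)
  case (Suc n)
  have "cd_norm E (S ((S ^^ n) xi)) <= t^2 * cd_norm E ((S ^^ n) xi)" using S Suc by blast
  also have "... <= t^2 * ((t^2)^n * cd_norm E xi)" using Suc by (intro mult_left_mono) auto
  finally show ?case using S Suc by (simp add: mult.assoc)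
 qed (use x in simp)
 have pwK: "pw n = K (map (%(xi, eta). ((S ^^ n) xi, eta)) hs)" for n
 proof (induction n)
  case 0 then show ?case by (simp add: pw0 h_def case_prod_unfold)
 next
  case (Suc n)
  have v: "valid (map (%(xi, eta). ((S ^^ n) xi, eta)) hs)" by (rule valid_map[OF hs]) (use Sn in blast)
  have hp: "cs_mult A h (pw n) = cs_mult A (pw n) h" for n
   by (induction n) (use pwc hc in \<open>simp_all add: pw0 pwS A.mult_assoc[symmetric]\<close>)
  have "pw (Suc n) = cs_mult A (K hs) (K (map (%(xi, eta). ((S ^^ n) xi, eta)) hs))"
   using hp[of n] by (simp add: pwS Suc[symmetric] h_def[symmetric])
  also have "... = K (map (%(xi, eta). (osum hs xi, eta)) (map (%(xi, eta). ((S ^^ n) xi, eta)) hs))" by (rule K_mult[OF hs v])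
  finally show ?case by (simp add: S_def case_prod_unfold o_def)
 qed
 obtain C where C: "C >= 0" "!!S t. (ALL xi:Cd E. S xi : Cd E & cd_norm E (S xi) <= t * cd_norm E xi) ==> 0 <= t ==>
   nm A (K (map (%(xi, eta). (S xi, eta)) hs)) <= C * t" using K_norm_const[OF hs] by blast
 have pwn: "nm A (pw n) <= C * (t^2)^n" for n
  unfolding pwK by (rule C(2)) (use Sn in auto)
 have dbl: "cs_mult A (pw m) (pw n) = pw (Suc (m + n))" for m n
  by (induction n) (use pwc hc in \<open>simp_all add: pw0 pwS A.mult_assoc[symmetric]\<close>)
 have sq: "((%x. cs_mult A x x) ^^ n) h = pw (2^n - 1)" for n
 proof (induction n)
  case (Suc n)
  have "(1::nat) <= 2^n" by simp
  then have "Suc ((2^n - 1) + (2^n - 1)) = 2 ^ Suc n - (1::nat)" unfolding power_Suc by arith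
  then show ?case using dbl[of "2^n - 1" "2^n - 1"] Suc by simp
 qed (simp add: pw0)
 \<comment> \<open>A strictly larger \<open>s\<close> is positive even if \<open>t = 0\<close>; the
   constant \<open>C / s\<close> absorbs the shift of the exponent by one.\<close>
 have "nm A h <= s" if s: "s > t^2" for s
 proof (rule le_of_power_le)
  have sp: "s > 0" using s zero_le_power2[of t] by linarith
  then show "0 <= s" by simp
  show "nm A h ^ 2 ^ n <= C / s * s ^ 2 ^ n" for n
  proof -
   have "nm A h ^ 2 ^ n = nm A (pw (2^n - 1))" using A.norm_iterated_square[OF hc, of n] sq[of n] by simp
   also have "... <= C * (t^2)^(2^n - 1)" by (rule pwn)
   also have "... <= C * s^(2^n - 1)" using C(1) s by (intro mult_left_mono power_mono) auto
   also have "... = C / s * s ^ 2 ^ n" using sp power_minus_mult[of "2^n" s] by (simp add: field_simps)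
   finally show ?thesis .
  qed
 qed
 then have "nm A h <= t^2" by (rule dense_ge)
 then show ?thesis unfolding hn by (rule power2_le_imp_le[OF _ t(1)])
qed

lemma K_opnorm: "valid ps ==> nm A (K ps) <= nm Ad (osum ps)"
 by (rule K_bound) (use opn_props[OF osum_Ad] in auto)

text \<open>One operator may be represented by several lists. That \<open>K ps\<close> depends only
  on \<open>osum ps\<close> is part of the bound \<open>K_opnorm\<close>, hence the relational
  form.\<close>

definition spanrel :: "(('e => complex) => ('e => complex)) => 'a => bool" where
 "spanrel x y \<longleftrightarrow> (EX ps. valid ps & x = osum ps & y = K ps)"

lemma valid_append: "valid (ps @ qs) \<longleftrightarrow> valid ps & valid qs" by auto

sublocale R: dense_map Ad A spanrel 1
proof
 fix x y assume xy: "spanrel x y"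
 then obtain ps where ps: "valid ps" "x = osum ps" "y = K ps" by (auto simp: spanrel_def)
 show "x : car Ad & y : car A" using osum_Ad K_in ps by auto
 show "nm A y <= 1 * nm Ad x" using K_opnorm ps by simp
 show "spanrel (c .[Ad] x) (c .[A] y)" for c
  unfolding spanrel_def ps using osum_scale[OF ps(1)] K_scale[OF ps(1)] ps(1) valid_map[OF ps(1), of "%xi e. c * xi e"] Cd_scale by blast
 fix x' y' assume "spanrel x' y'"
 then obtain qs where qs: "valid qs" "x' = osum qs" "y' = K qs" by (auto simp: spanrel_def)
 show "spanrel (x +[Ad] x') (y +[A] y')"
  unfolding spanrel_def ps qs using osum_append K_append[OF ps(1) qs(1)] ps(1) qs(1) valid_append by metis
next
 show "!!tau. cs_cauchy A tau ==> EX y. cs_lim A tau y" by (rule A.cauchy_lim)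
qed

abbreviation "LR == lim_rel Ad A spanrel"

lemma LR_mult: assumes "LR x y" "LR x' y'" shows "LR (x *[Ad] x') (y *[A] y')"
proof -
 obtain sg tau where s: "!!n. spanrel (sg n) (tau n)" "cs_lim Ad sg x" "cs_lim A tau y" using assms(1) by (auto simp: lim_rel_def)
 obtain sg' tau' where s': "!!n. spanrel (sg' n) (tau' n)" "cs_lim Ad sg' x'" "cs_lim A tau' y'" using assms(2) by (auto simp: lim_rel_def)
 have "spanrel (sg n *[Ad] sg' n) (tau n *[A] tau' n)" for n
 proof -
  obtain ps qs where ps: "valid ps" "sg n = osum ps" "tau n = K ps" and qs: "valid qs" "sg' n = osum qs" "tau' n = K qs"
   using s(1)[of n] s'(1)[of n] by (auto simp: spanrel_def)
  show ?thesis unfolding spanrel_def ps qs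
   using osum_comp[OF ps(1) qs(1)] K_mult[OF ps(1) qs(1)] valid_map[OF qs(1), of "osum ps"] osum_in[OF ps(1)] by blast
 qed
 then show ?thesis unfolding lim_rel_def
  by (intro exI[of _ "%n. sg n *[Ad] sg' n"] exI[of _ "%n. tau n *[A] tau' n"] conjI allI
    Ad_lim_mult[OF s(2) s'(2)] A.cs_lim_mult[OF s(3) s'(3)])
qed

lemma LR_star: assumes "LR x y" shows "LR (cs_star Ad x) (cs_star A y)"
proof -
 obtain sg tau where s: "!!n. spanrel (sg n) (tau n)" "cs_lim Ad sg x" "cs_lim A tau y" using assms(1) by (auto simp: lim_rel_def)
 have "spanrel (cs_star Ad (sg n)) (cs_star A (tau n))" for n
 proof -
  obtain ps where ps: "valid ps" "sg n = osum ps" "tau n = K ps" using s(1)[of n] by (auto simp: spanrel_def)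
  have "cs_star Ad (osum ps) = restrict (osum (map prod.swap ps)) (Cd E)"
   by (rule Ad_star[OF osum_adj[OF ps(1)]]) (simp add: osum_def)
  then have "cs_star Ad (osum ps) = osum (map prod.swap ps)" by (simp add: osum_def)
  moreover have "valid (map prod.swap ps)" using ps(1) by auto
  ultimately show ?thesis unfolding spanrel_def ps using K_star[OF ps(1)] by blast
 qed
 then show ?thesis unfolding lim_rel_def
  by (intro exI[of _ "%n. cs_star Ad (sg n)"] exI[of _ "%n. cs_star A (tau n)"] conjI allI Ad_lim_star[OF s(2)] A.cs_lim_star[OF s(3)])
qed

text \<open>The finite sums form a subspace, so their closure is a closed subspace containing all
  rank one operators and therefore all compact ones.\<close>

lemma compact_LR: assumes x: "x : car (compact_ops E)" shows "EX y. LR x y"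
proof -
 let ?D = "{osum ps | ps. valid ps}"
 have sub: "?D <= car Ad" using osum_Ad by blast
 have "closed_subspace Ad (cs_topology Ad closure_of ?D)"
 proof (rule Ad.closed_subspace_closure[OF sub])
  show "cs_zero Ad : ?D" using osum_Nil by (intro CollectI exI[of _ "[]"]) (simp del: Ad_simps)
  fix x y assume "x : ?D" "y : ?D"
  then obtain ps qs where "valid ps" "x = osum ps" "valid qs" "y = osum qs" by blast
  then show "x +[Ad] y : ?D" using osum_append[of ps qs] valid_append[of ps qs] by (intro CollectI exI[of _ "ps @ qs"]) (simp del: Ad_simps)
 next
  fix c x assume "x : ?D"
  then obtain ps where ps: "valid ps" "x = osum ps" by blast
  then show "c .[Ad] x : ?D" using osum_scale[OF ps(1), of c] valid_map[OF ps(1), of "%xi e. c * xi e"] Cd_scale by blast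
 qed
 moreover have "{rank_one E xi eta | xi eta. xi : Cd E & eta : Cd E} <= cs_topology Ad closure_of ?D"
 proof -
  have "{rank_one E xi eta | xi eta. xi : Cd E & eta : Cd E} <= ?D"
  proof
   fix z assume "z : {rank_one E xi eta | xi eta. xi : Cd E & eta : Cd E}"
   then obtain xi eta where "xi : Cd E" "eta : Cd E" "z = rank_one E xi eta" by blast
   then show "z : ?D" using osum_rank[of xi eta] by (intro CollectI exI[of _ "[(xi, eta)]"]) simp
  qed
  also have "?D <= cs_topology Ad closure_of ?D"
   by (rule closure_of_subset) (use sub in \<open>simp add: Ad.cs_topology_eq\<close>)
  finally show ?thesis .
 qed
 ultimately have "x : cs_topology Ad closure_of ?D" using x unfolding compact_ops_def closed_span_def by auto
 then obtain sg where s: "!!n. sg n : ?D" "cs_lim Ad sg x" using Ad.closure_of_seq_iff[OF sub] by blast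
 show ?thesis
 proof (rule R.lim_rel_exists[OF _ s(2)])
  show "EX y. spanrel (sg n) y" for n using s(1)[of n] unfolding spanrel_def by blast
 qed
qed

definition Phi :: "(('e => complex) => ('e => complex)) => 'a" where
 "Phi x = (THE y. LR x y)"

lemma Phi_eq: "LR x y ==> Phi x = y"
 unfolding Phi_def using R.lim_rel_unique by blast

lemma Phi_LR: "x : car (compact_ops E) ==> LR x (Phi x)"
 using compact_LR Phi_eq by metis

lemma compact_simps: "cs_add (compact_ops E) = cs_add Ad" "cs_scale (compact_ops E) = cs_scale Ad"
 "cs_mult (compact_ops E) = cs_mult Ad" "cs_star (compact_ops E) = cs_star Ad"
 by (simp_all add: compact_ops_def)

lemma Phi_hom: "star_hom (compact_ops E) A Phi"
 unfolding star_hom_def compact_simps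
proof (intro conjI ballI allI funcsetI)
 fix x assume x: "x : car (compact_ops E)"
 note l = Phi_LR[OF x]
 show "Phi x : car A" using R.lim_rel_in[OF l] by blast
 show "Phi (c .[Ad] x) = c .[A] Phi x" for c by (rule Phi_eq[OF R.lim_rel_scale[OF l]])
 show "Phi (cs_star Ad x) = cs_star A (Phi x)" by (rule Phi_eq[OF LR_star[OF l]])
 fix y assume y: "y : car (compact_ops E)"
 note l' = Phi_LR[OF y]
 show "Phi (x +[Ad] y) = Phi x +[A] Phi y" by (rule Phi_eq[OF R.lim_rel_add[OF l l']])
 show "Phi (x *[Ad] y) = Phi x *[A] Phi y" by (rule Phi_eq[OF LR_mult[OF l l']])
qed

lemma Phi_rank: assumes "xi : Cd E" "eta : Cd E" shows "Phi (rank_one E xi eta) = T1 xi *[A] cs_star A (T1 eta)"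
proof (rule Phi_eq[OF R.lim_relI])
 have "K [(xi, eta)] = T1 xi *[A] cs_star A (T1 eta)" using assms by (simp add: TD)
 then show "spanrel (rank_one E xi eta) (T1 xi *[A] cs_star A (T1 eta))"
  unfolding spanrel_def using assms osum_rank[of xi eta] by (intro exI[of _ "[(xi, eta)]"]) simp
qed

lemma left_action_Ad: assumes f: "f : C0c (verts E)" shows "left_action E f : car Ad"
proof -
 have "adj_pair (left_action E f) (left_action E (%v. cnj (f v)))"
  using Cd_mult_left[OF _ f] Cd_mult_left[OF _ C0_cnj[OF f]]
  by (auto simp: adj_pair_def left_action_def cd_inner_def fun_eq_iff mult_ac)
 then show ?thesis unfolding Ad_iff by (auto simp: left_action_def)
qed

lemma left_action_norm:
 assumes f: "f : C0c (verts E)" and c: "0 <= c" "!!v. cmod (f v) <= c" shows "nm Ad (left_action E f) <= c"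
proof (rule opn_le[OF c(1)])
 fix xi assume x: "xi : Cd E"
 show "cd_norm E (left_action E f xi) <= c * cd_norm E xi"
 proof (rule cd_norm_le)
  show "0 <= c * cd_norm E xi" using c cd_norm_nonneg[OF x] by simp
  fix v
  have "sqn E (left_action E f xi) v <= c^2 * sqn E xi v" unfolding sqn_def infsum_cmult_right'[symmetric]
  proof (rule infsum_mono)
   show "(%e. (cmod (left_action E f xi e))^2) summable_on fib E v"
    by (rule Cd_summable[OF Ad_in[OF left_action_Ad[OF f] x]])
   show "(%e. c^2 * (cmod (xi e))^2) summable_on fib E v" by (rule summable_on_cmult_right[OF Cd_summable[OF x]])
   show "(cmod (left_action E f xi e))^2 <= c^2 * (cmod (xi e))^2" for e
    using c x by (auto simp: left_action_def norm_mult power_mult_distrib intro!: mult_right_mono power_mono)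
  qed
  also have "... <= c^2 * (cd_norm E xi)^2" by (intro mult_left_mono sqn_le x) simp
  finally show "sqn E (left_action E f xi) v <= (c * cd_norm E xi)^2" by (simp add: power_mult_distrib)
 qed
qed

text \<open>Both sides of the Cuntz-Krieger equation are continuous in \<open>f\<close>. It suffices
  to have it for approximants whose left action is a finite sum, where it becomes an equation
  between elements of \<open>A\<close>.\<close>

lemma ck_pairI:
 assumes sub: "C0c (subtopology (verts E) (E_rg E)) <= C0c (verts E)"
  and approx: "!!f eps. f : C0c (subtopology (verts E) (E_rg E)) ==> eps > 0 ==>
   EX f' ps. f' : C0c (verts E) & (ALL v. cmod (f' v - f v) <= eps) & valid ps & kern f' ps & T0 f' = K ps"
 shows "ck_pair E A T0 T1"
 unfolding ck_pair_def
proof (intro conjI exI[of _ Phi] ballI toep Phi_hom Phi_rank)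
 fix f assume f: "f : C0c (subtopology (verts E) (E_rg E))"
 then have fc: "f : C0c (verts E)" using sub by blast
 have "EX f' ps. f' : C0c (verts E) & (ALL v. cmod (f' v - f v) <= inverse (real (Suc n))) & valid ps & kern f' ps & T0 f' = K ps" for n
  by (rule approx[OF f]) simp
 then obtain F ps where F: "!!n. F n : C0c (verts E)" "!!n v. cmod (F n v - f v) <= inverse (real (Suc n))"
  "!!n. valid (ps n)" "!!n. kern (F n) (ps n)" "!!n. T0 (F n) = K (ps n)" by metis
 have d: "(%v. F n v - f v) : C0c (verts E)" for n
  using C0_add[OF F(1) C0_scale[OF fc, of "-1"], of n] by simp
 have la: "left_action E (F n) = osum (ps n)" for n by (rule kern_left_action[OF F(3,4)])
 have "(%n. nm Ad (left_action E (F n) -[Ad] left_action E f)) \<longlonglongrightarrow> 0"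
 proof (rule Lim_null_comparison[OF _ LIMSEQ_inverse_real_of_nat])
  have e: "left_action E (F n) -[Ad] left_action E f = left_action E (%v. F n v - f v)" for n
   by (auto simp: left_action_def fun_eq_iff algebra_simps)
  have "nm Ad (left_action E (%v. F n v - f v)) <= inverse (real (Suc n))" for n
   by (rule left_action_norm[OF d _ F(2)]) simp
  moreover have "0 <= nm Ad (left_action E (%v. F n v - f v))" for n by (rule opn_props(1)[OF left_action_Ad[OF d]])
  ultimately show "\<forall>\<^sub>F n in sequentially. norm (nm Ad (left_action E (F n) -[Ad] left_action E f)) <= inverse (real (Suc n))"
   unfolding e by simp
 qed
 then have 1: "cs_lim Ad (%n. osum (ps n)) (left_action E f)"
  using left_action_Ad F(1) fc unfolding cs_lim_def la[symmetric] by blast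
 have "cs_lim (C0 (verts E)) F f"
 proof -
  have "(%n. nm (C0 (verts E)) (F n -[C0 (verts E)] f)) \<longlonglongrightarrow> 0"
  proof (rule Lim_null_comparison[OF _ LIMSEQ_inverse_real_of_nat])
   have "nm (C0 (verts E)) (F n -[C0 (verts E)] f) <= inverse (real (Suc n))" for n
    using F(2) by (intro C0_norm_le) auto
   moreover have "0 <= nm (C0 (verts E)) (F n -[C0 (verts E)] f)" for n using C0_norm_nonneg[OF d] by simp
   ultimately show "\<forall>\<^sub>F n in sequentially. norm (nm (C0 (verts E)) (F n -[C0 (verts E)] f)) <= inverse (real (Suc n))" by simp
  qed
  then show ?thesis using F(1) fc by (simp add: cs_lim_def)
 qed
 from star_hom_lim[OF C0_cstar A.cstar_algebra_axioms TD(1) this]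
 have 2: "cs_lim A (%n. K (ps n)) (T0 f)" by (simp add: F(5))
 have "LR (left_action E f) (T0 f)" unfolding lim_rel_def
  using 1 2 F(3) by (intro exI[of _ "%n. osum (ps n)"] exI[of _ "%n. K (ps n)"]) (auto simp: spanrel_def)
 then show "T0 f = Phi (left_action E f)" using Phi_eq by simp
qed

end

lemma (in tgr) ck_pair_ksum:
 assumes A: "cstar_algebra A" and ck: "ck_pair E A T0 T1" and f: "f : C0c (subtopology (verts E) (E_rg E))"
  and ps: "valid ps" and k: "kern f ps"
 shows "T0 f = ksum A T1 ps"
proof -
 interpret toep E A T0 T1 using ck A by unfold_locales (auto simp: ck_pair_def cstar_algebra_def)
 obtain \<Phi> where P: "star_hom (compact_ops E) A \<Phi>" "!!xi eta. xi : Cd E ==> eta : Cd E ==> \<Phi> (rank_one E xi eta) = T1 xi *[A] cs_star A (T1 eta)"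
  "T0 f = \<Phi> (left_action E f)" using ck f by (auto simp: ck_pair_def)
 note PD = star_homD[OF P(1), unfolded compact_simps]
 have gen: "x : car (compact_ops E)" if "!!W. closed_subspace Ad W ==> {rank_one E xi eta | xi eta. xi : Cd E & eta : Cd E} <= W ==> x : W" for x
  using that by (auto simp: compact_ops_def closed_span_def)
 have z: "cs_zero Ad : car (compact_ops E)" by (rule gen) (simp add: closed_subspace_def)
 have r: "rank_one E xi eta : car (compact_ops E)" if "xi : Cd E" "eta : Cd E" for xi eta by (rule gen) (use that in blast)
 have a: "x +[Ad] y : car (compact_ops E)" if "x : car (compact_ops E)" "y : car (compact_ops E)" for x y
 proof (rule gen)
  fix W assume W: "closed_subspace Ad W" "{rank_one E xi eta | xi eta. xi : Cd E & eta : Cd E} <= W"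
  then have "x : W" "y : W" using that by (auto simp: compact_ops_def closed_span_def)
  then show "x +[Ad] y : W" using W(1) by (auto simp: closed_subspace_def)
 qed
 have "osum ps : car (compact_ops E) & \<Phi> (osum ps) = K ps" using ps
 proof (induction ps)
  case Nil
  have "0 .[Ad] cs_zero Ad = cs_zero Ad" by (rule Ad.scale_zero)
  then have "\<Phi> (cs_zero Ad) = 0 .[A] \<Phi> (cs_zero Ad)" using PD(3)[OF z, of 0] by metis
  then show ?case using z PD(1)[OF z] by (simp add: osum_Nil del: Ad_simps)
 next
  case (Cons p ps)
  obtain xi eta where p: "p = (xi, eta)" by fastforce
  have c: "xi : Cd E" "eta : Cd E" "valid ps" using Cons p by auto
  have e: "osum (p # ps) = rank_one E xi eta +[Ad] osum ps" using osum_append[of "[p]" ps] osum_rank by (simp add: p del: Ad_simps)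
  show ?case unfolding e using Cons(1)[OF c(3)] a r[OF c(1,2)] PD(2)[OF r[OF c(1,2)]] P(2)[OF c(1,2)] by (simp add: p del: Ad_simps)
 qed
 then show ?thesis using P(3) kern_left_action[OF ps k] by simp
qed

section \<open>Cuntz-Krieger pairs\<close>

text \<open>Extension by zero. A closed set missing 0 has a preimage that is compact in
  \<open>U\<close>, hence closed in the Hausdorff space \<open>X\<close>; one containing 0 has a
  preimage whose complement is open in \<open>U\<close>, hence in \<open>X\<close>.\<close>

lemma C0_subtopology:
 assumes X: "Hausdorff_space X" and U: "openin X U" and f: "f : C0c (subtopology X U)"
 shows "f : C0c X"
proof -
 have top: "topspace (subtopology X U) = U" using U openin_subset by fastforce
 have comp: "compactin X {x : U. eps <= cmod (f x)}" if "eps > 0" for eps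
  using C0_level[OF f that] unfolding top compactin_subtopology by blast
 have off: "f x = 0" if "x ~: U" for x using C0_off[OF f] top that by blast
 have Ut: "U <= topspace X" by (rule openin_subset[OF U])
 have "closedin X {x : topspace X. f x : C}" if C: "closed C" for C
 proof (cases "0 : C")
  case True
  have "openin (subtopology X U) {x : topspace (subtopology X U). f x : - C}"
   using openin_continuous_map_preimage[OF C0_cont[OF f], of "- C"] C by (simp add: open_Compl)
  then have "openin X {x : U. f x : - C}" unfolding top using openin_trans_full U by blast
  moreover have "topspace X - {x : topspace X. f x : C} = {x : U. f x : - C}"
  proof -
   have "f x : C" if "x ~: U" for x using off[OF that] True by simp
   then show ?thesis using Ut by blast
  qed
  ultimately show ?thesis unfolding closedin_def by auto
 next
  case False
  then obtain e where e: "e > 0" "!!y. y : C ==> e <= cmod y" using C separate_point_closed[of C 0] by auto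
  have "closedin (subtopology X U) {x : topspace (subtopology X U). f x : C}"
   using closedin_continuous_map_preimage[OF C0_cont[OF f]] C by simp
  then have "compactin (subtopology X U) {x : U. f x : C}"
   using closed_compactin[OF C0_level[OF f e(1)], of "{x : U. f x : C}"] e(2) unfolding top by auto
  then have "compactin X {x : U. f x : C}" by (simp add: compactin_subtopology)
  then have "closedin X {x : U. f x : C}" using X compactin_imp_closedin by blast
  moreover have "{x : topspace X. f x : C} = {x : U. f x : C}"
  proof -
   have "f x ~: C" if "x ~: U" for x using off[OF that] False by simp
   then show ?thesis using Ut by blast
  qed
  ultimately show ?thesis by simp
 qed
 then have c: "continuous_map X euclidean f" unfolding continuous_map_closedin by auto
 show ?thesis
 proof (rule C0_I[OF c])
  show "f x = 0" if "x ~: topspace X" for x using off Ut that by blast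
  fix eps :: real assume "eps > 0"
  then show "EX K. compactin X K & (ALL x:topspace X. eps <= cmod (f x) --> x : K)"
   using comp[of eps] off by (intro exI[of _ "{x : U. eps <= cmod (f x)}"]) force
 qed
qed

lemma C0_subtopologyI:
 assumes X: "Hausdorff_space X" and f: "f : C0c X" and K: "compactin X K" "K <= U" and off: "!!x. x ~: K ==> f x = 0"
 shows "f : C0c (subtopology X U)"
proof (rule C0_I)
 show "continuous_map (subtopology X U) euclidean f" by (rule continuous_map_from_subtopology[OF C0_cont[OF f]])
 show "f x = 0" if "x ~: topspace (subtopology X U)" for x
  using off that K compactin_subset_topspace[OF K(1)] by auto
 fix eps :: real assume "eps > 0"
 then show "EX K. compactin (subtopology X U) K & (ALL x:topspace (subtopology X U). eps <= cmod (f x) --> x : K)"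
  using K off by (intro exI[of _ K]) (force simp: compactin_subtopology)
qed

section \<open>Regular vertices and finite rank left actions\<close>

context tgr
begin

lemma E_fin_open: "openin (verts E) (E_fin E)"
proof (subst openin_subopen, intro ballI)
 fix v assume "v : E_fin E"
 then obtain U V where U: "openin (verts E) U" "v : U" "U <= V" "V <= vts E"
  "compactin (edges E) {e : eds E. rmap E e : V}" by (auto simp: E_fin_def)
 then have "U <= E_fin E" by (auto simp: E_fin_def)
 then show "EX T. openin (verts E) T & v : T & T <= E_fin E" using U by blast
qed

lemma E_rg_open: "openin (verts E) (E_rg E)"
 unfolding E_rg_def by (intro openin_diff E_fin_open) simp

lemma E_rg_fin: "E_rg E <= E_fin E"
 by (auto simp: E_rg_def)

text \<open>Finitely many of the neighbourhoods witnessing \<open>E_fin\<close> cover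
  \<open>K\<close>, and the preimage is closed in the union of theirs.\<close>

lemma r_preimage_compact:
 assumes K: "compactin (verts E) K" "K <= E_fin E"
 shows "compactin (edges E) {e : eds E. rmap E e : K}"
proof -
 define good where "good v U V \<longleftrightarrow> openin (verts E) U & v : U & U <= V &
  compactin (edges E) {e : eds E. rmap E e : V}" for v U V
 have "EX U V. good v U V" if "v : K" for v
 proof -
  have "v : E_fin E" using K(2) that by blast
  then show ?thesis unfolding E_fin_def good_def by blast
 qed
 then obtain U V where "!!v. v : K ==> good v (U v) (V v)" by metis
 then have UV: "!!v. v : K ==> openin (verts E) (U v)" "!!v. v : K ==> v : U v" "!!v. v : K ==> U v <= V v"
  "!!v. v : K ==> compactin (edges E) {e : eds E. rmap E e : V v}" by (simp_all add: good_def)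
 have cov: "K <= (\<Union>v\<in>K. U v)" using UV(2) by blast
 obtain I where I: "finite I" "I <= K" "K <= (\<Union>v\<in>I. U v)"
  by (rule compactin_indexed_cover[OF K(1) UV(1) cov])
 have "closedin (verts E) K" using compactin_imp_closedin[OF verts_LCH(2) K(1)] .
 then have cl: "closedin (edges E) {e : eds E. rmap E e : K}" by (rule closedin_continuous_map_preimage[OF r_cont])
 have co: "compactin (edges E) (\<Union>v\<in>I. {e : eds E. rmap E e : V v})"
 proof (rule compactin_Union)
  show "finite ((%v. {e : eds E. rmap E e : V v}) ` I)" using I(1) by simp
  fix S assume "S : (%v. {e : eds E. rmap E e : V v}) ` I"
  then obtain v where v: "v : I" "S = {e : eds E. rmap E e : V v}" by blast
  then have "v : K" using I(2) by blast
  then show "compactin (edges E) S" unfolding v(2) by (rule UV(4))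
 qed
 have "{e : eds E. rmap E e : K} <= (\<Union>v\<in>I. {e : eds E. rmap E e : V v})"
 proof
  fix e assume e: "e : {e : eds E. rmap E e : K}"
  then obtain v where v: "v : I" "rmap E e : U v" using I(3) by blast
  then have "rmap E e : V v" using UV(3)[of v] I(2) by blast
  then show "e : (\<Union>v\<in>I. {e : eds E. rmap E e : V v})" using v e by blast
 qed
 then show ?thesis by (rule closed_compactin[OF co _ cl])
qed

text \<open>With a partition of unity \<open>k i\<close> on the compact preimage of \<open>K\<close>
  under \<open>rmap E\<close>, the legs are the square root of \<open>k i\<close> and its product
  with \<open>f (rmap E e)\<close>. Diagonal entries add up to \<open>f (rmap E e)\<close>;
  off-diagonal ones vanish because a chart contains at most one edge of a fibre.\<close>

lemma kern_exists:
 assumes f: "f : C0c (verts E)" and K: "compactin (verts E) K" "K <= E_fin E" and off: "!!v. v ~: K ==> f v = 0"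
 shows "EX ps. valid ps & kern f ps"
proof -
 obtain I :: "'e set" and k :: "'e => 'e => real" and U D where k: "finite I"
  "!!i. i : I ==> continuous_map (edges E) euclideanreal (k i)" "!!i e. i : I ==> 0 <= k i e"
  "!!i. i : I ==> chart E (U i)" "!!i. i : I ==> compactin (edges E) (D i)" "!!i. i : I ==> D i <= U i"
  "!!i e. i : I ==> e ~: D i ==> k i e = 0"
  "!!e. e : {e : eds E. rmap E e : K} ==> (\<Sum>i\<in>I. k i e) = 1"
  by (rule partition_of_unity[OF r_preimage_compact[OF K]], rule that, assumption+)
 obtain xs where xs: "set xs = I" "distinct xs" using finite_distinct_list[OF k(1)] by blast
 define p where "p i e = complex_of_real (sqrt (k i e))" for i e
 have pC: "p i : Cd E" if i: "i : I" for i
 proof (rule Cd_Cc[OF k(5)[OF i]])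
  show "continuous_map (edges E) euclidean (p i)" unfolding p_def[abs_def] by (intro cont_of_real continuous_map_sqrt k i)
 qed (simp add: p_def k(7)[OF i])
 define ps where "ps = map (%i. (%e. f (rmap E e) * p i e, p i)) xs"
 have "valid ps" unfolding ps_def using pC xs Cd_mult_left[OF _ f] by auto
 moreover have "kern f ps" unfolding kern_def
 proof (intro ballI impI)
  fix e e' assume e: "e : eds E" "e' : eds E" "dmap E e = dmap E e'"
  have s: "(\<Sum>(xi, eta)\<leftarrow>ps. xi e * cnj (eta e')) = (\<Sum>i\<in>I. f (rmap E e) * p i e * cnj (p i e'))"
   unfolding ps_def using xs by (simp add: o_def sum_list_distinct_conv_sum_set)
  show "(\<Sum>(xi, eta)\<leftarrow>ps. xi e * cnj (eta e')) = (if e = e' then f (rmap E e) else 0)"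
  proof (cases "e = e'")
   case True
   have "p i e * cnj (p i e) = complex_of_real (k i e)" if "i : I" for i
    using k(3)[OF that] unfolding p_def by (simp flip: of_real_mult)
   then have "(\<Sum>i\<in>I. f (rmap E e) * p i e * cnj (p i e)) = f (rmap E e) * complex_of_real (\<Sum>i\<in>I. k i e)"
    by (simp add: sum_distrib_left mult.assoc)
   also have "... = f (rmap E e)" using k(8)[of e] e off by (cases "rmap E e : K") auto
   finally show ?thesis using s True by simp
  next
   case False
   have "p i e * cnj (p i e') = 0" if i: "i : I" for i
   proof -
    have "k i e = 0 | k i e' = 0"
     using chart_inj[OF k(4)[OF i]] k(6)[OF i] k(7)[OF i] e False unfolding inj_on_def by blast
    then show ?thesis by (auto simp: p_def)
   qed
   then have "(\<Sum>i\<in>I. f (rmap E e) * p i e * cnj (p i e')) = 0"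
    unfolding mult.assoc by (intro sum.neutral ballI) simp
   then show ?thesis using s False by simp
  qed
 qed
 ultimately show ?thesis by blast
qed

lemma C0_rg: "f : C0c (subtopology (verts E) (E_rg E)) ==> f : C0c (verts E)"
 by (rule C0_subtopology[OF verts_LCH(2) E_rg_open])

lemma C0_rg_dense:
 assumes f: "f : C0c (subtopology (verts E) (E_rg E))" and e: "eps > 0"
 obtains f' K where "f' : C0c (subtopology (verts E) (E_rg E))" "!!v. cmod (f' v - f v) <= eps"
  "compactin (verts E) K" "K <= E_rg E" "!!v. v ~: K ==> f' v = 0"
proof -
 obtain g where g: "g : C0c (subtopology (verts E) (E_rg E))" "!!v. cmod (g v - f v) <= eps"
  "!!v. g v ~= 0 ==> v : topspace (subtopology (verts E) (E_rg E)) & eps <= cmod (f v)" using C0_cutoff[OF f e] by blast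
 let ?K = "{v : topspace (subtopology (verts E) (E_rg E)). eps <= cmod (f v)}"
 have "compactin (verts E) ?K & ?K <= E_rg E" using C0_level[OF f e] unfolding compactin_subtopology by blast
 then show thesis using that[of g ?K] g by blast
qed

text \<open>Trades the existence of \<open>\<Phi>\<close> for equations between elements of
  \<open>A\<close>. In this form the condition passes to generated subalgebras, to products and
  along regular factor maps.\<close>

lemma ck_iff:
 assumes A: "cstar_algebra A"
 shows "ck_pair E A T0 T1 \<longleftrightarrow> toeplitz_pair E A T0 T1 &
  (ALL f:C0c (subtopology (verts E) (E_rg E)). ALL ps. valid ps --> kern f ps --> T0 f = ksum A T1 ps)"
proof
 assume "ck_pair E A T0 T1"
 then show "toeplitz_pair E A T0 T1 & (ALL f:C0c (subtopology (verts E) (E_rg E)). ALL ps. valid ps --> kern f ps --> T0 f = ksum A T1 ps)"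
  using ck_pair_ksum[OF A] by (auto simp: ck_pair_def)
next
 assume a: "toeplitz_pair E A T0 T1 & (ALL f:C0c (subtopology (verts E) (E_rg E)). ALL ps. valid ps --> kern f ps --> T0 f = ksum A T1 ps)"
 interpret toep E A T0 T1 using a A by unfold_locales (auto simp: cstar_algebra_def)
 show "ck_pair E A T0 T1"
 proof (rule ck_pairI)
  show "C0c (subtopology (verts E) (E_rg E)) <= C0c (verts E)" using C0_rg by blast
  fix f and eps :: real assume f: "f : C0c (subtopology (verts E) (E_rg E))" and e: "eps > 0"
  obtain f' C where f': "f' : C0c (subtopology (verts E) (E_rg E))" "!!v. cmod (f' v - f v) <= eps"
   "compactin (verts E) C" "C <= E_rg E" "!!v. v ~: C ==> f' v = 0" using C0_rg_dense[OF f e] by metis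
  obtain ps where "valid ps" "kern f' ps" using kern_exists[OF C0_rg[OF f'(1)] f'(3)] f'(4,5) E_rg_fin by blast
  then show "EX f' ps. f' : C0c (verts E) & (ALL v. cmod (f' v - f v) <= eps) & valid ps & kern f' ps & T0 f' = K ps"
   using a f' C0_rg by blast
 qed
qed

end

lemma toeplitz_hom:
 assumes A: "cstar_algebra A" and "toeplitz_pair E A T0 T1" "star_hom A B phi"
 shows "toeplitz_pair E B (%f. phi (T0 f)) (%xi. phi (T1 xi))"
proof -
 interpret A: cs_alg A using A by (simp add: cs_alg_def)
 note T = toeplitzD[OF assms(2)] and h = star_homD[OF assms(3)]
 have T0: "f : C0c (verts E) ==> T0 f : car A" for f using star_homD(1)[OF T(1)] .
 have "cs_mult B (cs_star B (phi (T1 xi))) (phi (T1 eta)) = phi (T0 (cd_inner E xi eta))" if "xi : Cd E" "eta : Cd E" for xi eta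
  using h(4)[of "cs_star A (T1 xi)" "T1 eta"] h(5)[of "T1 xi"] T(2,5) that by simp
 moreover have "cs_mult B (phi (T0 f)) (phi (T1 xi)) = phi (T1 (left_action E f xi))"
  if "f : C0c (verts E)" "xi : Cd E" for f xi
  using h(4)[of "T0 f" "T1 xi"] T0 T(2,6) that by simp
 ultimately show ?thesis unfolding toeplitz_pair_def using star_hom_comp[OF T(1) assms(3)] T h(1,2,3) by auto
qed

lemma ck_pair_hom:
 assumes A: "cstar_algebra A" and "ck_pair E A T0 T1" "star_hom A B phi"
 shows "ck_pair E B (%f. phi (T0 f)) (%xi. phi (T1 xi))"
proof -
 interpret A: cs_alg A using A by (simp add: cs_alg_def)
 have t: "toeplitz_pair E A T0 T1" using assms(2) by (simp add: ck_pair_def)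
 obtain \<Phi> where P: "star_hom (compact_ops E) A \<Phi>" "!!xi eta. xi : Cd E ==> eta : Cd E ==> \<Phi> (rank_one E xi eta) = T1 xi *[A] cs_star A (T1 eta)"
  "!!f. f : C0c (subtopology (verts E) (E_rg E)) ==> T0 f = \<Phi> (left_action E f)" using assms(2) by (auto simp: ck_pair_def)
 show ?thesis unfolding ck_pair_def
 proof (intro conjI exI[of _ "%x. phi (\<Phi> x)"] ballI toeplitz_hom[OF A t assms(3)] star_hom_comp[OF P(1) assms(3)])
  fix xi eta assume x: "xi : Cd E" "eta : Cd E"
  have "T1 xi : car A" "T1 eta : car A" using toeplitzD(2)[OF t] x by auto
  then show "phi (\<Phi> (rank_one E xi eta)) = phi (T1 xi) *[B] cs_star B (phi (T1 eta))"
   using P(2)[OF x] star_homD(4)[OF assms(3), of "T1 xi" "cs_star A (T1 eta)"] star_homD(5)[OF assms(3), of "T1 eta"] by simp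
 qed (simp add: P(3))
qed

section \<open>The universal property of the graph algebra\<close>

text \<open>Carries an algebra over an arbitrary type along an injection to a copy over
  \<open>ck_univ\<close>, the type over which \<open>ck_reps\<close> ranges.\<close>

definition cs_transport :: "('a => 'b) => 'a cstar => 'b cstar" where
 "cs_transport j A = (let i = inv_into (car A) j in \<lparr>
   cs_carrier = j ` car A,
   cs_zero = j (cs_zero A),
   cs_add = (%x y. j (cs_add A (i x) (i y))),
   cs_scale = (%c x. j (cs_scale A c (i x))),
   cs_mult = (%x y. j (cs_mult A (i x) (i y))),
   cs_star = (%x. j (cs_star A (i x))),
   cs_norm = (%x. nm A (i x))\<rparr>)"

lemma transport_cstar:
 assumes A: "cstar_algebra A" and j: "inj_on j (car A)"
 shows "cstar_algebra (cs_transport j A)" and "star_hom A (cs_transport j A) j"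
  and "star_hom (cs_transport j A) A (inv_into (car A) j)"
proof -
 interpret A: cs_alg A using A by (simp add: cs_alg_def)
 let ?B = "cs_transport j A" let ?i = "inv_into (car A) j"
 have ij: "?i (j x) = x" if "x : car A" for x using inv_into_f_f[OF j that] .
 have sel: "car ?B = j ` car A" "cs_zero ?B = j (cs_zero A)"
  "!!x y. cs_add ?B x y = j (cs_add A (?i x) (?i y))" "!!c x. cs_scale ?B c x = j (cs_scale A c (?i x))"
  "!!x y. cs_mult ?B x y = j (cs_mult A (?i x) (?i y))" "!!x. cs_star ?B x = j (cs_star A (?i x))" "!!x. nm ?B x = nm A (?i x)"
  by (simp_all add: cs_transport_def Let_def)
 have jeq: "j x = j y \<longleftrightarrow> x = y" if "x : car A" "y : car A" for x y using j that by (auto dest: inj_onD)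
 show "cstar_algebra ?B"
 proof (rule cstar_algebraI)
  show "pre_cstar ?B"
  proof
   show "x +[?B] y = y +[?B] x" if "x : car ?B" "y : car ?B" for x y
    using that by (auto simp: sel ij A.a_comm)
  qed (auto simp: sel ij jeq A.a_assoc A.scale_addR A.scale_addL A.nm_zero_iff A.nm_triangle A.nm_scale A.mult_assoc A.mult_add_left
    A.mult_add_right A.mult_scale_left A.mult_scale_right A.star_add A.star_scale A.star_mult A.norm_mult A.norm_star_mult)
  fix X assume X: "cs_cauchy ?B X"
  then have Xc: "!!n. X n : j ` car A" by (simp add: cs_cauchy_def sel)
  then obtain Y where Y: "!!n. Y n : car A" "!!n. X n = j (Y n)" unfolding image_iff by metis
  have "cs_cauchy A Y" using X Y unfolding cs_cauchy_def by (simp add: sel ij)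
  then obtain y where "cs_lim A Y y" using A.cauchy_lim by blast
  then have "cs_lim ?B X (j y)" using Y unfolding cs_lim_def by (auto simp: sel ij)
  then show "EX x. cs_lim ?B X x" by blast
 qed
 show "star_hom A ?B j" "star_hom ?B A ?i" unfolding star_hom_def by (auto simp: sel ij)
qed

text \<open>Evaluation of formal star-polynomials; generator symbols labelled by functions outside
  \<open>C0\<close> or \<open>Cd\<close> get the value zero so that every term evaluates into the
  carrier.\<close>

primrec tev :: "('v, 'e) tgraph => 'a cstar => (('v => complex) => 'a) => (('e => complex) => 'a) => ('v, 'e) ck_term => 'a" where
 "tev E A T0 T1 (Gen0 f) = (if f : C0c (verts E) then T0 f else cs_zero A)"
| "tev E A T0 T1 (Gen1 xi) = (if xi : Cd E then T1 xi else cs_zero A)"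
| "tev E A T0 T1 (Plus s t) = cs_add A (tev E A T0 T1 s) (tev E A T0 T1 t)"
| "tev E A T0 T1 (Scale c s) = cs_scale A c (tev E A T0 T1 s)"
| "tev E A T0 T1 (Times s t) = cs_mult A (tev E A T0 T1 s) (tev E A T0 T1 t)"
| "tev E A T0 T1 (Star s) = cs_star A (tev E A T0 T1 s)"

lemma ck_reps_family: "cs_family (ck_reps E) fst"
 by (rule cs_family.intro) (auto simp: ck_reps_def)

lemma ksum_sub [simp]: "ksum (A\<lparr>cs_carrier := W\<rparr>) T1 ps = ksum A T1 ps"
 by (induction ps) auto

lemma ksum_generated [simp]: "ksum (cstar_generated A S) T1 ps = ksum A T1 ps"
 by (induction ps) auto

abbreviation gens :: "('v, 'e) tgraph => (('v => complex) => 'a) => (('e => complex) => 'a) => 'a set" where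
 "gens E T0 T1 == T0 ` C0c (verts E) Un T1 ` Cd E"

lemma star_hom_generated:
 assumes h: "star_hom A B phi" and sub: "car (cstar_generated A S) <= car A"
 shows "star_hom (cstar_generated A S) B phi"
proof -
 note hD = star_homD[OF h]
 have c: "x : car A" if "x : car (cstar_generated A S)" for x using sub that by blast
 show ?thesis unfolding star_hom_def generated_simps by (intro conjI ballI allI funcsetI hD c)
qed

lemma toeplitz_generated:
 assumes "toeplitz_pair E A T0 T1" shows "toeplitz_pair E (cstar_generated A (gens E T0 T1)) T0 T1"
proof -
 have "gens E T0 T1 <= car (cstar_generated A (gens E T0 T1))" by (rule generated_superset)
 then have "T0 f : car (cstar_generated A (gens E T0 T1))" if "f : C0c (verts E)" for f using that by blast
 moreover have "T1 xi : car (cstar_generated A (gens E T0 T1))" if "xi : Cd E" for xi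
  using generated_superset[of "gens E T0 T1" A] that by blast
 ultimately show ?thesis using assms unfolding toeplitz_pair_def star_hom_def by auto
qed

context tgr
begin

lemma ck_generated:
 assumes A: "cstar_algebra A" and ck: "ck_pair E A T0 T1"
 shows "ck_pair E (cstar_generated A (gens E T0 T1)) T0 T1" "gens E T0 T1 <= car A" "cstar_algebra (cstar_generated A (gens E T0 T1))"
proof -
 interpret A: cs_alg A using A by (simp add: cs_alg_def)
 have t: "toeplitz_pair E A T0 T1" using ck by (simp add: ck_pair_def)
 show S: "gens E T0 T1 <= car A" using toeplitzD(2)[OF t] star_homD(1)[OF toeplitzD(1)[OF t]] by auto
 show G: "cstar_algebra (cstar_generated A (gens E T0 T1))" by (rule A.generated_cstar[OF S])
 show "ck_pair E (cstar_generated A (gens E T0 T1)) T0 T1"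
  unfolding ck_iff[OF G] using toeplitz_generated[OF t] ck[unfolded ck_iff[OF A]] by simp
qed

text \<open>The values of terms are closed under all operations, so their closure is a C*-subalgebra
  containing the generators.\<close>

lemma generated_term_limit:
 assumes A: "cstar_algebra A" and S: "gens E T0 T1 <= car A" and x: "x : car (cstar_generated A (gens E T0 T1))"
 shows "EX s. cs_lim A (%n. tev E A T0 T1 (s n)) x"
proof -
 interpret A: cs_alg A using A by (simp add: cs_alg_def)
 let ?e = "tev E A T0 T1"
 have c: "?e s : car A" for s by (induction s) (use S in auto)
 have sub: "range ?e <= car A" using c by blast
 have sa: "cstar_subalgebra A (cs_topology A closure_of (range ?e))"
 proof (rule A.closure_subalgebra[OF sub])
  have "cs_zero A = ?e (Scale 0 (Gen1 (%e. 0)))" using c[of "Gen1 (%e. 0)"] by simp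
  then show "cs_zero A : range ?e" by (rule range_eqI)
  fix x y assume "x : range ?e" "y : range ?e"
  then obtain s t where st: "x = ?e s" "y = ?e t" by blast
  show "x +[A] y : range ?e" unfolding st by (rule range_eqI[of _ _ "Plus s t"]) simp
  show "x *[A] y : range ?e" unfolding st by (rule range_eqI[of _ _ "Times s t"]) simp
  show "cs_star A x : range ?e" unfolding st by (rule range_eqI[of _ _ "Star s"]) simp
  show "k .[A] x : range ?e" for k unfolding st by (rule range_eqI[of _ _ "Scale k s"]) simp
 qed
 have ge: "gens E T0 T1 <= cs_topology A closure_of (range ?e)"
 proof -
  have "gens E T0 T1 <= range ?e"
  proof
   fix x assume "x : gens E T0 T1"
   then consider f where "f : C0c (verts E)" "x = T0 f" | xi where "xi : Cd E" "x = T1 xi" by blast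
   then show "x : range ?e"
   proof cases
    case 1 then show ?thesis by (intro range_eqI[of _ _ "Gen0 f"]) simp
   next
    case 2 then show ?thesis by (intro range_eqI[of _ _ "Gen1 xi"]) simp
   qed
  qed
  also have "... <= cs_topology A closure_of (range ?e)" by (rule closure_of_subset) (use sub in \<open>simp add: A.cs_topology_eq\<close>)
  finally show ?thesis .
 qed
 have "x : cs_topology A closure_of (range ?e)" by (rule subsetD[OF generated_least[OF ge sa] x])
 then obtain X where X: "!!n. X n : range ?e" "cs_lim A X x" using A.closure_of_seq_iff[OF sub] by blast
 then have "ALL n. EX s. X n = ?e s" by blast
 then obtain s where "ALL n. X n = ?e (s n)" by (rule choice[THEN exE])
 then have "X = (%n. ?e (s n))" by auto
 then show ?thesis using X(2) by blast
qed

text \<open>An element is coded by a sequence of terms whose values converge to it. The code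
  determines the limit, so the coding is injective and the generated algebra can be copied into
  \<open>ck_univ\<close>.\<close>

lemma ck_pair_coded:
 assumes A: "cstar_algebra (A :: 'a cstar)" and ck: "ck_pair E A T0 T1"
 obtains B :: "('v, 'e) ck_univ cstar" and T0' T1' i where "(B, T0', T1') : ck_reps E" "star_hom B A i"
  "!!f. f : C0c (verts E) ==> i (T0' f) = T0 f" "!!xi. xi : Cd E ==> i (T1' xi) = T1 xi"
proof -
 interpret A: cs_alg A using A by (simp add: cs_alg_def)
 let ?G = "cstar_generated A (gens E T0 T1)"
 note g = ck_generated[OF A ck]
 have "EX s. cs_lim A (%n. tev E A T0 T1 (s n)) x" if "x : car ?G" for x by (rule generated_term_limit[OF A g(2) that])
 then obtain j where j: "!!x. x : car ?G ==> cs_lim A (%n. tev E A T0 T1 (j x n)) x" by metis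
 have inj: "inj_on j (car ?G)"
 proof (rule inj_onI)
  fix x y assume "x : car ?G" "y : car ?G" "j x = j y"
  then show "x = y" using j[of x] j[of y] A.cs_lim_unique by simp
 qed
 note tr = transport_cstar[OF g(3) inj]
 let ?i = "inv_into (car ?G) j"
 have sub: "car ?G <= car A" by (rule A.subalgebra_subset[OF A.generated_subalgebra[OF g(2)]])
 have hA: "star_hom (cs_transport j ?G) A ?i" using tr(3) sub unfolding star_hom_def by auto
 have ij: "?i (j x) = x" if "x : gens E T0 T1" for x
  using inv_into_f_f[OF inj] generated_superset[of "gens E T0 T1" A] that by blast
 show thesis
 proof (rule that[of "cs_transport j ?G" "%f. j (T0 f)" "%xi. j (T1 xi)" ?i])
  show "(cs_transport j ?G, %f. j (T0 f), %xi. j (T1 xi)) : ck_reps E"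
   unfolding ck_reps_def using tr(1) ck_pair_hom[OF g(3,1) tr(2)] by simp
 qed (use hA ij in auto)
qed

section \<open>The universal pair and its universal property\<close>

interpretation F: cs_family "ck_reps E" fst by (rule ck_reps_family)

abbreviation "GP == cs_prod (ck_reps E) fst"

lemma rep_ck: assumes "rho : ck_reps E" shows "cstar_algebra (fst rho)" "ck_pair E (fst rho) (fst (snd rho)) (snd (snd rho))"
 and "toeplitz_pair E (fst rho) (fst (snd rho)) (snd (snd rho))"
 using assms by (auto simp: ck_reps_def ck_pair_def)

lemma t0_app: "rho : ck_reps E ==> t0 E f rho = fst (snd rho) f" and t1_app: "rho : ck_reps E ==> t1 E xi rho = snd (snd rho) xi"
 by (auto simp: t0_def t1_def split: prod.splits)

lemma t_ext: "t0 E f : extensional (ck_reps E)" "t1 E xi : extensional (ck_reps E)"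
 by (auto simp: t0_def t1_def)

lemma t0_in: assumes f: "f : C0c (verts E)" shows "t0 E f : car GP"
proof (rule F.prod_carrierI[OF t_ext(1), where c = "nm (C0 (verts E)) f"])
 fix rho assume r: "rho : ck_reps E"
 note T = toeplitzD[OF rep_ck(3)[OF r]]
 show "t0 E f rho : car (fst rho)" "nm (fst rho) (t0 E f rho) <= nm (C0 (verts E)) f"
  unfolding t0_app[OF r] using star_homD(1)[OF T(1) f] star_hom_contractive[OF C0_cstar rep_ck(1)[OF r] T(1) f] by auto
qed

lemma t1_in: assumes x: "xi : Cd E" shows "t1 E xi : car GP"
proof (rule F.prod_carrierI[OF t_ext(2), where c = "cd_norm E xi"])
 fix rho assume r: "rho : ck_reps E"
 interpret T: toep E "fst rho" "fst (snd rho)" "snd (snd rho)"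
  using rep_ck[OF r] by unfold_locales (auto simp: cstar_algebra_def)
 show "t1 E xi rho : car (fst rho)" "nm (fst rho) (t1 E xi rho) <= cd_norm E xi"
  unfolding t1_app[OF r] using T.TD(2)[OF x] T.T1_norm[OF x] by auto
qed

lemma t_toeplitz: "toeplitz_pair E GP (t0 E) (t1 E)"
proof -
 have eqI: "x = y" if "x : extensional (ck_reps E)" "y : extensional (ck_reps E)" "!!rho. rho : ck_reps E ==> x rho = y rho" for x y :: "('v, 'e) ck_rep => ('v, 'e) ck_univ"
  using that by (rule extensionalityI)
 note T = toeplitzD[OF rep_ck(3)]
 note T0 = star_homD[OF toeplitzD(1)[OF rep_ck(3)], simplified]
 show ?thesis
  unfolding toeplitz_pair_def star_hom_def
  by (intro conjI ballI allI funcsetI t0_in t1_in; (rule eqI)?) (auto simp: t_ext t0_app t1_app T(3-6) T0)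
qed

lemma ksum_prod: assumes "rho : ck_reps E" shows "ksum GP (t1 E) ps rho = ksum (fst rho) (snd (snd rho)) ps"
 by (induction ps) (use assms in \<open>auto simp: t1_app\<close>)

lemma ksum_prod_ext: "ksum GP (t1 E) ps : extensional (ck_reps E)"
 by (cases ps) auto

lemma t_ck_prod: "ck_pair E GP (t0 E) (t1 E)"
 unfolding ck_iff[OF F.prod_cstar]
proof (intro conjI ballI allI impI t_toeplitz)
 fix f ps assume f: "f : C0c (subtopology (verts E) (E_rg E))" and ps: "valid ps" "kern f ps"
 show "t0 E f = ksum GP (t1 E) ps"
 proof (rule extensionalityI[OF t_ext(1) ksum_prod_ext])
  fix rho assume r: "rho : ck_reps E"
  show "t0 E f rho = ksum GP (t1 E) ps rho"
   unfolding ksum_prod[OF r] t0_app[OF r] using ck_pair_ksum[OF rep_ck(1,2)[OF r] f ps] .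
 qed
qed

lemma graph_algebra_eq: "OA E = cstar_generated GP (gens E (t0 E) (t1 E))"
 by (simp add: graph_algebra_def)

lemma graph_cstar: "cstar_algebra (OA E)" and t_ck: "ck_pair E (OA E) (t0 E) (t1 E)"
 and gens_in: "gens E (t0 E) (t1 E) <= car GP"
 using ck_generated[OF F.prod_cstar t_ck_prod] by (simp_all add: graph_algebra_eq)

lemma t0_graph: "f : C0c (verts E) ==> t0 E f : car (OA E)"
 and t1_graph: "xi : Cd E ==> t1 E xi : car (OA E)"
 using generated_superset[of "gens E (t0 E) (t1 E)" GP] by (auto simp: graph_algebra_eq)

text \<open>The coded copy of the given pair is one of the coordinates of the product; evaluating
  there and decoding is the required homomorphism.\<close>

lemma graph_universal:
 assumes A: "cstar_algebra A" and ck: "ck_pair E A T0 T1"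
 obtains \<mu> where "star_hom (OA E) A \<mu>" "!!f. f : C0c (verts E) ==> \<mu> (t0 E f) = T0 f"
  "!!xi. xi : Cd E ==> \<mu> (t1 E xi) = T1 xi"
proof -
 obtain B :: "('v, 'e) ck_univ cstar" and T0' T1' i where B: "(B, T0', T1') : ck_reps E" "star_hom B A i"
  "!!f. f : C0c (verts E) ==> i (T0' f) = T0 f" "!!xi. xi : Cd E ==> i (T1' xi) = T1 xi"
  using ck_pair_coded[OF A ck] by blast
 let ?rho = "(B, T0', T1')"
 interpret P: cs_alg GP using F.prod_cstar by (simp add: cs_alg_def)
 have sub: "car (OA E) <= car GP"
  unfolding graph_algebra_eq by (rule P.subalgebra_subset[OF P.generated_subalgebra[OF gens_in]])
 have h: "star_hom GP A (%x. i (x ?rho))" using star_hom_comp[OF F.prod_eval[OF B(1)]] B(2) by simp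
 have "star_hom (OA E) A (%x. i (x ?rho))" unfolding graph_algebra_eq by (rule star_hom_generated[OF h sub[unfolded graph_algebra_eq]])
 then show thesis by (rule that) (use t0_app[OF B(1)] t1_app[OF B(1)] B(3,4) in auto)
qed

lemma graph_hom_unique:
 assumes A: "cstar_algebra A" and h: "star_hom (OA E) A \<mu>" "star_hom (OA E) A \<nu>"
  and eq: "!!f. f : C0c (verts E) ==> \<mu> (t0 E f) = \<nu> (t0 E f)" "!!xi. xi : Cd E ==> \<mu> (t1 E xi) = \<nu> (t1 E xi)"
  and x: "x : car (OA E)"
 shows "\<mu> x = \<nu> x"
 by (rule star_hom_agree[OF F.prod_cstar gens_in A h[unfolded graph_algebra_eq] _ x[unfolded graph_algebra_eq]]) (use eq in auto)

end

section \<open>Pulling back along factor maps\<close>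

abbreviation Alex :: "'a topology => 'a option topology" where
 "Alex == Alexandroff_compactification"

lemma pull_off: "x ~: topspace X ==> pull X m f x = 0"
 by (simp add: pull_def)

lemma pull_eq: "x : topspace X ==> pull X m f x = case_option 0 f (m (Some x))"
 by (simp add: pull_def)

lemma case_option_pull:
 "m None = None ==> x : topspace (Alex X) ==> case_option 0 (pull X m f) x = case_option 0 f (m x)"
 by (auto simp: pull_def)

lemma pull_C0:
 assumes m: "continuous_map (Alex X) (Alex Y) m" "m None = None" and f: "f : C0c Y"
 shows "pull X m f : C0c X"
 unfolding C0_iff_Alexandroff
proof (intro conjI allI impI pull_off)
 have "continuous_map (Alex Y) euclidean (case_option 0 f)" using f unfolding C0_iff_Alexandroff by blast
 from continuous_map_compose[OF m(1) this]
 show "continuous_map (Alex X) euclidean (case_option 0 (pull X m f))"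
  by (rule continuous_map_eq) (simp only: case_option_pull[where m=m, OF m(2)] o_apply)
qed

lemma pull_add: "pull X m (%x. f x + g x) = (%x. pull X m f x + pull X m g x)"
 and pull_mult: "pull X m (%x. f x * g x) = (%x. pull X m f x * pull X m g x)"
 and pull_scale: "pull X m (%x. c * f x) = (%x. c * pull X m f x)"
 and pull_cnj: "pull X m (%x. cnj (f x)) = (%x. cnj (pull X m f x))"
 by (auto simp: pull_def fun_eq_iff split: option.splits)

lemma pull_le: "0 <= c ==> (!!y. cmod (f y) <= c) ==> cmod (pull X m f x) <= c"
 by (auto simp: pull_def split: option.splits)

lemma pull_hom:
 assumes m: "continuous_map (Alex X) (Alex Y) m" "m None = None"
 shows "star_hom (C0 Y) (C0 X) (pull X m)"
 unfolding star_hom_def C0_simps by (intro conjI ballI allI funcsetI pull_C0[OF m] pull_add pull_mult pull_scale pull_cnj)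

lemma pull_pull:
 assumes "m' None = None" "m None = None" "!!x. x : topspace (Alex Z) ==> m' x : topspace (Alex X)"
  "!!x. x : topspace (Alex Z) ==> m (m' x) = m'' x"
 shows "pull Z m' (pull X m f) = pull Z m'' f"
proof
 fix z show "pull Z m' (pull X m f) z = pull Z m'' f z"
 proof (cases "z : topspace Z")
  case True
  then have "Some z : topspace (Alex Z)" by simp
  then show ?thesis using True case_option_pull[where m=m, OF assms(2), of "m' (Some z)" X f] assms(3,4) by (simp add: pull_eq del: topspace_Alexandroff_compactification)
 qed (simp add: pull_off)
qed

text \<open>Compact sets are the closed sets of the compactification that avoid infinity, and
  preimages of such sets avoid infinity too: factor maps are proper where they are finite.\<close>

lemma preimage_compact:
 assumes m: "continuous_map (Alex X) (Alex Y) m" "m None = None" and C: "compactin Y C" and Y: "Hausdorff_space Y"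
 shows "compactin X {x : topspace X. m (Some x) : Some ` C}" and "closedin X {x : topspace X. m (Some x) : Some ` C}"
proof -
 have "closedin (Alex Y) (Some ` C)" using C compactin_imp_closedin[OF Y C] by simp
 then have "closedin (Alex X) {x : topspace (Alex X). m x : Some ` C}" by (rule closedin_continuous_map_preimage[OF m(1)])
 moreover have "{x : topspace (Alex X). m x : Some ` C} = Some ` {x : topspace X. m (Some x) : Some ` C}"
  using m(2) by auto
 ultimately show "compactin X {x : topspace X. m (Some x) : Some ` C}" "closedin X {x : topspace X. m (Some x) : Some ` C}" by simp_all
qed

locale fmap = F: tgr F + E: tgr E for F :: "('w, 'g) tgraph" and E :: "('v, 'e) tgraph" +
 fixes m :: "('w, 'g, 'v, 'e) gmap"
 assumes fm: "factor_map F E m"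
begin

abbreviation "m0 == fst m"
abbreviation "m1 == snd m"
abbreviation "pl0 == pull (verts F) m0"
abbreviation "pl1 == pull (edges F) m1"

lemma m0_cont: "continuous_map (Alex (verts F)) (Alex (verts E)) m0"
 and m1_cont: "continuous_map (Alex (edges F)) (Alex (edges E)) m1"
 and m0_None: "m0 None = None" and m1_None: "m1 None = None"
 using fm by (auto simp: factor_map_def)

lemma m0_in: assumes "v : vts F" "m0 (Some v) = Some w" shows "w : vts E"
proof -
 have "m0 (Some v) : topspace (Alex (verts E))" using m0_cont assms(1) unfolding continuous_map_def by auto
 then show ?thesis using assms(2) by auto
qed

lemma m1_in: assumes "e : eds F" "m1 (Some e) = Some e'" shows "e' : eds E"
proof -
 have "m1 (Some e) : topspace (Alex (edges E))" using m1_cont assms(1) unfolding continuous_map_def by auto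
 then show ?thesis using assms(2) by auto
qed

lemma m1_ends:
 assumes "e : eds F" "m1 (Some e) = Some e'"
 shows "m0 (Some (rmap F e)) = Some (rmap E e')" "m0 (Some (dmap F e)) = Some (dmap E e')"
 using fm assms m1_in[OF assms] unfolding factor_map_def by metis+

lemma lift_unique:
 assumes "e' : eds E" "v : vts F" "m0 (Some v) = Some (dmap E e')"
 shows "EX! e. e : eds F & m1 (Some e) = Some e' & dmap F e = v"
 using fm assms unfolding factor_map_def by metis

text \<open>Unique lifting matches the edges over \<open>v\<close> that stay finite with the edges
  over the image of \<open>v\<close>. This is why pulling back preserves fibre sums and inner
  products.\<close>

lemma fibre_bij:
 assumes v: "v : vts F" "m0 (Some v) = Some w"
 shows "bij_betw (%e. the (m1 (Some e))) {e : fib F v. m1 (Some e) ~= None} (fib E w)"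
 unfolding bij_betw_def
proof
 have mem: "the (m1 (Some e)) : fib E w" if "e : {e : fib F v. m1 (Some e) ~= None}" for e
  using that m1_in[of e] m1_ends(2)[of e] v(2) by auto
 show "inj_on (%e. the (m1 (Some e))) {e : fib F v. m1 (Some e) ~= None}"
 proof (rule inj_onI)
  fix e f assume e: "e : {e : fib F v. m1 (Some e) ~= None}" "f : {e : fib F v. m1 (Some e) ~= None}" "the (m1 (Some e)) = the (m1 (Some f))"
  have "m0 (Some v) = Some (dmap E (the (m1 (Some e))))" using mem[OF e(1)] v by auto
  from lift_unique[OF _ v(1) this] show "e = f" using e mem[OF e(1)] by auto
 qed
 show "(%e. the (m1 (Some e))) ` {e : fib F v. m1 (Some e) ~= None} = fib E w"
 proof (intro set_eqI iffI)
  fix e' assume e': "e' : fib E w"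
  then obtain e where "e : eds F" "m1 (Some e) = Some e'" "dmap F e = v"
   using lift_unique[of e' v] v by auto
  then show "e' : (%e. the (m1 (Some e))) ` {e : fib F v. m1 (Some e) ~= None}" by (intro image_eqI[of _ _ e]) auto
 qed (use mem in blast)
qed

lemma fibre_None:
 assumes v: "m0 (Some v) = None" and e: "e : fib F v" shows "m1 (Some e) = None"
 using m1_ends(2)[of e] v e by (cases "m1 (Some e)") auto

lemma fibre_sum:
 fixes g :: "'e => 'b::{comm_monoid_add, t2_space}"
 assumes v: "v : vts F"
 shows "infsum (%e. case_option 0 g (m1 (Some e))) (fib F v) = (case m0 (Some v) of None => 0 | Some w => infsum g (fib E w))"
  and "(!!w. m0 (Some v) = Some w ==> g summable_on fib E w) ==> (%e. case_option 0 g (m1 (Some e))) summable_on fib F v"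
proof -
 let ?h = "%e. case_option 0 g (m1 (Some e))"
 have z: "?h e = 0" if "m0 (Some v) = None" "e : fib F v" for e using fibre_None[OF that] by simp
 show "infsum ?h (fib F v) = (case m0 (Some v) of None => 0 | Some w => infsum g (fib E w))"
 proof (cases "m0 (Some v)")
  case None
  have "infsum ?h (fib F v) = 0" by (rule infsum_0) (rule z[OF None])
  then show ?thesis using None by simp
 next
  case (Some w)
  have "infsum ?h (fib F v) = infsum (%e. g (the (m1 (Some e)))) {e : fib F v. m1 (Some e) ~= None}"
   by (rule infsum_cong_neutral) auto
  also have "... = infsum g (fib E w)" by (rule infsum_reindex_bij_betw[OF fibre_bij[OF v Some]])
  finally show ?thesis using Some by simp
 qed
 assume s: "!!w. m0 (Some v) = Some w ==> g summable_on fib E w"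
 show "?h summable_on fib F v"
 proof (cases "m0 (Some v)")
  case None' : None
  have "?h summable_on fib F v \<longleftrightarrow> (%e. 0 :: 'b) summable_on fib F v" by (rule summable_on_cong) (rule z[OF None'])
  then show ?thesis by simp
 next
  case (Some w)
  have "?h summable_on fib F v \<longleftrightarrow> (%e. g (the (m1 (Some e)))) summable_on {e : fib F v. m1 (Some e) ~= None}"
   by (rule summable_on_cong_neutral) auto
  also have "... \<longleftrightarrow> g summable_on fib E w" by (rule summable_on_reindex_bij_betw[OF fibre_bij[OF v Some]])
  finally show ?thesis using s[OF Some] by simp
 qed
qed

lemma pull_inner: "cd_inner F (pl1 xi) (pl1 eta) = pl0 (cd_inner E xi eta)"
proof
 fix v
 show "cd_inner F (pl1 xi) (pl1 eta) v = pl0 (cd_inner E xi eta) v"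
 proof (cases "v : vts F")
  case False
  then show ?thesis unfolding cd_inner_def F.fib_empty[OF False] by (simp add: pull_off)
 next
  case True
  have "cd_inner F (pl1 xi) (pl1 eta) v = infsum (%e. case_option 0 (%e. cnj (xi e) * eta e) (m1 (Some e))) (fib F v)"
   unfolding cd_inner_def by (rule infsum_cong) (auto simp: pull_eq split: option.splits)
  also have "... = pl0 (cd_inner E xi eta) v"
   unfolding fibre_sum(1)[OF True] pull_eq[OF True] by (auto simp: cd_inner_def split: option.splits)
  finally show ?thesis .
 qed
qed

lemma pull_Cd: assumes x: "xi : Cd E" shows "pl1 xi : Cd F"
proof -
 have "pl1 xi : C0c (edges F)" by (rule pull_C0[OF m1_cont m1_None E.Cd_in_C0[OF x]])
 then have c: "continuous_map (edges F) euclidean (pl1 xi)" by (rule C0_cont)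
 have s: "(%e. (cmod (pl1 xi e))^2) summable_on fib F v" if v: "v : vts F" for v
 proof -
  have "(%e. (cmod (pl1 xi e))^2) summable_on fib F v \<longleftrightarrow> (%e. case_option 0 (%e. (cmod (xi e))^2) (m1 (Some e))) summable_on fib F v"
   by (rule summable_on_cong) (auto simp: pull_eq split: option.splits)
  then show ?thesis using fibre_sum(2)[OF v, of "%e. (cmod (xi e))^2"] E.Cd_summable[OF x] by simp
 qed
 have "cd_inner F (pl1 xi) (pl1 xi) : C0c (verts F)"
  unfolding pull_inner by (rule pull_C0[OF m0_cont m0_None CdD(3)[OF x]])
 then show ?thesis using c s by (simp add: Cd_def pull_off)
qed

lemma pull_left_action:
 assumes x: "xi : Cd E" shows "left_action F (pl0 f) (pl1 xi) = pl1 (left_action E f xi)"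
proof
 fix e
 show "left_action F (pl0 f) (pl1 xi) e = pl1 (left_action E f xi) e"
 proof (cases "e : eds F")
  case True
  then show ?thesis using x pull_Cd[OF x] m1_ends(1)[OF True] F.r_in[OF True]
   by (auto simp: left_action_def pull_eq split: option.splits)
 qed (use x pull_Cd[OF x] in \<open>simp add: left_action_def pull_off\<close>)
qed

lemma pull_toeplitz:
 assumes A: "toeplitz_pair F A T0 T1" shows "toeplitz_pair E A (%f. T0 (pl0 f)) (%xi. T1 (pl1 xi))"
proof -
 note T = toeplitzD[OF A]
 show ?thesis unfolding toeplitz_pair_def
 proof (intro conjI ballI allI funcsetI)
  show "star_hom (C0 (verts E)) A (%f. T0 (pl0 f))" by (rule star_hom_comp[OF pull_hom[OF m0_cont m0_None] T(1)])
  fix xi assume x: "xi : Cd E"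
  show "T1 (pl1 xi) : car A" by (rule T(2)[OF pull_Cd[OF x]])
  show "T1 (pl1 (%e. c * xi e)) = cs_scale A c (T1 (pl1 xi))" for c unfolding pull_scale by (rule T(4)[OF pull_Cd[OF x]])
  show "T0 (pl0 f) *[A] T1 (pl1 xi) = T1 (pl1 (left_action E f xi))" if "f : C0c (verts E)" for f
   unfolding T(6)[OF pull_C0[OF m0_cont m0_None that] pull_Cd[OF x]] pull_left_action[OF x] ..
  fix eta assume y: "eta : Cd E"
  show "T1 (pl1 (%e. xi e + eta e)) = T1 (pl1 xi) +[A] T1 (pl1 eta)" unfolding pull_add by (rule T(3)[OF pull_Cd[OF x] pull_Cd[OF y]])
  show "cs_star A (T1 (pl1 xi)) *[A] T1 (pl1 eta) = T0 (pl0 (cd_inner E xi eta))"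
   unfolding T(5)[OF pull_Cd[OF x] pull_Cd[OF y]] pull_inner ..
 qed
qed

abbreviation "pls == map (%(xi, eta). (pl1 xi, pl1 eta))"

lemma pls_valid: "E.valid ps ==> F.valid (pls ps)"
 using pull_Cd by auto

lemma ksum_pls: "ksum A (%xi. T1 (pl1 xi)) ps = ksum A T1 (pls ps)"
 by (induction ps) auto

end

section \<open>Regular factor maps and induced homomorphisms\<close>

locale rfmap = fmap +
 assumes reg: "regular_factor_map F E m"
begin

lemma reg_nonempty: "v : vts F ==> m0 (Some v) : Some ` E_rg E ==> EX e:eds F. rmap F e = v"
 and reg_finite: "e : eds F ==> m0 (Some (rmap F e)) : Some ` E_rg E ==> m1 (Some e) : Some ` eds E"
 using reg F.r_in unfolding regular_factor_map_def by blast+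

text \<open>For edges with finite images unique lifting makes equality of edges equivalent to
  equality of images. An edge sent to infinity contributes 0 to the sum, and by regularity its range
  does not lie over a regular vertex, so the required entry is 0 as well.\<close>

lemma kern_pull:
 assumes k: "E.kern f ps" and f: "!!v. v ~: E_rg E ==> f v = 0"
 shows "F.kern (pl0 f) (pls ps)"
 unfolding F.kern_def
proof (intro ballI impI)
 fix e e' assume e: "e : eds F" "e' : eds F" "dmap F e = dmap F e'"
 have s: "(\<Sum>(xi, eta)\<leftarrow>pls ps. xi e * cnj (eta e')) = (\<Sum>(xi, eta)\<leftarrow>ps. pl1 xi e * cnj (pl1 eta e'))"
  by (simp add: o_def case_prod_unfold)
 show "(\<Sum>(xi, eta)\<leftarrow>pls ps. xi e * cnj (eta e')) = (if e = e' then pl0 f (rmap F e) else 0)"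
 proof (cases "m1 (Some e) = None | m1 (Some e') = None")
  case True
  then have "(\<Sum>(xi, eta)\<leftarrow>ps. pl1 xi e * cnj (pl1 eta e')) = 0"
   using e by (induction ps) (auto simp: pull_eq)
  moreover have "pl0 f (rmap F e) = 0" if "m1 (Some e) = None"
  proof -
   have "m0 (Some (rmap F e)) ~: Some ` E_rg E" using reg_finite[OF e(1)] that by auto
   then show ?thesis using F.r_in[OF e(1)] f by (auto simp: pull_eq split: option.splits)
  qed
  ultimately show ?thesis using True s by auto
 next
  case False
  then obtain a b where ab: "m1 (Some e) = Some a" "m1 (Some e') = Some b" by (meson not_None_eq)
  have ain: "a : eds E" "b : eds E" using m1_in e ab by auto
  have da: "dmap E a = dmap E b" using m1_ends(2)[OF e(1) ab(1)] m1_ends(2)[OF e(2) ab(2)] e(3) by simp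
  have "(\<Sum>(xi, eta)\<leftarrow>ps. pl1 xi e * cnj (pl1 eta e')) = (\<Sum>(xi, eta)\<leftarrow>ps. xi a * cnj (eta b))" using e ab by (simp add: pull_eq)
  also have "... = (if a = b then f (rmap E a) else 0)" using k ain da unfolding E.kern_def by blast
  also have "a = b \<longleftrightarrow> e = e'"
  proof
   assume "a = b"
   then show "e = e'" using lift_unique[OF ain(1) F.d_in[OF e(1)] m1_ends(2)[OF e(1) ab(1)]] e ab by auto
  qed (use ab in simp)
  also have "f (rmap E a) = pl0 f (rmap F e)" using m1_ends(1)[OF e(1) ab(1)] F.r_in[OF e(1)] by (simp add: pull_eq)
  finally show ?thesis using s by simp
 qed
qed

text \<open>Around the image \<open>w\<close> there is a compact \<open>D\<close> of regular
  vertices. By regularity the edges with range over \<open>D\<close> are finite under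
  \<open>m1\<close> and lie over the compact set \<open>C\<close>, so they form a compact set; and
  every vertex near \<open>v\<close> receives an edge, so no sources accumulate at
  \<open>v\<close>.\<close>

lemma preimage_rg:
 assumes v: "v : vts F" "m0 (Some v) : Some ` E_rg E" shows "v : E_rg F"
proof -
 obtain w where w: "m0 (Some v) = Some w" "w : E_rg E" using v(2) by blast
 have wt: "w : vts E" using m0_in[OF v(1) w(1)] .
 then have cw: "compactin (verts E) {w}" by (simp add: compactin_sing)
 have sw: "{w} <= E_rg E" using w by blast
 obtain h :: "_ => real" and D where h: "continuous_map (verts E) euclideanreal h" "!!x. 0 <= h x" "!!x. h x <= 1"
  "!!x. x : {w} ==> h x = 1" "compactin (verts E) D" "D <= E_rg E" "!!x. x ~: D ==> h x = 0"
  by (rule LCH_bump[OF E.verts_LCH cw E.E_rg_open sw], rule that, assumption+)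
 define U where "U = {x : vts E. h x : {0<..}}"
 have U: "openin (verts E) U" unfolding U_def by (rule openin_continuous_map_preimage[OF h(1)]) simp
 have wU: "w : U" using wt h(4)[of w] by (simp add: U_def)
 have UD: "U <= D" using h(7) unfolding U_def by force
 define C where "C = {e : eds E. rmap E e : D}"
 have C: "compactin (edges E) C" unfolding C_def by (rule E.r_preimage_compact[OF h(5)]) (use h(6) E.E_rg_fin in blast)
 have ms: "continuous_map (verts F) (Alex (verts E)) (m0 \<circ> Some)" by (rule continuous_map_compose[OF continuous_map_Some m0_cont])
 define U' where "U' = {x : vts F. m0 (Some x) : Some ` U}"
 define V' where "V' = {x : vts F. m0 (Some x) : Some ` D}"
 have U': "openin (verts F) U'" unfolding U'_def using openin_continuous_map_preimage[OF ms, of "Some ` U"] U by (simp add: o_def)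
 have vU': "v : U'" using v(1) w(1) wU by (simp add: U'_def)
 have U'V': "U' <= V'" using UD unfolding U'_def V'_def by blast
 have V't: "V' <= vts F" unfolding V'_def by blast
 have clV: "closedin (verts F) V'" unfolding V'_def by (rule preimage_compact(2)[OF m0_cont m0_None h(5) E.verts_LCH(2)])
 have cl: "closedin (edges F) {e : eds F. rmap F e : V'}" by (rule closedin_continuous_map_preimage[OF F.r_cont clV])
 have co: "compactin (edges F) {e : eds F. m1 (Some e) : Some ` C}"
  by (rule preimage_compact(1)[OF m1_cont m1_None C E.edges_LCH(2)])
 have "{e : eds F. rmap F e : V'} <= {e : eds F. m1 (Some e) : Some ` C}"
 proof
  fix e assume "e : {e : eds F. rmap F e : V'}"
  then have e: "e : eds F" "m0 (Some (rmap F e)) : Some ` D" by (auto simp: V'_def)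
  then have "m0 (Some (rmap F e)) : Some ` E_rg E" using h(6) by blast
  then obtain a where a: "m1 (Some e) = Some a" "a : eds E" using reg_finite[OF e(1)] by blast
  then have "rmap E a : D" using m1_ends(1)[OF e(1) a(1)] e(2) by auto
  then show "e : {e : eds F. m1 (Some e) : Some ` C}" using a e by (simp add: C_def)
 qed
 then have "compactin (edges F) {e : eds F. rmap F e : V'}" by (rule closed_compactin[OF co _ cl])
 then have "v : E_fin F" unfolding E_fin_def using U' vU' U'V' V't by blast
 moreover have "v ~: verts F closure_of (E_sce F)"
 proof
  assume "v : verts F closure_of (E_sce F)"
  then obtain y where y: "y : E_sce F" "y : U'" using U' vU' unfolding in_closure_of by blast
  have "y : vts F" "m0 (Some y) : Some ` E_rg E" using y(2) UD h(6) by (auto simp: U'_def)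
  then obtain e where "e : eds F" "rmap F e = y" using reg_nonempty by blast
  then have "y : rmap F ` eds F" by blast
  moreover have "rmap F ` eds F <= verts F closure_of (rmap F ` eds F)"
   by (rule closure_of_subset) (use F.r_in in blast)
  ultimately show False using y(1) unfolding E_sce_def by blast
 qed
 ultimately show ?thesis by (simp add: E_rg_def)
qed

lemma pull_rg:
 assumes f: "f : C0c (subtopology (verts E) (E_rg E))"
 shows "pl0 f : C0c (subtopology (verts F) (E_rg F))"
proof -
 have off: "f v = 0" if "v ~: E_rg E" for v using C0_off[OF f] that by simp
 have p: "pl0 f : C0c (verts F)" by (rule pull_C0[OF m0_cont m0_None E.C0_rg[OF f]])
 have nz: "v : E_rg F" if "pl0 f v ~= 0" for v
 proof -
  have v: "v : vts F" using that pull_off by metis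
  moreover have "m0 (Some v) : Some ` E_rg E" using that off v by (auto simp: pull_eq split: option.splits)
  ultimately show ?thesis by (rule preimage_rg)
 qed
 show ?thesis
 proof (rule C0_I)
  show "continuous_map (subtopology (verts F) (E_rg F)) euclidean (pl0 f)" by (rule continuous_map_from_subtopology[OF C0_cont[OF p]])
  show "pl0 f v = 0" if "v ~: topspace (subtopology (verts F) (E_rg F))" for v
   using that nz[of v] C0_off[OF p, of v] by auto
  fix eps :: real assume e: "eps > 0"
  have "{v : vts F. eps <= cmod (pl0 f v)} <= E_rg F" using nz e by force
  then have "compactin (subtopology (verts F) (E_rg F)) {v : vts F. eps <= cmod (pl0 f v)}"
   using C0_level[OF p e] by (simp add: compactin_subtopology)
  then show "EX K. compactin (subtopology (verts F) (E_rg F)) K & (ALL x:topspace (subtopology (verts F) (E_rg F)). eps <= cmod (pl0 f x) --> x : K)"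
   by (intro exI conjI) auto
 qed
qed

lemma pull_ck:
 assumes A: "cstar_algebra A" and ck: "ck_pair F A T0 T1" shows "ck_pair E A (%f. T0 (pl0 f)) (%xi. T1 (pl1 xi))"
 unfolding E.ck_iff[OF A]
proof (intro conjI ballI allI impI pull_toeplitz)
 show "toeplitz_pair F A T0 T1" using ck by (simp add: ck_pair_def)
 fix f ps assume f: "f : C0c (subtopology (verts E) (E_rg E))" and ps: "E.valid ps" "E.kern f ps"
 have off: "f v = 0" if "v ~: E_rg E" for v using C0_off[OF f] that by simp
 show "T0 (pl0 f) = ksum A (%xi. T1 (pl1 xi)) ps"
  unfolding ksum_pls by (rule F.ck_pair_ksum[OF A ck pull_rg[OF f] pls_valid[OF ps(1)] kern_pull[OF ps(2) off]])
qed

text \<open>The universal property gives existence, and restricting to the carrier makes the map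
  unique as a function, so the description operator in \<open>induced_hom\<close> denotes
  it.\<close>

lemma induced:
 shows "star_hom (OA E) (OA F) (induced_hom F E m)"
  and "!!f. f : C0c (verts E) ==> induced_hom F E m (t0 E f) = t0 F (pl0 f)"
  and "!!xi. xi : Cd E ==> induced_hom F E m (t1 E xi) = t1 F (pl1 xi)"
proof -
 obtain \<mu> where \<mu>: "star_hom (OA E) (OA F) \<mu>" "!!f. f : C0c (verts E) ==> \<mu> (t0 E f) = t0 F (pl0 f)"
  "!!xi. xi : Cd E ==> \<mu> (t1 E xi) = t1 F (pl1 xi)"
  using E.graph_universal[OF F.graph_cstar pull_ck[OF F.graph_cstar F.t_ck]] by metis
 let ?c = "car (OA E)"
 interpret GE: cs_alg "OA E" using E.graph_cstar by (simp add: cs_alg_def)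
 define \<nu> where "\<nu> = restrict \<mu> ?c"
 have eq: "\<nu> x = \<mu> x" if "x : ?c" for x using that by (simp add: \<nu>_def)
 note D = star_homD[OF \<mu>(1)]
 have \<nu>h: "star_hom (OA E) (OA F) \<nu>"
  unfolding star_hom_def using D by (auto simp: eq)
 let ?P = "%\<mu>. \<mu> : extensional ?c & star_hom (OA E) (OA F) \<mu> &
   (ALL f:C0c (verts E). \<mu> (t0 E f) = t0 F (pl0 f)) & (ALL xi:Cd E. \<mu> (t1 E xi) = t1 F (pl1 xi))"
 have P: "?P \<nu>" using \<nu>h \<mu> eq E.t0_graph E.t1_graph by (simp add: \<nu>_def)
 have un: "\<nu>' = \<nu>" if "?P \<nu>'" for \<nu>'
 proof (rule extensionalityI[of _ ?c])
  show "\<nu>' : extensional ?c" using that by blast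
  show "\<nu> : extensional ?c" by (simp add: \<nu>_def)
  fix x assume x: "x : ?c"
  have h: "star_hom (OA E) (OA F) \<nu>'" using that by blast
  have "\<nu>' (t0 E f) = \<nu> (t0 E f)" if "f : C0c (verts E)" for f
   using \<open>?P \<nu>'\<close> P that by metis
  moreover have "\<nu>' (t1 E xi) = \<nu> (t1 E xi)" if "xi : Cd E" for xi
   using \<open>?P \<nu>'\<close> P that by metis
  ultimately show "\<nu>' x = \<nu> x" by (rule E.graph_hom_unique[OF F.graph_cstar h \<nu>h _ _ x])
 qed
 have e: "induced_hom F E m = \<nu>" unfolding induced_hom_def by (rule the_equality[of ?P, OF P un])
 show "star_hom (OA E) (OA F) (induced_hom F E m)" unfolding e by (rule \<nu>h)
 show "induced_hom F E m (t0 E f) = t0 F (pl0 f)" if "f : C0c (verts E)" for f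
  unfolding e eq[OF E.t0_graph[OF that]] by (rule \<mu>(2)[OF that])
 show "induced_hom F E m (t1 E xi) = t1 F (pl1 xi)" if "xi : Cd E" for xi
  unfolding e eq[OF E.t1_graph[OF that]] by (rule \<mu>(3)[OF that])
qed

end

section \<open>Projective limits of compactified spaces\<close>

locale plim =
 fixes Lam :: "'i set" and le :: "'i => 'i => bool" and X :: "'i => 'x topology" and n :: "'i => 'i => 'x option => 'x option"
 assumes dir: "directed_set Lam le"
  and LC: "!!i. i : Lam ==> locally_compact_space (X i)" and T2: "!!i. i : Lam ==> Hausdorff_space (X i)"
  and n_cont: "!!i j. i : Lam ==> j : Lam ==> le i j ==> continuous_map (Alex (X j)) (Alex (X i)) (n i j)"
  and n_None: "!!i j. i : Lam ==> j : Lam ==> le i j ==> n i j None = None"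
  and n_id: "!!i x. i : Lam ==> x : topspace (Alex (X i)) ==> n i i x = x"
  and n_comp: "!!i j k x. i : Lam ==> j : Lam ==> k : Lam ==> le i j ==> le j k ==> x : topspace (Alex (X k)) ==>
   n i j (n j k x) = n i k x"
begin

lemma le_refl: "i : Lam ==> le i i"
 and Lam_ne: "Lam ~= {}"
 using dir unfolding directed_set_def by blast+

lemma le_trans: "i : Lam ==> j : Lam ==> k : Lam ==> le i j ==> le j k ==> le i k"
 using dir[unfolded directed_set_def, THEN conjunct2, THEN conjunct2, THEN conjunct1, rule_format, of i j k] .

lemma ub: assumes "i : Lam" "j : Lam" obtains k where "k : Lam" "le i k" "le j k"
 using dir assms unfolding directed_set_def by blast

lemma ub_finite: assumes "finite J" "J <= Lam" shows "EX k:Lam. ALL j:J. le j k"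
 using assms
proof (induction J)
 case empty
 then show ?case using Lam_ne by blast
next
 case (insert i J)
 then obtain k where k: "k : Lam" "ALL j:J. le j k" by blast
 obtain l where l: "l : Lam" "le i l" "le k l" using ub[of i k] insert(4) k(1) by blast
 have "le j l" if "j : J" for j using le_trans[of j k l] that insert(4) k l by blast
 then show ?case using l by blast
qed

abbreviation "K i == Alex (X i)"
abbreviation "P == proj_lim_space Lam le K n"
abbreviation "V == proj_lim_part Lam le X n"
abbreviation "Inf_pt == (\<lambda>i\<in>Lam. None :: 'x option)"

lemma K_T2: "i : Lam ==> Hausdorff_space (K i)"
 by (simp add: Hausdorff_space_Alexandroff_compactification LC T2)

lemma n_in: "i : Lam ==> j : Lam ==> le i j ==> x : topspace (K j) ==> n i j x : topspace (K i)"
 using n_cont[of i j] unfolding continuous_map_def by blast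

lemma P_top: "topspace P = {x : (\<Pi>\<^sub>E i\<in>Lam. topspace (K i)). ALL i:Lam. ALL j:Lam. le i j --> n i j (x j) = x i}"
 by (auto simp: proj_lim_space_def)

lemma P_in: "x : topspace P ==> i : Lam ==> x i : topspace (K i)"
 unfolding P_top by blast

lemma P_comp: "x : topspace P ==> i : Lam ==> j : Lam ==> le i j ==> n i j (x j) = x i"
 unfolding P_top by blast

lemma P_ext:
 assumes x: "x : topspace P" "y : topspace P" and k: "k : Lam" and eq: "!!i. i : Lam ==> le k i ==> x i = y i"
 shows "x = y"
proof (rule extensionalityI[of _ Lam])
 show "x : extensional Lam" "y : extensional Lam" using x unfolding P_top PiE_def by blast+
 fix i assume i: "i : Lam"
 obtain j where j: "j : Lam" "le i j" "le k j" by (rule ub[OF i k])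
 show "x i = y i" using P_comp[OF x(1) i j(1,2)] P_comp[OF x(2) i j(1,2)] eq[OF j(1,3)] by simp
qed

abbreviation "Z == product_topology K Lam"

lemma Z_proj: "i : Lam ==> continuous_map Z (K i) (%x. x i)"
 by (rule continuous_map_product_projection)

lemma coherent_closed:
 assumes "i : Lam" "j : Lam" "le i j" shows "closedin Z {x : topspace Z. n i j (x j) = x i}"
proof (rule closedin_continuous_maps_eq[OF K_T2[OF assms(1)]])
 show "continuous_map Z (K i) (%x. n i j (x j))"
  using continuous_map_compose[OF Z_proj[OF assms(2)] n_cont[OF assms]] by (simp add: o_def)
 show "continuous_map Z (K i) (%x. x i)" by (rule continuous_map_product_projection[OF assms(1)])
qed

lemma Z_compact: "compact_space Z"
 by (simp add: compact_space_product_topology)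

lemma P_T2: "Hausdorff_space P"
 unfolding proj_lim_space_def
 by (rule Hausdorff_space_subtopology) (use K_T2 Hausdorff_space_product_topology in blast)

text \<open>For finite index sets compatible points exist by directedness; Tychonoff does the rest.\<close>

lemma thread:
 assumes l: "l : Lam" and R: "!!i. i : Lam ==> le l i ==> closedin (K i) (R i)" "!!i. i : Lam ==> le l i ==> R i ~= {}"
  and maps: "!!i j z. i : Lam ==> j : Lam ==> le l i ==> le i j ==> z : R j ==> n i j z : R i"
 obtains x where "x : topspace P" "!!i. i : Lam ==> le l i ==> x i : R i"
proof -
 define J where "J = {j : Lam. le l j}"
 \<comment> \<open>Coherence is demanded only below \<open>j\<close> and membership only at
   \<open>j\<close>. Thus each \<open>C j\<close> is nonempty by pushing down a single point of
   \<open>R j\<close>, and the sets decrease in \<open>j\<close>.\<close>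
 define C where "C j = {x : topspace Z. x j : R j} Int topspace Z Int (\<Inter>i\<in>{i:Lam. le i j}. {x : topspace Z. n i j (x j) = x i})" for j
 have JL: "J <= Lam" by (auto simp: J_def)
 have cl: "closedin Z (C j)" if j: "j : J" for j
 proof -
  have j': "j : Lam" "le l j" using j by (auto simp: J_def)
  have "closedin Z {x : topspace Z. x j : R j}"
   by (rule closedin_continuous_map_preimage[OF Z_proj[OF j'(1)] R(1)[OF j']])
  moreover have "closedin Z (\<Inter>i\<in>{i:Lam. le i j}. {x : topspace Z. n i j (x j) = x i})"
   by (rule closedin_Inter) (use le_refl[OF j'(1)] j' coherent_closed[OF _ j'(1)] in auto)
  ultimately show ?thesis unfolding C_def by (intro closedin_Int closedin_topspace)
 qed
 have CI: "x : C j \<longleftrightarrow> x : topspace Z & x j : R j & (ALL i:Lam. le i j --> n i j (x j) = x i)" for x j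
  unfolding C_def by blast
 have ne: "C j ~= {}" if j: "j : J" for j
 proof -
  have j': "j : Lam" "le l j" using j by (auto simp: J_def)
  obtain z where z: "z : R j" using R(2)[OF j'] by blast
  have zt: "z : topspace (K j)" using closedin_subset[OF R(1)[OF j']] z by blast
  define x where "x = (\<lambda>i\<in>Lam. if le i j then n i j z else None)"
  have xj: "x j = z" using j' le_refl n_id[OF j'(1) zt] by (simp add: x_def)
  have "x : topspace Z" using n_in[OF _ j'(1) _ zt] by (auto simp: x_def)
  then have "x : C j" unfolding CI xj using z by (simp add: x_def)
  then show ?thesis by blast
 qed
 have mono: "C k <= C j" if j: "j : J" "k : J" "le j k" for j k
 proof
  fix x assume x: "x : C k"
  have jk: "j : Lam" "k : Lam" "le l j" using j by (auto simp: J_def)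
  have xt: "x : topspace Z" and xR: "x k : R k" and xn: "!!i. i : Lam ==> le i k ==> n i k (x k) = x i" using x unfolding CI by blast+
  have xk: "x k : topspace (K k)" using xt jk(2) unfolding topspace_product_topology by blast
  have xj: "n j k (x k) = x j" by (rule xn[OF jk(1) j(3)])
  have "x j : R j" using maps[OF jk(1,2,3) j(3) xR] xj by simp
  moreover have "n i j (x j) = x i" if i: "i : Lam" "le i j" for i
   using n_comp[OF i(1) jk(1,2) i(2) j(3) xk] xj xn[OF i(1) le_trans[OF i(1) jk(1,2) i(2) j(3)]] by simp
  ultimately show "x : C j" unfolding CI using xt by blast
 qed
 have fip: "\<Inter>F ~= {}" if F: "finite F" "F <= C ` J" for F
 proof -
  obtain J' where J': "finite J'" "J' <= J" "F = C ` J'" using F finite_subset_image by metis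
  then have "finite (insert l J')" "insert l J' <= Lam" using l JL by auto
  then obtain k where k: "k : Lam" "ALL j:insert l J'. le j k" using ub_finite by meson
  then have kJ: "k : J" by (simp add: J_def)
  have "C k <= C j" if "j : J'" for j by (rule mono) (use that J'(2) k kJ in auto)
  then have "C k <= \<Inter>F" unfolding J'(3) by blast
  then show ?thesis using ne[OF kJ] by blast
 qed
 have "\<Inter>(C ` J) ~= {}"
  using Z_compact[unfolded compact_space_fip, rule_format, of "C ` J"] cl fip by blast
 then obtain x where x: "!!j. j : J ==> x : C j" by blast
 have xt: "x : topspace Z" using x[of l] l le_refl[OF l] unfolding CI J_def by blast
 have "n i j (x j) = x i" if ij: "i : Lam" "j : Lam" "le i j" for i j
 proof -
  obtain k where k: "k : Lam" "le j k" "le l k" by (rule ub[OF ij(2) l])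
  then have "x : C k" using x by (simp add: J_def)
  then have c: "!!i. i : Lam ==> le i k ==> n i k (x k) = x i" unfolding CI by blast
  have xk: "x k : topspace (K k)" using xt k(1) unfolding topspace_product_topology by blast
  show ?thesis using n_comp[OF ij(1,2) k(1) ij(3) k(2) xk] c[OF ij(2) k(2)] c[OF ij(1) le_trans[OF ij(1,2) k(1) ij(3) k(2)]] by simp
 qed
 then have "x : topspace P" unfolding P_top using xt[unfolded topspace_product_topology] by blast
 moreover have "x i : R i" if "i : Lam" "le l i" for i using x[of i] that unfolding CI J_def by blast
 ultimately show thesis by (rule that)
qed

lemma P_compact: "compact_space P"
proof -
 define S where "S = topspace Z Int (\<Inter>(i, j)\<in>{(i, j). i : Lam & j : Lam & le i j}. {x : topspace Z. n i j (x j) = x i})"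
 obtain i where "i : Lam" using Lam_ne by blast
 then have "closedin Z (\<Inter>(i, j)\<in>{(i, j). i : Lam & j : Lam & le i j}. {x : topspace Z. n i j (x j) = x i})"
  using le_refl by (intro closedin_Inter) (auto simp del: topspace_product_topology intro!: coherent_closed)
 then have "compactin Z S" unfolding S_def by (intro closedin_compact_space[OF Z_compact] closedin_Int closedin_topspace)
 moreover have A: "topspace Z Int {x. ALL i:Lam. ALL j:Lam. le i j --> n i j (x j) = x i} = S" unfolding S_def by blast
 have "P = subtopology Z S" unfolding proj_lim_space_def A[symmetric] subtopology_restrict ..
 ultimately show ?thesis by (simp add: compact_space_subtopology)
qed

lemma P_proj: "i : Lam ==> continuous_map P (K i) (%x. x i)"
 unfolding proj_lim_space_def by (rule continuous_map_from_subtopology[OF continuous_map_product_projection])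

text \<open>A basic open set of the product constrains finitely many coordinates, and by coherence
  all of them are conditions on one coordinate at a later index, which may also be taken above
  \<open>l\<close>.\<close>

lemma P_basis:
 assumes W: "openin P W" "x : W" and l: "l : Lam"
 obtains i U where "i : Lam" "le l i" "openin (K i) U" "x i : U" "{y : topspace P. y i : U} <= W"
proof -
 obtain W' where W': "openin Z W'" "W = W' Int {x. ALL i:Lam. ALL j:Lam. le i j --> n i j (x j) = x i}"
  using W(1) unfolding proj_lim_space_def openin_subtopology by blast
 have xP: "x : topspace P" using W openin_subset by blast
 have xW: "x : W'" using W W' by blast
 obtain U where U: "finite {i : Lam. U i ~= topspace (K i)}" "!!i. i : Lam ==> openin (K i) (U i)" "x : Pi\<^sub>E Lam U" "Pi\<^sub>E Lam U <= W'"
  using W'(1)[unfolded openin_product_topology_alt, rule_format, OF xW] by blast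
 let ?F = "{i : Lam. U i ~= topspace (K i)}"
 have "finite (insert l ?F)" "insert l ?F <= Lam" using U(1) l by auto
 then obtain k where k: "k : Lam" "ALL j:insert l ?F. le j k" using ub_finite by meson
 define O' where "O' = topspace (K k) Int (\<Inter>i\<in>?F. {z : topspace (K k). n i k z : U i})"
 have op: "openin (K k) {z : topspace (K k). n i k z : U i}" if "i : ?F" for i
  by (rule openin_continuous_map_preimage[OF n_cont U(2)]) (use that k in auto)
 have "openin (K k) O'"
 proof (cases "?F = {}")
  case True
  then have "O' = topspace (K k)" unfolding O'_def by blast
  then show ?thesis by (simp only: openin_topspace)
 next
  case False
  then show ?thesis unfolding O'_def by (intro openin_Int openin_topspace openin_INT2 U(1)) (use op in blast)+
 qed
 moreover have "x k : O'"
  unfolding O'_def using P_in[OF xP k(1)] P_comp[OF xP _ k(1)] k(2) U(3) by (auto simp: PiE_iff)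
 moreover have "{y : topspace P. y k : O'} <= W"
 proof
  fix y assume "y : {y : topspace P. y k : O'}"
  then have y: "y : topspace P" "y k : O'" by auto
  have "y i : U i" if i: "i : Lam" for i
  proof (cases "i : ?F")
   case True
   then have "n i k (y k) : U i" using y(2) unfolding O'_def by blast
   then show ?thesis using P_comp[OF y(1) i k(1)] k(2) True by auto
  next
   case False
   then show ?thesis using P_in[OF y(1) i] i by blast
  qed
  then have "y : Pi\<^sub>E Lam U" using y(1) unfolding P_top PiE_def by blast
  moreover have "ALL i:Lam. ALL j:Lam. le i j --> n i j (y j) = y i" using y(1) unfolding P_top by blast
  ultimately show "y : W" unfolding W'(2) using U(4) by blast
 qed
 ultimately show thesis using that[of k O'] k by blast
qed

lemma Inf_pt_P: "Inf_pt : topspace P"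
 unfolding P_top using n_None by auto

lemma V_eq: "V = subtopology P (topspace P - {Inf_pt})"
 by (simp add: proj_lim_part_def Let_def)

lemma V_top: "topspace V = topspace P - {Inf_pt}"
 unfolding V_eq by auto

lemma V_P: "x : topspace V ==> x : topspace P"
 unfolding V_top by blast

lemma V_finite: assumes "x : topspace V" obtains i where "i : Lam" "x i ~= None"
proof -
 have x: "x : topspace P" "x ~= Inf_pt" using assms unfolding V_top by auto
 have "x = Inf_pt" if "ALL i:Lam. x i = None"
 proof (rule extensionalityI[of _ Lam])
  show "x : extensional Lam" using x(1) unfolding P_top PiE_def by blast
 qed (use that in auto)
 then show thesis using x(2) that by blast
qed

lemma V_I: "x : topspace P ==> i : Lam ==> x i ~= None ==> x : topspace V"
 unfolding V_top by auto

lemma finite_above: assumes "x : topspace P" "i : Lam" "j : Lam" "le i j" "x i ~= None" shows "x j ~= None"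
 using P_comp[OF assms(1-4)] n_None[OF assms(2-4)] assms(5) by metis

lemma V_in: "x : topspace V ==> i : Lam ==> x i = Some u ==> u : topspace (X i)"
 using P_in[OF V_P, of x i] by auto

lemma V_open_P: "openin P (topspace P - {Inf_pt})"
 using closedin_Hausdorff_sing_eq[OF P_T2, of Inf_pt] Inf_pt_P by (intro openin_diff) auto

lemma openin_V: "openin V W \<longleftrightarrow> openin P W & W <= topspace V"
 unfolding V_top unfolding V_eq by (rule openin_open_subtopology[OF V_open_P])

text \<open>\<open>P\<close> is a compact Hausdorff space, so a subset of \<open>V\<close> is
  compact precisely if it is closed in \<open>P\<close>.\<close>

lemma compactin_V: "compactin V C \<longleftrightarrow> closedin P C & C <= topspace V"
proof -
 have "compactin P C \<longleftrightarrow> closedin P C" using P_T2 P_compact compactin_imp_closedin closedin_compact_space by blast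
 then show ?thesis unfolding V_top unfolding V_eq compactin_subtopology by simp
qed

lemma V_LC: "locally_compact_space V" and V_T2: "Hausdorff_space V"
 unfolding V_eq using P_T2 P_compact V_open_P
 by (auto intro: locally_compact_space_open_subset compact_imp_locally_compact_space Hausdorff_space_subtopology)

lemma V_basic_open: assumes "i : Lam" "openin (X i) U" shows "openin V {y : topspace V. y i : Some ` U}"
proof -
 have "openin P {y : topspace P. y i : Some ` U}" by (rule openin_continuous_map_preimage[OF P_proj[OF assms(1)]]) (simp add: assms(2))
 moreover have "{y : topspace V. y i : Some ` U} = {y : topspace P. y i : Some ` U}"
  using V_P V_I[OF _ assms(1)] by auto
 ultimately show ?thesis unfolding openin_V by auto
qed

lemma V_basis:
 assumes W: "openin V W" "x : W" and l: "l : Lam" "x l ~= None"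
 obtains i U u where "i : Lam" "le l i" "openin (X i) U" "x i = Some u" "u : U" "{y : topspace V. y i : Some ` U} <= W"
proof -
 have WP: "openin P W" using W(1) openin_V by blast
 obtain i U where i: "i : Lam" "le l i" "openin (K i) U" "x i : U" "{y : topspace P. y i : U} <= W"
  by (rule P_basis[OF WP W(2) l(1)])
 have xP: "x : topspace P" using WP W(2) openin_subset by blast
 obtain u where u: "x i = Some u" using finite_above[OF xP l(1) i(1,2) l(2)] by blast
 define U' where "U' = {z : topspace (X i). Some z : U}"
 have "openin (X i) U'" unfolding U'_def by (rule openin_continuous_map_preimage[OF continuous_map_Some i(3)])
 moreover have "u : U'" using i(4) P_in[OF xP i(1)] u by (auto simp: U'_def)
 moreover have "{y : topspace V. y i : Some ` U'} <= W" using i(5) V_P by (auto simp: U'_def)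
 ultimately show thesis using that i u by blast
qed

definition p :: "'i => ('i => 'x option) option => 'x option" where
 "p i = case_option None (%x. x i)"

lemma p_None [simp]: "p i None = None" and p_Some [simp]: "p i (Some x) = x i"
 by (simp_all add: p_def)

text \<open>The coordinate of \<open>P\<close> is continuous. For a closed set missing infinity the
  preimage in \<open>P\<close> misses \<open>Inf_pt\<close> and is compact in \<open>V\<close>; for
  one containing infinity the complement of the preimage is open in \<open>V\<close>.\<close>

lemma p_cont: assumes i: "i : Lam" shows "continuous_map (Alex V) (K i) (p i)"
 unfolding continuous_map_closedin
proof (intro conjI allI impI)
 show "p i : topspace (Alex V) \<rightarrow> topspace (K i)"
 proof
  fix x assume "x : topspace (Alex V)"
  then consider "x = None" | y where "x = Some y" "y : topspace V" by auto
  then show "p i x : topspace (K i)" by cases (use P_in[OF V_P i] in auto)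
 qed
 fix C assume C: "closedin (K i) C"
 have cl: "closedin P {x : topspace P. x i : C}" by (rule closedin_continuous_map_preimage[OF P_proj[OF i] C])
 show "closedin (Alex V) {x : topspace (Alex V). p i x : C}"
 proof (cases "None : C")
  case True
  have "openin V (topspace V - {x : topspace P. x i : C})"
   using openin_diff[OF V_open_P cl] unfolding openin_V V_top by blast
  moreover have "{x : topspace (Alex V). p i x : C} = topspace (Alex V) - Some ` (topspace V - {x : topspace P. x i : C})"
   using True V_P by auto
  ultimately show ?thesis unfolding closedin_Alexandroff_compactification by blast
 next
  case False
  let ?C = "{x : topspace P. x i : C}"
  have "x i ~= None" if "x i : C" for x :: "'i => 'x option" using that False by metis
  then have sub: "?C <= topspace V" using V_I[OF _ i] by blast
  then have c: "compactin V ?C" using cl unfolding compactin_V by blast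
  have "{x : topspace (Alex V). p i x : C} = Some ` ?C"
   using False sub V_P by auto
  then show ?thesis using c compactin_imp_closedin[OF V_T2 c] by simp
 qed
qed

lemma p_p: assumes "i : Lam" "j : Lam" "le i j" "x : topspace (Alex V)" shows "n i j (p j x) = p i x"
 using assms n_None P_comp V_P by auto

end

locale plim_surj = plim +
 assumes surj: "!!i j. i : Lam ==> j : Lam ==> le i j ==> topspace (Alex (X i)) <= n i j ` topspace (Alex (X j))"
begin

text \<open>The preimages of \<open>z\<close> at later indices are nonempty closed sets respected by
  the connecting maps, so \<open>thread\<close> applies.\<close>

lemma P_surj: assumes i: "i : Lam" and z: "z : topspace (K i)" shows "EX x:topspace P. x i = z"
proof -
 define R where "R j = {y : topspace (K j). n i j y : {z}}" for j
 have zc: "closedin (K i) {z}" using closedin_Hausdorff_sing_eq[OF K_T2[OF i]] z by blast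
 have 1: "closedin (K j) (R j)" if "j : Lam" "le i j" for j
  unfolding R_def by (rule closedin_continuous_map_preimage[OF n_cont[OF i that] zc])
 have 2: "R j ~= {}" if "j : Lam" "le i j" for j using surj[OF i that] z unfolding R_def by blast
 have 3: "n j k y : R j" if "j : Lam" "k : Lam" "le i j" "le j k" "y : R k" for j k y
  using that n_in[of j k y] n_comp[OF i that(1,2,3,4), of y] unfolding R_def by auto
 obtain x where x: "x : topspace P" "!!j. j : Lam ==> le i j ==> x j : R j" by (rule thread[OF i 1 2 3]) auto
 have "n i i (x i) = z" using x(2)[OF i le_refl[OF i]] unfolding R_def by blast
 then show ?thesis using x(1) n_id[OF i P_in[OF x(1) i]] by auto
qed

text \<open>Every point has a basic neighbourhood on which the given function is almost constant; finitely
 many of them come from one index \<open>i\<close>, where they form a cover by surjectivity, and a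
 partition of unity glues the values.\<close>

lemma C0_dense:
 assumes g: "g : C0c V" and e: "eps > 0" and l: "l : Lam"
 obtains i f where "i : Lam" "le l i" "f : C0c (X i)" "!!x. cmod (pull V (p i) f x - g x) <= eps"
proof -
 define d where "d = eps / 2"
 have d: "d > 0" using e by (simp add: d_def)
 have gI: "g Inf_pt = 0" using C0_off[OF g] unfolding V_top by blast
 have gopen: "EX W. openin P W & x : W & (ALL y:W. cmod (g x - g y) <= d)" if x: "x : topspace P" for x
 proof (cases "x : topspace V")
  case True
  have "openin V {y : topspace V. g y : ball (g x) d}" by (rule openin_continuous_map_preimage[OF C0_cont[OF g]]) simp
  then show ?thesis using True d unfolding openin_V
   by (intro exI[of _ "{y : topspace V. g y : ball (g x) d}"]) (auto simp: dist_norm)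
 next
  case False
  \<comment> \<open>At the point at infinity the neighbourhood is the complement of a compact level
    set of \<open>g\<close>.\<close>
  then have x0: "x = Inf_pt" using x unfolding V_top by blast
  have "compactin V {y : topspace V. d <= cmod (g y)}" by (rule C0_level[OF g d])
  then have "closedin P {y : topspace V. d <= cmod (g y)}" unfolding compactin_V by blast
  then have "openin P (topspace P - {y : topspace V. d <= cmod (g y)})" by blast
  moreover have "cmod (g x - g y) <= d" if "y : topspace P - {y : topspace V. d <= cmod (g y)}" for y
   using that d C0_off[OF g, of y] gI x0 by (cases "y : topspace V") auto
  ultimately show ?thesis using x False by (intro exI[of _ "topspace P - {y : topspace V. d <= cmod (g y)}"]) auto
 qed
 have "EX i U. i : Lam & le l i & openin (K i) U & x i : U & (ALL y:topspace P. y i : U --> cmod (g x - g y) <= d)"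
  if x: "x : topspace P" for x
 proof -
  obtain W where W: "openin P W" "x : W" "ALL y:W. cmod (g x - g y) <= d" using gopen[OF x] by blast
  obtain i U where i: "i : Lam" "le l i" "openin (K i) U" "x i : U" "{y : topspace P. y i : U} <= W"
   by (rule P_basis[OF W(1,2) l])
  then show ?thesis using W(3) by blast
 qed
 then obtain \<iota> U where \<iota>: "!!x. x : topspace P ==> \<iota> x : Lam & le l (\<iota> x) & openin (K (\<iota> x)) (U x) & x (\<iota> x) : U x &
   (ALL y:topspace P. y (\<iota> x) : U x --> cmod (g x - g y) <= d)" by metis
 define B where "B x = {y : topspace P. y (\<iota> x) : U x}" for x
 have Bo: "openin P (B x)" if "x : topspace P" for x
  unfolding B_def by (rule openin_continuous_map_preimage[OF P_proj]) (use \<iota>[OF that] in auto)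
 have xB: "x : B x" if "x : topspace P" for x using \<iota>[OF that] that by (simp add: B_def)
 have Pc: "compactin P (topspace P)" using P_compact by (simp add: compact_space_def)
 have Bc: "topspace P <= (\<Union>x\<in>topspace P. B x)" using xB by blast
 obtain S where S: "finite S" "S <= topspace P" "topspace P <= (\<Union>x\<in>S. B x)"
  using compactin_indexed_cover[OF Pc Bo Bc] by blast
 have "finite (insert l (\<iota> ` S))" "insert l (\<iota> ` S) <= Lam" using S(1,2) l \<iota> by auto
 then obtain i where i: "i : Lam" "ALL j:insert l (\<iota> ` S). le j i" using ub_finite by meson
 let ?O = "%x. {z : topspace (K i). n (\<iota> x) i z : U x}"
 have Oo: "openin (K i) (?O x)" if "x : S" for x
  by (rule openin_continuous_map_preimage[OF n_cont]) (use i \<iota> that S(2) in auto)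
 have Oc: "EX x:S. z : ?O x" if z: "z : topspace (K i)" for z
 proof -
  obtain y where y: "y : topspace P" "y i = z" using P_surj[OF i(1) z] by blast
  then obtain x where x: "x : S" "y : B x" using S(3) by blast
  have "n (\<iota> x) i z = y (\<iota> x)" using P_comp[OF y(1), of "\<iota> x" i] i x(1) S(2) \<iota> y(2) by auto
  then have "z : ?O x" using x(2) z by (simp add: B_def)
  then show ?thesis using x(1) by blast
 qed
 have KLC: "locally_compact_space (K i)" by (rule compact_imp_locally_compact_space) simp
 have ex: "EX x h. x : S & continuous_map (K i) euclideanreal h & (ALL y. 0 <= h y) & h z = 1 & (ALL y. y ~: ?O x --> h y = (0::real))"
  if z: "z : topspace (K i)" for z
 proof -
  obtain x where x: "x : S" "z : ?O x" using Oc[OF z] by blast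
  have cz: "compactin (K i) {z}" and sz: "{z} <= ?O x" using z x by (auto simp: compactin_sing)
  obtain h :: "_ => real" and D where h: "continuous_map (K i) euclideanreal h" "!!x. 0 <= h x" "!!x. h x <= 1"
   "!!x. x : {z} ==> h x = 1" "compactin (K i) D" "D <= ?O x" "!!x. x ~: D ==> h x = 0"
   by (rule LCH_bump[OF KLC K_T2[OF i(1)] cz Oo[OF x(1)] sz], rule that, assumption+)
  have "ALL y. y ~: ?O x --> h y = 0" using h(6,7) by blast
  then show ?thesis using x(1) h(1,2,4) by (intro exI[of _ x] exI[of _ h]) simp
 qed
 define good where "good z x h \<longleftrightarrow> x : S & continuous_map (K i) euclideanreal h & (ALL y. 0 <= h y) & h z = 1 & (ALL y. y ~: ?O x --> h y = (0::real))" for z x h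
 have "ALL z. EX x h. z : topspace (K i) --> good z x h" using ex unfolding good_def by meson
 then obtain xi h where "ALL z. z : topspace (K i) --> good z (xi z) (h z)" by metis
 then have H: "!!z. z : topspace (K i) ==> xi z : S & continuous_map (K i) euclideanreal (h z) & (ALL y. 0 <= h z y) & h z z = 1 &
   (ALL y. y ~: ?O (xi z) --> h z y = (0::real))" unfolding good_def by blast
 let ?N = "%z. {y : topspace (K i). h z y : {1/2<..}}"
 have No: "openin (K i) (?N z)" if "z : topspace (K i)" for z
  by (rule openin_continuous_map_preimage[of _ euclideanreal]) (use H[OF that] in auto)
 have Nc: "topspace (K i) <= (\<Union>z\<in>topspace (K i). ?N z)" using H by force
 have Kc: "compactin (K i) (topspace (K i))" using compact_space_Alexandroff_compactification compact_space_def by blast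
 obtain T where T: "finite T" "T <= topspace (K i)" "topspace (K i) <= (\<Union>z\<in>T. ?N z)"
  using compactin_indexed_cover[OF Kc No Nc] by blast
 define w where "w y = (\<Sum>z\<in>T. h z y)" for y
 have w: "1/2 < w y" if y: "y : topspace (K i)" for y
 proof -
  obtain z where z: "z : T" "1/2 < h z y" using T(3) y by auto
  have "h z y <= w y" unfolding w_def by (rule member_le_sum[OF z(1)]) (use H T in auto)
  then show ?thesis using z by linarith
 qed
 \<comment> \<open>A weighted mean of the sample values of \<open>g\<close>. The weights already
   exceed 1/2 in total on \<open>K i\<close>; the \<open>max\<close> only secures a continuous
   quotient.\<close>
 define F where "F y = (\<Sum>z\<in>T. complex_of_real (h z y) * g (xi z)) / complex_of_real (max (1/2) (w y))" for y
 have wc: "continuous_map (K i) euclideanreal w"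
  unfolding w_def by (rule continuous_map_sum[OF T(1)]) (use H T(2) in blast)
 have Fc: "continuous_map (K i) euclidean F"
 proof -
  have 1: "continuous_map (K i) euclidean (%y. \<Sum>z\<in>T. complex_of_real (h z y) * g (xi z))"
   by (rule continuous_map_sum[OF T(1)]) (intro cont_mult cont_of_real continuous_map_const[THEN iffD2], use H T(2) in auto)
  have "continuous_map (K i) euclideanreal (%y. 1 / max (1/2) (w y))"
   by (intro continuous_map_real_divide continuous_map_real_max wc) auto
  then have "continuous_map (K i) euclidean (%y. (\<Sum>z\<in>T. complex_of_real (h z y) * g (xi z)) * complex_of_real (1 / max (1/2) (w y)))"
   by (intro cont_mult 1 cont_of_real)
  then show ?thesis unfolding F_def by (rule continuous_map_eq) simp
 qed
 have Fg: "cmod (F (y i) - g y) <= d" if y: "y : topspace P" for y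
 proof -
  have yi: "y i : topspace (K i)" by (rule P_in[OF y i(1)])
  have w0: "w (y i) > 0" using w[OF yi] by linarith
  have m: "max (1/2) (w (y i)) = w (y i)" using w[OF yi] by simp
  have t: "cmod (complex_of_real (h z (y i)) * g (xi z) - complex_of_real (h z (y i)) * g y) <= h z (y i) * d" if z: "z : T" for z
  proof -
   have Hz: "xi z : S" "0 <= h z (y i)" "y i ~: ?O (xi z) ==> h z (y i) = 0" using H z T(2) by blast+
   have sP: "xi z : topspace P" using Hz(1) S(2) by blast
   have "h z (y i) = 0 | cmod (g (xi z) - g y) <= d"
   proof (cases "y i : ?O (xi z)")
    case True
    have s: "\<iota> (xi z) : Lam" "le (\<iota> (xi z)) i" "ALL y:topspace P. y (\<iota> (xi z)) : U (xi z) --> cmod (g (xi z) - g y) <= d"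
     using \<iota>[OF sP] i(2) Hz(1) by blast+
    have "y (\<iota> (xi z)) : U (xi z)" using True P_comp[OF y s(1) i(1) s(2)] by simp
    then show ?thesis using s(3) y by blast
   qed (use Hz(3) in blast)
   then show ?thesis unfolding right_diff_distrib[symmetric] norm_mult using Hz(2) by (auto intro: mult_left_mono)
  qed
  have "cmod ((\<Sum>z\<in>T. complex_of_real (h z (y i)) * g (xi z)) - complex_of_real (w (y i)) * g y) =
    cmod (\<Sum>z\<in>T. complex_of_real (h z (y i)) * g (xi z) - complex_of_real (h z (y i)) * g y)"
   by (simp add: w_def sum_subtractf sum_distrib_right)
  also have "... <= (\<Sum>z\<in>T. h z (y i) * d)" by (rule sum_norm_le) (rule t)
  also have "... = w (y i) * d" by (simp add: w_def sum_distrib_right)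
  finally have 1: "cmod ((\<Sum>z\<in>T. complex_of_real (h z (y i)) * g (xi z)) - complex_of_real (w (y i)) * g y) <= w (y i) * d" .
  have "F (y i) * complex_of_real (w (y i)) = (\<Sum>z\<in>T. complex_of_real (h z (y i)) * g (xi z))"
   unfolding F_def m using w0 by simp
  then have "cmod ((F (y i) - g y) * complex_of_real (w (y i))) <= w (y i) * d"
   using 1 by (simp add: left_diff_distrib mult.commute[of "g y"])
  then show ?thesis using w0 by (simp add: norm_mult mult.commute)
 qed
 have F0: "cmod (F None) <= d" using Fg[OF Inf_pt_P] i(1) gI by simp
 \<comment> \<open>Subtracting the value at infinity makes \<open>f\<close> vanish there. As
   \<open>g\<close> is 0 at \<open>Inf_pt\<close>, this costs a further \<open>d\<close>, hence
   \<open>d = eps / 2\<close>.\<close>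
 define f where "f u = (if u : topspace (X i) then F (Some u) - F None else 0)" for u
 have "continuous_map (K i) euclidean (%y. F y - F None)" by (intro continuous_map_diff Fc) auto
 then have "continuous_map (K i) euclidean (case_option 0 f)"
  by (rule continuous_map_eq) (auto simp: f_def)
 then have fC: "f : C0c (X i)" unfolding C0_iff_Alexandroff by (simp add: f_def)
 have "cmod (pull V (p i) f x - g x) <= eps" for x
 proof (cases "x : topspace V")
  case True
  have eq: "pull V (p i) f x = F (x i) - F None"
   using True V_in[OF True i(1)] by (auto simp: pull_eq f_def split: option.splits)
  have "cmod (pull V (p i) f x - g x) = cmod ((F (x i) - g x) - F None)" unfolding eq by (simp add: algebra_simps)
  also have "... <= d + d" using Fg[OF V_P[OF True]] F0 norm_triangle_ineq4 order_trans add_mono by metis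
  finally show ?thesis by (simp add: d_def)
 qed (use e C0_off[OF g] in \<open>simp add: pull_off\<close>)
 then show thesis using that i fC by blast
qed

end

section \<open>Projective limits of topological graphs\<close>

context tgr begin

lemma d_open: assumes U: "openin (edges E) U" shows "openin (verts E) (dmap E ` U)"
proof (subst openin_subopen, intro ballI)
 fix v assume "v : dmap E ` U"
 then obtain e where e: "e : U" "v = dmap E e" by blast
 then have "e : eds E" using U openin_subset by blast
 then obtain C where C: "chart E C" "e : C" by (rule chart_exists)
 have "openin (subtopology (edges E) C) (C Int U)" using U by (metis inf_commute openin_subtopology)
 moreover have "open_map (subtopology (edges E) C) (subtopology (verts E) (dmap E ` C)) (dmap E)"
  using C(1) unfolding chart_def by (meson homeomorphic_imp_open_map)
 ultimately have "openin (subtopology (verts E) (dmap E ` C)) (dmap E ` (C Int U))" unfolding open_map_def by blast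
 then have "openin (verts E) (dmap E ` (C Int U))" using C(1) openin_trans_full unfolding chart_def by blast
 then show "EX T. openin (verts E) T & v : T & T <= dmap E ` U" using e C(2) by blast
qed

end

section \<open>The limit graph\<close>

locale psys =
 fixes Lam :: "'i set" and le :: "'i => 'i => bool" and E :: "'i => ('v, 'e) tgraph" and m :: "'i => 'i => ('v, 'e, 'v, 'e) gmap"
 assumes proj: "projective_system Lam le E m" and regs: "regular_system Lam le E m" and surjs: "surjective_system Lam le E m"
begin

lemma tgrE: "i : Lam ==> tgr (E i)"
 using proj by (simp add: projective_system_def tgr_def)

lemma rf: assumes "i : Lam" "j : Lam" "le i j" shows "rfmap (E j) (E i) (m i j)"
proof -
 interpret F: tgr "E j" using tgrE assms by blast
 interpret G: tgr "E i" using tgrE assms by blast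
 have "factor_map (E j) (E i) (m i j)" using proj assms by (simp add: projective_system_def)
 moreover have "regular_factor_map (E j) (E i) (m i j)" using regs assms by (simp add: regular_system_def)
 ultimately show ?thesis by unfold_locales
qed

lemma sys_comp:
 assumes "i : Lam" "j : Lam" "k : Lam" "le i j" "le j k"
 shows "x : topspace (Alex (verts (E k))) ==> fst (m i j) (fst (m j k) x) = fst (m i k) x"
  and "y : topspace (Alex (edges (E k))) ==> snd (m i j) (snd (m j k) y) = snd (m i k) y"
 using proj[unfolded projective_system_def, THEN conjunct2, THEN conjunct2, THEN conjunct2, THEN conjunct2, rule_format, OF assms] by blast+

sublocale VV: plim_surj Lam le "%i. verts (E i)" "%i j. fst (m i j)"
proof
 show "directed_set Lam le" using proj by (simp add: projective_system_def)
 fix i assume i: "i : Lam"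
 show "locally_compact_space (verts (E i))" "Hausdorff_space (verts (E i))" by (rule tgr.verts_LCH[OF tgrE[OF i]])+
 show "fst (m i i) x = x" if "x : topspace (Alex (verts (E i)))" for x
  using proj[unfolded projective_system_def, THEN conjunct2, THEN conjunct2, THEN conjunct2, THEN conjunct1, rule_format, OF i] that by blast
 fix j assume j: "j : Lam" "le i j"
 interpret M: rfmap "E j" "E i" "m i j" by (rule rf[OF i j])
 show "continuous_map (Alex (verts (E j))) (Alex (verts (E i))) (fst (m i j))" by (rule M.m0_cont)
 show "fst (m i j) None = None" by (rule M.m0_None)
 show "topspace (Alex (verts (E i))) <= fst (m i j) ` topspace (Alex (verts (E j)))"
  using surjs i j unfolding surjective_system_def by blast
next
 show "fst (m i j) (fst (m j k) x) = fst (m i k) x"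
  if "i : Lam" "j : Lam" "k : Lam" "le i j" "le j k" "x : topspace (Alex (verts (E k)))" for i j k x
  by (rule sys_comp(1)[OF that])
qed

text \<open>Surjectivity on vertices passes to edges: choose a vertex over
  \<open>dmap (E i) a\<close> and lift \<open>a\<close> to it.\<close>

lemma edge_surj:
 assumes "i : Lam" "j : Lam" "le i j"
 shows "topspace (Alex (edges (E i))) <= snd (m i j) ` topspace (Alex (edges (E j)))"
proof
 fix y assume y: "y : topspace (Alex (edges (E i)))"
 interpret M: rfmap "E j" "E i" "m i j" by (rule rf[OF assms])
 show "y : snd (m i j) ` topspace (Alex (edges (E j)))"
 proof (cases y)
  case None
  then show ?thesis using M.m1_None by (intro image_eqI[of _ _ None]) auto
 next
  case (Some a)
  then have a: "a : eds (E i)" using y by auto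
  then have da: "Some (dmap (E i) a) : topspace (Alex (verts (E i)))" using M.E.d_in by simp
  from subsetD[OF VV.surj[OF assms] da] obtain x where x: "Some (dmap (E i) a) = fst (m i j) x" "x : topspace (Alex (verts (E j)))"
   by (rule imageE)
  then obtain v where "x = Some v" "v : vts (E j)" using M.m0_None by auto
  then obtain e where "e : eds (E j)" "snd (m i j) (Some e) = Some a" using M.lift_unique[OF a, of v] x(1) by auto
  then show ?thesis using Some by (intro image_eqI[of _ _ "Some e"]) auto
 qed
qed

sublocale VE: plim_surj Lam le "%i. edges (E i)" "%i j. snd (m i j)"
proof
 show "directed_set Lam le" by (rule VV.dir)
 fix i assume i: "i : Lam"
 show "locally_compact_space (edges (E i))" "Hausdorff_space (edges (E i))" by (rule tgr.edges_LCH[OF tgrE[OF i]])+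
 show "snd (m i i) x = x" if "x : topspace (Alex (edges (E i)))" for x
  using proj[unfolded projective_system_def, THEN conjunct2, THEN conjunct2, THEN conjunct2, THEN conjunct1, rule_format, OF i] that by blast
 fix j assume j: "j : Lam" "le i j"
 interpret M: rfmap "E j" "E i" "m i j" by (rule rf[OF i j])
 show "continuous_map (Alex (edges (E j))) (Alex (edges (E i))) (snd (m i j))" by (rule M.m1_cont)
 show "snd (m i j) None = None" by (rule M.m1_None)
 show "topspace (Alex (edges (E i))) <= snd (m i j) ` topspace (Alex (edges (E j)))" by (rule edge_surj[OF i j])
next
 show "snd (m i j) (snd (m j k) x) = snd (m i k) x"
  if "i : Lam" "j : Lam" "k : Lam" "le i j" "le j k" "x : topspace (Alex (edges (E k)))" for i j k x
  by (rule sys_comp(2)[OF that])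
qed

abbreviation "G == proj_lim Lam le E m"

lemma G_verts: "verts G = VV.V" and G_edges: "edges G = VE.V"
 by (simp_all add: proj_lim_def Let_def)

text \<open>Treats \<open>d\<close> and \<open>r\<close> together. The endpoints at indices above a
  finite one are coherent singletons, so \<open>thread\<close> finds a vertex and
  \<open>VV.P_ext\<close> makes it unique.\<close>

lemma proj_lim_end:
 assumes h: "!!i a. i : Lam ==> a : eds (E i) ==> h i a : vts (E i)"
  and compat: "!!i j a b. i : Lam ==> j : Lam ==> le i j ==> b : eds (E j) ==> snd (m i j) (Some b) = Some a ==>
   fst (m i j) (Some (h j b)) = Some (h i a)"
  and e: "e : topspace VE.V"
 shows "proj_lim_end Lam le (topspace VV.V) h e : topspace VV.V"
  and "i : Lam ==> e i = Some a ==> proj_lim_end Lam le (topspace VV.V) h e i = Some (h i a)"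
proof -
 have eP: "e : topspace VE.P" by (rule VE.V_P[OF e])
 define k where "k = (SOME i. i : Lam & e i ~= None)"
 have "k : Lam & e k ~= None" unfolding k_def by (rule someI_ex) (use VE.V_finite[OF e] in blast)
 then have k: "k : Lam" "e k ~= None" by auto
 have fin: "e i = Some (the (e i))" "the (e i) : eds (E i)" if i: "i : Lam" "le k i" for i
 proof -
  show f: "e i = Some (the (e i))" using VE.finite_above[OF eP k(1) i k(2)] by auto
  show "the (e i) : eds (E i)" by (rule VE.V_in[OF e i(1) f])
 qed
 let ?R = "%i. {Some (h i (the (e i)))}"
 have step: "fst (m i j) (Some (h j (the (e j)))) = Some (h i (the (e i)))" if ij: "i : Lam" "j : Lam" "le k i" "le i j" for i j
 proof -
  have kj: "le k j" by (rule VV.le_trans[OF k(1) ij(1,2,3,4)])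
  have "snd (m i j) (Some (the (e j))) = Some (the (e i))"
   using VE.P_comp[OF eP ij(1,2,4)] fin(1)[OF ij(2) kj] fin(1)[OF ij(1,3)] by simp
  then show ?thesis by (rule compat[OF ij(1,2,4) fin(2)[OF ij(2) kj]])
 qed
 have cl: "closedin (Alex (verts (E i))) (?R i)" if i: "i : Lam" "le k i" for i
  using closedin_Hausdorff_sing_eq[OF VV.K_T2[OF i(1)]] h[OF i(1) fin(2)[OF i]] by simp
 obtain v where v: "v : topspace VV.P" "!!i. i : Lam ==> le k i ==> v i : ?R i"
  by (rule VV.thread[OF k(1) cl]) (use step in auto)
 have vV: "v : topspace VV.V" by (rule VV.V_I[OF v(1) k(1)]) (use v(2)[OF k(1) VV.le_refl[OF k(1)]] in simp)
 let ?P = "%v. v : topspace VV.V & (ALL i:Lam. le k i --> v i = Some (h i (the (e i))))"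
 have Pv: "?P v" using vV v(2) by auto
 have eq: "proj_lim_end Lam le (topspace VV.V) h e = v"
  unfolding proj_lim_end_def Let_def k_def[symmetric]
 proof (rule the_equality[of ?P, OF Pv])
  fix w assume w: "?P w"
  then have "w : topspace VV.V" by blast
  then show "w = v" by (rule VV.P_ext[OF VV.V_P v(1) k(1)]) (use w v(2) in auto)
 qed
 then show "proj_lim_end Lam le (topspace VV.V) h e : topspace VV.V" using vV by simp
 assume i: "i : Lam" "e i = Some a"
 obtain j where j: "j : Lam" "le i j" "le k j" by (rule VV.ub[OF i(1) k(1)])
 have "snd (m i j) (Some (the (e j))) = Some a" using VE.P_comp[OF eP i(1) j(1,2)] fin(1)[OF j(1,3)] i(2) by simp
 from compat[OF i(1) j(1,2) fin(2)[OF j(1,3)] this] show "proj_lim_end Lam le (topspace VV.V) h e i = Some (h i a)"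
  unfolding eq using VV.P_comp[OF v(1) i(1) j(1,2)] v(2)[OF j(1,3)] by simp
qed

lemma d_ends: assumes e: "e : topspace VE.V"
 shows "dmap G e : topspace VV.V" and "i : Lam ==> e i = Some a ==> dmap G e i = Some (dmap (E i) a)"
proof -
 have g: "dmap G = proj_lim_end Lam le (topspace VV.V) (%i. dmap (E i))" by (simp add: proj_lim_def Let_def)
 have h: "dmap (E i) a : vts (E i)" if "i : Lam" "a : eds (E i)" for i a by (rule tgr.d_in[OF tgrE that(2)]) fact
 have c: "fst (m i j) (Some (dmap (E j) b)) = Some (dmap (E i) a)"
  if "i : Lam" "j : Lam" "le i j" "b : eds (E j)" "snd (m i j) (Some b) = Some a" for i j a b
  by (rule fmap.m1_ends(2)[OF rfmap.axioms(1)[OF rf[OF that(1-3)]] that(4,5)])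
 show "dmap G e : topspace VV.V" unfolding g by (rule proj_lim_end(1)[OF h c e])
 show "i : Lam ==> e i = Some a ==> dmap G e i = Some (dmap (E i) a)" unfolding g by (rule proj_lim_end(2)[OF h c e])
qed

lemma r_ends: assumes e: "e : topspace VE.V"
 shows "rmap G e : topspace VV.V" and "i : Lam ==> e i = Some a ==> rmap G e i = Some (rmap (E i) a)"
proof -
 have g: "rmap G = proj_lim_end Lam le (topspace VV.V) (%i. rmap (E i))" by (simp add: proj_lim_def Let_def)
 have h: "rmap (E i) a : vts (E i)" if "i : Lam" "a : eds (E i)" for i a by (rule tgr.r_in[OF tgrE that(2)]) fact
 have c: "fst (m i j) (Some (rmap (E j) b)) = Some (rmap (E i) a)"
  if "i : Lam" "j : Lam" "le i j" "b : eds (E j)" "snd (m i j) (Some b) = Some a" for i j a b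
  by (rule fmap.m1_ends(1)[OF rfmap.axioms(1)[OF rf[OF that(1-3)]] that(4,5)])
 show "rmap G e : topspace VV.V" unfolding g by (rule proj_lim_end(1)[OF h c e])
 show "i : Lam ==> e i = Some a ==> rmap G e i = Some (rmap (E i) a)" unfolding g by (rule proj_lim_end(2)[OF h c e])
qed

text \<open>Near a given edge a basic neighbourhood of its endpoint is a condition at one index
  \<open>i\<close>, where the endpoint is computed by the continuous map \<open>h i\<close>.\<close>

lemma ends_cont:
 assumes D: "!!e. e : topspace VE.V ==> D e : topspace VV.V" "!!e i a. e : topspace VE.V ==> i : Lam ==> e i = Some a ==> D e i = Some (h i a)"
  and h: "!!i. i : Lam ==> continuous_map (edges (E i)) (verts (E i)) (h i)"
 shows "continuous_map VE.V VV.V D"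
 unfolding continuous_map_def
proof (intro conjI allI impI)
 show "D : topspace VE.V \<rightarrow> topspace VV.V" using D(1) by blast
 fix W assume W: "openin VV.V W"
 show "openin VE.V {e : topspace VE.V. D e : W}"
 proof (subst openin_subopen, intro ballI)
  fix e assume "e : {e : topspace VE.V. D e : W}"
  then have e: "e : topspace VE.V" "D e : W" by auto
  obtain l where l: "l : Lam" "e l ~= None" by (rule VE.V_finite[OF e(1)])
  then have "D e l ~= None" using D(2)[OF e(1) l(1)] by auto
  then obtain i U u where i: "i : Lam" "le l i" "openin (verts (E i)) U" "D e i = Some u" "u : U" "{y : topspace VV.V. y i : Some ` U} <= W"
   by (rule VV.V_basis[OF W e(2) l(1)])
  define U' where "U' = {a : eds (E i). h i a : U}"
  have U': "openin (edges (E i)) U'" unfolding U'_def by (rule openin_continuous_map_preimage[OF h[OF i(1)] i(3)])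
  obtain a where a: "e i = Some a" using VE.finite_above[OF VE.V_P[OF e(1)] l(1) i(1,2) l(2)] by blast
  have "a : U'" using D(2)[OF e(1) i(1) a] i(4,5) VE.V_in[OF e(1) i(1) a] by (simp add: U'_def)
  then have "e : {y : topspace VE.V. y i : Some ` U'}" using e(1) a by simp
  moreover have "{y : topspace VE.V. y i : Some ` U'} <= {e : topspace VE.V. D e : W}"
   using D(1) D(2)[OF _ i(1)] i(6) by (fastforce simp: U'_def)
  ultimately show "EX T. openin VE.V T & e : T & T <= {e : topspace VE.V. D e : W}"
   using VE.V_basic_open[OF i(1) U'] by blast
 qed
qed

text \<open>At each later index \<open>j\<close> the edge \<open>a\<close> has exactly one lift
  \<open>c j\<close> over \<open>v j\<close>. Uniqueness forces these lifts to be coherent, so they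
  are the coordinates of the only possible edge of the limit.\<close>

lemma lift:
 assumes i: "i : Lam" and a: "a : eds (E i)" and v: "v : topspace VV.V" "v i = Some (dmap (E i) a)"
 shows "EX! e. e : topspace VE.V & e i = Some a & dmap G e = v"
proof -
 have vj: "v j = Some (the (v j))" "the (v j) : vts (E j)" "fst (m i j) (Some (the (v j))) = Some (dmap (E i) a)"
  if j: "j : Lam" "le i j" for j
 proof -
  show f: "v j = Some (the (v j))" using VV.finite_above[OF VV.V_P[OF v(1)] i j] v(2) by simp
  show "the (v j) : vts (E j)" by (rule VV.V_in[OF v(1) j(1) f])
  show "fst (m i j) (Some (the (v j))) = Some (dmap (E i) a)" using VV.P_comp[OF VV.V_P[OF v(1)] i j] f v(2) by simp
 qed
 have un: "EX! e. e : eds (E j) & snd (m i j) (Some e) = Some a & dmap (E j) e = the (v j)" if j: "j : Lam" "le i j" for j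
  by (rule fmap.lift_unique[OF rfmap.axioms(1)[OF rf[OF i j]] a vj(2,3)[OF j]])
 define c where "c j = (THE e. e : eds (E j) & snd (m i j) (Some e) = Some a & dmap (E j) e = the (v j))" for j
 have c: "c j : eds (E j)" "snd (m i j) (Some (c j)) = Some a" "dmap (E j) (c j) = the (v j)" if j: "j : Lam" "le i j" for j
  using theI'[OF un[OF j]] unfolding c_def by blast+
 have cu: "b = c j" if "j : Lam" "le i j" "b : eds (E j)" "snd (m i j) (Some b) = Some a" "dmap (E j) b = the (v j)" for j b
  using un[OF that(1,2)] c[OF that(1,2)] that by blast
 \<comment> \<open>The image of \<open>c k\<close> at \<open>j\<close> satisfies the description
   that characterizes \<open>c j\<close>.\<close>
 have cc: "snd (m j k) (Some (c k)) = Some (c j)" if jk: "j : Lam" "k : Lam" "le i j" "le j k" for j k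
 proof -
  have ik: "le i k" by (rule VV.le_trans[OF i jk])
  interpret M: rfmap "E k" "E j" "m j k" by (rule rf[OF jk(1,2,4)])
  interpret M': rfmap "E j" "E i" "m i j" by (rule rf[OF i jk(1,3)])
  have s: "snd (m i j) (snd (m j k) (Some (c k))) = Some a"
   using sys_comp(2)[OF i jk, of "Some (c k)"] c(1,2)[OF jk(2) ik] by simp
  then obtain b where b: "snd (m j k) (Some (c k)) = Some b" using M'.m1_None by (cases "snd (m j k) (Some (c k))") auto
  have bin: "b : eds (E j)" by (rule M.m1_in[OF c(1)[OF jk(2) ik] b])
  have "fst (m j k) (Some (the (v k))) = Some (dmap (E j) b)" using M.m1_ends(2)[OF c(1)[OF jk(2) ik] b] c(3)[OF jk(2) ik] by simp
  then have "dmap (E j) b = the (v j)" using VV.P_comp[OF VV.V_P[OF v(1)] jk(1,2,4)] vj(1)[OF jk(2) ik] by (metis option.sel)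
  then show ?thesis using cu[OF jk(1,3) bin] s b by simp
 qed
 have cl: "closedin (Alex (edges (E j))) {Some (c j)}" if j: "j : Lam" "le i j" for j
  using closedin_Hausdorff_sing_eq[OF VE.K_T2[OF j(1)]] c(1)[OF j] by simp
 obtain e where e: "e : topspace VE.P" "!!j. j : Lam ==> le i j ==> e j : {Some (c j)}"
  by (rule VE.thread[OF i cl]) (use cc in auto)
 have "c i = a"
 proof -
  note r = VV.le_refl[OF i]
  show ?thesis using c(2)[OF i r] VE.n_id[OF i, of "Some (c i)"] c(1)[OF i r] by simp
 qed
 then have ei: "e i = Some a" using e(2)[OF i VV.le_refl[OF i]] by simp
 have eV: "e : topspace VE.V" by (rule VE.V_I[OF e(1) i]) (simp add: ei)
 have de: "dmap G e = v"
  by (rule VV.P_ext[OF VV.V_P[OF d_ends(1)[OF eV]] VV.V_P[OF v(1)] i]) (use d_ends(2)[OF eV] e(2) c(3) vj(1) in auto)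
 show ?thesis
 proof (rule ex1I[of _ e])
  show "e : topspace VE.V & e i = Some a & dmap G e = v" using eV ei de by blast
  fix e' assume e': "e' : topspace VE.V & e' i = Some a & dmap G e' = v"
  then have e'V: "e' : topspace VE.V" by blast
  show "e' = e"
  proof (rule VE.P_ext[OF VE.V_P[OF e'V] e(1) i])
   fix j assume j: "j : Lam" "le i j"
   obtain b where b: "e' j = Some b" using VE.finite_above[OF VE.V_P[OF e'V] i j] e' by auto
   have "b = c j"
   proof (rule cu[OF j VE.V_in[OF e'V j(1) b]])
    show "snd (m i j) (Some b) = Some a" using VE.P_comp[OF VE.V_P[OF e'V] i j] b e' by simp
    show "dmap (E j) b = the (v j)" using d_ends(2)[OF e'V j(1) b] e' by simp
   qed
   then show "e' j = e j" using e(2)[OF j] b by simp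
  qed
 qed
qed

text \<open>The nontrivial inclusion is the existence part of \<open>lift\<close>. Basic open sets
  thus go to basic open sets, which makes \<open>dmap G\<close> open.\<close>

lemma d_basic: assumes i: "i : Lam" and U: "openin (edges (E i)) U"
 shows "dmap G ` {e : topspace VE.V. e i : Some ` U} = {v : topspace VV.V. v i : Some ` (dmap (E i) ` U)}"
proof (intro set_eqI iffI)
 fix v assume "v : dmap G ` {e : topspace VE.V. e i : Some ` U}"
 then obtain e u where "v = dmap G e" "e : topspace VE.V" "e i = Some u" "u : U" by blast
 then show "v : {v : topspace VV.V. v i : Some ` (dmap (E i) ` U)}" using d_ends i by auto
next
 fix v assume "v : {v : topspace VV.V. v i : Some ` (dmap (E i) ` U)}"
 then obtain u where u: "v : topspace VV.V" "v i = Some (dmap (E i) u)" "u : U" by auto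
 have "u : eds (E i)" using U u(3) openin_subset by blast
 from lift[OF i this u(1,2)] obtain e where "e : topspace VE.V" "e i = Some u" "dmap G e = v" by blast
 then show "v : dmap G ` {e : topspace VE.V. e i : Some ` U}" using u(3) by blast
qed

lemma d_open_map: "open_map VE.V VV.V (dmap G)"
 unfolding open_map_def
proof (intro allI impI)
 fix W assume W: "openin VE.V W"
 show "openin VV.V (dmap G ` W)"
 proof (subst openin_subopen, intro ballI)
  fix v assume "v : dmap G ` W"
  then obtain e where e: "e : W" "v = dmap G e" by blast
  have eV: "e : topspace VE.V" using W e openin_subset by blast
  obtain l where l: "l : Lam" "e l ~= None" by (rule VE.V_finite[OF eV])
  obtain i U u where i: "i : Lam" "le l i" "openin (edges (E i)) U" "e i = Some u" "u : U" "{y : topspace VE.V. y i : Some ` U} <= W"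
   by (rule VE.V_basis[OF W e(1) l])
  interpret T: tgr "E i" by (rule tgrE[OF i(1)])
  have "openin VV.V (dmap G ` {y : topspace VE.V. y i : Some ` U})"
   unfolding d_basic[OF i(1,3)] by (rule VV.V_basic_open[OF i(1) T.d_open[OF i(3)]])
  moreover have "v : dmap G ` {y : topspace VE.V. y i : Some ` U}" using e eV i by blast
  ultimately show "EX T. openin VV.V T & v : T & T <= dmap G ` W" using i(6) by blast
 qed
qed

lemma d_cont_lim: "continuous_map VE.V VV.V (dmap G)"
 by (rule ends_cont[OF d_ends tgr.d_cont[OF tgrE]])

lemma d_local: "local_homeomorphism VE.V VV.V (dmap G)"
 unfolding local_homeomorphism_def
proof (intro conjI ballI)
 show "dmap G : topspace VE.V \<rightarrow> topspace VV.V" using d_ends(1) by blast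
 fix e assume e: "e : topspace VE.V"
 obtain i where i: "i : Lam" "e i ~= None" by (rule VE.V_finite[OF e])
 then obtain a where a: "e i = Some a" by blast
 interpret T: tgr "E i" by (rule tgrE[OF i(1)])
 obtain C where C: "chart (E i) C" "a : C" by (rule T.chart_exists[OF VE.V_in[OF e i(1) a]])
 have Co: "openin (edges (E i)) C" using C(1) by (simp add: chart_def)
 \<comment> \<open>The edges lying over a chart of \<open>E i\<close>: injectivity of
   \<open>dmap G\<close> there combines injectivity of the chart with the uniqueness part of
   \<open>lift\<close>.\<close>
 define W where "W = {y : topspace VE.V. y i : Some ` C}"
 have W: "openin VE.V W" unfolding W_def by (rule VE.V_basic_open[OF i(1) Co])
 have dW: "openin VV.V (dmap G ` W)" using d_open_map W unfolding open_map_def by blast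
 have topW: "topspace (subtopology VE.V W) = W" "topspace (subtopology VV.V (dmap G ` W)) = dmap G ` W"
  using openin_subset[OF W] openin_subset[OF dW] by auto
 have inj: "inj_on (dmap G) W"
 proof (rule inj_onI)
  fix x y assume xy: "x : W" "y : W" "dmap G x = dmap G y"
  then obtain b c where b: "x i = Some b" "b : C" and c: "y i = Some c" "c : C" unfolding W_def by blast
  have V: "x : topspace VE.V" "y : topspace VE.V" using xy unfolding W_def by auto
  have "dmap (E i) b = dmap (E i) c" using d_ends(2)[OF V(1) i(1) b(1)] d_ends(2)[OF V(2) i(1) c(1)] xy(3) by simp
  then have "b = c" using T.chart_inj[OF C(1)] b c by (meson inj_onD)
  then show "x = y" using lift[OF i(1) VE.V_in[OF V(1) i(1) b(1)] d_ends(1)[OF V(1)] d_ends(2)[OF V(1) i(1) b(1)]] V b c xy(3) by metis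
 qed
 have "homeomorphic_map (subtopology VE.V W) (subtopology VV.V (dmap G ` W)) (dmap G)"
 proof (rule bijective_open_imp_homeomorphic_map)
  show "continuous_map (subtopology VE.V W) (subtopology VV.V (dmap G ` W)) (dmap G)"
   unfolding continuous_map_in_subtopology topW using continuous_map_from_subtopology[OF d_cont_lim] by blast
  show "open_map (subtopology VE.V W) (subtopology VV.V (dmap G ` W)) (dmap G)"
   unfolding open_map_def
  proof (intro allI impI)
   fix O' assume "openin (subtopology VE.V W) O'"
   then have O': "openin VE.V O'" "O' <= W" using openin_open_subtopology[OF W] by blast+
   then have "openin VV.V (dmap G ` O')" using d_open_map unfolding open_map_def by blast
   then show "openin (subtopology VV.V (dmap G ` W)) (dmap G ` O')" using openin_open_subtopology[OF dW] O'(2) by blast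
  qed
 qed (use inj topW in auto)
 then show "EX U. openin VE.V U & e : U & openin VV.V (dmap G ` U) & homeomorphic_map (subtopology VE.V U) (subtopology VV.V (dmap G ` U)) (dmap G)"
  using W dW e a C(2) by (intro exI[of _ W]) (auto simp: W_def)
qed

sublocale GG: tgr G
proof
 show "topological_graph G"
  unfolding topological_graph_def G_verts G_edges
  by (intro conjI VV.V_LC VV.V_T2 VE.V_LC VE.V_T2 d_local ends_cont[OF r_ends tgr.r_cont[OF tgrE]])
qed

section \<open>The projections as regular factor maps\<close>

definition pm :: "'i => ('i => 'v option, 'i => 'e option, 'v, 'e) gmap" where
 "pm i = (VV.p i, VE.p i)"

lemma pm_simps: "fst (pm i) = VV.p i" "snd (pm i) = VE.p i"
 by (simp_all add: pm_def)

lemma pm_factor: assumes i: "i : Lam" shows "factor_map G (E i) (pm i)"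
 unfolding factor_map_def pm_simps G_verts G_edges
proof (intro conjI ballI impI VV.p_cont[OF i] VE.p_cont[OF i] VV.p_None VE.p_None)
 fix e e' assume e: "e : topspace VE.V" "e' : eds (E i)" "VE.p i (Some e) = Some e'"
 then show "Some (rmap (E i) e') = VV.p i (Some (rmap G e))" "Some (dmap (E i) e') = VV.p i (Some (dmap G e))"
  using r_ends(2)[OF e(1) i] d_ends(2)[OF e(1) i] by simp_all
next
 fix a v assume "a : eds (E i)" "v : topspace VV.V" "Some (dmap (E i) a) = VV.p i (Some v)"
 then show "EX! e. e : topspace VE.V & VE.p i (Some e) = Some a & dmap G e = v" using lift[OF i, of a v] by simp
qed

text \<open>At each \<open>j\<close> above \<open>i\<close> the vertex \<open>v j\<close> is
  regular, so the edges into it form a nonempty compact set \<open>R j\<close>, and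
  \<open>thread\<close> yields an edge into \<open>v\<close>. An edge into \<open>v\<close> is
  finite at \<open>i\<close> because it is finite at some \<open>j\<close> above \<open>i\<close>,
  where regularity of \<open>m i j\<close> applies.\<close>

lemma pm_regular:
 assumes i: "i : Lam" and v: "v : topspace VV.V" "v i = Some w" "w : E_rg (E i)"
 shows "EX e:topspace VE.V. rmap G e = v" and "!!e. e : topspace VE.V ==> rmap G e = v ==> e i ~= None"
proof -
 define u where "u j = the (v j)" for j
 have u: "v j = Some (u j)" "u j : vts (E j)" "fst (m i j) (Some (u j)) = Some w" "u j : E_rg (E j)" if j: "j : Lam" "le i j" for j
 proof -
  interpret M: rfmap "E j" "E i" "m i j" by (rule rf[OF i j])
  show f: "v j = Some (u j)" using VV.finite_above[OF VV.V_P[OF v(1)] i j] v(2) by (auto simp: u_def)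
  show t: "u j : vts (E j)" by (rule VV.V_in[OF v(1) j(1) f])
  show w: "fst (m i j) (Some (u j)) = Some w" using VV.P_comp[OF VV.V_P[OF v(1)] i j] f v(2) by simp
  show "u j : E_rg (E j)" by (rule M.preimage_rg[OF t]) (simp add: w v(3))
 qed
 have fin: "snd (m i j) (Some b) ~= None" if j: "j : Lam" "le i j" and b: "b : eds (E j)" "rmap (E j) b = u j" for j b
 proof -
  interpret M: rfmap "E j" "E i" "m i j" by (rule rf[OF i j])
  show ?thesis using M.reg_finite[OF b(1)] u(3)[OF j] b(2) v(3) by auto
 qed
 show "e i ~= None" if e: "e : topspace VE.V" "rmap G e = v" for e
 proof -
  obtain k where k: "k : Lam" "e k ~= None" by (rule VE.V_finite[OF e(1)])
  obtain j where j: "j : Lam" "le i j" "le k j" by (rule VV.ub[OF i k(1)])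
  obtain b where b: "e j = Some b" using VE.finite_above[OF VE.V_P[OF e(1)] k(1) j(1,3) k(2)] by blast
  have "rmap (E j) b = u j" using r_ends(2)[OF e(1) j(1) b] e(2) u(1)[OF j(1,2)] by simp
  then show ?thesis using fin[OF j(1,2) VE.V_in[OF e(1) j(1) b]] VE.P_comp[OF VE.V_P[OF e(1)] i j(1,2)] b by simp
 qed
 define R where "R j = Some ` {b : eds (E j). rmap (E j) b : {u j}}" for j
 have cl: "closedin (Alex (edges (E j))) (R j)" if j: "j : Lam" "le i j" for j
 proof -
  interpret T: tgr "E j" by (rule tgrE[OF j(1)])
  have "compactin (edges (E j)) {b : eds (E j). rmap (E j) b : {u j}}"
   by (rule T.r_preimage_compact) (use u(2,4)[OF j] T.E_rg_fin in \<open>auto simp: compactin_sing\<close>)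
  then show ?thesis unfolding R_def using compactin_imp_closedin[OF T.edges_LCH(2)] by simp
 qed
 have ne: "R j ~= {}" if j: "j : Lam" "le i j" for j
 proof -
  interpret M: rfmap "E j" "E i" "m i j" by (rule rf[OF i j])
  show ?thesis using M.reg_nonempty[OF u(2)[OF j]] u(3)[OF j] v(3) unfolding R_def by auto
 qed
 have step: "snd (m j k) z : R j" if jk: "j : Lam" "k : Lam" "le i j" "le j k" "z : R k" for j k z
 proof -
  have ik: "le i k" by (rule VV.le_trans[OF i jk(1-4)])
  interpret M: rfmap "E k" "E j" "m j k" by (rule rf[OF jk(1,2,4)])
  obtain b where b: "z = Some b" "b : eds (E k)" "rmap (E k) b = u k" using jk(5) unfolding R_def by blast
  have uk: "fst (m j k) (Some (u k)) = Some (u j)"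
   using VV.P_comp[OF VV.V_P[OF v(1)] jk(1,2,4)] u(1)[OF jk(2) ik] u(1)[OF jk(1,3)] by simp
  then obtain c where c: "snd (m j k) (Some b) = Some c" "c : eds (E j)"
   using M.reg_finite[OF b(2)] b(3) u(4)[OF jk(1,3)] by auto
  have "rmap (E j) c = u j" using M.m1_ends(1)[OF b(2) c(1)] b(3) uk by simp
  then show ?thesis unfolding R_def b(1) c(1) using c(2) by blast
 qed
 have "EX e:topspace VE.P. ALL j:Lam. le i j --> e j : R j" by (rule VE.thread[OF i cl ne step]) blast+
 then obtain e where e: "e : topspace VE.P" "!!j. j : Lam ==> le i j ==> e j : R j" by blast
 have eV: "e : topspace VE.V" by (rule VE.V_I[OF e(1) i]) (use e(2)[OF i VV.le_refl[OF i]] in \<open>auto simp: R_def\<close>)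
 have "rmap G e = v"
 proof (rule VV.P_ext[OF VV.V_P[OF r_ends(1)[OF eV]] VV.V_P[OF v(1)] i])
  fix j assume j: "j : Lam" "le i j"
  obtain b where b: "e j = Some b" "rmap (E j) b = u j" using e(2)[OF j] unfolding R_def by blast
  show "rmap G e j = v j" using r_ends(2)[OF eV j(1) b(1)] b(2) u(1)[OF j] by simp
 qed
 then show "EX e:topspace VE.V. rmap G e = v" using eV by blast
qed

lemma pm_rf: assumes i: "i : Lam" shows "rfmap G (E i) (pm i)"
proof -
 interpret T: tgr "E i" by (rule tgrE[OF i])
 have "regular_factor_map G (E i) (pm i)"
  unfolding regular_factor_map_def pm_simps G_verts G_edges
 proof (intro conjI pm_factor[OF i] ballI impI)
  fix v assume "v : topspace VV.V" "VV.p i (Some v) : Some ` E_rg (E i)"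
  then obtain w where v: "v : topspace VV.V" "v i = Some w" "w : E_rg (E i)" by auto
  show "{e : topspace VE.V. rmap G e = v} ~= {}" using pm_regular(1)[OF i v] by blast
  fix e assume e: "e : topspace VE.V" "rmap G e = v"
  then obtain a where a: "e i = Some a" using pm_regular(2)[OF i v] by blast
  then show "VE.p i (Some e) : Some ` eds (E i)" using VE.V_in[OF e(1) i a] by simp
 qed
 then show ?thesis using pm_factor[OF i] by unfold_locales
qed

end

section \<open>Density of pulled-back functions\<close>

lemma (in tgr) cd_norm_scaled:
 assumes xi: "xi : Cd E" and eta: "eta : Cd E" and M: "0 <= M" and le: "!!e. cmod (xi e) <= M * cmod (eta e)"
 shows "cd_norm E xi <= M * cd_norm E eta"
proof (rule cd_norm_le)
 fix v
 have "sqn E xi v <= infsum (%e. M^2 * (cmod (eta e))^2) (fib E v)"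
  unfolding sqn_def
 proof (rule infsum_mono[OF Cd_summable[OF xi] summable_on_cmult_right[OF Cd_summable[OF eta]]])
  show "(cmod (xi e))^2 <= M^2 * (cmod (eta e))^2" for e
   unfolding power_mult_distrib[symmetric] by (rule power_mono[OF le]) simp
 qed
 also have "... = M^2 * sqn E eta v" unfolding sqn_def by (rule infsum_cmult_right')
 also have "... <= M^2 * (cd_norm E eta)^2" by (intro mult_left_mono sqn_le[OF eta]) auto
 finally show "sqn E xi v <= (M * cd_norm E eta)^2" by (simp add: power_mult_distrib)
qed (use M cd_norm_nonneg[OF eta] in simp)

context plim
begin

lemma V_img_compact:
 assumes C: "compactin V C" and i: "i : Lam" and fin: "!!x. x : C ==> x i ~= None"
 shows "compactin (X i) ((%x. the (x i)) ` C)"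
proof -
 have CV: "C <= topspace V" by (rule compactin_subset_topspace[OF C])
 have "compactin (K i) ((p i \<circ> Some) ` C)"
  by (rule image_compactin[OF C continuous_map_compose[OF continuous_map_Some p_cont[OF i]]])
 then have "closedin (K i) ((p i \<circ> Some) ` C)" using compactin_imp_closedin[OF K_T2[OF i]] by blast
 moreover have "(p i \<circ> Some) ` C = Some ` ((%x. the (x i)) ` C)"
  unfolding image_image by (rule image_cong) (use fin in auto)
 ultimately show ?thesis by simp
qed

text \<open>The open conditions \<open>S i\<close> persist at later indices, so on a compact set one
  index serves all points. It is used for finiteness of coordinates and for regularity of
  vertices.\<close>

lemma compact_level:
 assumes C: "compactin V C" and l: "l : Lam"
  and S: "!!i. i : Lam ==> openin (X i) (S i)" "!!x. x : C ==> EX i:Lam. x i : Some ` S i"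
  and mono: "!!i j x. i : Lam ==> j : Lam ==> le i j ==> x : topspace V ==> x i : Some ` S i ==> x j : Some ` S j"
 obtains i where "i : Lam" "le l i" "!!x. x : C ==> x i : Some ` S i"
proof -
 have CV: "C <= topspace V" by (rule compactin_subset_topspace[OF C])
 let ?W = "%i. {x : topspace V. x i : Some ` S i}"
 have W: "openin V (?W i)" if "i : Lam" for i by (rule V_basic_open[OF that S(1)[OF that]])
 have cov: "C <= (\<Union>i\<in>Lam. ?W i)"
 proof
  fix x assume x: "x : C"
  then show "x : (\<Union>i\<in>Lam. ?W i)" using S(2)[OF x] CV by auto
 qed
 obtain J where J: "finite J" "J <= Lam" "C <= (\<Union>i\<in>J. ?W i)" by (rule compactin_indexed_cover[OF C W cov])
 then have "finite (insert l J)" "insert l J <= Lam" using l by auto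
 then obtain k where k: "k : Lam" "ALL j:insert l J. le j k" using ub_finite by meson
 have "x k : Some ` S k" if x: "x : C" for x
 proof -
  obtain j where "j : J" "x j : Some ` S j" using J(3) x by blast
  then show ?thesis using mono[of j k x] J(2) k CV x by blast
 qed
 then show thesis using that k by blast
qed

lemma finite_level:
 assumes C: "compactin V C" and l: "l : Lam"
 obtains i where "i : Lam" "le l i" "!!x. x : C ==> x i ~= None"
proof -
 have CV: "C <= topspace V" by (rule compactin_subset_topspace[OF C])
 have fin: "x i : Some ` topspace (X i) \<longleftrightarrow> x i ~= None" if "x : topspace V" "i : Lam" for x i
  using V_in[OF that] by auto
 obtain i where i: "i : Lam" "le l i" "!!x. x : C ==> x i : Some ` topspace (X i)"
 proof (rule compact_level[OF C l, of "%i. topspace (X i)"])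
  show "EX i:Lam. x i : Some ` topspace (X i)" if "x : C" for x
   using V_finite[of x] fin[of x] CV that by (metis subsetD)
  show "x j : Some ` topspace (X j)" if "i : Lam" "j : Lam" "le i j" "x : topspace V" "x i : Some ` topspace (X i)" for i j x
   using finite_above[OF V_P[OF that(4)] that(1-3)] fin that by metis
 qed auto
 then show thesis using that by blast
qed

text \<open>The image of \<open>C\<close> at level \<open>i\<close> is compact in \<open>S\<close>;
  a bump there pulls back to a function that is 1 on \<open>C\<close>.\<close>

lemma V_bump:
 assumes C: "compactin V C" and i: "i : Lam" and S: "openin (X i) S" "!!x. x : C ==> x i : Some ` S"
 obtains k :: "'x => complex" and D where "continuous_map (X i) euclidean k" "!!u. cmod (k u) <= 1" "compactin (X i) D" "D <= S"
  "!!u. u ~: D ==> k u = 0" "!!x. x : C ==> pull V (p i) k x = 1"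
proof -
 have CV: "C <= topspace V" by (rule compactin_subset_topspace[OF C])
 have cC: "compactin (X i) ((%x. the (x i)) ` C)" by (rule V_img_compact[OF C i]) (use S(2) in auto)
 have sC: "(%x. the (x i)) ` C <= S" using S(2) by force
 obtain h :: "'x => real" and D where h: "continuous_map (X i) euclideanreal h" "!!x. 0 <= h x" "!!x. h x <= 1"
  "!!x. x : (%x. the (x i)) ` C ==> h x = 1" "compactin (X i) D" "D <= S" "!!x. x ~: D ==> h x = 0"
  by (rule LCH_bump[OF LC[OF i] T2[OF i] cC S(1) sC], rule that, assumption+)
 show thesis
 proof (rule that[of "%u. complex_of_real (h u)" D])
  show "continuous_map (X i) euclidean (%u. complex_of_real (h u))" by (rule cont_of_real[OF h(1)])
  fix x assume x: "x : C"
  then obtain u where "x i = Some u" "u : (%x. the (x i)) ` C" using S(2)[OF x] by force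
  then show "pull V (p i) (%u. complex_of_real (h u)) x = 1" using x CV h(4) by (auto simp: pull_eq)
 qed (use h in auto)
qed

lemma pull_up:
 assumes "i : Lam" "j : Lam" "le i j" shows "pull V (p j) (pull (X j) (n i j) f) = pull V (p i) f"
 by (rule pull_pull) (use p_cont[OF assms(2)] p_p[OF assms] n_None[OF assms] in \<open>auto simp: continuous_map_def\<close>)

end

context psys
begin

abbreviation "PL0 i == pull VV.V (VV.p i)"
abbreviation "PL1 i == pull VE.V (VE.p i)"

lemmas pm_eqs = pm_simps G_verts G_edges

lemma PL_C0: "i : Lam ==> f : C0c (verts (E i)) ==> PL0 i f : C0c VV.V"
 by (rule pull_C0[OF VV.p_cont VV.p_None])

lemma PL_Cd: assumes i: "i : Lam" and x: "xi : Cd (E i)" shows "PL1 i xi : Cd G"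
proof -
 interpret M: rfmap G "E i" "pm i" by (rule pm_rf[OF i])
 show ?thesis using M.pull_Cd[OF x] by (simp only: pm_eqs)
qed

lemma PL_inner: assumes i: "i : Lam" shows "cd_inner G (PL1 i xi) (PL1 i eta) = PL0 i (cd_inner (E i) xi eta)"
proof -
 interpret M: rfmap G "E i" "pm i" by (rule pm_rf[OF i])
 show ?thesis using M.pull_inner by (simp only: pm_eqs)
qed

text \<open>Uniform approximation says nothing about sums over infinite fibres. So \<open>xi\<close>
  is first truncated to \<open>zeta\<close> with compact support, and approximants of
  \<open>zeta\<close> are multiplied by a fixed pulled-back bump \<open>b\<close> equal to 1 on that
  support: a uniform error \<open>d\<close> becomes a module error of at most
  \<open>d * M\<close>.\<close>

lemma Cd_dense:
 assumes x: "xi : Cd G" and e: "eps > 0"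
 shows "EX i:Lam. EX eta:Cd (E i). cd_norm G (%e. PL1 i eta e - xi e) <= eps"
proof -
 have e2: "(eps / 2)^2 > 0" using e by simp
 obtain h :: "_ => real" and D where h: "continuous_map (edges G) euclideanreal h" "!!e. 0 <= h e" "!!e. h e <= 1"
  "compactin (edges G) D" "!!e. e ~: D ==> h e = 0"
  "!!v. v : vts G ==> infsum (%e. (1 - h e) * (cmod (xi e))^2) (fib G v) <= (eps / 2)^2"
  by (rule GG.sqn_tail[OF x e2], rule that, assumption+)
 define zeta where "zeta e = complex_of_real (h e) * xi e" for e
 have zeta: "zeta : Cd G" unfolding zeta_def by (rule GG.Cd_mult[OF x cont_of_real[OF h(1)], of 1]) (use h in auto)
 have d1: "cd_norm G (%e. zeta e - xi e) <= eps / 2"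
 proof (rule cd_norm_le)
  fix v assume v: "v : vts G"
  have s: "(%e. (1 - h e) * (cmod (xi e))^2) summable_on fib G v"
   by (rule summable_on_comparison_test[OF GG.Cd_summable[OF x]]) (use h in \<open>auto intro: mult_left_le_one_le\<close>)
  have le: "(cmod (zeta e - xi e))^2 <= (1 - h e) * (cmod (xi e))^2" for e
  proof -
   have "zeta e - xi e = - (complex_of_real (1 - h e) * xi e)" by (simp add: zeta_def algebra_simps)
   then have "(cmod (zeta e - xi e))^2 = (1 - h e)^2 * (cmod (xi e))^2"
    by (simp only: norm_minus_cancel norm_mult norm_of_real power_mult_distrib power2_abs)
   also have "... <= (1 - h e) * (cmod (xi e))^2"
    using h(2,3)[of e] by (intro mult_right_mono) (auto simp: power2_eq_square mult_left_le)
   finally show ?thesis .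
  qed
  have "sqn G (%e. zeta e - xi e) v <= infsum (%e. (1 - h e) * (cmod (xi e))^2) (fib G v)"
   unfolding sqn_def by (rule infsum_mono[OF _ s]) (use le GG.Cd_summable[OF GG.Cd_diff[OF zeta x]] in auto)
  then show "sqn G (%e. zeta e - xi e) v <= (eps / 2)^2" using h(6)[OF v] by linarith
 qed (use e in simp)
 have D: "compactin VE.V D" using h(4) by (simp only: pm_eqs)
 obtain l0 where l0: "l0 : Lam" using VV.Lam_ne by blast
 obtain l where l: "l : Lam" "le l0 l" "!!e. e : D ==> e l ~= None" by (rule VE.finite_level[OF D l0], rule that, assumption+)
 have Dl: "e l : Some ` eds (E l)" if "e : D" for e
  using l(3)[OF that] VE.V_in[of e l] l(1) that compactin_subset_topspace[OF D] by auto
 obtain k :: "'e => complex" and D' where k: "continuous_map (edges (E l)) euclidean k" "!!u. cmod (k u) <= 1" "compactin (edges (E l)) D'"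
  "D' <= eds (E l)" "!!u. u ~: D' ==> k u = 0" "!!e. e : D ==> PL1 l k e = 1"
  by (rule VE.V_bump[OF D l(1) openin_topspace], erule Dl, rule that, assumption+)
 interpret El: tgr "E l" by (rule tgrE[OF l(1)])
 have kC: "k : Cd (E l)" by (rule El.Cd_Cc[OF k(3,1,5)])
 define b where "b = PL1 l k"
 have b: "b : Cd G" unfolding b_def by (rule PL_Cd[OF l(1) kC])
 define M where "M = cd_norm G b"
 have M: "0 <= M" unfolding M_def by (rule cd_norm_nonneg[OF b])
 \<comment> \<open>Chosen after \<open>b\<close>, whose norm is independent of the index of
   approximation; the summand 1 covers \<open>M = 0\<close>.\<close>
 define d where "d = eps / (2 * (M + 1))"
 have d: "d > 0" using e M by (simp add: d_def)
 have "zeta : C0c VE.V" using GG.Cd_in_C0[OF zeta] by (simp only: pm_eqs)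
 from VE.C0_dense[OF this d l(1)] obtain i f where i: "i : Lam" "le l i" "f : C0c (edges (E i))"
  "!!e. cmod (PL1 i f e - zeta e) <= d" by metis
 interpret Mp: rfmap "E i" "E l" "m l i" by (rule rf[OF l(1) i(1,2)])
 \<comment> \<open>The bump was built at level \<open>l\<close>; its pullback to level
   \<open>i\<close> represents the same function \<open>b\<close> on the limit.\<close>
 define eta where "eta e = f e * Mp.pl1 k e" for e
 have eta: "eta : Cd (E i)" unfolding eta_def
  by (rule Mp.F.Cd_mult[OF Mp.pull_Cd[OF kC] C0_cont[OF i(3)] C0_norm_ge[OF i(3)]])
 have PLe: "PL1 i eta e = PL1 i f e * b e" for e
  unfolding eta_def pull_mult b_def VE.pull_up[OF l(1) i(1,2)] ..
 have fe: "zeta e * b e = zeta e" for e using k(6)[of e] h(5)[of e] by (cases "e : D") (auto simp: zeta_def b_def)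
 have diff: "PL1 i eta e - zeta e = (PL1 i f e - zeta e) * b e" for e unfolding PLe left_diff_distrib fe ..
 have Peta: "PL1 i eta : Cd G" by (rule PL_Cd[OF i(1) eta])
 have "cd_norm G (%e. PL1 i eta e - zeta e) <= d * M"
  unfolding M_def
 proof (rule GG.cd_norm_scaled[OF GG.Cd_diff[OF Peta zeta] b])
  show "cmod (PL1 i eta e - zeta e) <= d * cmod (b e)" for e
   unfolding diff norm_mult using i(4)[of e] by (intro mult_right_mono) auto
 qed (use d in simp)
 also have "d * M <= eps / 2" using M e by (simp add: d_def field_simps)
 finally have d2: "cd_norm G (%e. PL1 i eta e - zeta e) <= eps / 2" .
 have "cd_norm G (%e. PL1 i eta e - xi e) <= cd_norm G (%e. PL1 i eta e - zeta e) + cd_norm G (%e. zeta e - xi e)"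
  using GG.N.nm_triangle[of "%e. PL1 i eta e - zeta e" "%e. zeta e - xi e"] GG.Cd_diff[OF Peta zeta] GG.Cd_diff[OF zeta x] by simp
 then show ?thesis using d1 d2 i(1) eta by (intro bexI[of _ i] bexI[of _ eta]) auto
qed

text \<open>Near \<open>v\<close> the edges of \<open>G\<close> lie in a compact set
  \<open>C\<close> whose ranges cover a neighbourhood. From some index \<open>j\<close> on all of
  \<open>C\<close> is finite and the neighbourhood is visible at level \<open>j\<close>. Since the
  limit projects onto \<open>E j\<close>, the edges of \<open>E j\<close> near \<open>v j\<close>
  are images of \<open>C\<close>, which yields both finiteness and the absence of sources.\<close>

lemma rg_exhaust:
 assumes v: "v : E_rg G" shows "EX i:Lam. v i : Some ` E_rg (E i)"
proof -
 have vfin: "v : E_fin G" and vsce: "v ~: VV.V closure_of E_sce G" using v unfolding E_rg_def G_verts by auto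
 obtain U V where U: "openin VV.V U" "v : U" "U <= V" "compactin VE.V {e : topspace VE.V. rmap G e : V}"
  using vfin unfolding E_fin_def pm_eqs by blast
 have vV: "v : topspace VV.V" using U openin_subset by blast
 define C where "C = {e : topspace VE.V. rmap G e : V}"
 have C: "compactin VE.V C" using U(4) by (simp add: C_def)
 have rc: "continuous_map VE.V VV.V (rmap G)" using GG.r_cont by (simp only: pm_eqs)
 have "compactin VV.V (rmap G ` C)" by (rule image_compactin[OF C rc])
 then have rC: "closedin VV.V (rmap G ` C)" by (rule compactin_imp_closedin[OF VV.V_T2])
 have W: "openin VV.V (U - VV.V closure_of E_sce G)" by (rule openin_diff[OF U(1) closedin_closure_of])
 have WC: "U - VV.V closure_of E_sce G <= rmap G ` C"
 proof
  fix y assume y: "y : U - VV.V closure_of E_sce G"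
  have yV: "y : topspace VV.V" using y U(1) openin_subset by blast
  have "E_sce G <= VV.V closure_of E_sce G" by (rule closure_of_subset) (simp add: E_sce_def pm_eqs)
  then have yc: "y : VV.V closure_of (rmap G ` topspace VE.V)" using y yV unfolding E_sce_def pm_eqs by blast
  show "y : rmap G ` C"
  proof (rule ccontr)
   assume "y ~: rmap G ` C"
   then have yU: "y : U - rmap G ` C" using y by blast
   have "openin VV.V (U - rmap G ` C)" by (rule openin_diff[OF U(1) rC])
   from yc[unfolded in_closure_of, THEN conjunct2, rule_format, OF conjI[OF yU this]]
   obtain z where "z : rmap G ` topspace VE.V" "z : U - rmap G ` C" by blast
   then show False using U(3) unfolding C_def by blast
  qed
 qed
 obtain l where l: "l : Lam" "v l ~= None" by (rule VV.V_finite[OF vV])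
 have vW: "v : U - VV.V closure_of E_sce G" using U(2) vsce by blast
 obtain i O' u where i: "i : Lam" "le l i" "openin (verts (E i)) O'" "v i = Some u" "u : O'"
  "{y : topspace VV.V. y i : Some ` O'} <= U - VV.V closure_of E_sce G"
  by (rule VV.V_basis[OF W vW l])
 obtain j where j: "j : Lam" "le i j" "!!e. e : C ==> e j ~= None" by (rule VE.finite_level[OF C i(1)], rule that, assumption+)
 interpret Mp: rfmap "E j" "E i" "m i j" by (rule rf[OF i(1) j(1,2)])
 define C' where "C' = (%e. the (e j)) ` C"
 have C': "compactin (edges (E j)) C'" unfolding C'_def by (rule VE.V_img_compact[OF C j(1)]) (use j(3) in blast)
 define B where "B = {w : vts (E j). (Mp.m0 \<circ> Some) w : Some ` O'}"
 have B: "openin (verts (E j)) B" unfolding B_def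
  by (rule openin_continuous_map_preimage[OF continuous_map_compose[OF continuous_map_Some Mp.m0_cont]]) (simp add: i(3))
 have yB: "y : U - VV.V closure_of E_sce G" if y: "y : topspace VV.V" "y j = Some w" "w : B" for y w
  using i(6) y VV.P_comp[OF VV.V_P[OF y(1)] i(1) j(1,2)] by (auto simp: B_def)
 \<comment> \<open>Here surjectivity enters: \<open>a\<close> is a coordinate of an edge of the
   limit, whose range then lies in \<open>U\<close>.\<close>
 have sub1: "a : C'" if a: "a : eds (E j)" "rmap (E j) a : B" for a
 proof -
  have "Some a : topspace (Alex (edges (E j)))" using a by simp
  then obtain e where e: "e : topspace VE.P" "e j = Some a" using VE.P_surj[OF j(1)] by blast
  have eV: "e : topspace VE.V" by (rule VE.V_I[OF e(1) j(1)]) (simp add: e)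
  have "rmap G e : U" using yB[OF r_ends(1)[OF eV] r_ends(2)[OF eV j(1) e(2)] a(2)] by blast
  then have "e : C" using eV U(3) by (auto simp: C_def)
  then show ?thesis unfolding C'_def using e(2) by force
 qed
 have sub2: "w : rmap (E j) ` eds (E j)" if w: "w : B" for w
 proof -
  have "Some w : topspace (Alex (verts (E j)))" using w by (simp add: B_def)
  then obtain y where y: "y : topspace VV.P" "y j = Some w" using VV.P_surj[OF j(1)] by blast
  have yV: "y : topspace VV.V" by (rule VV.V_I[OF y(1) j(1)]) (simp add: y)
  obtain e where e: "e : C" "y = rmap G e" using yB[OF yV y(2) w] WC by blast
  obtain a where a: "e j = Some a" using j(3)[OF e(1)] by blast
  have eV: "e : topspace VE.V" using e(1) by (simp add: C_def)
  show ?thesis using r_ends(2)[OF eV j(1) a] e(2) y(2) VE.V_in[OF eV j(1) a] by auto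
 qed
 obtain w where w: "v j = Some w" using VV.finite_above[OF VV.V_P[OF vV] i(1) j(1,2)] i(4) by auto
 have wB: "w : B" using VV.P_comp[OF VV.V_P[OF vV] i(1) j(1,2)] VV.V_in[OF vV j(1) w] w i(4,5) by (simp add: B_def)
 have cw: "compactin (verts (E j)) {w}" using VV.V_in[OF vV j(1) w] by (simp add: compactin_sing)
 have sw: "{w} <= B" using wB by blast
 obtain h :: "'v => real" and D where h: "continuous_map (verts (E j)) euclideanreal h" "!!x. 0 <= h x" "!!x. h x <= 1"
  "!!x. x : {w} ==> h x = 1" "compactin (verts (E j)) D" "D <= B" "!!x. x ~: D ==> h x = 0"
  by (rule LCH_bump[OF Mp.F.verts_LCH cw B sw], rule that, assumption+)
 define O2 where "O2 = {x : vts (E j). h x : {0<..}}"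
 have O2: "openin (verts (E j)) O2" unfolding O2_def by (rule openin_continuous_map_preimage[OF h(1)]) simp
 have wO: "w : O2" using h(4)[of w] VV.V_in[OF vV j(1) w] by (simp add: O2_def)
 have OD: "O2 <= D" using h(7) unfolding O2_def by force
 have Dt: "D <= vts (E j)" by (rule compactin_subset_topspace[OF h(5)])
 have "closedin (edges (E j)) {a : eds (E j). rmap (E j) a : D}"
  by (rule closedin_continuous_map_preimage[OF Mp.F.r_cont compactin_imp_closedin[OF Mp.F.verts_LCH(2) h(5)]])
 moreover have "{a : eds (E j). rmap (E j) a : D} <= C'" using sub1 h(6) by blast
 ultimately have "compactin (edges (E j)) {a : eds (E j). rmap (E j) a : D}" using closed_compactin[OF C'] by blast
 then have "w : E_fin (E j)" unfolding E_fin_def using O2 wO OD Dt by blast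
 moreover have "w ~: verts (E j) closure_of E_sce (E j)"
 proof
  assume "w : verts (E j) closure_of E_sce (E j)"
  then obtain z where z: "z : E_sce (E j)" "z : B" using B wB unfolding in_closure_of by blast
  have "rmap (E j) ` eds (E j) <= verts (E j) closure_of (rmap (E j) ` eds (E j))"
   by (rule closure_of_subset) (use Mp.F.r_in in blast)
  then show False using z sub2[OF z(2)] unfolding E_sce_def by blast
 qed
 ultimately have "w : E_rg (E j)" by (simp add: E_rg_def)
 then show ?thesis using j(1) w by blast
qed

text \<open>As in \<open>Cd_dense\<close>, but with a bump supported in the regular vertices of
  level \<open>l\<close>. Its pullback gives the approximant compact support in the regular vertices
  of level \<open>i\<close>, where \<open>kern_exists\<close> supplies the finite sum.\<close>

lemma rg_dense:
 assumes f: "f : C0c (subtopology (verts G) (E_rg G))" and e: "eps > 0"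
 shows "EX i:Lam. EX g:C0c (subtopology (verts (E i)) (E_rg (E i))). (ALL v. cmod (PL0 i g v - f v) <= eps) &
  (EX ps. tgr.valid (E i) ps & tgr.kern (E i) g ps)"
proof -
 define d where "d = eps / 2"
 have d: "d > 0" using e by (simp add: d_def)
 obtain f' C where f': "f' : C0c (subtopology (verts G) (E_rg G))" "!!v. cmod (f' v - f v) <= d"
  "compactin (verts G) C" "C <= E_rg G" "!!v. v ~: C ==> f' v = 0"
  by (rule GG.C0_rg_dense[OF f d], rule that, assumption+)
 have C: "compactin VV.V C" using f'(3) by (simp only: pm_eqs)
 obtain l0 where l0: "l0 : Lam" using VV.Lam_ne by blast
 have "EX l:Lam. ALL v:C. v l : Some ` E_rg (E l)"
 proof (rule VV.compact_level[OF C l0, of "%i. E_rg (E i)"])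
  show "openin (verts (E i)) (E_rg (E i))" if "i : Lam" for i by (rule tgr.E_rg_open[OF tgrE[OF that]])
  show "EX i:Lam. v i : Some ` E_rg (E i)" if "v : C" for v using rg_exhaust that f'(4) by blast
  fix i j v assume ij: "i : Lam" "j : Lam" "le i j" and v: "v : topspace VV.V" "v i : Some ` E_rg (E i)"
  interpret Mp: rfmap "E j" "E i" "m i j" by (rule rf[OF ij])
  have "v i ~= None" using v(2) by auto
  then obtain w where w: "v j = Some w" using VV.finite_above[OF VV.V_P[OF v(1)] ij] by blast
  have "w : E_rg (E j)" by (rule Mp.preimage_rg[OF VV.V_in[OF v(1) ij(2) w]]) (use VV.P_comp[OF VV.V_P[OF v(1)] ij] w v(2) in simp)
  then show "v j : Some ` E_rg (E j)" using w by blast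
 qed blast
 then obtain l where l: "l : Lam" "!!v. v : C ==> v l : Some ` E_rg (E l)" by blast
 interpret El: tgr "E l" by (rule tgrE[OF l(1)])
 obtain k :: "'v => complex" and D where k: "continuous_map (verts (E l)) euclidean k" "!!u. cmod (k u) <= 1" "compactin (verts (E l)) D"
  "D <= E_rg (E l)" "!!u. u ~: D ==> k u = 0" "!!v. v : C ==> PL0 l k v = 1"
  by (rule VV.V_bump[OF C l(1) El.E_rg_open], erule l(2), rule that, assumption+)
 have kC: "k : C0c (verts (E l))"
 proof (rule C0_I[OF k(1)])
  show "k u = 0" if "u ~: vts (E l)" for u using that k(5) compactin_subset_topspace[OF k(3)] by blast
  show "EX K. compactin (verts (E l)) K & (ALL u:vts (E l). d <= cmod (k u) --> u : K)" if "d > 0" for d :: real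
   using k(3,5) that by (intro exI[of _ D]) force
 qed
 have "f' : C0c VV.V" using GG.C0_rg[OF f'(1)] by (simp only: pm_eqs)
 from VV.C0_dense[OF this d l(1)] obtain i g where i: "i : Lam" "le l i" "g : C0c (verts (E i))"
  "!!v. cmod (PL0 i g v - f' v) <= d" by metis
 interpret Mp: rfmap "E i" "E l" "m l i" by (rule rf[OF l(1) i(1,2)])
 define g' where "g' v = g v * Mp.pl0 k v" for v
 have g'C: "g' : C0c (verts (E i))" unfolding g'_def by (rule C0_mult[OF i(3) pull_C0[OF Mp.m0_cont Mp.m0_None kC]])
 define D' where "D' = {v : vts (E i). Mp.m0 (Some v) : Some ` D}"
 have D': "compactin (verts (E i)) D'" unfolding D'_def by (rule preimage_compact(1)[OF Mp.m0_cont Mp.m0_None k(3) El.verts_LCH(2)])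
 have D'rg: "D' <= E_rg (E i)" unfolding D'_def using Mp.preimage_rg k(4) by blast
 have off: "g' v = 0" if "v ~: D'" for v
  using that k(5) C0_off[OF i(3), of v] by (cases "v : vts (E i)") (auto simp: g'_def D'_def pull_eq split: option.splits)
 have g'rg: "g' : C0c (subtopology (verts (E i)) (E_rg (E i)))"
  by (rule C0_subtopologyI[OF Mp.F.verts_LCH(2) g'C D' D'rg off])
 have "D' <= E_fin (E i)" using D'rg Mp.F.E_rg_fin by blast
 then have ps: "EX ps. Mp.F.valid ps & Mp.F.kern g' ps" by (rule Mp.F.kern_exists[OF g'C D' _ off])
 have PLg: "PL0 i g' v = PL0 i g v * PL0 l k v" for v
  unfolding g'_def pull_mult VV.pull_up[OF l(1) i(1,2)] ..
 have fe: "f' v * PL0 l k v = f' v" for v using k(6)[of v] f'(5)[of v] by (cases "v : C") auto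
 have diff: "PL0 i g' v - f' v = (PL0 i g v - f' v) * PL0 l k v" for v unfolding PLg left_diff_distrib fe ..
 have "cmod (PL0 i g' v - f v) <= eps" for v
 proof -
  have "cmod (PL0 i g' v - f' v) <= d * 1" unfolding diff norm_mult
   using d by (intro mult_mono i(4) pull_le k(2)) auto
  then show ?thesis using f'(2)[of v] norm_triangle_ineq[of "PL0 i g' v - f' v" "f' v - f v"] by (simp add: d_def)
 qed
 then show ?thesis using i(1) g'rg ps by blast
qed

end

section \<open>The inductive limit of the graph algebras\<close>

lemma bilinear_lim:
 assumes X: "normed_sp X" and Y: "normed_sp Y" and Z: "normed_sp Z"
  and B: "!!x y. x : car X ==> y : car Y ==> B x y : car Z"
  and diff: "!!x x' y. x : car X ==> x' : car X ==> y : car Y ==> B (x -[X] x') y = B x y -[Z] B x' y"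
   "!!x y y'. x : car X ==> y : car Y ==> y' : car Y ==> B x (y -[Y] y') = B x y -[Z] B x y'"
  and n: "!!x y. x : car X ==> y : car Y ==> nm Z (B x y) <= nm X x * nm Y y"
  and lim: "cs_lim X sg x" "cs_lim Y tau y"
 shows "cs_lim Z (%n. B (sg n) (tau n)) (B x y)"
proof -
 interpret X: normed_sp X by fact
 interpret Y: normed_sp Y by fact
 interpret Z: normed_sp Z by fact
 have c: "!!n. sg n : car X" "x : car X" "!!n. tau n : car Y" "y : car Y"
  and l: "(%n. nm X (sg n -[X] x)) \<longlonglongrightarrow> 0" "(%n. nm Y (tau n -[Y] y)) \<longlonglongrightarrow> 0"
  using lim by (auto simp: cs_lim_def)
 have "(%n. nm X (sg n -[X] x) * nm Y (tau n) + nm X x * nm Y (tau n -[Y] y)) \<longlonglongrightarrow> 0 * nm Y y + nm X x * 0"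
  by (intro tendsto_intros l Y.cs_lim_norm lim)
 then have t: "(%n. nm X (sg n -[X] x) * nm Y (tau n) + nm X x * nm Y (tau n -[Y] y)) \<longlonglongrightarrow> 0" by simp
 have "nm Z (B (sg n) (tau n) -[Z] B x y) <= nm X (sg n -[X] x) * nm Y (tau n) + nm X x * nm Y (tau n -[Y] y)" for n
 proof -
  have "nm Z (B (sg n) (tau n) -[Z] B x y) <= nm Z (B (sg n) (tau n) -[Z] B x (tau n)) + nm Z (B x (tau n) -[Z] B x y)"
   by (intro Z.nm_minus_triangle B c)
  also have "... = nm Z (B (sg n -[X] x) (tau n)) + nm Z (B x (tau n -[Y] y))" by (simp only: diff c)
  also have "... <= nm X (sg n -[X] x) * nm Y (tau n) + nm X x * nm Y (tau n -[Y] y)"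
   by (intro add_mono n) (simp_all add: c)
  finally show ?thesis .
 qed
 moreover have "0 <= nm Z (B (sg n) (tau n) -[Z] B x y)" for n by (rule Z.nm_nonneg) (simp add: B c)
 ultimately have "(%n. nm Z (B (sg n) (tau n) -[Z] B x y)) \<longlonglongrightarrow> 0"
  by (intro tendsto_sandwich[OF _ _ tendsto_const t]) auto
 then show ?thesis using B c by (simp add: cs_lim_def)
qed

lemma lim_rel_bilinear:
 assumes "lim_rel X A R x y" "lim_rel X' A R' x' y'"
  and "!!x y x' y'. R x y ==> R' x' y' ==> R'' (B x x') (C y y')"
  and "!!sg tau. cs_lim X sg x ==> cs_lim X' tau x' ==> cs_lim X'' (%n. B (sg n) (tau n)) (B x x')"
  and "!!sg tau. cs_lim A sg y ==> cs_lim A tau y' ==> cs_lim A (%n. C (sg n) (tau n)) (C y y')"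
 shows "lim_rel X'' A R'' (B x x') (C y y')"
proof -
 obtain sg tau sg' tau' where s: "!!n. R (sg n) (tau n)" "cs_lim X sg x" "cs_lim A tau y" "!!n. R' (sg' n) (tau' n)" "cs_lim X' sg' x'" "cs_lim A tau' y'"
  using assms(1,2) unfolding lim_rel_def by auto
 show ?thesis unfolding lim_rel_def
  by (rule exI[of _ "%n. B (sg n) (sg' n)"], rule exI[of _ "%n. C (tau n) (tau' n)"]) (intro conjI allI assms s)
qed

context dense_map
begin

lemma lim_rel_dense:
 assumes x: "x : car X" and d: "!!eps. eps > 0 ==> EX x' y'. R x' y' & nm X (x' -[X] x) <= eps"
 shows "EX y. lim_rel X A R x y"
proof -
 have "EX x'. (EX y'. R x' y') & nm X (x' -[X] x) <= inverse (real (Suc n))" for n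
  using d[of "inverse (real (Suc n))"] by auto
 then obtain sg where s: "!!n. EX y'. R (sg n) y'" "!!n. nm X (sg n -[X] x) <= inverse (real (Suc n))" by metis
 have c: "sg n : car X" for n using s(1)[of n] R_in by blast
 have "(%n. nm X (sg n -[X] x)) \<longlonglongrightarrow> 0"
  by (rule tendsto_sandwich[OF _ _ tendsto_const LIMSEQ_inverse_real_of_nat]) (use s(2) c x in auto)
 then have "cs_lim X sg x" using c x by (simp add: cs_lim_def)
 then show ?thesis using lim_rel_exists s(1) by blast
qed

definition extn :: "'x => 'a" where
 "extn x = (THE y. lim_rel X A R x y)"

lemma extn_eq: "lim_rel X A R x y ==> extn x = y"
 unfolding extn_def by (rule the_equality) (auto intro: lim_rel_unique)

end

context psys
begin

sublocale S: cs_system Lam "%i. OA (E i)" le "%i j. induced_hom (E j) (E i) (m i j)"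
proof (intro cs_system.intro cs_family.intro cs_system_axioms.intro)
 show "cstar_algebra (OA (E i))" if "i : Lam" for i by (rule tgr.graph_cstar[OF tgrE[OF that]])
 show "directed_set Lam le" by (rule VV.dir)
 show "star_hom (OA (E i)) (OA (E j)) (induced_hom (E j) (E i) (m i j))" if "i : Lam" "j : Lam" "le i j" for i j
  by (rule rfmap.induced(1)[OF rf[OF that]])
 fix i j k a assume ijk: "i : Lam" "j : Lam" "k : Lam" "le i j" "le j k" and a: "a : car (OA (E i))"
 have ik: "le i k" by (rule VV.le_trans[OF ijk])
 interpret M1: rfmap "E j" "E i" "m i j" by (rule rf[OF ijk(1,2,4)])
 interpret M2: rfmap "E k" "E j" "m j k" by (rule rf[OF ijk(2,3,5)])
 interpret M3: rfmap "E k" "E i" "m i k" by (rule rf[OF ijk(1,3) ik])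
 have p0: "M2.pl0 (M1.pl0 f) = M3.pl0 f" for f
  by (rule pull_pull) (use M2.m0_None M1.m0_None VV.n_in[OF ijk(2,3,5)] sys_comp(1)[OF ijk] in blast)+
 have p1: "M2.pl1 (M1.pl1 f) = M3.pl1 f" for f
  by (rule pull_pull) (use M2.m1_None M1.m1_None VE.n_in[OF ijk(2,3,5)] sys_comp(2)[OF ijk] in blast)+
 show "induced_hom (E k) (E j) (m j k) (induced_hom (E j) (E i) (m i j) a) = induced_hom (E k) (E i) (m i k) a"
 proof (rule M1.E.graph_hom_unique[OF M2.F.graph_cstar star_hom_comp[OF M1.induced(1) M2.induced(1)] M3.induced(1) _ _ a])
  fix f assume f: "f : C0c (verts (E i))"
  show "induced_hom (E k) (E j) (m j k) (induced_hom (E j) (E i) (m i j) (t0 (E i) f)) = induced_hom (E k) (E i) (m i k) (t0 (E i) f)"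
   unfolding M1.induced(2)[OF f] M3.induced(2)[OF f] M2.induced(2)[OF pull_C0[OF M1.m0_cont M1.m0_None f]] p0 ..
 next
  fix xi assume x: "xi : Cd (E i)"
  show "induced_hom (E k) (E j) (m j k) (induced_hom (E j) (E i) (m i j) (t1 (E i) xi)) = induced_hom (E k) (E i) (m i k) (t1 (E i) xi)"
   unfolding M1.induced(3)[OF x] M3.induced(3)[OF x] M2.induced(3)[OF M1.pull_Cd[OF x]] p1 ..
 qed
qed

sublocale LA: cs_alg S.L
 using S.L_cstar by (simp add: cs_alg_def)

sublocale CV: cs_alg "C0 VV.V"
 using C0_cstar by (simp add: cs_alg_def)

abbreviation "L0 i f == S.inc i (t0 (E i) f)"
abbreviation "L1 i xi == S.inc i (t1 (E i) xi)"

lemma L_ck: assumes i: "i : Lam" shows "ck_pair (E i) S.L (L0 i) (L1 i)"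
proof -
 interpret T: tgr "E i" by (rule tgrE[OF i])
 show ?thesis by (rule ck_pair_hom[OF T.graph_cstar T.t_ck S.inc_hom[OF i]])
qed

lemma L_toep: "i : Lam ==> toep (E i) S.L (L0 i) (L1 i)"
 using L_ck tgrE S.L_cstar by (simp add: toep_def toep_axioms_def cs_alg_def ck_pair_def)

section \<open>The limit pair in the inductive limit\<close>

definition R0 where "R0 g y \<longleftrightarrow> (EX i:Lam. EX f:C0c (verts (E i)). g = PL0 i f & y = L0 i f)"
definition R1 where "R1 x y \<longleftrightarrow> (EX i:Lam. EX xi:Cd (E i). x = PL1 i xi & y = L1 i xi)"

lemma R0_I: "i : Lam ==> f : C0c (verts (E i)) ==> R0 (PL0 i f) (L0 i f)"
 and R1_I: "i : Lam ==> xi : Cd (E i) ==> R1 (PL1 i xi) (L1 i xi)"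
 unfolding R0_def R1_def by blast+

lemma up0:
 assumes ij: "i : Lam" "j : Lam" "le i j" and f: "f : C0c (verts (E i))"
 shows "EX f':C0c (verts (E j)). PL0 i f = PL0 j f' & L0 i f = L0 j f'"
proof -
 interpret M: rfmap "E j" "E i" "m i j" by (rule rf[OF ij])
 show ?thesis
 proof (intro bexI[of _ "M.pl0 f"] conjI pull_C0[OF M.m0_cont M.m0_None f])
  show "PL0 i f = PL0 j (M.pl0 f)" by (rule VV.pull_up[OF ij, symmetric])
  show "L0 i f = L0 j (M.pl0 f)" unfolding M.induced(2)[OF f, symmetric] by (rule S.inc_compat[OF ij M.E.t0_graph[OF f], symmetric])
 qed
qed

lemma up1:
 assumes ij: "i : Lam" "j : Lam" "le i j" and x: "xi : Cd (E i)"
 shows "EX xi':Cd (E j). PL1 i xi = PL1 j xi' & L1 i xi = L1 j xi'"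
proof -
 interpret M: rfmap "E j" "E i" "m i j" by (rule rf[OF ij])
 show ?thesis
 proof (intro bexI[of _ "M.pl1 xi"] conjI M.pull_Cd[OF x])
  show "PL1 i xi = PL1 j (M.pl1 xi)" by (rule VE.pull_up[OF ij, symmetric])
  show "L1 i xi = L1 j (M.pl1 xi)" unfolding M.induced(3)[OF x, symmetric] by (rule S.inc_compat[OF ij M.E.t1_graph[OF x], symmetric])
 qed
qed

lemma common00:
 assumes "R0 g y" "R0 h z"
 obtains i f f' where "i : Lam" "f : C0c (verts (E i))" "f' : C0c (verts (E i))"
  "g = PL0 i f" "y = L0 i f" "h = PL0 i f'" "z = L0 i f'"
proof -
 obtain i f where i: "i : Lam" "f : C0c (verts (E i))" "g = PL0 i f" "y = L0 i f" using assms(1) unfolding R0_def by blast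
 obtain j f' where j: "j : Lam" "f' : C0c (verts (E j))" "h = PL0 j f'" "z = L0 j f'" using assms(2) unfolding R0_def by blast
 obtain k where k: "k : Lam" "le i k" "le j k" by (rule VV.ub[OF i(1) j(1)])
 obtain f1 where f1: "f1 : C0c (verts (E k))" "PL0 i f = PL0 k f1" "L0 i f = L0 k f1" using up0[OF i(1) k(1,2) i(2)] by blast
 obtain f2 where f2: "f2 : C0c (verts (E k))" "PL0 j f' = PL0 k f2" "L0 j f' = L0 k f2" using up0[OF j(1) k(1,3) j(2)] by blast
 show thesis by (rule that[OF k(1) f1(1) f2(1)]) (simp_all only: i(3,4) j(3,4) f1(2,3) f2(2,3))
qed

lemma common11:
 assumes "R1 g y" "R1 h z"
 obtains i f f' where "i : Lam" "f : Cd (E i)" "f' : Cd (E i)" "g = PL1 i f" "y = L1 i f" "h = PL1 i f'" "z = L1 i f'"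
proof -
 obtain i f where i: "i : Lam" "f : Cd (E i)" "g = PL1 i f" "y = L1 i f" using assms(1) unfolding R1_def by blast
 obtain j f' where j: "j : Lam" "f' : Cd (E j)" "h = PL1 j f'" "z = L1 j f'" using assms(2) unfolding R1_def by blast
 obtain k where k: "k : Lam" "le i k" "le j k" by (rule VV.ub[OF i(1) j(1)])
 obtain f1 where f1: "f1 : Cd (E k)" "PL1 i f = PL1 k f1" "L1 i f = L1 k f1" using up1[OF i(1) k(1,2) i(2)] by blast
 obtain f2 where f2: "f2 : Cd (E k)" "PL1 j f' = PL1 k f2" "L1 j f' = L1 k f2" using up1[OF j(1) k(1,3) j(2)] by blast
 show thesis by (rule that[OF k(1) f1(1) f2(1)]) (simp_all only: i(3,4) j(3,4) f1(2,3) f2(2,3))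
qed

lemma common01:
 assumes "R0 g y" "R1 h z"
 obtains i f f' where "i : Lam" "f : C0c (verts (E i))" "f' : Cd (E i)"
  "g = PL0 i f" "y = L0 i f" "h = PL1 i f'" "z = L1 i f'"
proof -
 obtain i f where i: "i : Lam" "f : C0c (verts (E i))" "g = PL0 i f" "y = L0 i f" using assms(1) unfolding R0_def by blast
 obtain j f' where j: "j : Lam" "f' : Cd (E j)" "h = PL1 j f'" "z = L1 j f'" using assms(2) unfolding R1_def by blast
 obtain k where k: "k : Lam" "le i k" "le j k" by (rule VV.ub[OF i(1) j(1)])
 obtain f1 where f1: "f1 : C0c (verts (E k))" "PL0 i f = PL0 k f1" "L0 i f = L0 k f1" using up0[OF i(1) k(1,2) i(2)] by blast
 obtain f2 where f2: "f2 : Cd (E k)" "PL1 j f' = PL1 k f2" "L1 j f' = L1 k f2" using up1[OF j(1) k(1,3) j(2)] by blast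
 show thesis by (rule that[OF k(1) f1(1) f2(1)]) (simp_all only: i(3,4) j(3,4) f1(2,3) f2(2,3))
qed

text \<open>Each vertex of \<open>E i\<close> is a coordinate of a vertex of the limit, by
  surjectivity. This provides the bound required of \<open>R0\<close> by
  \<open>dense_map\<close>.\<close>

lemma PL0_norm:
 assumes i: "i : Lam" and f: "f : C0c (verts (E i))"
 shows "nm (C0 (verts (E i))) f <= nm (C0 VV.V) (PL0 i f)"
proof (rule C0_norm_le[OF C0_norm_nonneg[OF PL_C0[OF i f]]])
 fix u assume "u : vts (E i)"
 then have "Some u : topspace (Alex (verts (E i)))" by simp
 then obtain v where v: "v : topspace VV.P" "v i = Some u" using VV.P_surj[OF i] by blast
 have "v : topspace VV.V" by (rule VV.V_I[OF v(1) i]) (simp add: v)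
 then have "PL0 i f v = f u" using v by (simp add: pull_eq)
 then show "cmod (f u) <= nm (C0 VV.V) (PL0 i f)" using C0_norm_ge[OF PL_C0[OF i f], of v] by simp
qed

lemma PL1_norm:
 assumes i: "i : Lam" and x: "xi : Cd (E i)" shows "cd_norm (E i) xi <= cd_norm G (PL1 i xi)"
 unfolding cd_norm_def PL_inner[OF i] G_verts using PL0_norm[OF i CdD(3)[OF x]] by simp

sublocale D0: dense_map "C0 VV.V" S.L R0 1
proof
 fix g y assume "R0 g y"
 then obtain i f where i: "i : Lam" and f: "f : C0c (verts (E i))" and gy: "g = PL0 i f" "y = L0 i f" unfolding R0_def by blast
 interpret T: toep "E i" S.L "L0 i" "L1 i" by (rule L_toep[OF i])
 show "g : C0c VV.V & y : car S.L" unfolding gy using PL_C0[OF i f] T.T0D(1)[OF f] by blast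
 show "nm S.L y <= 1 * nm (C0 VV.V) g" unfolding gy using T.T0_norm[OF f] PL0_norm[OF i f] by simp
 show "R0 (c .[C0 VV.V] g) (c .[S.L] y)" for c
  using R0_I[OF i C0_scale[OF f, of c]] T.T0D(3)[OF f, of c] unfolding gy C0_simps pull_scale by simp
next
 fix g y h z assume "R0 g y" "R0 h z"
 then obtain i f f' where i: "i : Lam" and f: "f : C0c (verts (E i))" "f' : C0c (verts (E i))"
  and gy: "g = PL0 i f" "y = L0 i f" "h = PL0 i f'" "z = L0 i f'" by (rule common00)
 interpret T: toep "E i" S.L "L0 i" "L1 i" by (rule L_toep[OF i])
 show "R0 (g +[C0 VV.V] h) (y +[S.L] z)"
  using R0_I[OF i C0_add[OF f]] T.T0D(2)[OF f] unfolding gy C0_simps pull_add by simp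
qed (rule LA.cauchy_lim)

sublocale D1: dense_map "CdN G" S.L R1 1
proof (intro dense_map.intro dense_map_axioms.intro)
 show "normed_sp (CdN G)" by (rule GG.CdN_normed)
 show "normed_sp S.L" by unfold_locales
 fix g y assume "R1 g y"
 then obtain i f where i: "i : Lam" and f: "f : Cd (E i)" and gy: "g = PL1 i f" "y = L1 i f" unfolding R1_def by blast
 interpret T: toep "E i" S.L "L0 i" "L1 i" by (rule L_toep[OF i])
 show "g : car (CdN G) & y : car S.L" unfolding gy using PL_Cd[OF i f] T.TD(2)[OF f] by simp
 show "nm S.L y <= 1 * nm (CdN G) g" unfolding gy using T.T1_norm[OF f] PL1_norm[OF i f] by simp
 show "R1 (c .[CdN G] g) (c .[S.L] y)" for c
  using R1_I[OF i T.Cd_scale[OF f, of c]] T.TD(4)[OF f, of c] unfolding gy CdN_simps pull_scale by simp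
next
 fix g y h z assume "R1 g y" "R1 h z"
 then obtain i f f' where i: "i : Lam" and f: "f : Cd (E i)" "f' : Cd (E i)"
  and gy: "g = PL1 i f" "y = L1 i f" "h = PL1 i f'" "z = L1 i f'" by (rule common11)
 interpret T: toep "E i" S.L "L0 i" "L1 i" by (rule L_toep[OF i])
 show "R1 (g +[CdN G] h) (y +[S.L] z)"
  using R1_I[OF i T.Cd_add[OF f]] T.TD(3)[OF f] unfolding gy CdN_simps pull_add by simp
qed (rule LA.cauchy_lim)

abbreviation "T0 == D0.extn"
abbreviation "T1 == D1.extn"

lemma T0_rel: assumes g: "g : C0c VV.V" shows "lim_rel (C0 VV.V) S.L R0 g (T0 g)"
proof -
 obtain l where l: "l : Lam" using VV.Lam_ne by blast
 have "EX x' y'. R0 x' y' & nm (C0 VV.V) (x' -[C0 VV.V] g) <= eps" if e: "eps > 0" for eps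
 proof -
  obtain i f where i: "i : Lam" "le l i" "f : C0c (verts (E i))" and d: "!!v. cmod (PL0 i f v - g v) <= eps"
   by (rule VV.C0_dense[OF g e l], rule that, assumption+)
  have "nm (C0 VV.V) (PL0 i f -[C0 VV.V] g) <= eps" by (rule C0_norm_le) (use e d in \<open>auto simp: C0_simps\<close>)
  then show ?thesis using R0_I[OF i(1,3)] by blast
 qed
 then obtain y where y: "lim_rel (C0 VV.V) S.L R0 g y" using D0.lim_rel_dense[OF g] by blast
 then show ?thesis unfolding D0.extn_eq[OF y] .
qed

lemma T1_rel: assumes x: "xi : Cd G" shows "lim_rel (CdN G) S.L R1 xi (T1 xi)"
proof -
 have "EX x' y'. R1 x' y' & nm (CdN G) (x' -[CdN G] xi) <= eps" if e: "eps > 0" for eps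
 proof -
  obtain i eta where i: "i : Lam" "eta : Cd (E i)" and d: "cd_norm G (%e. PL1 i eta e - xi e) <= eps" using Cd_dense[OF x e] by blast
  have "nm (CdN G) (PL1 i eta -[CdN G] xi) <= eps" using d by simp
  then show ?thesis using R1_I[OF i] by blast
 qed
 then have "EX y. lim_rel (CdN G) S.L R1 xi y" by (intro D1.lim_rel_dense) (simp_all add: x)
 then obtain y where y: "lim_rel (CdN G) S.L R1 xi y" by blast
 then show ?thesis unfolding D1.extn_eq[OF y] .
qed

lemma T0_in: "g : C0c VV.V ==> T0 g : car S.L"
 using D0.lim_rel_in[OF T0_rel] by blast

lemma T1_in: "xi : Cd G ==> T1 xi : car S.L"
 using D1.lim_rel_in[OF T1_rel] by blast

lemma T0_PL: "i : Lam ==> f : C0c (verts (E i)) ==> T0 (PL0 i f) = L0 i f"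
 by (rule D0.extn_eq[OF D0.lim_relI[OF R0_I]])

lemma T1_PL: "i : Lam ==> xi : Cd (E i) ==> T1 (PL1 i xi) = L1 i xi"
 by (rule D1.extn_eq[OF D1.lim_relI[OF R1_I]])

lemma T0_hom: "star_hom (C0 VV.V) S.L T0"
 unfolding star_hom_def
proof (intro conjI ballI allI funcsetI)
 fix g assume g: "g : C0c VV.V"
 show "T0 g : car S.L" by (rule T0_in[OF g])
 show "T0 (c .[C0 VV.V] g) = c .[S.L] T0 g" for c by (rule D0.extn_eq[OF D0.lim_rel_scale[OF T0_rel[OF g]]])
 have star: "R0 (cs_star (C0 VV.V) g) (cs_star S.L y)" if r: "R0 g y" for g y
 proof -
  obtain i f where i: "i : Lam" and f: "f : C0c (verts (E i))" and gy: "g = PL0 i f" "y = L0 i f" using r unfolding R0_def by blast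
  interpret T: toep "E i" S.L "L0 i" "L1 i" by (rule L_toep[OF i])
  show ?thesis using R0_I[OF i C0_cnj[OF f]] T.T0D(5)[OF f] unfolding gy C0_simps pull_cnj by simp
 qed
 \<comment> \<open>The unary star is treated as a binary operation that ignores its second
   argument.\<close>
 have "lim_rel (C0 VV.V) S.L R0 (cs_star (C0 VV.V) g) (cs_star S.L (T0 g))"
  by (rule lim_rel_bilinear[OF T0_rel[OF g] T0_rel[OF g], of R0 "%x y. cs_star (C0 VV.V) x" "%x y. cs_star S.L x"])
   (use star CV.cs_lim_star LA.cs_lim_star in blast)+
 then show "T0 (cs_star (C0 VV.V) g) = cs_star S.L (T0 g)" by (rule D0.extn_eq)
 fix h assume h: "h : C0c VV.V"
 show "T0 (g +[C0 VV.V] h) = T0 g +[S.L] T0 h" by (rule D0.extn_eq[OF D0.lim_rel_add[OF T0_rel[OF g] T0_rel[OF h]]])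
 have mult: "R0 (g *[C0 VV.V] h) (y *[S.L] z)" if r: "R0 g y" "R0 h z" for g h y z
 proof -
  obtain i f f' where i: "i : Lam" and f: "f : C0c (verts (E i))" "f' : C0c (verts (E i))"
   and gy: "g = PL0 i f" "y = L0 i f" "h = PL0 i f'" "z = L0 i f'" by (rule common00[OF r])
  interpret T: toep "E i" S.L "L0 i" "L1 i" by (rule L_toep[OF i])
  show ?thesis using R0_I[OF i C0_mult[OF f]] T.T0D(4)[OF f] unfolding gy C0_simps pull_mult by simp
 qed
 have "lim_rel (C0 VV.V) S.L R0 (g *[C0 VV.V] h) (T0 g *[S.L] T0 h)"
  by (rule lim_rel_bilinear[OF T0_rel[OF g] T0_rel[OF h], where B = "cs_mult (C0 VV.V)"]) (rule mult CV.cs_lim_mult LA.cs_lim_mult, assumption+)+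
 then show "T0 (g *[C0 VV.V] h) = T0 g *[S.L] T0 h" by (rule D0.extn_eq)
qed

lemma inner_lim: "cs_lim (CdN G) sg xi ==> cs_lim (CdN G) tau eta ==> cs_lim (C0 VV.V) (%n. cd_inner G (sg n) (tau n)) (cd_inner G xi eta)"
proof (rule bilinear_lim[OF GG.CdN_normed GG.CdN_normed CV.normed_sp_axioms, of "cd_inner G"])
 fix x y assume xy: "x : car (CdN G)" "y : car (CdN G)"
 show "cd_inner G x y : C0c VV.V" using GG.Cd_inner(1)[of x y] xy by (simp add: G_verts)
 show "nm (C0 VV.V) (cd_inner G x y) <= nm (CdN G) x * nm (CdN G) y" using GG.inner_norm[of x y] xy by (simp add: G_verts)
 fix z assume z: "z : car (CdN G)"
 have x: "x : Cd G" and y: "y : Cd G" and zm: "(%e. - 1 * z e) : Cd G" using xy z GG.Cd_scale[of z "- 1"] by simp_all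
 show "cd_inner G (x -[CdN G] z) y = cd_inner G x y -[C0 VV.V] cd_inner G z y"
  unfolding CdN_simps C0_simps fun_eq_iff GG.inner_add_left[OF y x zm] inner_scale_left by simp
 show "cd_inner G y (x -[CdN G] z) = cd_inner G y x -[C0 VV.V] cd_inner G y z"
  unfolding CdN_simps C0_simps fun_eq_iff GG.inner_add_right[OF y x zm] inner_scale_right by simp
qed

lemma left_lim: "cs_lim (C0 VV.V) sg f ==> cs_lim (CdN G) tau eta ==> cs_lim (CdN G) (%n. left_action G (sg n) (tau n)) (left_action G f eta)"
proof (rule bilinear_lim[OF CV.normed_sp_axioms GG.CdN_normed GG.CdN_normed, of "left_action G"])
 fix f y assume fy: "f : C0c VV.V" "y : car (CdN G)"
 have f: "f : C0c (verts G)" and y: "y : Cd G" using fy by (simp_all add: G_verts)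
 have l: "left_action G f y = (%e. f (rmap G e) * y e)" if "y : Cd G" for f y using that by (simp add: left_action_def)
 have c: "(%e. f (rmap G e) * y e) : Cd G" by (rule GG.Cd_mult_left[OF y f])
 show "left_action G f y : car (CdN G)" using c l[OF y] by simp
 have "cd_norm G (%e. f (rmap G e) * y e) <= nm (C0 (verts G)) f * cd_norm G y"
  by (rule GG.cd_norm_scaled[OF c y C0_norm_nonneg[OF f]]) (simp add: norm_mult mult_right_mono C0_norm_ge[OF f])
 then show "nm (CdN G) (left_action G f y) <= nm (C0 VV.V) f * nm (CdN G) y" using l[OF y] by (simp add: G_verts)
 show "left_action G (f -[C0 VV.V] f') y = left_action G f y -[CdN G] left_action G f' y" for f'
  unfolding l[OF y] by (simp add: C0_simps algebra_simps)
 fix z assume z: "z : car (CdN G)"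
 have "(y -[CdN G] z) : Cd G" using GG.Cd_diff[OF y, of z] z by simp
 then show "left_action G f (y -[CdN G] z) = left_action G f y -[CdN G] left_action G f z"
  using l[of "y -[CdN G] z" f] l[OF y, of f] l[of z f] z by (simp add: algebra_simps)
qed

text \<open>Each relation involves at most two functions, which can be moved to a common index,
  where it is the relation of the pair \<open>L0 i\<close>, \<open>L1 i\<close>;
  \<open>lim_rel_bilinear\<close> carries it to the limits.\<close>

lemma T_toeplitz: "toeplitz_pair G S.L T0 T1"
 unfolding toeplitz_pair_def G_verts
proof (intro conjI ballI allI funcsetI T0_hom)
 fix xi assume x: "xi : Cd G"
 show "T1 xi : car S.L" by (rule T1_in[OF x])
 show "T1 (%e. c * xi e) = c .[S.L] T1 xi" for c using D1.extn_eq[OF D1.lim_rel_scale[OF T1_rel[OF x], of c]] by simp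
 show "T0 f *[S.L] T1 xi = T1 (left_action G f xi)" if f: "f : C0c VV.V" for f
 proof -
  have "R1 (left_action G g h) (y *[S.L] z)" if r: "R0 g y" "R1 h z" for g y h z
  proof -
   obtain i f f' where i: "i : Lam" and f: "f : C0c (verts (E i))" "f' : Cd (E i)"
    and gy: "g = PL0 i f" "y = L0 i f" "h = PL1 i f'" "z = L1 i f'" by (rule common01[OF r])
   interpret T: toep "E i" S.L "L0 i" "L1 i" by (rule L_toep[OF i])
   interpret M: rfmap G "E i" "pm i" by (rule pm_rf[OF i])
   have "left_action G (PL0 i f) (PL1 i f') = PL1 i (left_action (E i) f f')" using M.pull_left_action[OF f(2), of f] by (simp only: pm_eqs)
   moreover have "left_action (E i) f f' : Cd (E i)" using T.Cd_mult_left[OF f(2,1)] f(2) by (simp add: left_action_def)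
   ultimately show ?thesis using R1_I[OF i] T.TD(6)[OF f] unfolding gy by simp
  qed
  then have "lim_rel (CdN G) S.L R1 (left_action G f xi) (T0 f *[S.L] T1 xi)"
   by (rule lim_rel_bilinear[OF T0_rel[OF f] T1_rel[OF x] _ left_lim LA.cs_lim_mult])
  then show ?thesis by (rule D1.extn_eq[symmetric])
 qed
 fix eta assume y: "eta : Cd G"
 show "T1 (%e. xi e + eta e) = T1 xi +[S.L] T1 eta" using D1.extn_eq[OF D1.lim_rel_add[OF T1_rel[OF x] T1_rel[OF y]]] by simp
 have "R0 (cd_inner G g h) (cs_star S.L y *[S.L] z)" if r: "R1 g y" "R1 h z" for g y h z
 proof -
  obtain i f f' where i: "i : Lam" and f: "f : Cd (E i)" "f' : Cd (E i)"
   and gy: "g = PL1 i f" "y = L1 i f" "h = PL1 i f'" "z = L1 i f'" by (rule common11[OF r])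
  interpret T: toep "E i" S.L "L0 i" "L1 i" by (rule L_toep[OF i])
  show ?thesis unfolding gy PL_inner[OF i] T.TD(5)[OF f] by (rule R0_I[OF i T.Cd_inner(1)[OF f]])
 qed
 then have "lim_rel (C0 VV.V) S.L R0 (cd_inner G xi eta) (cs_star S.L (T1 xi) *[S.L] T1 eta)"
  by (rule lim_rel_bilinear[OF T1_rel[OF x] T1_rel[OF y] _ inner_lim LA.cs_lim_mult[OF LA.cs_lim_star]])
 then show "cs_star S.L (T1 xi) *[S.L] T1 eta = T0 (cd_inner G xi eta)" by (rule D0.extn_eq[symmetric])
qed

lemma ksum_cong: "set ps <= X \<times> X ==> (!!x. x : X ==> T x = T' x) ==> ksum A T ps = ksum A T' ps"
 by (induction ps) auto

text \<open>For an approximant from \<open>rg_dense\<close> the required equation is the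
  Cuntz-Krieger equation at index \<open>i\<close>, and the finite sum pulls back to
  \<open>G\<close> by \<open>kern_pull\<close>.\<close>

lemma T_ck: "ck_pair G S.L T0 T1"
proof -
 interpret T: toep G S.L T0 T1 by unfold_locales (rule T_toeplitz)
 show ?thesis
 proof (rule T.ck_pairI)
  show "C0c (subtopology (verts G) (E_rg G)) <= C0c (verts G)" using GG.C0_rg by blast
  fix f :: "('i => 'v option) => complex" and eps :: real
  assume f: "f : C0c (subtopology (verts G) (E_rg G))" and e: "eps > 0"
  obtain i g ps where i: "i : Lam" and g: "g : C0c (subtopology (verts (E i)) (E_rg (E i)))"
   and d: "ALL v. cmod (PL0 i g v - f v) <= eps" and ps: "tgr.valid (E i) ps" "tgr.kern (E i) g ps"
   using rg_dense[OF f e] by blast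
  interpret M: rfmap G "E i" "pm i" by (rule pm_rf[OF i])
  have gC: "g : C0c (verts (E i))" by (rule M.E.C0_rg[OF g])
  have off: "g v = 0" if "v ~: E_rg (E i)" for v using C0_off[OF g] that by simp
  have "T0 (PL0 i g) = ksum S.L (L1 i) ps"
   unfolding T0_PL[OF i gC] by (rule M.E.ck_pair_ksum[OF S.L_cstar L_ck[OF i] g ps])
  also have "... = ksum S.L (%xi. T1 (PL1 i xi)) ps" by (rule ksum_cong[OF ps(1)]) (rule T1_PL[OF i, symmetric])
  also have "... = ksum S.L T1 (M.pls ps)" using M.ksum_pls[of S.L T1 ps] by (simp only: pm_eqs)
  finally have k: "T0 (PL0 i g) = ksum S.L T1 (M.pls ps)" .
  have "PL0 i g : C0c (verts G)" using PL_C0[OF i gC] by (simp only: pm_eqs)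
  moreover have "GG.kern (M.pl0 g) (M.pls ps)" by (rule M.kern_pull[OF ps(2) off])
  then have "GG.kern (PL0 i g) (M.pls ps)" by (simp only: pm_eqs)
  ultimately show "EX f' ps. f' : C0c (verts G) & (ALL v. cmod (f' v - f v) <= eps) & GG.valid ps & GG.kern f' ps & T0 f' = ksum S.L T1 ps"
   using d M.pls_valid[OF ps(1)] k by blast
 qed
qed

end

section \<open>The isomorphism\<close>

context psys
begin

abbreviation "\<mu> i == induced_hom G (E i) (pm i)"

lemma mu_hom: "i : Lam ==> star_hom (OA (E i)) (OA G) (\<mu> i)"
 by (rule rfmap.induced(1)[OF pm_rf])

lemma mu_t0: assumes i: "i : Lam" and f: "f : C0c (verts (E i))" shows "\<mu> i (t0 (E i) f) = t0 G (PL0 i f)"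
 using rfmap.induced(2)[OF pm_rf[OF i] f] by (simp only: pm_eqs)

lemma mu_t1: assumes i: "i : Lam" and x: "xi : Cd (E i)" shows "\<mu> i (t1 (E i) xi) = t1 G (PL1 i xi)"
 using rfmap.induced(3)[OF pm_rf[OF i] x] by (simp only: pm_eqs)

lemma mu_compat:
 assumes ij: "i : Lam" "j : Lam" "le i j" and a: "a : car (OA (E i))"
 shows "\<mu> j (induced_hom (E j) (E i) (m i j) a) = \<mu> i a"
proof -
 interpret M: rfmap "E j" "E i" "m i j" by (rule rf[OF ij])
 show ?thesis
 proof (rule M.E.graph_hom_unique[OF GG.graph_cstar star_hom_comp[OF M.induced(1) mu_hom[OF ij(2)]] mu_hom[OF ij(1)] _ _ a])
  show "\<mu> j (induced_hom (E j) (E i) (m i j) (t0 (E i) f)) = \<mu> i (t0 (E i) f)" if f: "f : C0c (verts (E i))" for f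
   unfolding M.induced(2)[OF f] mu_t0[OF ij(2) pull_C0[OF M.m0_cont M.m0_None f]] mu_t0[OF ij(1) f] VV.pull_up[OF ij] ..
  show "\<mu> j (induced_hom (E j) (E i) (m i j) (t1 (E i) xi)) = \<mu> i (t1 (E i) xi)" if x: "xi : Cd (E i)" for xi
   unfolding M.induced(3)[OF x] mu_t1[OF ij(2) M.pull_Cd[OF x]] mu_t1[OF ij(1) x] VE.pull_up[OF ij] ..
 qed
qed

text \<open>At every index \<open>j\<close> above \<open>i\<close> the element
  \<open>\<mu> i a\<close> is the image of the connecting map's value under the contraction
  \<open>\<mu> j\<close>, so \<open>S.inc_norm_ge\<close> applies.\<close>

lemma mu_norm_le:
 assumes i: "i : Lam" and a: "a : car (OA (E i))"
 shows "nm (OA G) (\<mu> i a) <= nm S.L (S.inc i a)"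
 unfolding S.L_norm
proof (rule S.inc_norm_ge[OF i a])
 fix j assume j: "j : Lam" "le i j"
 have "induced_hom (E j) (E i) (m i j) a : car (OA (E j))"
  by (rule star_homD(1)[OF rfmap.induced(1)[OF rf[OF i j]] a])
 from star_hom_contractive[OF tgr.graph_cstar[OF tgrE[OF j(1)]] GG.graph_cstar mu_hom[OF j(1)] this]
 show "nm (OA G) (\<mu> i a) <= nm (OA (E j)) (induced_hom (E j) (E i) (m i j) a)"
  unfolding mu_compat[OF i j a] .
qed

sublocale OG: cs_alg "OA G"
 using GG.graph_cstar by (simp add: cs_alg_def)

abbreviation "W == \<Union>i\<in>Lam. \<mu> i ` car (OA (E i))"

lemma W_I: "i : Lam ==> a : car (OA (E i)) ==> \<mu> i a : W"
 by blast

lemma W_common: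
 assumes "x : W" "y : W"
 obtains i a b where "i : Lam" "a : car (OA (E i))" "b : car (OA (E i))" "x = \<mu> i a" "y = \<mu> i b"
proof -
 have up: "EX c:car (OA (E k)). \<mu> i a = \<mu> k c"
  if "i : Lam" "k : Lam" "le i k" "a : car (OA (E i))" for i k a
  using mu_compat[OF that] star_homD(1)[OF rfmap.induced(1)[OF rf[OF that(1-3)]] that(4)] by metis
 obtain i a where i: "i : Lam" "a : car (OA (E i))" "x = \<mu> i a" using assms(1) by blast
 obtain j b where j: "j : Lam" "b : car (OA (E j))" "y = \<mu> j b" using assms(2) by blast
 obtain k where k: "k : Lam" "le i k" "le j k" by (rule VV.ub[OF i(1) j(1)])
 obtain c where c: "c : car (OA (E k))" "\<mu> i a = \<mu> k c" using up[OF i(1) k(1,2) i(2)] by blast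
 obtain d where d: "d : car (OA (E k))" "\<mu> j b = \<mu> k d" using up[OF j(1) k(1,3) j(2)] by blast
 show thesis by (rule that[OF k(1) c(1) d(1)]) (simp_all only: i(3) j(3) c(2) d(2))
qed

lemma W_in: "W <= car (OA G)"
proof
 fix x assume "x : W"
 then obtain i a where i: "i : Lam" "a : car (OA (E i))" "x = \<mu> i a" by blast
 show "x : car (OA G)" unfolding i(3) by (rule star_homD(1)[OF mu_hom[OF i(1)] i(2)])
qed

sublocale PP: cs_alg GG.GP
 using cs_family.prod_cstar[OF ck_reps_family] by (simp add: cs_alg_def)

lemma OG_simps:
 "cs_zero (OA G) = cs_zero GG.GP" "cs_add (OA G) = cs_add GG.GP" "cs_scale (OA G) = cs_scale GG.GP"
 "cs_mult (OA G) = cs_mult GG.GP" "cs_star (OA G) = cs_star GG.GP" "nm (OA G) = nm GG.GP"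
 by (simp_all add: graph_algebra_def)

lemma OG_sub: "car (OA G) <= car GG.GP"
 unfolding GG.graph_algebra_eq by (rule PP.subalgebra_subset[OF PP.generated_subalgebra[OF GG.gens_in]])

lemma OG_lim: "cs_lim (OA G) X x ==> cs_lim GG.GP X x"
 using OG_sub unfolding cs_lim_def OG_simps by blast

text \<open>The closure is taken in the product, because \<open>cstar_generated\<close> is an
  intersection of subalgebras of the product.\<close>

lemma W_subalgebra: "cstar_subalgebra GG.GP (cs_topology GG.GP closure_of W)"
proof (rule PP.closure_subalgebra)
 show "W <= car GG.GP" using W_in OG_sub by blast
 obtain i where i: "i : Lam" using VV.Lam_ne by blast
 interpret Ai: cs_alg "OA (E i)" using S.fam[OF i] by (simp add: cs_alg_def)
 show "cs_zero GG.GP : W" using W_I[OF i Ai.zero_in] star_hom_zero[OF S.fam[OF i] GG.graph_cstar mu_hom[OF i]] unfolding OG_simps by simp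
next
 fix x y assume "x : W" "y : W"
 then obtain i a b where i: "i : Lam" and ab: "a : car (OA (E i))" "b : car (OA (E i))" "x = \<mu> i a" "y = \<mu> i b"
  by (rule W_common)
 interpret Ai: cs_alg "OA (E i)" using S.fam[OF i] by (simp add: cs_alg_def)
 note h = star_homD[OF mu_hom[OF i], unfolded OG_simps]
 show "x +[GG.GP] y : W" using W_I[OF i Ai.add_in[OF ab(1,2)]] h(2)[OF ab(1,2)] ab(3,4) by simp
 show "x *[GG.GP] y : W" using W_I[OF i Ai.mult_in[OF ab(1,2)]] h(4)[OF ab(1,2)] ab(3,4) by simp
next
 fix x assume "x : W"
 then obtain i a where i: "i : Lam" and a: "a : car (OA (E i))" "x = \<mu> i a" by blast
 interpret Ai: cs_alg "OA (E i)" using S.fam[OF i] by (simp add: cs_alg_def)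
 note h = star_homD[OF mu_hom[OF i], unfolded OG_simps]
 show "c .[GG.GP] x : W" for c using W_I[OF i Ai.scale_in[OF a(1), of c]] h(3)[OF a(1), of c] a(2) by simp
 show "cs_star GG.GP x : W" using W_I[OF i Ai.star_in[OF a(1)]] h(5)[OF a(1)] a(2) by simp
qed

text \<open>Pulled-back functions are dense and \<open>t0 G\<close>, \<open>t1 G\<close> map them
  into \<open>W\<close>; by continuity all generators lie in the closure of \<open>W\<close>, which
  is a subalgebra.\<close>

lemma W_dense: assumes x: "x : car (OA G)" shows "EX X. (ALL n. X n : W) & cs_lim (OA G) X x"
proof -
 have WP: "W <= car GG.GP" using W_in OG_sub by blast
 note cl = PP.closure_of_seq_iff[OF WP]
 interpret T: toep G "OA G" "t0 G" "t1 G" by unfold_locales (use GG.t_ck in \<open>simp add: ck_pair_def\<close>)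
 have "t0 G f : cs_topology GG.GP closure_of W" if f: "f : C0c (verts G)" for f
 proof -
  have fV: "f : C0c VV.V" using f by (simp only: pm_eqs)
  \<comment> \<open>Only the approximating sequence \<open>sg\<close> of pulled-back functions is
    taken from \<open>T0_rel\<close>.\<close>
  obtain sg tau where s: "!!n. R0 (sg n) (tau n)" "cs_lim (C0 VV.V) sg f" using T0_rel[OF fV] unfolding lim_rel_def by blast
  have "t0 G (sg n) : W" for n
  proof -
   obtain i g where i: "i : Lam" "g : C0c (verts (E i))" "sg n = PL0 i g" using s(1)[of n] unfolding R0_def by blast
   then show ?thesis using W_I[OF i(1) tgr.t0_graph[OF tgrE[OF i(1)] i(2)]] mu_t0[OF i(1,2)] by simp
  qed
  moreover have "cs_lim (C0 (verts G)) sg f" using s(2) by (simp only: pm_eqs)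
  then have "cs_lim GG.GP (%n. t0 G (sg n)) (t0 G f)" by (intro OG_lim star_hom_lim[OF C0_cstar GG.graph_cstar T.TD(1)])
  ultimately show ?thesis unfolding cl by (intro exI[of _ "%n. t0 G (sg n)"]) blast
 qed
 moreover have "t1 G xi : cs_topology GG.GP closure_of W" if xi: "xi : Cd G" for xi
 proof -
  obtain sg tau where s: "!!n. R1 (sg n) (tau n)" "cs_lim (CdN G) sg xi" using T1_rel[OF xi] unfolding lim_rel_def by blast
  have "t1 G (sg n) : W" for n
  proof -
   obtain i g where i: "i : Lam" "g : Cd (E i)" "sg n = PL1 i g" using s(1)[of n] unfolding R1_def by blast
   then show ?thesis using W_I[OF i(1) tgr.t1_graph[OF tgrE[OF i(1)] i(2)]] mu_t1[OF i(1,2)] by simp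
  qed
  moreover have "cs_lim (OA G) (%n. t1 G (sg n)) (t1 G xi)"
  proof -
   have c: "sg n : Cd G" for n using s(2) by (simp add: cs_lim_def)
   have l: "(%n. nm (CdN G) (sg n -[CdN G] xi)) \<longlonglongrightarrow> 0" using s(2) unfolding cs_lim_def by blast
   have d: "t1 G (sg n -[CdN G] xi) = t1 G (sg n) -[OA G] t1 G xi" for n
    using T.TD(3)[OF c GG.Cd_scale[OF xi, of "-1"]] T.TD(4)[OF xi, of "-1"] by (simp only: CdN_simps)
   have "nm (OA G) (t1 G (sg n) -[OA G] t1 G xi) <= nm (CdN G) (sg n -[CdN G] xi)" for n
    unfolding d[symmetric] CdN_simps by (intro T.T1_norm GG.Cd_add c GG.Cd_scale xi)
   then have "(%n. nm (OA G) (t1 G (sg n) -[OA G] t1 G xi)) \<longlonglongrightarrow> 0"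
    by (intro tendsto_sandwich[OF _ _ tendsto_const l] eventuallyI OG.nm_nonneg OG.add_in OG.scale_in T.TD(2) c xi)
   then show ?thesis unfolding cs_lim_def using T.TD(2) c xi by blast
  qed
  then have "cs_lim GG.GP (%n. t1 G (sg n)) (t1 G xi)" by (rule OG_lim)
  ultimately show ?thesis unfolding cl by (intro exI[of _ "%n. t1 G (sg n)"]) blast
 qed
 ultimately have "t0 G ` C0c (verts G) Un t1 G ` Cd G <= cs_topology GG.GP closure_of W" by blast
 then have "car (OA G) <= cs_topology GG.GP closure_of W"
  unfolding GG.graph_algebra_eq by (rule generated_least[OF _ W_subalgebra])
 then have "x : cs_topology GG.GP closure_of W" using x by blast
 then obtain X where X: "ALL n. X n : W" "cs_lim GG.GP X x" unfolding cl by blast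
 moreover have "X n : car (OA G)" for n using X(1) W_in by blast
 ultimately have "cs_lim (OA G) X x" using x unfolding cs_lim_def OG_simps by blast
 then show ?thesis using X(1) by blast
qed

lemma limit_isomorphic: "cs_isomorphic (OA G) S.L"
proof -
 obtain \<nu> where \<nu>: "star_hom (OA G) S.L \<nu>" "!!f. f : C0c (verts G) ==> \<nu> (t0 G f) = T0 f"
  "!!xi. xi : Cd G ==> \<nu> (t1 G xi) = T1 xi"
  by (rule GG.graph_universal[OF S.L_cstar T_ck], rule that, assumption+)
 note h = star_homD[OF \<nu>(1)]
 \<comment> \<open>Both homomorphisms agree on the generators \<open>t0\<close> and
   \<open>t1\<close> of the algebra of \<open>E i\<close>.\<close>
 have \<nu>\<mu>: "\<nu> (\<mu> i a) = S.inc i a" if i: "i : Lam" and a: "a : car (OA (E i))" for i a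
 proof (rule tgr.graph_hom_unique[OF tgrE[OF i] S.L_cstar star_hom_comp[OF mu_hom[OF i] \<nu>(1)] S.inc_hom[OF i] _ _ a])
  show "\<nu> (\<mu> i (t0 (E i) f)) = L0 i f" if f: "f : C0c (verts (E i))" for f
   unfolding mu_t0[OF i f] T0_PL[OF i f, symmetric] by (rule \<nu>(2)) (simp only: PL_C0[OF i f] pm_eqs)
  show "\<nu> (\<mu> i (t1 (E i) xi)) = L1 i xi" if x: "xi : Cd (E i)" for xi
   unfolding mu_t1[OF i x] T1_PL[OF i x, symmetric] by (rule \<nu>(3)[OF PL_Cd[OF i x]])
 qed
 have W_iso: "nm S.L (\<nu> x) = nm (OA G) x" if x: "x : W" for x
 proof -
  obtain i a where i: "i : Lam" "a : car (OA (E i))" "x = \<mu> i a" using x by blast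
  have "nm S.L (\<nu> x) <= nm (OA G) x"
   by (rule star_hom_contractive[OF GG.graph_cstar S.L_cstar \<nu>(1)]) (use x W_in in blast)
  moreover have "nm (OA G) x <= nm S.L (\<nu> x)" using mu_norm_le[OF i(1,2)] \<nu>\<mu>[OF i(1,2)] i(3) by simp
  ultimately show ?thesis by simp
 qed
 have iso: "nm S.L (\<nu> x) = nm (OA G) x" if x: "x : car (OA G)" for x
 proof -
  obtain X where X: "!!n. X n : W" "cs_lim (OA G) X x" using W_dense[OF x] by blast
  have "(%n. nm S.L (\<nu> (X n))) \<longlonglongrightarrow> nm S.L (\<nu> x)"
   by (rule LA.cs_lim_norm[OF star_hom_lim[OF GG.graph_cstar S.L_cstar \<nu>(1) X(2)]])
  then have "(%n. nm (OA G) (X n)) \<longlonglongrightarrow> nm S.L (\<nu> x)" unfolding W_iso[OF X(1)] .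
  then show ?thesis using OG.cs_lim_norm[OF X(2)] LIMSEQ_unique by blast
 qed
 have diff: "nm S.L (\<nu> x -[S.L] \<nu> y) = nm (OA G) (x -[OA G] y)"
  if xy: "x : car (OA G)" "y : car (OA G)" for x y
  using iso[OF OG.add_in[OF xy(1) OG.scale_in[OF xy(2)]], of "-1"] h(2)[OF xy(1) OG.scale_in[OF xy(2)], of "-1"] h(3)[OF xy(2), of "-1"] by simp
 have "inj_on \<nu> (car (OA G))"
 proof (rule inj_onI)
  fix x y assume xy: "x : car (OA G)" "y : car (OA G)" "\<nu> x = \<nu> y"
  have "nm (OA G) (x -[OA G] y) = nm S.L (\<nu> y -[S.L] \<nu> y)" using diff[OF xy(1,2)] xy(3) by simp
  also have "... = 0" using LA.minus_self[OF h(1)[OF xy(2)]] LA.nm_zero_iff[OF LA.zero_in] by simp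
  finally show "x = y" using OG.nm_zero_iff[OF OG.add_in[OF xy(1) OG.scale_in[OF xy(2), of "-1"]]] OG.minus_eq_zero[OF xy(1,2)] by simp
 qed
 \<comment> \<open>An approximating sequence of images of the \<open>S.inc i\<close> has preimages;
   these are Cauchy since \<open>\<nu>\<close> is isometric, and their limit is mapped to
   \<open>y\<close>.\<close>
 moreover have "y : \<nu> ` car (OA G)" if y: "y : car S.L" for y
 proof -
  obtain Y where Y: "!!n. Y n : S.images" "cs_lim S.L Y y" using S.L_dense[OF y] by blast
  have "EX x:car (OA G). \<nu> x = Y n" for n
  proof -
   obtain i a where i: "i : Lam" "a : car (OA (E i))" "Y n = S.inc i a" using Y(1)[of n] by blast
   then show ?thesis using \<nu>\<mu>[OF i(1,2)] star_homD(1)[OF mu_hom[OF i(1)] i(2)] by (intro bexI[of _ "\<mu> i a"]) simp_all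
  qed
  then obtain X where X: "!!n. X n : car (OA G)" "!!n. \<nu> (X n) = Y n" by metis
  have "cs_cauchy S.L Y" by (rule LA.cs_lim_cauchy[OF Y(2)])
  then have "cs_cauchy (OA G) X" using diff[OF X(1) X(1)] X(1) unfolding cs_cauchy_def X(2) by simp
  then obtain x where x: "cs_lim (OA G) X x" using OG.cauchy_lim by blast
  have "cs_lim S.L Y (\<nu> x)" using star_hom_lim[OF GG.graph_cstar S.L_cstar \<nu>(1) x] unfolding X(2) by simp
  then have "\<nu> x = y" using LA.cs_lim_unique[OF _ Y(2)] by blast
  then show ?thesis using x unfolding cs_lim_def by blast
 qed
 ultimately have "bij_betw \<nu> (car (OA G)) (car S.L)" unfolding bij_betw_def using h(1) by blast
 then show ?thesis unfolding cs_isomorphic_def using \<nu>(1) by blast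
qed

end

theorem proposition4p13:
  fixes \<Lambda> :: "'i set"
    and le :: "'i \<Rightarrow> 'i \<Rightarrow> bool"
    and E :: "'i \<Rightarrow> ('v, 'e) tgraph"
    and m :: "'i \<Rightarrow> 'i \<Rightarrow> ('v, 'e, 'v, 'e) gmap"
  assumes "projective_system \<Lambda> le E m"
    and "regular_system \<Lambda> le E m"
    and "surjective_system \<Lambda> le E m"
  shows "cs_isomorphic
           (graph_algebra (proj_lim \<Lambda> le E m))
           (inductive_limit \<Lambda> le (\<lambda>i. graph_algebra (E i)) (\<lambda>i j. induced_hom (E j) (E i) (m i j)))"
  by (rule psys.limit_isomorphic) (use assms in \<open>simp add: psys_def\<close>)

end
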